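(* For any $V\in C(\mathcal X)$ and any $\bar\mu_0\in\mathcal P(\mathcal X)$ there exists a unique Sinkhorn potential flow $(\mu_t)_{t\ge0}$ of $V$ starting at $\bar\mu_0$. Moreover: (i) (Energy dissipation) $t\mapsto E(\mu_t)$ is locally absolutely continuous, non-increasing, and for a.e. $t\ge 0$, $\frac{d}{dt}E(\mu_t)=-\mathbf g_{\mu_t}(\dot\mu_t,\dot\mu_t)$. (ii) (Long-term behavior) $\lim_{t\to+\infty}E(\mu_t)=\min_{\mathcal P(\mathcal X)}E=\min_{\mathcal X}V$. If moreover $V$ has a unique minimizer $x^\star\in\mathcal X$, then $\mu_t\to\delta_{x^\star}$ weakly-* as $t\to+\infty$. (iii) (Non-expansiveness) If $(\mu^1_t)_{t\ge0}$ and $(\mu^2_t)_{t\ge0}$ are two Sinkhorn potential flows of $V$, then $t\mapsto\|B(\mu^1_t)-B(\mu^2_t)\|_{\mathcal H_c}$ is non-increasing.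
   Context: Standing setting: $(\mathcal X,\mathsf d)$ is a compact metric space; $\varepsilon>0$; $c\in C(\mathcal X\times\mathcal X)$ is symmetric and nonnegative and $k_c:=\exp(-c/\varepsilon)$ is a positive definite universal kernel (its RKHS is dense in $(C(\mathcal X),\|\cdot\|_\infty)$). $V\in C(\mathcal X)$ and $E(\mu):=\int V\,d\mu$. $\mathcal M(\mathcal X)$ denotes signed Radon measures (dual of $C(\mathcal X)$, weak-* topology), $\mathcal M_+(\mathcal X)$ the nonnegative ones, $\mathcal P(\mathcal X)$ the probability measures. Schrödinger potentials: for $f\in C(\mathcal X)$, $\mu\in\mathcal P(\mathcal X)$ let $T_\varepsilon(f,\mu)(y):=-\varepsilon\log\int\exp((f(x)-c(x,y))/\varepsilon)\,d\mu(x)$. For $\mu,\nu\in\mathcal P(\mathcal X)$, $(f_{\mu,\nu},f_{\nu,\mu})$ is the unique pair in $C(\mathcal X)^2$ with $f_{\mu,\nu}=T_\varepsilon(f_{\nu,\mu},\nu)$, $f_{\nu,\mu}=T_\varepsilon(f_{\mu,\nu},\mu)$ and $\int f_{\mu,\nu}d\mu=\int f_{\nu,\mu}d\nu$; write $f_\mu:=f_{\mu,\mu}$. Operators: $k_\mu(x,y):=\exp((f_\mu(x)+f_\mu(y)-c(x,y))/\varepsilon)$; $\mathcal H_c$, $\mathcal H_\mu\subset C(\mathcal X)$ are the RKHSs of $k_c$, $k_\mu$. $H_c:\mathcal H_c^*\to\mathcal H_c$ and $H_\mu:\mathcal H_\mu^*\to\mathcal H_\mu$ are the Riesz isomorphisms;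 on measures $H_c[\sigma](y)=\int k_c(x,y)d\sigma(x)$ and $H_\mu[\sigma](y)=\int k_\mu(x,y)d\sigma(x)$. $K_\mu[\phi]:=H_\mu[\phi\mu]$ for $\phi\in C(\mathcal X)$; $\mathrm{Id}-K_\mu^2$ is invertible on $C(\mathcal X)/\mathbb R$. Embedding: $B(\mu):=\exp(-f_\mu/\varepsilon)\in\mathcal H_c$; $B$ is a homeomorphism from $\mathcal P(\mathcal X)$ onto $\mathcal B:=H_c[\mathcal M_+(\mathcal X)]\cap\{b\in\mathcal H_c:\|b\|_{\mathcal H_c}=1\}$, with inverse $B^{-1}(b)=b\,H_c^{-1}[b]$. Tangent space and metric: $T_\mu:=\{\sigma\in\mathcal H_\mu^*:\langle\sigma,1\rangle=0\}$, $\mathbf g_\mu(\sigma_1,\sigma_2):=\frac\varepsilon2\langle\sigma_1,(\mathrm{Id}-K_\mu^2)^{-1}H_\mu[\sigma_2]\rangle$. Admissible curves: a curve $(\mu_t)_{t\in I}$ in $\mathcal P(\mathcal X)$ is locally absolutely continuous for the Sinkhorn distance (equivalently) iff $t\mapsto B(\mu_t)$ belongs to the Hilbert-valued Sobolev space $\mathscr H^1_{loc}(I;\mathcal H_c)$; then for a.e. $t$ there is $\dot\mu_t\in T_{\mu_t}$ with $\langle\dot\mu_t,\phi\rangle=\frac{d}{ds}\langle\mu_s,\phi\rangle|_{s=t}$ for all $\phi\in\mathcal H_{\mu_t}$. Pressures: $P\mu:=\{p\in C(\mathcal X):p\le0,\ p=0\text{ on }\operatorname{supp}\mu\}$. Definition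 (Sinkhorn potential flow): $(\mu_t)_{t\ge0}$ is a Sinkhorn potential flow of $V$ starting at $\bar\mu_0$ if it is admissible on $[0,\infty)$, $\mu_0=\bar\mu_0$, and for a.e. $t$ there exist $p_t\in P\mu_t$ and $C_t\in\mathbb R$ with $\frac\varepsilon2(\mathrm{Id}-K_{\mu_t}^2)^{-1}H_{\mu_t}[\dot\mu_t]+V+p_t=C_t$ (i.e. the inclusion $\frac\varepsilon2(\mathrm{Id}-K_{\mu_t}^2)^{-1}H_{\mu_t}[\dot\mu_t]+V+P\mu_t\ni0$ holds in $C(\mathcal X)/\mathbb R$). *)

theory Defs
  imports "HOL-Probability.Probability"
begin

definition Probs :: "'a::metric_space measure set" where
  "Probs = {\<mu>. prob_space \<mu> \<and> sets \<mu> = sets borel}"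

definition msupp :: "'a::metric_space measure \<Rightarrow> 'a set" where
  "msupp \<mu> = {x. \<forall>e>0. emeasure \<mu> (ball x e) > 0}"

definition Energy :: "('a::metric_space \<Rightarrow> real) \<Rightarrow> 'a measure \<Rightarrow> real" where
  "Energy V \<mu> = (\<integral>x. V x \<partial>\<mu>)"

text \<open>Values of the pairing of g with a unit-norm element of the span of kernel sections.\<close>
definition rkhs_vals :: "('a \<Rightarrow> 'a \<Rightarrow> real) \<Rightarrow> ('a \<Rightarrow> real) \<Rightarrow> real set" where
  "rkhs_vals k g = {(\<Sum>x\<in>S. a x * g x) | S a. finite S \<and>
       (\<Sum>x\<in>S. \<Sum>y\<in>S. a x * a y * k x y) \<le> 1}"

definition in_rkhs :: "('a \<Rightarrow> 'a \<Rightarrow> real) \<Rightarrow> ('a \<Rightarrow> real) \<Rightarrow> bool" where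
  "in_rkhs k g \<longleftrightarrow> bdd_above (rkhs_vals k g)"

definition rkhs_norm :: "('a \<Rightarrow> 'a \<Rightarrow> real) \<Rightarrow> ('a \<Rightarrow> real) \<Rightarrow> real" where
  "rkhs_norm k g = Sup (rkhs_vals k g)"

definition pos_def_kernel :: "('a \<Rightarrow> 'a \<Rightarrow> real) \<Rightarrow> bool" where
  "pos_def_kernel k \<longleftrightarrow> (\<forall>x y. k x y = k y x) \<and>
     (\<forall>S a. finite S \<longrightarrow> (\<Sum>x\<in>S. \<Sum>y\<in>S. a x * a y * k x y) \<ge> 0)"

definition universal_kernel :: "('a::topological_space \<Rightarrow> 'a \<Rightarrow> real) \<Rightarrow> bool" where
  "universal_kernel k \<longleftrightarrow> (\<forall>\<phi>. continuous_on UNIV \<phi> \<longrightarrow>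
     (\<forall>e>0. \<exists>g. in_rkhs k g \<and> (\<forall>x. \<bar>\<phi> x - g x\<bar> < e)))"

definition Teps :: "real \<Rightarrow> ('a \<Rightarrow> 'a \<Rightarrow> real) \<Rightarrow> ('a \<Rightarrow> real) \<Rightarrow> 'a measure \<Rightarrow> 'a \<Rightarrow> real" where
  "Teps \<epsilon> c f \<mu> y = - \<epsilon> * ln (\<integral>x. exp ((f x - c x y) / \<epsilon>) \<partial>\<mu>)"

definition schr_pair :: "real \<Rightarrow> ('a::topological_space \<Rightarrow> 'a \<Rightarrow> real) \<Rightarrow> 'a measure \<Rightarrow> 'a measure
     \<Rightarrow> ('a \<Rightarrow> real) \<times> ('a \<Rightarrow> real)" where
  "schr_pair \<epsilon> c \<mu> \<nu> = (THE (f, g). continuous_on UNIV f \<and> continuous_on UNIV g \<and>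
      f = Teps \<epsilon> c g \<nu> \<and> g = Teps \<epsilon> c f \<mu> \<and> (\<integral>x. f x \<partial>\<mu>) = (\<integral>x. g x \<partial>\<nu>))"

definition fpot :: "real \<Rightarrow> ('a::topological_space \<Rightarrow> 'a \<Rightarrow> real) \<Rightarrow> 'a measure \<Rightarrow> 'a \<Rightarrow> real" where
  "fpot \<epsilon> c \<mu> = fst (schr_pair \<epsilon> c \<mu> \<mu>)"

definition Bemb :: "real \<Rightarrow> ('a::topological_space \<Rightarrow> 'a \<Rightarrow> real) \<Rightarrow> 'a measure \<Rightarrow> 'a \<Rightarrow> real" where
  "Bemb \<epsilon> c \<mu> = (\<lambda>x. exp (- fpot \<epsilon> c \<mu> x / \<epsilon>))"

definition kc :: "real \<Rightarrow> ('a \<Rightarrow> 'a \<Rightarrow> real) \<Rightarrow> 'a \<Rightarrow> 'a \<Rightarrow> real" where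
  "kc \<epsilon> c x y = exp (- c x y / \<epsilon>)"

definition kmu :: "real \<Rightarrow> ('a::topological_space \<Rightarrow> 'a \<Rightarrow> real) \<Rightarrow> 'a measure \<Rightarrow> 'a \<Rightarrow> 'a \<Rightarrow> real" where
  "kmu \<epsilon> c \<mu> x y = exp ((fpot \<epsilon> c \<mu> x + fpot \<epsilon> c \<mu> y - c x y) / \<epsilon>)"

definition Kop :: "real \<Rightarrow> ('a::topological_space \<Rightarrow> 'a \<Rightarrow> real) \<Rightarrow> 'a measure \<Rightarrow> ('a \<Rightarrow> real) \<Rightarrow> 'a \<Rightarrow> real" where
  "Kop \<epsilon> c \<mu> \<phi> y = (\<integral>x. kmu \<epsilon> c \<mu> x y * \<phi> x \<partial>\<mu>)"

text \<open>(Id - K_mu^2)^{-1} on C(X)/R: a continuous representative v of the class with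
  (Id - K_mu^2) v = u modulo constants (unique modulo constants).\<close>
definition Kinv :: "real \<Rightarrow> ('a::topological_space \<Rightarrow> 'a \<Rightarrow> real) \<Rightarrow> 'a measure \<Rightarrow> ('a \<Rightarrow> real) \<Rightarrow> 'a \<Rightarrow> real" where
  "Kinv \<epsilon> c \<mu> u = (SOME v. continuous_on UNIV v \<and>
      (\<exists>C. \<forall>x. v x - Kop \<epsilon> c \<mu> (Kop \<epsilon> c \<mu> v) x = u x + C))"

text \<open>t \<mapsto> B(mu_t) lies in H^1_loc([0,\<infinity>); H_c), expressed via an L^2_loc upper gradient.\<close>
definition admissible :: "real \<Rightarrow> ('a::metric_space \<Rightarrow> 'a \<Rightarrow> real) \<Rightarrow> (real \<Rightarrow> 'a measure) \<Rightarrow> bool" where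
  "admissible \<epsilon> c \<mu> \<longleftrightarrow> (\<forall>t\<ge>0. \<mu> t \<in> Probs) \<and>
     (\<exists>m::real \<Rightarrow> real. (\<forall>T. m absolutely_integrable_on {0..T} \<and>
                               (\<lambda>t. (m t)\<^sup>2) integrable_on {0..T}) \<and>
        (\<forall>s t. 0 \<le> s \<longrightarrow> s \<le> t \<longrightarrow>
           rkhs_norm (kc \<epsilon> c) (\<lambda>x. Bemb \<epsilon> c (\<mu> t) x - Bemb \<epsilon> c (\<mu> s) x) \<le> integral {s..t} m))"

text \<open>D is the tangent vector dot-mu_t (an element of H_mu^* acting on H_{mu_t}).\<close>
definition tangent :: "real \<Rightarrow> ('a::metric_space \<Rightarrow> 'a \<Rightarrow> real) \<Rightarrow> (real \<Rightarrow> 'a measure) \<Rightarrow> real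
     \<Rightarrow> (('a \<Rightarrow> real) \<Rightarrow> real) \<Rightarrow> bool" where
  "tangent \<epsilon> c \<mu> t D \<longleftrightarrow>
     (\<forall>\<phi>. in_rkhs (kmu \<epsilon> c (\<mu> t)) \<phi> \<longrightarrow>
        ((\<lambda>s. \<integral>x. \<phi> x \<partial>(\<mu> s)) has_real_derivative D \<phi>) (at t within {0..})) \<and>
     (\<exists>M. \<forall>\<phi>. in_rkhs (kmu \<epsilon> c (\<mu> t)) \<phi> \<longrightarrow>
        \<bar>D \<phi>\<bar> \<le> M * rkhs_norm (kmu \<epsilon> c (\<mu> t)) \<phi>)"

definition Hmu :: "real \<Rightarrow> ('a::topological_space \<Rightarrow> 'a \<Rightarrow> real) \<Rightarrow> 'a measure
     \<Rightarrow> (('a \<Rightarrow> real) \<Rightarrow> real) \<Rightarrow> 'a \<Rightarrow> real" where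
  "Hmu \<epsilon> c \<mu> D y = D (\<lambda>x. kmu \<epsilon> c \<mu> x y)"

definition gmet :: "real \<Rightarrow> ('a::topological_space \<Rightarrow> 'a \<Rightarrow> real) \<Rightarrow> 'a measure
     \<Rightarrow> (('a \<Rightarrow> real) \<Rightarrow> real) \<Rightarrow> (('a \<Rightarrow> real) \<Rightarrow> real) \<Rightarrow> real" where
  "gmet \<epsilon> c \<mu> D1 D2 = \<epsilon> / 2 * D1 (Kinv \<epsilon> c \<mu> (Hmu \<epsilon> c \<mu> D2))"

definition Press :: "'a::metric_space measure \<Rightarrow> ('a \<Rightarrow> real) set" where
  "Press \<mu> = {p. continuous_on UNIV p \<and> (\<forall>x. p x \<le> 0) \<and> (\<forall>x\<in>msupp \<mu>. p x = 0)}"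

definition sinkhorn_flow :: "real \<Rightarrow> ('a::metric_space \<Rightarrow> 'a \<Rightarrow> real) \<Rightarrow> ('a \<Rightarrow> real)
     \<Rightarrow> 'a measure \<Rightarrow> (real \<Rightarrow> 'a measure) \<Rightarrow> bool" where
  "sinkhorn_flow \<epsilon> c V \<mu>0 \<mu> \<longleftrightarrow> admissible \<epsilon> c \<mu> \<and> \<mu> 0 = \<mu>0 \<and>
     (AE t in lborel. t \<ge> 0 \<longrightarrow>
        (\<exists>D. tangent \<epsilon> c \<mu> t D \<and>
           (\<exists>p\<in>Press (\<mu> t). \<exists>C. \<forall>x.
              \<epsilon> / 2 * Kinv \<epsilon> c (\<mu> t) (Hmu \<epsilon> c (\<mu> t) D) x + V x + p x = C)))"

definition loc_abs_cont :: "(real \<Rightarrow> real) \<Rightarrow> bool" where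
  "loc_abs_cont f \<longleftrightarrow> (\<exists>g. (\<forall>T. g absolutely_integrable_on {0..T}) \<and>
      (\<forall>s t. 0 \<le> s \<longrightarrow> s \<le> t \<longrightarrow> f t - f s = integral {s..t} g))"

end

theory Submission
  imports Defs
begin

text \<open>
  With \<open>b = B \<mu>\<close> and \<open>\<sigma> = \<mu> / b\<close> one has \<open>b = H[\<sigma>]\<close> and \<open>\<integral> b d\<sigma> = 1\<close>. Applying \<open>Id - K\<close> to the flow equation turns it into
  the complementarity problem \<open>q := \<epsilon>/2 b' + V b - H[V \<sigma>] \<ge> 0\<close>, \<open>\<integral> q d\<sigma> = 0\<close> (with \<open>p = - q / b\<close>), in which
  \<open>b \<mapsto> V b - H[V \<sigma>]\<close> is skew-symmetric in the RKHS of the kernel. For two flows this makes \<open>\<parallel>b1 - b2\<parallel>\<close> non-increasing, whence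
  uniqueness. Testing \<open>q \<ge> 0\<close> at a minimiser \<open>x\<close> of \<open>V\<close> gives \<open>\<epsilon>/2 b'(x) \<ge> \<kappa> (E - min V)\<close> with a lower bound \<open>\<kappa>\<close> of the
  kernel, and \<open>b \<le> 1\<close>, so the non-increasing energy must converge to \<open>min V\<close>.

  Existence comes from the implicit Euler scheme for measures supported on finite sets: each step is a linear
  complementarity problem whose matrix is a positive definite matrix plus a skew one. The steps contract the RKHS distance, so their
  speed is non-increasing, and the energy inequality bounds the sum of the squared speeds. Compactness of bounded sets
  of measures and density of the grids give a limit curve; its potentials have norm 1 because each step changes the squared norm by
  exactly the squared increment.
\<close>

section \<open>Absolutely continuous functions on the half line\<close>

text \<open>No Hilbert space is built. RKHS membership and norm bounds are statements about finite
  sums (\<open>rkhs_le\<close>), measures are seen through their potentials \<open>Hk\<close>, and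
  the pairing of a weak derivative \<open>d\<close> with \<psi> is the derivative of \<integral>
  \<psi> d\<sigma>. Norm bounds give equicontinuity, so pointwise convergence is as good as uniform
  convergence. The bounds \<open>\<kappa> \<le> k \<le> 1\<close> supply the constants: contraction
  factors of the Sinkhorn map and of K, mass bounds for \<sigma>, and
  \<open>\<kappa> \<le> B \<mu> \<le> 1\<close>. Two obstacles shape the rest. Signs of residuals
  are known only on finite grids, so the limit inequality is reached on a dense sequence and
  extended by continuity. And the speed may blow up at time 0: it is square integrable there, finite
  and non-increasing afterwards. Monotonicity of the speed is also used for absolute continuity of
  the energy, whose basic estimate holds only at almost every time and must be transported to all
  times. Hence (i) and (ii) are shown for the constructed curve, whose speed bound \<open>m\<close>
  is monotone.\<close>

lemma negligible_upper_derivative_gt: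
  fixes f :: "real \<Rightarrow> real"
  assumes f: "integrable lborel f" and pq: "p < q" and R: "R > 0"
  shows "negligible {t. \<bar>t\<bar> < R \<and> f t < p \<and> (\<forall>d>0. \<exists>s. s \<noteq> t \<and> \<bar>s - t\<bar> < d \<and>
     (LINT x:{min s t..max s t}|lborel. f x) > q * \<bar>s - t\<bar>)}" (is "negligible ?A")
  unfolding negligible_outer
proof (intro allI impI)
  fix e :: real assume e: "e > 0"
  have [measurable]: "f \<in> borel_measurable borel"
    using borel_measurable_integrable[OF f] by simp
  define W where "W = {-R<..<R}"
  define h where "h x = (\<bar>f x - p\<bar> + \<bar>q - p\<bar>) * indicator W x" for x
  have h0: "h x \<ge> 0" for x unfolding h_def by simp
  have Wint: "set_integrable lborel W (\<lambda>x. c::real)" for c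
    unfolding set_integrable_def W_def real_scaleR_def
    by (rule integrable_mult_left) (auto intro!: integrable_real_indicator simp: emeasure_bounded_finite[unfolded infinity_ennreal_def])
  have Wf: "set_integrable lborel W f"
    unfolding set_integrable_def by (rule integrable_mult_indicator) (auto simp: W_def f)
  have Wfp: "set_integrable lborel W (\<lambda>x. f x - c)" for c
    by (rule set_integral_diff(1)[OF Wf Wint])
  have hint: "integrable lborel h"
  proof -
    have "set_integrable lborel W (\<lambda>x. \<bar>f x - p\<bar> + \<bar>q - p\<bar>)"
      by (intro set_integral_add set_integrable_abs Wfp Wint)
    then show ?thesis unfolding h_def set_integrable_def by (simp add: mult.commute)
  qed
  define N where "N = density lborel (\<lambda>x. ennreal (h x))"
  have setsN: "sets N = sets borel" unfolding N_def by simp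
  have Nfin: "emeasure N (space N) \<noteq> \<infinity>"
    unfolding N_def using hint h0 by (simp add: emeasure_density nn_integral_eq_integral)
  interpret N: finite_measure N by standard (rule Nfin)
  define B where "B = {t\<in>W. f t < p}"
  have B: "B \<in> sets borel" unfolding B_def W_def by measurable
  define e' where "e' = e * (q - p) / 2"
  have e': "e' > 0" using e pq unfolding e'_def by simp
  have "emeasure N B < emeasure N B + ennreal e'"
    using e' N.emeasure_finite[of B] by (simp add: ennreal_add_left_cancel_less less_top[symmetric])
  then obtain U0 where U0: "B \<subseteq> U0" "open U0" "emeasure N U0 < emeasure N B + ennreal e'"
    unfolding outer_regular[OF setsN Nfin B[folded setsN, unfolded setsN]] INF_less_iff
    by auto
  define U where "U = U0 \<inter> W"
  have U: "B \<subseteq> U" "open U" "U \<subseteq> W" using U0 by (auto simp: U_def B_def W_def)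
  have Ub: "U \<in> sets borel" using U by auto
  have NU: "measure N (U - B) < e'"
  proof -
    have "emeasure N U \<le> emeasure N U0"
      by (rule emeasure_mono) (use U0 in \<open>auto simp: U_def setsN\<close>)
    then have "emeasure N U < emeasure N B + ennreal e'" using U0 by order
    then have "measure N U < measure N B + e'"
      using e' unfolding N.emeasure_eq_measure
      by (simp add: ennreal_plus[symmetric] ennreal_less_iff del: ennreal_plus)
    moreover have "measure N (U - B) = measure N U - measure N B"
      by (rule N.finite_measure_Diff) (use U B Ub in \<open>auto simp: setsN\<close>)
    ultimately show ?thesis by simp
  qed
  have measN: "measure N S = (LINT x:S|lborel. h x)" if S: "S \<in> sets borel" for S
  proof -
    have "integrable lborel (\<lambda>x. h x * indicator S x)"
      using integrable_mult_indicator[OF _ hint, of S] S by (simp add: mult.commute)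
    then have "emeasure N S = ennreal (\<integral>x. h x * indicator S x \<partial>lborel)"
      unfolding N_def using S h0 hint
      by (subst emeasure_density)
         (auto simp: nn_integral_eq_integral[symmetric] ennreal_mult'' ennreal_indicator[symmetric] intro!: nn_integral_cong)
    then show ?thesis
      unfolding set_lebesgue_integral_def measure_def using h0
      by (simp add: mult.commute)
  qed
  \<comment> \<open>Intervals inside \<open>U\<close> on which the mean of \<open>f\<close> exceeds
    \<open>q\<close> form a Vitali cover of the exceptional set. The point \<open>t\<close> is an
    end point of its interval, not the centre.\<close>
  define K where "K = {(a,r). r > 0 \<and> cball a r \<subseteq> U \<and> (LINT x:cball a r|lborel. f x) > q * (2 * r)}"
  obtain C where C: "countable C" "C \<subseteq> K"
     "pairwise (\<lambda>i j. disjnt (cball (fst i) (snd i)) (cball (fst j) (snd j))) C"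
     "negligible (?A - (\<Union>i \<in> C. cball (fst i) (snd i)))"
  proof (rule Vitali_covering_theorem_cballs[of K snd ?A fst])
    show "0 < snd i" if "i \<in> K" for i using that by (auto simp: K_def)
    fix t d :: real assume t: "t \<in> ?A" and d: "0 < d"
    then have "t \<in> U" using U(1) by (auto simp: B_def W_def abs_less_iff)
    then obtain d' where d': "d' > 0" "cball t d' \<subseteq> U" using U(2) open_contains_cball by blast
    obtain s where s: "s \<noteq> t" "\<bar>s - t\<bar> < min d d'" "(LINT x:{min s t..max s t}|lborel. f x) > q * \<bar>s - t\<bar>"
    proof -
      have "\<forall>d>0. \<exists>s. s \<noteq> t \<and> \<bar>s - t\<bar> < d \<and> (LINT x:{min s t..max s t}|lborel. f x) > q * \<bar>s - t\<bar>"
        using t by blast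
      then show ?thesis using that d d' by (meson min_less_iff_conj)
    qed
    define a r where "a = (s + t) / 2" and "r = \<bar>s - t\<bar> / 2"
    have cb: "cball a r = {min s t..max s t}"
      unfolding a_def r_def cball_eq_atLeastAtMost by (auto simp: min_def max_def abs_if field_simps)
    have "cball a r \<subseteq> cball t d'" unfolding cb unfolding cball_eq_atLeastAtMost using s(2) by (auto simp: min_def max_def abs_if split: if_splits)
    moreover have "(LINT x:cball a r|lborel. f x) > q * (2 * r)" unfolding cb using s(3) by (simp add: r_def)
    moreover have "r > 0" using s(1) by (simp add: r_def)
    ultimately have "(a, r) \<in> K" unfolding K_def using d' by blast
    moreover have "t \<in> cball a r" unfolding cb by auto
    moreover have "r < d" using s(2) d unfolding r_def by (simp add: abs_if split: if_splits)
    ultimately show "\<exists>i. i \<in> K \<and> t \<in> cball (fst i) (snd i) \<and> snd i < d" by (intro exI[of _ "(a, r)"]) simp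
  qed
  \<comment> \<open>The countable disjoint family is re-indexed by the naturals, with empty sets in
    the gaps, so that integrals over finite unions can be passed to the limit.\<close>
  define I where "I n = (if n \<in> to_nat_on C ` C then cball (fst (from_nat_into C n)) (snd (from_nat_into C n)) else {})" for n
  define S where "S = (\<Union>n. I n)"
  have I_cases: "I n = {} \<or> (\<exists>i\<in>C. to_nat_on C i = n \<and> I n = cball (fst i) (snd i))" for n
    unfolding I_def using C(1) by auto
  have Salt: "S = (\<Union>i \<in> C. cball (fst i) (snd i))"
  proof
    show "S \<subseteq> (\<Union>i \<in> C. cball (fst i) (snd i))" unfolding S_def using I_cases by blast
    show "(\<Union>i \<in> C. cball (fst i) (snd i)) \<subseteq> S"
    proof (rule UN_least)
      fix i assume "i \<in> C"
      then have "I (to_nat_on C i) = cball (fst i) (snd i)" unfolding I_def using C(1) by simp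
      then show "cball (fst i) (snd i) \<subseteq> S" unfolding S_def by blast
    qed
  qed
  have Idisj: "I m \<inter> I n = {}" if "m \<noteq> n" for m n
  proof -
    consider "I m = {} \<or> I n = {}" | i j where "i \<in> C" "j \<in> C" "to_nat_on C i = m" "to_nat_on C j = n"
      "I m = cball (fst i) (snd i)" "I n = cball (fst j) (snd j)"
      using I_cases[of m] I_cases[of n] by blast
    then show ?thesis
    proof cases
      case 2
      then have "i \<noteq> j" using that by blast
      then show ?thesis using C(3) 2 unfolding pairwise_def disjnt_def by metis
    qed auto
  qed
  have Ib: "I n \<in> sets borel" for n unfolding I_def by auto
  have IK: "(LINT x:I n|lborel. f x - q) \<ge> 0 \<and> I n \<subseteq> U" for n
  proof (cases "I n = {}")
    case True then show ?thesis by (simp add: set_lebesgue_integral_def)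
  next
    case False
    then obtain i where i: "i \<in> C" "I n = cball (fst i) (snd i)" using I_cases by blast
    obtain a r where ar: "i = (a, r)" by force
    have K: "r > 0" "cball a r \<subseteq> U" "(LINT x:cball a r|lborel. f x) > q * (2 * r)"
      using i ar C(2) by (auto simp: K_def)
    have 1: "set_integrable lborel (cball a r) f"
      unfolding set_integrable_def by (rule integrable_mult_indicator) (auto simp: f)
    have 2: "set_integrable lborel (cball a r) (\<lambda>x. q)"
      unfolding set_integrable_def cball_eq_atLeastAtMost real_scaleR_def
      by (rule integrable_mult_left) (auto intro!: integrable_real_indicator simp: emeasure_bounded_finite[unfolded infinity_ennreal_def])
    have 3: "(LINT x:cball a r|lborel. q) = q * (2 * r)"
      using K unfolding set_lebesgue_integral_def cball_eq_atLeastAtMost by simp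
    show ?thesis using K set_integral_diff(2)[OF 1 2] 3 unfolding i ar by simp
  qed
  have SU: "S \<subseteq> U" and Sb: "S \<in> sets borel" using IK Ib by (auto simp: S_def)
  have sub: "set_integrable lborel X g" if "set_integrable lborel W g" "X \<subseteq> U" "X \<in> sets borel" for X and g :: "real \<Rightarrow> real"
    by (rule set_integrable_subset[OF that(1)]) (use that U in auto)
  have "(LINT x:S|lborel. f x - q) \<ge> 0"
  proof -
    have s: "set_integrable lborel (\<Union>n. I n) (\<lambda>x. f x - q)"
      by (rule sub[OF Wfp]) (use SU Sb in \<open>auto simp: S_def\<close>)
    have J: "set_integrable lborel (I n) (\<lambda>x. f x - q)" for n
      by (rule sub[OF Wfp]) (use IK Ib in auto)
    have U: "(\<Union>n. \<Union>i\<in>{..n}. I i) = (\<Union>n. I n)" by auto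
    have "(\<lambda>n. LINT x:(\<Union>i\<in>{..n}. I i)|lborel. f x - q) \<longlonglongrightarrow> (LINT x:(\<Union>n. \<Union>i\<in>{..n}. I i)|lborel. f x - q)"
      by (rule set_integral_cont_up[where A="\<lambda>n. \<Union>i\<in>{..n}. I i"]) (use Ib s in \<open>auto simp: incseq_def U\<close>, fastforce)
    moreover have "(LINT x:(\<Union>i\<in>{..n}. I i)|lborel. f x - q) \<ge> 0" for n
      by (subst set_integral_finite_Union[where I="{..n}" and A=I])
         (use Ib IK J Idisj in \<open>auto intro!: sum_nonneg simp: disjoint_family_on_def\<close>)
    ultimately show ?thesis unfolding S_def U by (auto intro: LIMSEQ_le_const)
  qed
  moreover have "(LINT x:S|lborel. f x - p) = (LINT x:S|lborel. f x - q) + (q - p) * measure lborel S"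
  proof -
    have "(LINT x:S|lborel. f x - p) = (LINT x:S|lborel. (f x - q) + (q - p))" by simp
    also have "\<dots> = (LINT x:S|lborel. f x - q) + (LINT x:S|lborel. q - p)"
      by (rule set_integral_add(2)[OF sub[OF Wfp SU Sb] sub[OF Wint SU Sb]])
    finally show ?thesis using Sb by (simp add: set_lebesgue_integral_def mult.commute)
  qed
  \<comment> \<open>On \<open>B\<close> the integrand \<open>f - p\<close> is negative, so only
    \<open>S - B\<close>, which lies in \<open>U - B\<close>, counts. Together with means above
    \<open>q\<close> this bounds \<open>(q - p) * measure lborel S\<close>.\<close>
  moreover have "(LINT x:S|lborel. f x - p) \<le> measure N (U - B)"
  proof -
    have "(LINT x:S|lborel. f x - p) \<le> (LINT x:U-B|lborel. h x)"
      unfolding set_lebesgue_integral_def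
    proof (rule integral_mono)
      show "integrable lborel (\<lambda>x. indicator S x *\<^sub>R (f x - p))"
        using sub[OF Wfp SU Sb] unfolding set_integrable_def .
      show "integrable lborel (\<lambda>x. indicator (U - B) x *\<^sub>R h x)"
        by (rule integrable_mult_indicator) (use B Ub hint in auto)
      fix x show "indicator S x *\<^sub>R (f x - p) \<le> indicator (U - B) x *\<^sub>R h x"
        using SU U(3) by (auto simp: indicator_def h_def B_def)
    qed
    then show ?thesis using measN[of "U - B"] B Ub by simp
  qed
  ultimately have "(q - p) * measure lborel S < e'" using NU by linarith
  then have mS: "measure lborel S < e / 2"
    using pq mult_less_cancel_left_pos[of "q - p" "measure lborel S" "e / 2"] unfolding e'_def by (simp add: mult.commute)
  have Sm: "S \<in> lmeasurable"
  proof -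
    have "bounded S" by (rule bounded_subset[of W]) (use SU U in \<open>auto simp: W_def\<close>)
    then show ?thesis by (rule bounded_set_imp_lmeasurable) (use Sb in simp)
  qed
  obtain T' where T': "?A - S \<subseteq> T'" "T' \<in> lmeasurable" "measure lebesgue T' < e/2"
    using C(4)[folded Salt] e unfolding negligible_outer by (meson half_gt_zero)
  have "measure lebesgue (S \<union> T') \<le> measure lebesgue S + measure lebesgue T'"
    using Sm T'(2) by (intro measure_Un_le) auto
  also have "\<dots> < e" using mS T'(3) Sb by simp
  finally show "\<exists>T. ?A \<subseteq> T \<and> T \<in> lmeasurable \<and> measure lebesgue T < e"
    using T' Sm by (intro exI[of _ "S \<union> T'"]) (auto intro: fmeasurable.Un)
qed

text \<open>If the bound failed at \<open>t\<close>, rationals with \<open>f t < p\<close>,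
  \<open>p < q\<close>, \<open>q < f t + e\<close> and \<open>R\<close> above the modulus of
  \<open>t\<close> would put \<open>t\<close> into one of countably many negligible sets.\<close>

lemma AE_upper_derivative_le:
  fixes f :: "real \<Rightarrow> real"
  assumes f: "integrable lborel f"
  shows "AE t in lborel. \<forall>e>0. \<forall>\<^sub>F s in at t. (LINT x:{min s t..max s t}|lborel. f x) \<le> (f t + e) * \<bar>s - t\<bar>"
proof -
  define P where "P p q R t \<longleftrightarrow> \<bar>t\<bar> < R \<and> f t < p \<and> (\<forall>d>0. \<exists>s. s \<noteq> t \<and> \<bar>s - t\<bar> < d \<and>
     (LINT x:{min s t..max s t}|lborel. f x) > q * \<bar>s - t\<bar>)" for p q R t
  define I where "I = {(p::real, q::real, R::real). p \<in> \<rat> \<and> q \<in> \<rat> \<and> R \<in> \<rat> \<and> p < q \<and> R > 0}"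
  have "countable I"
    by (rule countable_subset[of _ "\<rat> \<times> \<rat> \<times> \<rat>"]) (auto simp: I_def countable_rat)
  moreover have "AE t in lebesgue. \<not> P p q R t" if "(p,q,R) \<in> I" for p q R
  proof -
    have "negligible {t. P p q R t}" unfolding P_def
      by (rule negligible_upper_derivative_gt[OF f]) (use that in \<open>auto simp: I_def\<close>)
    then show ?thesis unfolding negligible_iff_null_sets by (rule AE_I') auto
  qed
  ultimately have "AE t in lebesgue. \<forall>i\<in>I. \<not> P (fst i) (fst (snd i)) (snd (snd i)) t"
    by (subst AE_ball_countable) auto
  then have "AE t in lborel. \<forall>i\<in>I. \<not> P (fst i) (fst (snd i)) (snd (snd i)) t"
    unfolding AE_completion_iff .
  then show ?thesis
  proof (rule eventually_mono, intro allI impI)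
    fix t e :: real assume t: "\<forall>i\<in>I. \<not> P (fst i) (fst (snd i)) (snd (snd i)) t" and e: "e > 0"
    obtain R :: real where R: "R \<in> \<rat>" "\<bar>t\<bar> < R" using Rats_dense_in_real[of "\<bar>t\<bar>" "\<bar>t\<bar> + 1"] by auto
    obtain p where p: "p \<in> \<rat>" "f t < p" "p < f t + e" using Rats_dense_in_real[of "f t" "f t + e"] e by auto
    obtain q where q: "q \<in> \<rat>" "p < q" "q < f t + e" using Rats_dense_in_real[OF p(3)] by auto
    have "\<not> P p q R t" using t p q R by (force simp: I_def)
    then obtain d where d: "d > 0" "\<And>s. s \<noteq> t \<Longrightarrow> \<bar>s - t\<bar> < d \<Longrightarrow> (LINT x:{min s t..max s t}|lborel. f x) \<le> q * \<bar>s - t\<bar>"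
      unfolding P_def using R p by (metis not_less)
    have "(LINT x:{min s t..max s t}|lborel. f x) \<le> (f t + e) * \<bar>s - t\<bar>" if "s \<noteq> t" "\<bar>s - t\<bar> < d" for s
      by (rule order_trans[OF d(2)[OF that] mult_right_mono]) (use q in auto)
    then show "\<forall>\<^sub>F s in at t. (LINT x:{min s t..max s t}|lborel. f x) \<le> (f t + e) * \<bar>s - t\<bar>"
      unfolding eventually_at using d(1) by (auto simp: dist_real_def)
  qed
qed

text \<open>Lebesgue differentiation: the upper bound on difference quotients, applied to
  \<open>f\<close> and to \<open>- f\<close>, pins the quotient from both sides.\<close>

lemma AE_has_derivative_integral:
  fixes f :: "real \<Rightarrow> real"
  assumes f: "integrable lborel f"
  shows "AE t in lborel. ((\<lambda>s. LINT x:{..s}|lborel. f x) has_real_derivative f t) (at t)"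
proof -
  define F where "F s = (LINT x:{..s}|lborel. f x)" for s
  have si: "set_integrable lborel A f" if "A \<in> sets borel" for A
    unfolding set_integrable_def by (rule integrable_mult_indicator) (use that f in auto)
  have Fd: "F s - F t = (LINT x:{t..s}|lborel. f x)" if "t \<le> s" for s t
  proof -
    have e: "{..s} = {..t} \<union> {t<..s}" using that by auto
    have "F s = F t + (LINT x:{t<..s}|lborel. f x)" unfolding F_def e
      by (rule set_integral_Un) (auto intro: si)
    moreover have "(LINT x:{t..s}|lborel. f x) = (LINT x:{t<..s}|lborel. f x)"
      by (rule set_integral_cong_set)
         (use borel_measurable_integrable[OF f] AE_lborel_singleton[of t] in \<open>auto simp: set_borel_measurable_def elim!: eventually_mono\<close>)
    ultimately show ?thesis by simp
  qed
  have Fq: "(F s - F t) / (s - t) * \<bar>s - t\<bar> = (LINT x:{min s t..max s t}|lborel. f x)" for s t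
    using Fd[of s t] Fd[of t s] by (cases "s < t"; cases "s = t") (auto simp: min_def max_def field_simps)
  have "AE t in lborel. (F has_real_derivative f t) (at t)"
    using AE_upper_derivative_le[OF f] AE_upper_derivative_le[OF Bochner_Integration.integrable_minus[OF f]]
  proof eventually_elim
    case (elim t)
    have m: "(LINT x:{min s t..max s t}|lborel. - f x) = - ((F s - F t) / (s - t) * \<bar>s - t\<bar>)" for s
      unfolding Fq by (rule set_integral_uminus) (auto intro: si)
    have up: "\<forall>\<^sub>F s in at t. (F s - F t) / (s - t) \<le> f t + e" and dn: "\<forall>\<^sub>F s in at t. f t - e \<le> (F s - F t) / (s - t)" if "e > 0" for e
    proof -
      show "\<forall>\<^sub>F s in at t. (F s - F t) / (s - t) \<le> f t + e"
        using elim(1)[rule_format, OF that] eventually_neq_at_within[of t t]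
        by eventually_elim (unfold Fq[symmetric], metis mult_le_cancel_right_pos right_minus_eq zero_less_abs_iff)
      show "\<forall>\<^sub>F s in at t. f t - e \<le> (F s - F t) / (s - t)"
        using elim(2)[rule_format, OF that] eventually_neq_at_within[of t t]
      proof eventually_elim
        case (elim s)
        then have "(f t - e) * \<bar>s - t\<bar> \<le> (F s - F t) / (s - t) * \<bar>s - t\<bar>" unfolding m by (simp add: algebra_simps)
        then show ?case using elim(2) by (metis mult_le_cancel_right_pos right_minus_eq zero_less_abs_iff)
      qed
    qed
    show ?case
      unfolding has_field_derivative_iff
    proof (rule order_tendstoI)
      fix a assume a: "a < f t"
      have "\<forall>\<^sub>F s in at t. f t - (f t - a) / 2 \<le> (F s - F t) / (s - t)" by (rule dn) (use a in simp)
      then show "\<forall>\<^sub>F s in at t. a < (F s - F t) / (s - t)" by (rule eventually_mono) (use a in argo)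
    next
      fix a assume a: "f t < a"
      have "\<forall>\<^sub>F s in at t. (F s - F t) / (s - t) \<le> f t + (a - f t) / 2" by (rule up) (use a in simp)
      then show "\<forall>\<^sub>F s in at t. (F s - F t) / (s - t) < a" by (rule eventually_mono) (use a in argo)
    qed
  qed
  then show ?thesis unfolding F_def .
qed

text \<open>Admissibility is phrased with Henstock-Kurzweil integrals and functions measurable for
  the completed measure, while densities and null sets are handled in \<open>lborel\<close>. This
  lemma passes between the two without changing integrals over intervals.\<close>

lemma borel_version_of_locally_integrable:
  fixes g :: "real \<Rightarrow> real"
  assumes g: "\<And>T. g absolutely_integrable_on {0..T}"
  obtains g' :: "real \<Rightarrow> real" where "g' \<in> borel_measurable borel" "AE t in lborel. t \<ge> 0 \<longrightarrow> g t = g' t"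
    "\<And>t. t < 0 \<Longrightarrow> g' t = 0"
    "\<And>a b. 0 \<le> a \<Longrightarrow> set_integrable lborel {a..b} g'"
    "\<And>a b. 0 \<le> a \<Longrightarrow> integral {a..b} g = (LINT t:{a..b}|lborel. g' t)"
proof -
  have "(\<lambda>t. indicator {0..real n} t * g t) \<in> borel_measurable lebesgue" for n
    using borel_measurable_integrable[OF g[unfolded set_integrable_def, of "real n"]] by simp
  moreover have "(\<lambda>n. indicator {0..real n} t * g t) \<longlonglongrightarrow> indicator {0..} t * g t" for t
  proof (rule tendsto_eventually, rule eventually_sequentiallyI)
    fix n assume "nat \<lceil>t\<rceil> \<le> n"
    then have "t \<le> real n" by linarith
    then show "indicator {0..real n} t * g t = indicator {0..} t * g t" by (auto simp: indicator_def)
  qed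
  ultimately have "(\<lambda>t. indicator {0..} t * g t) \<in> borel_measurable lebesgue"
    by (rule borel_measurable_LIMSEQ_real[rotated])
  then obtain h where h: "h \<in> borel_measurable lborel" "AE t in lborel. indicator {0..} t * g t = h t"
    using completion_ex_borel_measurable_real by blast
  define g' where "g' t = indicator {0..} t * h t" for t
  have m[measurable]: "g' \<in> borel_measurable borel" unfolding g'_def using h(1) by simp
  have eq: "AE t in lborel. t \<ge> 0 \<longrightarrow> g t = g' t" using h(2) by eventually_elim (auto simp: g'_def indicator_def split: if_splits)
  have ai: "g absolutely_integrable_on {a..b}" if "0 \<le> a" for a b
    by (rule set_integrable_subset[OF g[of b]]) (use that in auto)
  have int: "set_integrable lborel {a..b} g' \<and> integral {a..b} g = (LINT t:{a..b}|lborel. g' t)" if a: "0 \<le> a" for a b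
  proof -
    have m2: "(\<lambda>t. indicator {a..b} t *\<^sub>R g' t) \<in> borel_measurable lborel" by measurable
    have eq2: "AE t in lebesgue. indicator {a..b} t *\<^sub>R g t = indicator {a..b} t *\<^sub>R g' t"
      using AE_completion[OF eq] by eventually_elim (use a in \<open>auto simp: indicator_def\<close>)
    have i: "integrable lebesgue (\<lambda>t. indicator {a..b} t *\<^sub>R g' t)"
      using ai[OF a, of b] unfolding set_integrable_def
      by (rule integrable_cong_AE_imp[OF _ measurable_completion[OF m2] eq2])
    have si: "set_integrable lborel {a..b} g'"
      using i integrable_completion[OF m2] unfolding set_integrable_def by simp
    have "integral {a..b} g = (LINT t:{a..b}|lebesgue. g t)" by (rule set_lebesgue_integral_eq_integral(2)[OF ai[OF a], symmetric])
    also have "\<dots> = (LINT t:{a..b}|lebesgue. g' t)" unfolding set_lebesgue_integral_def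
      by (rule integral_cong_AE[OF _ _ eq2]) (use ai[OF a, of b] i in \<open>auto simp: set_integrable_def dest: borel_measurable_integrable\<close>)
    also have "\<dots> = (LINT t:{a..b}|lborel. g' t)" unfolding set_lebesgue_integral_def
      by (rule integral_completion[OF m2])
    finally show ?thesis using si by simp
  qed
  show ?thesis by (rule that[OF m eq _ conjunct1[OF int] conjunct2[OF int]]) (auto simp: g'_def)
qed

lemma AE_has_derivative_indefinite_integral:
  fixes g :: "real \<Rightarrow> real"
  assumes g: "\<And>T. g absolutely_integrable_on {0..T}"
  shows "AE t in lborel. t > 0 \<longrightarrow> ((\<lambda>s. integral {0..s} g) has_real_derivative g t) (at t)"
proof -
  obtain g' :: "real \<Rightarrow> real" where g': "g' \<in> borel_measurable borel" "AE t in lborel. t \<ge> 0 \<longrightarrow> g t = g' t"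
    "\<And>t. t < 0 \<Longrightarrow> g' t = 0"
    "\<And>a b. 0 \<le> a \<Longrightarrow> set_integrable lborel {a..b} g'"
    "\<And>a b. 0 \<le> a \<Longrightarrow> integral {a..b} g = (LINT t:{a..b}|lborel. g' t)"
    using borel_version_of_locally_integrable[OF g] by blast
  have "AE t in lborel. ((\<lambda>s. LINT x:{..s}|lborel. indicator {0..real n} x *\<^sub>R g' x) has_real_derivative indicator {0..real n} t *\<^sub>R g' t) (at t)" for n
    by (rule AE_has_derivative_integral) (use g'(4)[of 0 "real n"] in \<open>auto simp: set_integrable_def\<close>)
  then have "AE t in lborel. \<forall>n::nat. ((\<lambda>s. LINT x:{..s}|lborel. indicator {0..real n} x *\<^sub>R g' x) has_real_derivative indicator {0..real n} t *\<^sub>R g' t) (at t)"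
    by (simp add: AE_all_countable)
  then show ?thesis using g'(2)
  proof eventually_elim
    case (elim t)
    show ?case
    proof
      assume t: "0 < t"
      obtain n where n: "t < real n" using reals_Archimedean2 by blast
      have "((\<lambda>s. LINT x:{..s}|lborel. indicator {0..real n} x *\<^sub>R g' x) has_real_derivative g t) (at t)"
        using elim(1)[rule_format, of n] elim(2) t n by simp
      then show "((\<lambda>s. integral {0..s} g) has_real_derivative g t) (at t)"
      proof (rule has_field_derivative_transform_within_open[of _ _ _ "{0<..<real n}"])
        fix s assume s: "s \<in> {0<..<real n}"
        have "(LINT x:{..s}|lborel. indicator {0..real n} x *\<^sub>R g' x) = (LINT x:{0..s}|lborel. g' x)"
          unfolding set_lebesgue_integral_def by (rule Bochner_Integration.integral_cong) (use s in \<open>auto simp: indicator_def\<close>)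
        then show "(LINT x:{..s}|lborel. indicator {0..real n} x *\<^sub>R g' x) = integral {0..s} g" using g'(5)[of 0 s] by simp
      qed (use t n in auto)
    qed
  qed
qed

text \<open>With R the primitive of the modulus of G, both R + F and R - F are nondecreasing and
  define Stieltjes measures. Their sum has density 2 |G|, so the first is absolutely continuous and
  has a Radon-Nikodym density; subtracting |G| leaves the density of F.\<close>

lemma absolutely_continuous_FTC:
  fixes F G :: "real \<Rightarrow> real"
  assumes G: "\<And>T. G absolutely_integrable_on {0..T}"
    and FG: "\<And>a b. 0 \<le> a \<Longrightarrow> a \<le> b \<Longrightarrow> \<bar>F b - F a\<bar> \<le> integral {a..b} G"
  shows "\<exists>g::real \<Rightarrow> real. (\<forall>T. g absolutely_integrable_on {0..T}) \<and>
    (\<forall>a b. 0 \<le> a \<longrightarrow> a \<le> b \<longrightarrow> F b - F a = integral {a..b} g)"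
proof -
  obtain G' :: "real \<Rightarrow> real" where m[measurable]: "G' \<in> borel_measurable borel"
    and G'0: "\<And>t. t < 0 \<Longrightarrow> G' t = 0"
    and G'i: "\<And>a b. 0 \<le> a \<Longrightarrow> set_integrable lborel {a..b} G'"
    and G'e: "\<And>a b. 0 \<le> a \<Longrightarrow> integral {a..b} G = (LINT t:{a..b}|lborel. G' t)"
    using borel_version_of_locally_integrable[of G] G by metis
  define h where "h t = \<bar>G' t\<bar>" for t
  have hm[measurable]: "h \<in> borel_measurable borel" unfolding h_def by simp
  have h0: "h t \<ge> 0" for t by (simp add: h_def)
  define R where "R t = (LINT x:{0..t}|lborel. h x)" for t
  have hi: "set_integrable lborel {a..b} h" for a b
  proof -
    have "set_integrable lborel {max a 0..b} h" unfolding h_def by (intro set_integrable_abs G'i) simp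
    moreover have "(\<lambda>x. indicator {a..b} x *\<^sub>R h x) = (\<lambda>x. indicator {max a 0..b} x *\<^sub>R h x)"
      using G'0 by (auto simp: indicator_def h_def fun_eq_iff)
    ultimately show ?thesis unfolding set_integrable_def by simp
  qed
  have hi': "set_integrable lborel {a<..b} h" for a b
    by (rule set_integrable_subset[OF hi[of a b]]) auto
  have nnh: "(\<integral>\<^sup>+x. ennreal (h x) * indicator A x \<partial>lborel) = ennreal (LINT x:A|lborel. h x)"
    if "set_integrable lborel A h" for A
  proof -
    have "(\<integral>\<^sup>+x. ennreal (h x) * indicator A x \<partial>lborel) = (\<integral>\<^sup>+x. ennreal (indicator A x *\<^sub>R h x) \<partial>lborel)"
      by (intro nn_integral_cong) (auto simp: indicator_def)
    also have "\<dots> = ennreal (LINT x:A|lborel. h x)"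
      unfolding set_lebesgue_integral_def using that h0
      by (intro nn_integral_eq_integral) (auto simp: set_integrable_def)
    finally show ?thesis .
  qed
  have Rd: "R b - R a = (LINT x:{a<..b}|lborel. h x)" if ab: "a \<le> b" for a b
  proof -
    have "R c = (LINT x:{min a 0..c}|lborel. h x)" for c
      unfolding R_def set_lebesgue_integral_def
      by (rule Bochner_Integration.integral_cong) (auto simp: indicator_def h_def G'0)
    moreover have "(LINT x:{min a 0..b}|lborel. h x) = (LINT x:{min a 0..a} \<union> {a<..b}|lborel. h x)"
      by (rule arg_cong[where f="\<lambda>A. set_lebesgue_integral lborel A h"]) (use ab in auto)
    moreover have "\<dots> = (LINT x:{min a 0..a}|lborel. h x) + (LINT x:{a<..b}|lborel. h x)"
      by (rule set_integral_Un) (auto intro: hi hi')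
    ultimately show ?thesis by simp
  qed
  have Rcont: "isCont R t" for t
  proof -
    have "set_integrable lebesgue {t - 1..t + 1} h"
      using hi[of "t - 1" "t + 1"] unfolding set_integrable_def by (intro integrable_completion[THEN iffD2]) auto
    then have "continuous_on {t - 1..t + 1} (\<lambda>s. integral {t - 1..s} h)"
      by (intro indefinite_integral_continuous_1 set_lebesgue_integral_eq_integral(1))
    then have "continuous_on {t - 1..t + 1} (\<lambda>s. R (t - 1) + integral {t - 1..s} h)"
      by (intro continuous_intros)
    moreover have "R (t - 1) + integral {t - 1..s} h = R s" if "s \<in> {t - 1..t + 1}" for s
    proof -
      have "(LINT x:{t - 1<..s}|lborel. h x) = (LINT x:{t - 1..s}|lborel. h x)"
        by (rule set_integral_cong_set) (use AE_lborel_singleton[of "t - 1"] in \<open>auto simp: set_borel_measurable_def elim!: eventually_mono\<close>)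
      then show ?thesis using Rd[of "t - 1" s] that set_borel_integral_eq_integral(2)[OF hi, of "t - 1" s] by simp
    qed
    ultimately have "continuous_on {t - 1..t + 1} R" by (metis (no_types, lifting) continuous_on_cong)
    then have "continuous_on {t - 1<..<t + 1} R" by (rule continuous_on_subset) auto
    then show ?thesis by (simp add: continuous_on_eq_continuous_at)
  qed
  have Rmono: "R a \<le> R b" if "a \<le> b" for a b
  proof -
    have "0 \<le> (LINT x:{a<..b}|lborel. h x)" unfolding set_lebesgue_integral_def
      by (rule Bochner_Integration.integral_nonneg) (simp add: h0)
    then show ?thesis using Rd[OF that] by simp
  qed
  have R0: "R a = 0" if "a < 0" for a using that unfolding R_def by (simp add: set_lebesgue_integral_def)
  have R00: "R 0 = 0" unfolding R_def set_lebesgue_integral_def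
  proof (rule integral_eq_zero_AE)
    show "AE x in lborel. indicator {0..0} x *\<^sub>R h x = 0"
      using AE_lborel_singleton[of 0] by eventually_elim (simp add: indicator_def)
  qed
  \<comment> \<open>F is continued to the left by the constant \<open>F 0\<close>, and
    \<open>h\<close> vanishes there, so that the Stieltjes measures live on the whole line.\<close>
  define F' where "F' t = F (max t 0)" for t
  have F': "\<bar>F' b - F' a\<bar> \<le> R b - R a" if ab: "a \<le> b" for a b
  proof -
    have *: "\<bar>F b - F a\<bar> \<le> R b - R a" if "0 \<le> a" "a \<le> b" for a b
    proof -
      have "integral {a..b} G = (LINT t:{a..b}|lborel. G' t)" by (rule G'e[OF that(1)])
      also have "\<dots> \<le> (LINT t:{a..b}|lborel. h t)"
        by (rule set_integral_mono[OF G'i[OF that(1)] hi]) (simp add: h_def)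
      also have "\<dots> = (LINT t:{a<..b}|lborel. h t)"
        by (rule set_integral_cong_set) (use AE_lborel_singleton[of a] in \<open>auto simp: set_borel_measurable_def elim!: eventually_mono\<close>)
      finally show ?thesis using FG[OF that] Rd[OF that(2)] by simp
    qed
    consider "0 \<le> a" | "a < 0" "0 \<le> b" | "b < 0" by linarith
    then show ?thesis
    proof cases
      case 1 then show ?thesis using *[of a b] ab by (simp add: F'_def)
    next
      case 2 then show ?thesis using *[of 0 b] by (simp add: F'_def R0 R00)
    next
      case 3 then show ?thesis using ab by (simp add: F'_def R0)
    qed
  qed
  have F'cont: "isCont F' t" for t
    unfolding isCont_def
  proof (rule metric_tendsto_imp_tendsto[OF Rcont[of t, unfolded isCont_def]])
    show "\<forall>\<^sub>F x in at t. dist (F' x) (F' t) \<le> dist (R x) (R t)"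
    proof (intro always_eventually allI)
      fix x show "dist (F' x) (F' t) \<le> dist (R x) (R t)"
        using F'[of x t] F'[of t x] by (cases "x \<le> t") (auto simp: dist_real_def)
    qed
  qed
  define M1 where "M1 = interval_measure (\<lambda>t. R t + F' t)"
  define M2 where "M2 = interval_measure (\<lambda>t. R t - F' t)"
  have mono1: "R a + F' a \<le> R b + F' b" and mono2: "R a - F' a \<le> R b - F' b" if "a \<le> b" for a b
    using F'[OF that] by auto
  have cr: "continuous (at_right a) (\<lambda>t. R t + F' t)" "continuous (at_right a) (\<lambda>t. R t - F' t)" for a
    using Rcont[of a] F'cont[of a] by (auto intro!: continuous_intros simp: continuous_at_imp_continuous_within)
  have M1: "emeasure M1 {a<..b} = ennreal (R b + F' b - (R a + F' a))" if "a \<le> b" for a b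
    unfolding M1_def by (rule emeasure_interval_measure_Ioc[OF that mono1 cr(1)])
  have M2: "emeasure M2 {a<..b} = ennreal (R b - F' b - (R a - F' a))" if "a \<le> b" for a b
    unfolding M2_def by (rule emeasure_interval_measure_Ioc[OF that mono2 cr(2)])
  have sM1: "sets M1 = sets borel" and sM2: "sets M2 = sets borel" unfolding M1_def M2_def by simp_all
  \<comment> \<open>On half-open intervals the contributions of F to the two measures cancel, which
    identifies the sum \<open>M3\<close> with \<open>M4\<close>.\<close>
  define M3 where "M3 = measure_of UNIV (sets borel) (\<lambda>A. emeasure M1 A + emeasure M2 A)"
  define M4 where "M4 = density lborel (\<lambda>t. ennreal (2 * h t))"
  have sb: "sigma_algebra UNIV (sets (borel::real measure))" using sets.sigma_algebra_axioms[of "borel::real measure"] by simp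
  have eM3: "emeasure M3 A = emeasure M1 A + emeasure M2 A" if "A \<in> sets borel" for A
    unfolding M3_def
  proof (rule emeasure_measure_of_sigma[OF sb _ _ that])
    show "positive (sets borel) (\<lambda>A. emeasure M1 A + emeasure M2 A)" by (simp add: positive_def)
    show "countably_additive (sets borel) (\<lambda>A. emeasure M1 A + emeasure M2 A)"
    proof (rule countably_additiveI)
      fix A :: "nat \<Rightarrow> real set" assume A: "range A \<subseteq> sets borel" "disjoint_family A"
      have "(\<Sum>i. emeasure M1 (A i) + emeasure M2 (A i)) = (\<Sum>i. emeasure M1 (A i)) + (\<Sum>i. emeasure M2 (A i))"
        by (rule suminf_add[symmetric]) auto
      then show "(\<Sum>i. emeasure M1 (A i) + emeasure M2 (A i)) = emeasure M1 (\<Union>i. A i) + emeasure M2 (\<Union>i. A i)"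
        using A by (simp add: suminf_emeasure sM1 sM2)
    qed
  qed
  have sM3: "sets M3 = sets borel" unfolding M3_def using sigma_algebra.sigma_sets_eq[OF sb] by simp
  have M34: "M3 = M4"
  proof (rule measure_eqI_generator_eq)
    let ?E = "range (\<lambda>(a, b). {a<..b::real})"
    show "Int_stable ?E" by (auto simp: Int_stable_def)
    show "?E \<subseteq> Pow UNIV" by simp
    show "sets M3 = sigma_sets UNIV ?E" "sets M4 = sigma_sets UNIV ?E"
      unfolding sM3 M4_def by (simp_all add: borel_sigma_sets_Ioc)
    show "range (\<lambda>i::nat. {- real i<..real i}) \<subseteq> ?E" by auto
    show "(\<Union>i::nat. {- real i<..real i}) = UNIV"
    proof -
      have "\<exists>i::nat. - real i < x \<and> x \<le> real i" for x
        using reals_Archimedean2[of "\<bar>x\<bar>"] by (auto simp: abs_less_iff) (metis less_imp_le minus_less_iff)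
      then show ?thesis by auto
    qed
    show "emeasure M3 {- real i<..real i} \<noteq> \<infinity>" for i
      by (simp add: eM3 M1 M2)
    fix X assume "X \<in> ?E"
    then obtain a b where X: "X = {a<..b}" by auto
    show "emeasure M3 X = emeasure M4 X"
    proof (cases "a \<le> b")
      case True
      have "emeasure M4 X = (\<integral>\<^sup>+x. 2 * (ennreal (h x) * indicator {a<..b} x) \<partial>lborel)"
        unfolding M4_def X using h0 by (subst emeasure_density) (auto simp: ennreal_mult' mult.assoc)
      also have "\<dots> = ennreal (2 * (R b - R a))"
        using nnh[OF hi', of a b] Rd[OF True] Rmono[OF True] by (simp add: nn_integral_cmult ennreal_mult')
      also have "\<dots> = emeasure M3 X"
        unfolding X using True mono1[OF True] mono2[OF True]
        by (simp add: eM3 M1 M2 ennreal_plus[symmetric] del: ennreal_plus)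
      finally show ?thesis by simp
    qed (simp add: X)
  qed
  have "absolutely_continuous lborel M1"
    unfolding absolutely_continuous_def
  proof
    fix N assume N: "N \<in> null_sets (lborel::real measure)"
    have "emeasure M4 N = 0" unfolding M4_def using N
      by (subst emeasure_density) (auto simp: null_sets_def intro!: nn_integral_null_set[of N, simplified null_sets_def])
    then have "emeasure M1 N = 0" using N eM3[of N] unfolding M34 by (auto simp: null_sets_def)
    then show "N \<in> null_sets M1" using N by (auto simp: null_sets_def sM1)
  qed
  then obtain f where f: "f \<in> borel_measurable lborel" "density lborel f = M1"
    using sigma_finite_measure.Radon_Nikodym[OF sigma_finite_lborel, of M1] sM1 by auto
  define g1 where "g1 t = enn2real (f t)" for t
  have [measurable]: "f \<in> borel_measurable borel" using f(1) by simp
  have g1m[measurable]: "g1 \<in> borel_measurable borel" unfolding g1_def by measurable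
  have g1: "set_integrable lborel {a<..b} g1 \<and> (LINT t:{a<..b}|lborel. g1 t) = R b + F' b - (R a + F' a)" if ab: "a \<le> b" for a b
  proof -
    have fi: "(\<integral>\<^sup>+x. f x * indicator {a<..b} x \<partial>lborel) = ennreal (R b + F' b - (R a + F' a))"
      using M1[OF ab] unfolding f(2)[symmetric] by (subst (asm) emeasure_density) auto
    have "AE x in lborel. f x * indicator {a<..b} x \<noteq> \<infinity>"
      by (rule nn_integral_PInf_AE) (auto simp: fi)
    then have ae: "AE x in lborel. f x * indicator {a<..b} x = ennreal (indicator {a<..b} x *\<^sub>R g1 x)"
      by eventually_elim (auto simp: g1_def indicator_def less_top)
    have nn: "(\<integral>\<^sup>+x. ennreal (indicator {a<..b} x *\<^sub>R g1 x) \<partial>lborel) = ennreal (R b + F' b - (R a + F' a))"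
      unfolding fi[symmetric] by (rule nn_integral_cong_AE) (use ae in \<open>auto elim!: eventually_mono\<close>)
    have "integrable lborel (\<lambda>x. indicator {a<..b} x *\<^sub>R g1 x)"
      by (rule integrableI_nn_integral_finite[OF _ _ nn]) (auto simp: g1_def)
    moreover have "(\<integral>x. indicator {a<..b} x *\<^sub>R g1 x \<partial>lborel) = R b + F' b - (R a + F' a)"
      by (rule integral_eq_nn_integral[THEN trans]) (use nn mono1[OF ab] in \<open>auto simp: g1_def\<close>)
    ultimately show ?thesis unfolding set_integrable_def set_lebesgue_integral_def by simp
  qed
  have g2: "set_integrable lborel {a<..b} (\<lambda>t. g1 t - h t) \<and> (LINT t:{a<..b}|lborel. g1 t - h t) = F' b - F' a" if ab: "a \<le> b" for a b
    using set_integral_diff[OF conjunct1[OF g1[OF ab]] hi'] g1[OF ab] Rd[OF ab] by simp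
  have g3: "set_integrable lborel {a..b} (\<lambda>t. g1 t - h t) \<and> (LINT t:{a..b}|lborel. g1 t - h t) = F' b - F' a" if ab: "a \<le> b" for a b
  proof
    show "set_integrable lborel {a..b} (\<lambda>t. g1 t - h t)"
      by (rule set_integrable_subset[OF conjunct1[OF g2[of "a - 1" b]]]) (use ab in auto)
    have "(LINT t:{a<..b}|lborel. g1 t - h t) = (LINT t:{a..b}|lborel. g1 t - h t)"
      by (rule set_integral_cong_set) (use AE_lborel_singleton[of a] in \<open>auto simp: set_borel_measurable_def elim!: eventually_mono\<close>)
    then show "(LINT t:{a..b}|lborel. g1 t - h t) = F' b - F' a" using g2[OF ab] by simp
  qed
  show ?thesis
  proof (intro exI[of _ "\<lambda>t. g1 t - h t"] conjI allI impI)
    fix T :: real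
    show "(\<lambda>t. g1 t - h t) absolutely_integrable_on {0..T}"
    proof (cases "0 \<le> T")
      case True
      then show ?thesis using g3[OF True] unfolding set_integrable_def by (intro integrable_completion[THEN iffD2]) auto
    qed (simp add: set_integrable_def)
  next
    fix a b :: real assume ab: "0 \<le> a" "a \<le> b"
    then show "F b - F a = integral {a..b} (\<lambda>t. g1 t - h t)"
      using g3[OF ab(2)] set_borel_integral_eq_integral(2)[of "{a..b}" "\<lambda>t. g1 t - h t"] by (simp add: F'_def)
  qed
qed

lemma AC_differentiable_ae:
  fixes F G :: "real \<Rightarrow> real"
  assumes G: "\<And>T. G absolutely_integrable_on {0..T}"
    and FG: "\<And>a b. 0 \<le> a \<Longrightarrow> a \<le> b \<Longrightarrow> \<bar>F b - F a\<bar> \<le> integral {a..b} G"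
  shows "\<exists>g::real \<Rightarrow> real. (\<forall>T. g absolutely_integrable_on {0..T}) \<and>
    (\<forall>a b. 0 \<le> a \<longrightarrow> a \<le> b \<longrightarrow> F b - F a = integral {a..b} g) \<and>
    (AE t in lborel. t > 0 \<longrightarrow> (F has_real_derivative g t) (at t))"
proof -
  obtain g :: "real \<Rightarrow> real" where g: "\<And>T. g absolutely_integrable_on {0..T}"
    "\<And>a b. 0 \<le> a \<Longrightarrow> a \<le> b \<Longrightarrow> F b - F a = integral {a..b} g"
    using absolutely_continuous_FTC[of G F] G FG by metis
  have "AE t in lborel. t > 0 \<longrightarrow> (F has_real_derivative g t) (at t)"
    using AE_has_derivative_indefinite_integral[OF g(1)]
  proof eventually_elim
    case (elim t)
    show ?case
    proof
      assume t: "t > 0"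
      with elim have "((\<lambda>s. F 0 + integral {0..s} g) has_real_derivative g t) (at t)"
        by (auto intro!: derivative_eq_intros)
      then show "(F has_real_derivative g t) (at t)"
        by (rule has_field_derivative_transform_within_open[of _ _ _ "{0<..}"]) (use t in \<open>simp_all add: g(2)[of 0, symmetric] less_imp_le\<close>)
    qed
  qed
  with g show ?thesis by blast
qed

text \<open>The sign is required only of derivatives that exist, since their existence almost
  everywhere is supplied by \<open>AC_differentiable_ae\<close>.\<close>

lemma AC_nonincreasing:
  fixes F G :: "real \<Rightarrow> real"
  assumes G: "\<And>T. G absolutely_integrable_on {0..T}"
    and FG: "\<And>a b. 0 \<le> a \<Longrightarrow> a \<le> b \<Longrightarrow> \<bar>F b - F a\<bar> \<le> integral {a..b} G"
    and le: "AE t in lborel. t > 0 \<longrightarrow> (\<forall>D. (F has_real_derivative D) (at t) \<longrightarrow> D \<le> 0)"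
    and ab: "0 \<le> a" "a \<le> b"
  shows "F b \<le> F a"
proof -
  have "\<exists>g::real \<Rightarrow> real. (\<forall>T. g absolutely_integrable_on {0..T}) \<and>
    (\<forall>a b. 0 \<le> a \<longrightarrow> a \<le> b \<longrightarrow> F b - F a = integral {a..b} g) \<and>
    (AE t in lborel. t > 0 \<longrightarrow> (F has_real_derivative g t) (at t))"
    by (rule AC_differentiable_ae[of G F]) (use G FG in auto)
  then obtain g :: "real \<Rightarrow> real" where g: "\<And>T. g absolutely_integrable_on {0..T}"
    "\<And>a b. 0 \<le> a \<Longrightarrow> a \<le> b \<Longrightarrow> F b - F a = integral {a..b} g"
    "AE t in lborel. t > 0 \<longrightarrow> (F has_real_derivative g t) (at t)"
    by blast
  have gi: "g absolutely_integrable_on {a..b}"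
    by (rule set_integrable_subset[OF g(1)[of b]]) (use ab in auto)
  have ae: "AE t in lborel. t > 0 \<longrightarrow> g t \<le> 0" using le g(3) by eventually_elim auto
  have "integral {a..b} g = (LINT t:{a..b}|lebesgue. g t)" by (rule set_lebesgue_integral_eq_integral(2)[OF gi, symmetric])
  also have "\<dots> \<le> (LINT t:{a..b}|lebesgue. 0)"
    unfolding set_lebesgue_integral_def
  proof (rule integral_mono_AE)
    show "AE x in lebesgue. indicator {a..b} x *\<^sub>R g x \<le> indicator {a..b} x *\<^sub>R 0"
      using AE_completion[OF ae] AE_completion[OF AE_lborel_singleton[of 0]]
      by eventually_elim (use ab in \<open>auto simp: indicator_def\<close>)
  qed (use gi in \<open>auto simp: set_integrable_def\<close>)
  finally show ?thesis using g(2)[OF ab] by simp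
qed

section \<open>Riesz representation on compact metric spaces\<close>

abbreviation (input) cts :: "('a::topological_space \<Rightarrow> real) \<Rightarrow> bool" where
  "cts \<equiv> continuous_on UNIV"

text \<open>Test functions need only vanish outside \<open>U\<close>; their support may touch the
  boundary, which is why truncations \<open>max 0 (\<phi> x - e)\<close> appear below.\<close>

definition subordinate :: "'a::metric_space set \<Rightarrow> ('a \<Rightarrow> real) set" where
  "subordinate U = {\<phi>. cts \<phi> \<and> (\<forall>x. 0 \<le> \<phi> x \<and> \<phi> x \<le> 1 \<and> (x \<notin> U \<longrightarrow> \<phi> x = 0))}"

locale positive_functional =
  fixes L :: "('a::metric_space \<Rightarrow> real) \<Rightarrow> real"
  assumes compact_space: "compact (UNIV :: 'a set)"
    and add: "cts \<phi> \<Longrightarrow> cts \<psi> \<Longrightarrow> L (\<lambda>x. \<phi> x + \<psi> x) = L \<phi> + L \<psi>"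
    and scale: "cts \<phi> \<Longrightarrow> L (\<lambda>x. r * \<phi> x) = r * L \<phi>"
    and nonneg: "cts \<phi> \<Longrightarrow> (\<And>x. 0 \<le> \<phi> x) \<Longrightarrow> 0 \<le> L \<phi>"
begin

lemma L0: "L (\<lambda>x. 0) = 0"
  using scale[of "\<lambda>x. 0" 0] by simp

lemma mono: "cts \<phi> \<Longrightarrow> cts \<psi> \<Longrightarrow> (\<And>x. \<phi> x \<le> \<psi> x) \<Longrightarrow> L \<phi> \<le> L \<psi>"
  using nonneg[of "\<lambda>x. \<psi> x - \<phi> x"] add[of \<phi> "\<lambda>x. \<psi> x - \<phi> x"] continuous_on_diff[of UNIV \<psi> \<phi>] by auto

lemma sum_eq: "finite I \<Longrightarrow> (\<And>i. i \<in> I \<Longrightarrow> cts (\<phi> i)) \<Longrightarrow> L (\<lambda>x. \<Sum>i\<in>I. \<phi> i x) = (\<Sum>i\<in>I. L (\<phi> i))"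
proof (induction rule: finite_induct)
  case empty
  then show ?case by (simp add: L0)
next
  case (insert i I)
  then show ?case using add[of "\<phi> i" "\<lambda>x. \<Sum>i\<in>I. \<phi> i x"] by (auto intro!: continuous_intros)
qed

text \<open>Start of the Riesz-Markov construction: a content on open sets, then the outer measure
  it induces, to which Caratheodory's lemma is applied.\<close>

definition content_open :: "'a set \<Rightarrow> real" where
  "content_open U = (SUP \<phi>\<in>subordinate U. L \<phi>)"

definition outer_content :: "'a set \<Rightarrow> real" where
  "outer_content A = (INF U\<in>{U. open U \<and> A \<subseteq> U}. content_open U)"

lemma zero_sub: "(\<lambda>x. 0) \<in> subordinate U"
  by (simp add: subordinate_def)

lemma L_le_one: "\<phi> \<in> subordinate U \<Longrightarrow> L \<phi> \<le> L (\<lambda>x. 1)"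
  by (rule mono) (auto simp: subordinate_def)

lemma bdd: "bdd_above (L ` subordinate U)"
  by (rule bdd_aboveI[of _ "L (\<lambda>x. 1)"]) (auto intro: L_le_one)

lemma content_open_upper: "\<phi> \<in> subordinate U \<Longrightarrow> L \<phi> \<le> content_open U"
  unfolding content_open_def by (rule cSUP_upper[OF _ bdd])

lemma content_open_least: "(\<And>\<phi>. \<phi> \<in> subordinate U \<Longrightarrow> L \<phi> \<le> M) \<Longrightarrow> content_open U \<le> M"
  unfolding content_open_def by (rule cSUP_least) (use zero_sub in auto)

lemma content_open_nonneg: "0 \<le> content_open U"
  using content_open_upper[OF zero_sub] by (simp add: L0)

lemma content_open_mono: "U \<subseteq> W \<Longrightarrow> content_open U \<le> content_open W"
  by (rule content_open_least, rule content_open_upper) (auto simp: subordinate_def)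

lemma outer_content_lower: "open U \<Longrightarrow> A \<subseteq> U \<Longrightarrow> outer_content A \<le> content_open U"
  unfolding outer_content_def
  by (rule cINF_lower) (auto intro: bdd_belowI[of _ 0] content_open_nonneg)

lemma outer_content_greatest: "(\<And>U. open U \<Longrightarrow> A \<subseteq> U \<Longrightarrow> M \<le> content_open U) \<Longrightarrow> M \<le> outer_content A"
  unfolding outer_content_def by (rule cINF_greatest) auto

lemma outer_content_open: "open U \<Longrightarrow> outer_content U = content_open U"
  by (intro antisym outer_content_lower outer_content_greatest content_open_mono) auto

lemma outer_content_nonneg: "0 \<le> outer_content A"
  by (rule outer_content_greatest) (rule content_open_nonneg)

lemma outer_content_mono: "A \<subseteq> B \<Longrightarrow> outer_content A \<le> outer_content B"
  by (rule outer_content_greatest, rule outer_content_lower) auto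

text \<open>Truncation at height e costs at most e times the total mass and confines the function to
  the compact set where \<phi> is at least e.\<close>

lemma L_shift:
  assumes "cts \<phi>" "e \<ge> 0"
  shows "L \<phi> \<le> L (\<lambda>x. max 0 (\<phi> x - e)) + e * L (\<lambda>x. 1)"
proof -
  have "L \<phi> \<le> L (\<lambda>x. max 0 (\<phi> x - e) + e * 1)"
    using assms by (intro mono) (auto intro!: continuous_intros)
  also have "\<dots> = L (\<lambda>x. max 0 (\<phi> x - e)) + e * L (\<lambda>x. 1)"
    using assms by (subst add) (auto intro!: continuous_intros simp: scale[of "\<lambda>x. 1" e, simplified])
  finally show ?thesis .
qed

text \<open>After truncation, the compact set where \<phi> is at least e has a finite subcover, and
  a partition of unity built from distances to the complements splits the truncated function into
  pieces subordinate to the single sets.\<close>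

lemma content_open_UN:
  assumes U: "\<And>i::nat. open (U i)"
  shows "ennreal (content_open (\<Union>i. U i)) \<le> (\<Sum>i. ennreal (content_open (U i)))"
proof -
  have main: "\<exists>n. L \<phi> - e * L (\<lambda>x. 1) \<le> (\<Sum>i<n. content_open (U i))"
    if \<phi>: "\<phi> \<in> subordinate (\<Union>i. U i)" and e: "e > 0" for \<phi> e
  proof -
    have c[continuous_intros]: "cts \<phi>" using \<phi> by (simp add: subordinate_def)
    define K where "K = {x. e \<le> \<phi> x}"
    have "closed K" unfolding K_def using c by (intro closed_Collect_le) (auto intro: continuous_intros)
    then have K: "compact K" using compact_space by (metis compact_Int_closed inf_top_left)
    have "K \<subseteq> (\<Union>i. U i)" using \<phi> e unfolding K_def subordinate_def by force
    then obtain I where I: "finite I" "K \<subseteq> (\<Union>i\<in>I. U i)"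
      using compactE_image[OF K, of UNIV U] U by auto
    \<comment> \<open>\<open>infdist\<close> to the empty set is 0 by convention, so the whole space
      needs a separate case.\<close>
    define d where "d i x = (if U i = UNIV then 1 else infdist x (- U i))" for i x
    have dc[continuous_intros]: "cts (d i)" for i
      unfolding d_def by (cases "U i = UNIV") (auto intro!: continuous_intros)
    have d0: "d i x \<ge> 0" for i x unfolding d_def by (simp add: infdist_nonneg)
    have dpos: "d i x > 0 \<longleftrightarrow> x \<in> U i" for i x
    proof (cases "U i = UNIV")
      case False
      then have "infdist x (- U i) = 0 \<longleftrightarrow> x \<in> - U i"
        using U[of i] in_closed_iff_infdist_zero[of "- U i" x] by (auto simp: closed_Compl)
      then show ?thesis using False infdist_nonneg[of x "- U i"] unfolding d_def by auto
    qed (simp add: d_def)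
    define D where "D x = (\<Sum>i\<in>I. d i x)" for x
    have Dc[continuous_intros]: "cts D" unfolding D_def by (intro continuous_intros)
    have Dpos: "D x > 0" if "x \<in> K" for x
    proof -
      have "x \<in> (\<Union>i\<in>I. U i)" using I(2) that by (rule subsetD)
      then obtain i where "i \<in> I" "x \<in> U i" by blast
      then show ?thesis unfolding D_def using I d0 dpos by (intro sum_pos2[of _ i]) auto
    qed
    obtain \<delta> where \<delta>: "\<delta> > 0" "\<And>x. x \<in> K \<Longrightarrow> \<delta> \<le> D x"
    proof (cases "K = {}")
      case False
      obtain x0 where "x0 \<in> K" "\<forall>x\<in>K. D x0 \<le> D x"
        using continuous_attains_inf[OF K False continuous_on_subset[OF Dc]] by auto
      then show ?thesis using that[of "D x0"] Dpos by auto
    qed (use that[of 1] in auto)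
    \<comment> \<open>\<open>D\<close> may vanish off \<open>K\<close>. Replacing it by
      \<open>max (D x) \<delta>\<close> keeps the quotient continuous and changes nothing on
      \<open>K\<close>.\<close>
    define \<psi> where "\<psi> i x = max 0 (\<phi> x - e) * (d i x / max (D x) \<delta>)" for i x
    have \<psi>c: "cts (\<psi> i)" for i unfolding \<psi>_def using \<delta>(1)
      by (intro continuous_intros) (auto simp: max_def)
    have \<psi>s: "\<psi> i \<in> subordinate (U i)" if "i \<in> I" for i
    proof -
      have "d i x \<le> D x" for x unfolding D_def using that I d0 by (intro member_le_sum) auto
      then have le: "d i x / max (D x) \<delta> \<le> 1" for x using \<delta>(1) by (auto simp: divide_le_eq max_def intro: order_trans)
      have "max 0 (\<phi> x - e) \<le> 1" for x using \<phi> e by (auto simp: subordinate_def max_def intro: order_trans[of "\<phi> x - e" "\<phi> x"])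
      then have "\<psi> i x \<le> 1" for x unfolding \<psi>_def using le[of x] d0[of i x] \<delta>(1)
        by (intro mult_le_one) (auto intro!: divide_nonneg_nonneg)
      moreover have "0 \<le> \<psi> i x" for x unfolding \<psi>_def using d0[of i x] \<delta>(1) by (auto intro!: mult_nonneg_nonneg divide_nonneg_nonneg)
      moreover have "\<psi> i x = 0" if "x \<notin> U i" for x using that dpos[of i x] d0[of i x] unfolding \<psi>_def by auto
      ultimately show ?thesis unfolding subordinate_def using \<psi>c by blast
    qed
    have "(\<Sum>i\<in>I. \<psi> i x) = max 0 (\<phi> x - e)" for x
    proof (cases "x \<in> K")
      case True
      have "(\<Sum>i\<in>I. \<psi> i x) = max 0 (\<phi> x - e) * (D x / max (D x) \<delta>)"
        unfolding \<psi>_def D_def by (simp add: sum_distrib_left sum_divide_distrib)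
      then show ?thesis using \<delta>(2)[OF True] Dpos[OF True] by (simp add: max_def)
    next
      case False then show ?thesis unfolding \<psi>_def K_def by simp
    qed
    then have "L (\<lambda>x. max 0 (\<phi> x - e)) = (\<Sum>i\<in>I. L (\<psi> i))"
      using sum_eq[OF I(1), of \<psi>] \<psi>c by simp
    also have "\<dots> \<le> (\<Sum>i\<in>I. content_open (U i))"
      by (intro sum_mono content_open_upper \<psi>s)
    also have "\<dots> \<le> (\<Sum>i<Suc (Max (insert 0 I)). content_open (U i))"
      using I(1) by (intro sum_mono2) (auto simp: content_open_nonneg less_Suc_eq_le intro!: Max_ge)
    finally show ?thesis using L_shift[OF c, of e] e by (intro exI[of _ "Suc (Max (insert 0 I))"]) auto
  qed
  show ?thesis
  proof (cases "(\<Sum>i. ennreal (content_open (U i))) = \<top>")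
    case False
    then obtain S where S: "(\<Sum>i. ennreal (content_open (U i))) = ennreal S" "S \<ge> 0"
      by (cases "(\<Sum>i. ennreal (content_open (U i)))") auto
    have "content_open (\<Union>i. U i) \<le> S"
    proof (rule content_open_least)
      fix \<phi> assume \<phi>: "\<phi> \<in> subordinate (\<Union>i. U i)"
      have L1: "L (\<lambda>x. 1) \<ge> 0" by (rule nonneg) auto
      show "L \<phi> \<le> S"
      proof (rule field_le_epsilon)
        fix e :: real assume e: "e > 0"
        define e' where "e' = e / (L (\<lambda>x. 1) + 1)"
        have e': "e' > 0" "e' * L (\<lambda>x. 1) \<le> e" using e L1 by (auto simp: e'_def field_simps)
        obtain n where n: "L \<phi> - e' * L (\<lambda>x. 1) \<le> (\<Sum>i<n. content_open (U i))" using main[OF \<phi> e'(1)] by blast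
        have "ennreal (\<Sum>i<n. content_open (U i)) = (\<Sum>i<n. ennreal (content_open (U i)))"
          by (simp add: content_open_nonneg sum_ennreal)
        also have "\<dots> \<le> ennreal S" unfolding S(1)[symmetric] by (rule sum_le_suminf) auto
        finally have "(\<Sum>i<n. content_open (U i)) \<le> S" using S(2) by (simp add: ennreal_le_iff)
        then show "L \<phi> \<le> S + e" using n e'(2) by linarith
      qed
    qed
    then show ?thesis unfolding S(1) by (rule ennreal_leI)
  qed simp
qed

lemma outer_content_empty: "outer_content {} = 0"
proof -
  have "content_open {} \<le> 0"
    by (rule content_open_least) (auto simp: subordinate_def L0[unfolded fun_eq_iff] intro: eq_refl[OF trans[OF arg_cong[of _ "\<lambda>x. 0" L] L0]])
  then show ?thesis using outer_content_open[of "{}"] content_open_nonneg[of "{}"] by simp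
qed

lemma outer_content_UN: "ennreal (outer_content (\<Union>i::nat. A i)) \<le> (\<Sum>i. ennreal (outer_content (A i)))"
proof (rule ennreal_le_epsilon)
  fix e :: real assume e: "e > 0"
  have "\<exists>U. open U \<and> A i \<subseteq> U \<and> content_open U < outer_content (A i) + e * (1/2) ^ Suc i" for i
  proof (rule ccontr)
    assume "\<not> ?thesis"
    then have "outer_content (A i) + e * (1/2) ^ Suc i \<le> outer_content (A i)"
      by (intro outer_content_greatest) (meson not_less)
    moreover have "e * (1/2) ^ Suc i > 0" using e by (simp del: power_Suc)
    ultimately show False by linarith
  qed
  then obtain U where U: "\<And>i. open (U i)" "\<And>i. A i \<subseteq> U i" "\<And>i. content_open (U i) < outer_content (A i) + e * (1/2) ^ Suc i"
    by metis
  have "ennreal (outer_content (\<Union>i. A i)) \<le> ennreal (content_open (\<Union>i. U i))"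
    using U by (intro ennreal_leI outer_content_lower) blast+
  also have "\<dots> \<le> (\<Sum>i. ennreal (content_open (U i)))" by (rule content_open_UN[OF U(1)])
  also have "\<dots> \<le> (\<Sum>i. ennreal (outer_content (A i)) + ennreal (e * (1/2) ^ Suc i))"
    using U(3) e by (intro suminf_le) (auto simp: ennreal_plus[symmetric] outer_content_nonneg less_imp_le intro!: ennreal_leI simp del: ennreal_plus power_Suc)
  also have "\<dots> = (\<Sum>i. ennreal (outer_content (A i))) + (\<Sum>i. ennreal (e * (1/2) ^ Suc i))"
    by (rule suminf_add[symmetric]) auto
  also have "(\<Sum>i. ennreal (e * (1/2) ^ Suc i)) = ennreal e"
    using e power_half_series[THEN sums_mult, of e] by (intro suminf_ennreal_eq) (auto simp del: power_Suc)
  finally show "ennreal (outer_content (\<Union>i. A i)) \<le> (\<Sum>i. ennreal (outer_content (A i))) + ennreal e" .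
qed

text \<open>Caratheodory's condition for open sets. The part of \<open>W\<close> where a test
  function \<phi> of \<open>U \<inter> W\<close> is below e' is open and contains
  \<open>A - U\<close>; test functions supported there can be added to the truncation of \<phi>
  without exceeding 1.\<close>

lemma outer_content_split:
  assumes U: "open U"
  shows "outer_content (U \<inter> A) + outer_content (A - U) \<le> outer_content A"
proof (rule outer_content_greatest)
  fix W assume W: "open W" "A \<subseteq> W"
  have L1: "L (\<lambda>x. 1) \<ge> 0" by (rule nonneg) auto
  have "content_open (U \<inter> W) \<le> content_open W - outer_content (A - U)"
  proof (rule content_open_least)
    fix \<phi> assume \<phi>: "\<phi> \<in> subordinate (U \<inter> W)"
    have c: "cts \<phi>" using \<phi> by (simp add: subordinate_def)
    show "L \<phi> \<le> content_open W - outer_content (A - U)"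
    proof (rule field_le_epsilon)
      fix e :: real assume e: "e > 0"
      define e' where "e' = e / (L (\<lambda>x. 1) + 1)"
      have e': "e' > 0" "e' * L (\<lambda>x. 1) \<le> e" using e L1 by (auto simp: e'_def field_simps)
      define W' where "W' = W \<inter> {x. \<phi> x < e'}"
      have "open W'" unfolding W'_def using W(1) c by (intro open_Int open_Collect_less continuous_on_const) (auto intro: continuous_intros c)
      moreover have "A - U \<subseteq> W'" using W(2) \<phi> e' by (auto simp: W'_def subordinate_def)
      ultimately have 1: "outer_content (A - U) \<le> content_open W'" by (rule outer_content_lower)
      have "content_open W' \<le> content_open W - L (\<lambda>x. max 0 (\<phi> x - e'))"
      proof (rule content_open_least)
        fix \<psi> assume \<psi>: "\<psi> \<in> subordinate W'"
        have c': "cts \<psi>" using \<psi> by (simp add: subordinate_def)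
        have cm: "cts (\<lambda>x. max 0 (\<phi> x - e'))" by (intro continuous_intros c)
        have "(\<lambda>x. max 0 (\<phi> x - e') + \<psi> x) \<in> subordinate W"
          unfolding subordinate_def mem_Collect_eq
        proof (intro conjI allI impI)
          show "cts (\<lambda>x. max 0 (\<phi> x - e') + \<psi> x)" by (rule continuous_on_add[OF cm c'])
          fix x
          have p: "0 \<le> \<phi> x" "\<phi> x \<le> 1" "x \<notin> U \<inter> W \<Longrightarrow> \<phi> x = 0" using \<phi> by (auto simp: subordinate_def)
          have q: "0 \<le> \<psi> x" "\<psi> x \<le> 1" "x \<notin> W' \<Longrightarrow> \<psi> x = 0" using \<psi> by (auto simp: subordinate_def)
          show "0 \<le> max 0 (\<phi> x - e') + \<psi> x" using q by simp
          show "max 0 (\<phi> x - e') + \<psi> x \<le> 1"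
            using p q e' by (cases "\<phi> x < e'") (auto simp: W'_def max_def)
          assume "x \<notin> W" then show "max 0 (\<phi> x - e') + \<psi> x = 0" using p q e' by (auto simp: W'_def max_def)
        qed
        from content_open_upper[OF this] show "L \<psi> \<le> content_open W - L (\<lambda>x. max 0 (\<phi> x - e'))"
          using add[OF cm c'] by (simp only: le_diff_eq add.commute)
      qed
      then show "L \<phi> \<le> content_open W - outer_content (A - U) + e"
        using L_shift[OF c, of e'] e' 1 by simp
    qed
  qed
  moreover have "outer_content (U \<inter> A) \<le> content_open (U \<inter> W)"
    using U W by (intro outer_content_lower) auto
  ultimately show "outer_content (U \<inter> A) + outer_content (A - U) \<le> content_open W" by simp
qed

lemma outer_content_Un: "ennreal (outer_content (A \<union> B)) \<le> ennreal (outer_content A) + ennreal (outer_content B)"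
proof -
  have "(\<Union>i::nat. if i = 0 then A else if i = 1 then B else {}) = A \<union> B" by (auto split: if_splits)
  moreover have "(\<Sum>i::nat. ennreal (outer_content (if i = 0 then A else if i = 1 then B else {})))
     = (\<Sum>i\<in>{0,1::nat}. ennreal (outer_content (if i = 0 then A else if i = 1 then B else {})))"
    by (rule suminf_finite) (auto simp: outer_content_empty)
  ultimately show ?thesis using outer_content_UN[of "\<lambda>i. if i = 0 then A else if i = 1 then B else {}"] by simp
qed

lemma measure_space_outer_content:
  obtains \<sigma> :: "'a measure" where "sets \<sigma> = sets borel" "\<And>A. A \<in> sets borel \<Longrightarrow> emeasure \<sigma> A = ennreal (outer_content A)"
proof -
  let ?f = "\<lambda>A. ennreal (outer_content A)"
  define \<Lambda> where "\<Lambda> = lambda_system (UNIV::'a set) UNIV ?f"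
  interpret P: sigma_algebra "UNIV::'a set" UNIV by (rule sigma_algebra_Pow[of UNIV, simplified])
  have oms: "outer_measure_space UNIV ?f"
    unfolding outer_measure_space_def positive_def increasing_def countably_subadditive_def
    by (auto simp: outer_content_empty outer_content_UN intro!: ennreal_leI outer_content_mono)
  have ms: "measure_space UNIV \<Lambda> ?f" unfolding \<Lambda>_def by (rule P.caratheodory_lemma[OF oms])
  then have sa: "sigma_algebra UNIV \<Lambda>" by (simp add: measure_space_def)
  have op: "U \<in> \<Lambda>" if "open U" for U
    unfolding \<Lambda>_def lambda_system_def
  proof (clarsimp, rule antisym)
    fix x :: "'a set"
    have "ennreal (outer_content (U \<inter> x)) + ennreal (outer_content ((UNIV - U) \<inter> x)) = ennreal (outer_content (U \<inter> x) + outer_content (x - U))"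
      by (simp add: outer_content_nonneg Diff_Int_distrib2 Diff_eq Int_commute)
    also have "\<dots> \<le> ennreal (outer_content x)" by (intro ennreal_leI outer_content_split that)
    finally show "ennreal (outer_content (U \<inter> x)) + ennreal (outer_content ((UNIV - U) \<inter> x)) \<le> ennreal (outer_content x)" .
    have "x = (U \<inter> x) \<union> ((UNIV - U) \<inter> x)" by auto
    then show "ennreal (outer_content x) \<le> ennreal (outer_content (U \<inter> x)) + ennreal (outer_content ((UNIV - U) \<inter> x))"
      using outer_content_Un[of "U \<inter> x" "(UNIV - U) \<inter> x"] by simp
  qed
  have sub: "sets borel \<subseteq> \<Lambda>" unfolding borel_def
    by (subst sets_measure_of, simp) (rule sigma_algebra.sigma_sets_subset[OF sa], use op in auto)
  have sb: "sigma_algebra UNIV (sets (borel::'a measure))" using sets.sigma_algebra_axioms[of "borel::'a measure"] by simp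
  have ms': "measure_space UNIV (sets borel) ?f" by (rule measure_down[OF ms sb sub])
  have m: "positive (sets borel) ?f" "countably_additive (sets borel) ?f" using ms' by (auto simp: measure_space_def)
  show ?thesis
  proof (rule that[of "measure_of UNIV (sets borel) ?f"])
    show "sets (measure_of UNIV (sets borel) ?f) = sets (borel::'a measure)"
      using sigma_algebra.sigma_sets_eq[OF sb] by simp
    show "emeasure (measure_of UNIV (sets borel) ?f) A = ?f A" if "A \<in> sets borel" for A
      by (rule emeasure_measure_of_sigma[OF sb m that])
  qed
qed

text \<open>Layer-cake: \<open>n * \<phi> x\<close> is the sum over j of the slices
  \<open>min 1 (max 0 (n * \<phi> x - j))\<close>, each subordinate to a superlevel set.\<close>

lemma L_le_layers:
  assumes c: "cts \<phi>" and \<phi>: "\<And>x. 0 \<le> \<phi> x" "\<And>x. \<phi> x \<le> 1" and n: "n > 0"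
  shows "L \<phi> \<le> (\<Sum>j<n. content_open {x. real j / n < \<phi> x}) / n"
proof -
  define \<psi> where "\<psi> j x = min 1 (max 0 (n * \<phi> x - real j))" for j x
  have \<psi>c: "cts (\<psi> j)" for j unfolding \<psi>_def using c by (intro continuous_intros)
  have sum: "(\<Sum>j<m. min 1 (max 0 (y - real j))) = min (real m) y" if "0 \<le> y" for y :: real and m
    using that by (induction m) (auto simp: min_def max_def)
  have "(\<Sum>j<n. \<psi> j x) = n * \<phi> x" for x
    unfolding \<psi>_def using sum[of "n * \<phi> x" n] \<phi>[of x] n by (simp add: min_def)
  then have "n * L \<phi> = (\<Sum>j<n. L (\<psi> j))"
    using sum_eq[of "{..<n}" \<psi>] \<psi>c scale[OF c, of n] by simp
  also have "\<dots> \<le> (\<Sum>j<n. content_open {x. real j / n < \<phi> x})"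
  proof (intro sum_mono content_open_upper)
    fix j assume "j \<in> {..<n}"
    show "\<psi> j \<in> subordinate {x. real j / n < \<phi> x}"
      unfolding subordinate_def using \<psi>c n by (auto simp: \<psi>_def not_less field_simps)
  qed
  finally show ?thesis using n by (simp add: field_simps)
qed

text \<open>For \<phi> between 0 and 1 the layer estimate bounds L \<phi> by the integral up to mass
  / n. The same bound for 1 - \<phi> gives equality, and an affine change reaches all continuous
  functions.\<close>

theorem representation:
  obtains \<sigma> :: "'a measure" where "sets \<sigma> = sets borel" "finite_measure \<sigma>"
    "\<And>\<phi>. cts \<phi> \<Longrightarrow> (\<integral>x. \<phi> x \<partial>\<sigma>) = L \<phi>"
proof -
  obtain \<sigma> :: "'a measure" where \<sigma>: "sets \<sigma> = sets borel" "\<And>A. A \<in> sets borel \<Longrightarrow> emeasure \<sigma> A = ennreal (outer_content A)"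
    by (rule measure_space_outer_content) (rule that)
  have sp: "space \<sigma> = UNIV" using sets_eq_imp_space_eq[OF \<sigma>(1)] by simp
  interpret finite_measure \<sigma> by standard (simp add: \<sigma>(2) sp)
  have meas: "measure \<sigma> A = outer_content A" if "A \<in> sets borel" for A
    using \<sigma>(2)[OF that] outer_content_nonneg[of A] by (simp add: measure_def)
  have L1: "L (\<lambda>x. 1) = measure \<sigma> UNIV"
  proof -
    have "L (\<lambda>x. 1) \<le> content_open UNIV" by (rule content_open_upper) (simp add: subordinate_def)
    moreover have "content_open UNIV \<le> L (\<lambda>x. 1)" by (rule content_open_least) (rule L_le_one)
    ultimately show ?thesis by (simp add: meas outer_content_open)
  qed
  have bm: "\<phi> \<in> borel_measurable \<sigma>" if "cts \<phi>" for \<phi> :: "'a \<Rightarrow> real"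
    using borel_measurable_continuous_onI[OF that] measurable_cong_sets[OF \<sigma>(1) refl] by auto
  have int01: "integrable \<sigma> \<phi>" if "cts \<phi>" "\<And>x. 0 \<le> \<phi> x" "\<And>x. \<phi> x \<le> 1" for \<phi> :: "'a \<Rightarrow> real"
    by (rule integrable_const_bound[where B=1]) (use that bm in auto)
  have le: "L \<phi> \<le> (\<integral>x. \<phi> x \<partial>\<sigma>)" if c: "cts \<phi>" and \<phi>: "\<And>x. 0 \<le> \<phi> x" "\<And>x. \<phi> x \<le> 1" for \<phi>
  proof -
    have "L \<phi> \<le> (\<integral>x. \<phi> x \<partial>\<sigma>) + measure \<sigma> UNIV / real (Suc n)" for n
    proof -
      let ?n = "Suc n"
      let ?A = "\<lambda>j. {x. real j / ?n < \<phi> x}"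
      have o: "open (?A j)" for j using c by (intro open_Collect_less) (auto intro: continuous_intros)
      have "L \<phi> \<le> (\<Sum>j<?n. content_open (?A j)) / ?n" by (rule L_le_layers[OF c \<phi>]) simp
      also have "\<dots> = (\<Sum>j<?n. measure \<sigma> (?A j)) / ?n" using o by (simp add: meas outer_content_open)
      also have "\<dots> = (\<integral>x. (\<Sum>j<?n. indicator (?A j) x) / ?n \<partial>\<sigma>)"
        using o \<sigma>(1) by (simp add: sp emeasure_finite less_top[symmetric])
      also have "\<dots> \<le> (\<integral>x. \<phi> x + 1 / ?n \<partial>\<sigma>)"
      proof (rule integral_mono)
        show "integrable \<sigma> (\<lambda>x. (\<Sum>j<?n. indicat_real (?A j) x) / ?n)" using o \<sigma>(1) by (auto simp: less_top[symmetric])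
        show "integrable \<sigma> (\<lambda>x. \<phi> x + 1 / ?n)" using int01[OF c \<phi>] by auto
        fix x
        \<comment> \<open>At most \<open>?n * \<phi> x + 1\<close> of the indices j satisfy
          \<open>j < ?n * \<phi> x\<close>; this is the source of the error 1 / n.\<close>
        have *: "(\<Sum>j<m. indicat_real {x. real j / ?n < \<phi> x} x) \<le> ?n * \<phi> x + 1" for m
        proof (induction m)
          case (Suc m)
          have "(\<Sum>j<m. indicat_real {x. real j / ?n < \<phi> x} x) \<le> (\<Sum>j<m. 1)" by (intro sum_mono) (auto simp: indicator_def)
          then have "(\<Sum>j<m. indicat_real {x. real j / ?n < \<phi> x} x) \<le> real m" by simp
          moreover have "real m < ?n * \<phi> x" if "real m / ?n < \<phi> x" using that by (simp add: field_simps)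
          ultimately show ?case using Suc by (auto simp: indicator_def)
        qed (use \<phi>[of x] in simp)
        have "(\<Sum>j<?n. indicat_real (?A j) x) / ?n \<le> (?n * \<phi> x + 1) / ?n"
          by (rule divide_right_mono[OF *[of ?n]]) simp
        also have "\<dots> = \<phi> x + 1 / ?n" by (simp add: add_divide_distrib)
        finally show "(\<Sum>j<?n. indicat_real (?A j) x) / ?n \<le> \<phi> x + 1 / ?n" .
      qed
      also have "\<dots> = (\<integral>x. \<phi> x \<partial>\<sigma>) + measure \<sigma> UNIV / ?n"
        using int01[OF c \<phi>] by (subst Bochner_Integration.integral_add) (auto simp: sp)
      finally show ?thesis .
    qed
    moreover have "(\<lambda>n. (\<integral>x. \<phi> x \<partial>\<sigma>) + measure \<sigma> UNIV / real (Suc n)) \<longlonglongrightarrow> (\<integral>x. \<phi> x \<partial>\<sigma>) + 0"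
      by (intro tendsto_intros LIMSEQ_Suc[OF tendsto_divide_0[OF tendsto_const]] filterlim_at_top_imp_at_infinity filterlim_real_sequentially)
    ultimately show ?thesis by (metis (no_types, lifting) LIMSEQ_le_const add.right_neutral)
  qed
  have eq01: "L \<phi> = (\<integral>x. \<phi> x \<partial>\<sigma>)" if c: "cts \<phi>" and \<phi>: "\<And>x. 0 \<le> \<phi> x" "\<And>x. \<phi> x \<le> 1" for \<phi>
  proof -
    have c': "cts (\<lambda>x. 1 - \<phi> x)" using c by (intro continuous_intros)
    have "L (\<lambda>x. 1 - \<phi> x) \<le> (\<integral>x. 1 - \<phi> x \<partial>\<sigma>)" by (rule le[OF c']) (use \<phi> in auto)
    also have "\<dots> = measure \<sigma> UNIV - (\<integral>x. \<phi> x \<partial>\<sigma>)"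
      using int01[OF c \<phi>] by (subst Bochner_Integration.integral_diff) (auto simp: sp)
    finally have "L (\<lambda>x. 1 - \<phi> x) \<le> L (\<lambda>x. 1) - (\<integral>x. \<phi> x \<partial>\<sigma>)" by (simp add: L1)
    moreover have "L (\<lambda>x. 1 - \<phi> x) = L (\<lambda>x. 1) - L \<phi>"
      using add[OF c' c] by simp
    ultimately show ?thesis using le[OF c \<phi>] by simp
  qed
  show ?thesis
  proof (rule that[OF \<sigma>(1)])
    show "finite_measure \<sigma>" by unfold_locales
    fix \<phi> :: "'a \<Rightarrow> real" assume c: "cts \<phi>"
    obtain M where M: "M > 0" "\<And>x. \<bar>\<phi> x\<bar> \<le> M"
      using compact_imp_bounded[OF compact_continuous_image[OF c compact_space]] unfolding bounded_pos by auto
    define \<psi> where "\<psi> x = (\<phi> x / M + 1) / 2" for x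
    have \<psi>: "cts \<psi>" "0 \<le> \<psi> x" "\<psi> x \<le> 1" for x
    proof -
      show "cts \<psi>" unfolding \<psi>_def using c M(1) by (intro continuous_intros) auto
      have "- 1 \<le> \<phi> x / M" "\<phi> x / M \<le> 1" using M(1) M(2)[of x] by (auto simp: field_simps abs_le_iff)
      then show "0 \<le> \<psi> x" "\<psi> x \<le> 1" unfolding \<psi>_def by auto
    qed
    have \<phi>: "\<phi> = (\<lambda>x. (2 * M) * \<psi> x + (- M) * 1)" unfolding \<psi>_def using M(1) by (auto simp: fun_eq_iff field_simps)
    have "L \<phi> = (2 * M) * L \<psi> + (- M) * L (\<lambda>x. 1)"
      unfolding \<phi> using \<psi>(1) by (subst add) (auto intro!: continuous_intros simp: scale[of "\<lambda>x. 1" "- M", simplified] scale)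
    also have "\<dots> = (\<integral>x. (2 * M) * \<psi> x + (- M) * 1 \<partial>\<sigma>)"
      using int01[OF \<psi>] eq01[OF \<psi>] by (subst Bochner_Integration.integral_add) (auto simp: sp L1)
    finally show "(\<integral>x. \<phi> x \<partial>\<sigma>) = L \<phi>" using \<phi> by simp
  qed
qed

end

section \<open>Integration of continuous functions on a compact metric space\<close>

definition fin_borel :: "'a::metric_space measure \<Rightarrow> bool" where
  "fin_borel \<sigma> \<longleftrightarrow> finite_measure \<sigma> \<and> sets \<sigma> = sets borel"

text \<open>The compactness assumption mentions a type only; the \<open>itself\<close> parameter
  ties the locale to that type.\<close>

locale compact_metric =
  fixes type_marker :: "'a::metric_space itself"
  assumes compact_space: "compact (UNIV :: 'a set)"
begin

lemma continuous_bounded: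
  fixes \<phi> :: "'a \<Rightarrow> real"
  assumes "cts \<phi>"
  obtains M where "M > 0" "\<And>x. \<bar>\<phi> x\<bar> \<le> M"
  using compact_imp_bounded[OF compact_continuous_image[OF assms compact_space]] unfolding bounded_pos by auto

lemma fin_borel_space: "fin_borel (\<sigma> :: 'a measure) \<Longrightarrow> space \<sigma> = UNIV"
  unfolding fin_borel_def using sets_eq_imp_space_eq[of \<sigma> borel] by simp

lemma continuous_measurable:
  fixes \<phi> :: "'a \<Rightarrow> real"
  shows "fin_borel \<sigma> \<Longrightarrow> cts \<phi> \<Longrightarrow> \<phi> \<in> borel_measurable \<sigma>"
  using borel_measurable_continuous_onI[of \<phi>] measurable_cong_sets[of \<sigma> borel borel borel] unfolding fin_borel_def by auto

lemma integrable_continuous: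
  fixes \<phi> :: "'a \<Rightarrow> real" and \<sigma> :: "'a measure"
  assumes s: "fin_borel \<sigma>" and c: "cts \<phi>"
  shows "integrable \<sigma> \<phi>"
proof -
  obtain M where "\<And>x. \<bar>\<phi> x\<bar> \<le> M" by (rule continuous_bounded[OF c]) blast
  then show ?thesis using finite_measure.integrable_const_bound[of \<sigma> \<phi> M] continuous_measurable[OF s c] s
    by (auto simp: fin_borel_def)
qed

lemma integral_abs_bound:
  fixes \<phi> :: "'a \<Rightarrow> real" and \<sigma> :: "'a measure"
  assumes s: "fin_borel \<sigma>" and b: "\<And>x. \<bar>\<phi> x\<bar> \<le> M"
  shows "\<bar>\<integral>x. \<phi> x \<partial>\<sigma>\<bar> \<le> M * measure \<sigma> UNIV"
proof (cases "integrable \<sigma> \<phi>")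
  case True
  interpret finite_measure \<sigma> using s by (simp add: fin_borel_def)
  have "\<bar>\<integral>x. \<phi> x \<partial>\<sigma>\<bar> \<le> (\<integral>x. \<bar>\<phi> x\<bar> \<partial>\<sigma>)" by (rule integral_abs_bound)
  also have "\<dots> \<le> (\<integral>x. M \<partial>\<sigma>)" by (rule integral_mono) (use True b in auto)
  finally show ?thesis by (simp add: fin_borel_space[OF s] mult.commute)
next
  case False
  have "M \<ge> 0" using b[of undefined] by linarith
  then show ?thesis using False by (simp add: not_integrable_integral_eq)
qed

lemma uniform_continuity2:
  fixes G :: "'a \<Rightarrow> 'a \<Rightarrow> real"
  assumes c: "cts (\<lambda>p. G (fst p) (snd p))" and e: "e > 0"
  obtains d where "d > 0" "\<And>x y x' y'. dist x x' < d \<Longrightarrow> dist y y' < d \<Longrightarrow> \<bar>G x y - G x' y'\<bar> < e"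
proof -
  have "compact (UNIV :: ('a \<times> 'a) set)" using compact_Times[OF compact_space compact_space] by simp
  then have "uniformly_continuous_on UNIV (\<lambda>p. G (fst p) (snd p))" by (rule compact_uniformly_continuous[OF c])
  then obtain d where d: "d > 0" "\<And>p q. dist p q < d \<Longrightarrow> dist (G (fst p) (snd p)) (G (fst q) (snd q)) < e"
    using e unfolding uniformly_continuous_on_def by (metis UNIV_I)
  show ?thesis
  proof (rule that[of "d / 2"])
    show "d / 2 > 0" using d by simp
    fix x y x' y' :: 'a assume "dist x x' < d / 2" "dist y y' < d / 2"
    then have "dist (x, y) (x', y') < d"
      unfolding dist_Pair_Pair using sqrt_sum_squares_le_sum[of "dist x x'" "dist y y'"] by simp
    from d(2)[OF this] show "\<bar>G x y - G x' y'\<bar> < e" by (simp add: dist_real_def)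
  qed
qed

lemma continuous_section:
  fixes G :: "'a \<Rightarrow> 'a \<Rightarrow> real"
  assumes "cts (\<lambda>p. G (fst p) (snd p))"
  shows "cts (\<lambda>x. G x y)" "cts (\<lambda>y. G x y)"
  using continuous_on_compose2[OF assms, of UNIV "\<lambda>x. (x, y)"] continuous_on_compose2[OF assms, of UNIV "\<lambda>y. (x, y)"]
  by (simp_all add: continuous_on_Pair continuous_on_id continuous_on_const)

lemma continuous_integral:
  fixes G :: "'a \<Rightarrow> 'a \<Rightarrow> real" and \<sigma> \<rho> :: "'a measure"
  assumes c: "cts (\<lambda>p. G (fst p) (snd p))" and s: "fin_borel \<sigma>"
  shows "cts (\<lambda>y. \<integral>x. G x y \<partial>\<sigma>)"
  unfolding continuous_on_iff
proof (intro ballI allI impI)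
  fix y :: 'a and e :: real assume e: "e > 0"
  define e' where "e' = e / (measure \<sigma> UNIV + 1)"
  have e': "e' > 0" "e' * measure \<sigma> UNIV < e" using e by (auto simp: e'_def field_simps add_pos_nonneg)
  obtain d where d: "d > 0" "\<And>x y x' y'. dist x x' < d \<Longrightarrow> dist y y' < d \<Longrightarrow> \<bar>G x y - G x' y'\<bar> < e'"
    by (rule uniform_continuity2[OF c e'(1)]) blast
  show "\<exists>d>0. \<forall>x'\<in>UNIV. dist x' y < d \<longrightarrow> dist (\<integral>x. G x x' \<partial>\<sigma>) (\<integral>x. G x y \<partial>\<sigma>) < e"
  proof (intro exI[of _ d] conjI ballI impI)
    fix y' assume y': "dist y' y < d"
    have "\<bar>\<integral>x. G x y' - G x y \<partial>\<sigma>\<bar> \<le> e' * measure \<sigma> UNIV"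
      by (rule integral_abs_bound[OF s]) (use d y' in \<open>auto intro!: less_imp_le\<close>)
    then show "dist (\<integral>x. G x y' \<partial>\<sigma>) (\<integral>x. G x y \<partial>\<sigma>) < e"
      using e' by (simp add: dist_real_def Bochner_Integration.integral_diff[OF integrable_continuous[OF s continuous_section(1)[OF c]] integrable_continuous[OF s continuous_section(1)[OF c]]])
  qed (rule d)
qed

text \<open>Stronger than density: by total boundedness finite initial segments are already e-nets,
  which is what finite grids require.\<close>

lemma dense_sequence:
  obtains xs :: "nat \<Rightarrow> 'a" where "\<And>e. e > 0 \<Longrightarrow> \<exists>N. \<forall>x. \<exists>j\<le>N. dist x (xs j) < e"
proof -
  have "\<exists>F::'a set. finite F \<and> (\<forall>x. \<exists>y\<in>F. dist x y < 1 / Suc m)" for m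
  proof -
    obtain F :: "'a set" where F: "finite F" "UNIV \<subseteq> (\<Union>y\<in>F. ball y (1 / Suc m))"
      using seq_compact_imp_totally_bounded[OF compact_imp_seq_compact[OF compact_space], rule_format, of "1 / Suc m"] by auto
    have "\<exists>y\<in>F. dist x y < 1 / Suc m" for x
    proof -
      have "x \<in> (\<Union>y\<in>F. ball y (1 / Suc m))" using F(2) by (rule subsetD) simp
      then show ?thesis by (auto simp: dist_commute)
    qed
    then show ?thesis using F(1) by blast
  qed
  then obtain F :: "nat \<Rightarrow> 'a set" where F: "\<And>m. finite (F m)" "\<And>m x. \<exists>y\<in>F m. dist x y < 1 / Suc m" by metis
  define C where "C = (\<Union>m. F m)"
  have cC: "countable C" unfolding C_def by (rule countable_UN[OF _ countable_finite[OF F(1)]]) simp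
  have mem: "\<exists>j. from_nat_into C j = y" if "y \<in> C" for y
    using from_nat_into_surj[OF cC that] by blast
  show ?thesis
  proof (rule that[of "from_nat_into C"])
    fix e :: real assume "e > 0"
    then obtain m where m: "1 / real (Suc m) < e" by (metis nat_approx_posE)
    obtain J where J: "\<And>y. y \<in> C \<Longrightarrow> from_nat_into C (J y) = y" using mem by metis
    show "\<exists>N. \<forall>x. \<exists>j\<le>N. dist x (from_nat_into C j) < e"
    proof (rule exI[of _ "Max (J ` F m)"], rule allI)
      fix x
      obtain y where y: "y \<in> F m" "dist x y < 1 / Suc m" using F(2) by blast
      then have "y \<in> C" by (auto simp: C_def)
      then show "\<exists>j\<le>Max (J ` F m). dist x (from_nat_into C j) < e"
        using y m F(1)[of m] by (intro exI[of _ "J y"]) (auto simp: J)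
    qed
  qed
qed

text \<open>Choosing the least index within distance 1 / (n + 1) makes the projection
  \<open>\<pi> n\<close> Borel. The grids have at least n points of the sequence, so that every
  point of the sequence eventually belongs to them.\<close>

lemma discretisation:
  obtains xs :: "nat \<Rightarrow> 'a" and N :: "nat \<Rightarrow> nat" and \<pi> :: "nat \<Rightarrow> 'a \<Rightarrow> 'a" where
    "\<And>n. n \<le> N n" "\<And>n x. \<pi> n x \<in> xs ` {..N n}" "\<And>n z. \<pi> n -` {z} \<in> sets borel" "\<And>n x. dist x (\<pi> n x) < 1 / real (Suc n)"
    "\<And>x e. e > 0 \<Longrightarrow> \<exists>j. dist x (xs j) < e"
proof -
  obtain xs :: "nat \<Rightarrow> 'a" where xs: "\<And>e. e > 0 \<Longrightarrow> \<exists>N. \<forall>x. \<exists>j\<le>N. dist x (xs j) < e" by (rule dense_sequence) (rule that)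
  have "\<exists>N. \<forall>x. \<exists>j\<le>N. dist x (xs j) < 1 / real (Suc n)" for n by (rule xs) simp
  then obtain N where N: "\<And>n x. \<exists>j\<le>N n. dist x (xs j) < 1 / real (Suc n)" by metis
  define p where "p n x = (LEAST j. dist x (xs j) < 1 / real (Suc n))" for n x
  have p: "p n x \<le> N n" "dist x (xs (p n x)) < 1 / real (Suc n)" for n x
  proof -
    obtain j where j: "j \<le> N n" "dist x (xs j) < 1 / real (Suc n)" using N by blast
    show "p n x \<le> N n" using Least_le[of "\<lambda>j. dist x (xs j) < 1 / real (Suc n)", OF j(2)] j(1) by (simp add: p_def)
    show "dist x (xs (p n x)) < 1 / real (Suc n)" unfolding p_def by (rule LeastI[of "\<lambda>j. dist x (xs j) < 1 / real (Suc n)", OF j(2)])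
  qed
  have pm: "p n \<in> measurable borel (count_space UNIV)" for n
  proof -
    have [measurable]: "Measurable.pred borel (\<lambda>x. dist x (xs j) < 1 / real (Suc n))" for j
      by (auto simp: pred_def intro!: borel_open open_Collect_less continuous_intros simp del: of_nat_Suc)
    show ?thesis unfolding p_def by measurable
  qed
  show ?thesis
  proof (rule that[of "\<lambda>n. max n (N n)" "\<lambda>n x. xs (p n x)" xs])
    fix n z
    have "(\<lambda>x. xs (p n x)) -` {z} = (\<Union>j\<in>{j. xs j = z}. p n -` {j} \<inter> space borel)" by auto
    also have "\<dots> \<in> sets borel" by (intro sets.countable_UN'' measurable_sets[OF pm]) auto
    finally show "(\<lambda>x. xs (p n x)) -` {z} \<in> sets borel" .
  next
    fix x and e :: real assume "e > 0"
    then show "\<exists>j. dist x (xs j) < e" using xs by blast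
  qed (use p in \<open>auto simp: le_max_iff_disj\<close>)
qed

lemma integral_finite_range:
  fixes \<phi> :: "'a \<Rightarrow> real" and S :: "'a set" and \<sigma> :: "'a measure"
  assumes s: "fin_borel \<sigma>" and S: "finite S" "\<And>x. \<pi> x \<in> S" "\<And>z. \<pi> -` {z} \<in> sets borel"
  shows "(\<integral>x. \<phi> (\<pi> x) \<partial>\<sigma>) = (\<Sum>z\<in>S. measure \<sigma> (\<pi> -` {z}) * \<phi> z)" "integrable \<sigma> (\<lambda>x. \<phi> (\<pi> x))"
proof -
  interpret finite_measure \<sigma> using s by (simp add: fin_borel_def)
  have eq: "\<phi> (\<pi> x) = (\<Sum>z\<in>S. indicator (\<pi> -` {z}) x * \<phi> z)" for x
    using S(1) S(2)[of x] by (simp add: indicator_def if_distrib sum.delta cong: if_cong)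
  have m: "\<pi> -` {z} \<in> sets \<sigma>" for z using S(3) s by (simp add: fin_borel_def)
  show "integrable \<sigma> (\<lambda>x. \<phi> (\<pi> x))" unfolding eq using m by (auto simp: less_top[symmetric])
  show "(\<integral>x. \<phi> (\<pi> x) \<partial>\<sigma>) = (\<Sum>z\<in>S. measure \<sigma> (\<pi> -` {z}) * \<phi> z)"
    unfolding eq using m by (subst Bochner_Integration.integral_sum) (auto simp: less_top[symmetric] fin_borel_space[OF s])
qed

lemma tendsto_integral_discretisation:
  fixes \<phi> :: "'a \<Rightarrow> real" and \<sigma> :: "'a measure"
  assumes s: "fin_borel \<sigma>" and c: "cts \<phi>"
    and \<pi>: "\<And>n. finite (S n)" "\<And>n x. \<pi> n x \<in> S n" "\<And>n z. \<pi> n -` {z} \<in> sets borel" "\<And>n x. dist x (\<pi> n x) < 1 / real (Suc n)"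
  shows "(\<lambda>n. \<integral>x. \<phi> (\<pi> n x) \<partial>\<sigma>) \<longlonglongrightarrow> (\<integral>x. \<phi> x \<partial>\<sigma>)"
proof -
  obtain M where M: "\<And>x. \<bar>\<phi> x\<bar> \<le> M" by (rule continuous_bounded[OF c]) blast
  interpret finite_measure \<sigma> using s by (simp add: fin_borel_def)
  show ?thesis
  proof (rule integral_dominated_convergence[where w="\<lambda>_. M"])
    show "\<phi> \<in> borel_measurable \<sigma>" by (rule continuous_measurable[OF s c])
    show "(\<lambda>x. \<phi> (\<pi> n x)) \<in> borel_measurable \<sigma>" for n
      using integral_finite_range(2)[OF s \<pi>(1)[of n] \<pi>(2)[of n] \<pi>(3)[of n]] by blast
    show "AE x in \<sigma>. (\<lambda>n. \<phi> (\<pi> n x)) \<longlonglongrightarrow> \<phi> x"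
    proof (intro AE_I2)
      fix x
      have "(\<lambda>n. \<pi> n x) \<longlonglongrightarrow> x"
      proof (rule metric_tendsto_imp_tendsto[OF LIMSEQ_Suc[OF lim_1_over_n]])
        show "\<forall>\<^sub>F n in sequentially. dist (\<pi> n x) x \<le> dist (1 / of_nat (Suc n)) (0::real)"
          using \<pi>(4)[of x] by (auto simp: dist_commute less_imp_le)
      qed
      then show "(\<lambda>n. \<phi> (\<pi> n x)) \<longlonglongrightarrow> \<phi> x"
        using c by (intro isCont_tendsto_compose[of _ \<phi>]) (auto simp: continuous_on_eq_continuous_at)
    qed
  qed (use M in auto)
qed

text \<open>Fubini by discretising the first variable: there the exchange concerns a finite sum, and
  both sides pass to the limit.\<close>

lemma integral_swap:
  fixes G :: "'a \<Rightarrow> 'a \<Rightarrow> real" and \<sigma> \<rho> :: "'a measure"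
  assumes c: "cts (\<lambda>p. G (fst p) (snd p))" and s: "fin_borel \<sigma>" and r: "fin_borel \<rho>"
  shows "(\<integral>y. \<integral>x. G x y \<partial>\<sigma> \<partial>\<rho>) = (\<integral>x. \<integral>y. G x y \<partial>\<rho> \<partial>\<sigma>)"
proof -
  obtain xs :: "nat \<Rightarrow> 'a" and N :: "nat \<Rightarrow> nat" and \<pi> :: "nat \<Rightarrow> 'a \<Rightarrow> 'a" where
    \<pi>: "\<And>n x. \<pi> n x \<in> xs ` {..N n}" "\<And>n z. \<pi> n -` {z} \<in> sets borel" "\<And>n x. dist x (\<pi> n x) < 1 / real (Suc n)"
    by (rule discretisation) (rule that)
  note rl = finite_imageI[OF finite_atMost] \<pi>(1) \<pi>(2)
  have cs: "cts (\<lambda>y. G x y)" "cts (\<lambda>x. G x y)" for x y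
    by (rule continuous_section[OF c])+
  have c': "cts (\<lambda>p. G (snd p) (fst p))"
    using continuous_on_compose2[OF c, of UNIV "\<lambda>p. (snd p, fst p)"] by (simp add: continuous_on_Pair continuous_on_fst continuous_on_snd)
  have cI: "cts (\<lambda>x. \<integral>y. G x y \<partial>\<rho>)" by (rule continuous_integral[of "\<lambda>y x. G x y", OF c' r])
  have eq: "(\<integral>x. \<integral>y. G (\<pi> n x) y \<partial>\<rho> \<partial>\<sigma>) = (\<integral>y. \<integral>x. G (\<pi> n x) y \<partial>\<sigma> \<partial>\<rho>)" for n
    unfolding integral_finite_range(1)[OF s rl, of "\<lambda>x. \<integral>y. G x y \<partial>\<rho>" n] integral_finite_range(1)[OF s rl, of "\<lambda>x. G x y" n for y]
    by (subst Bochner_Integration.integral_sum) (auto simp: integrable_continuous[OF r cs(1)])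
  have A: "(\<lambda>n. \<integral>x. \<integral>y. G (\<pi> n x) y \<partial>\<rho> \<partial>\<sigma>) \<longlonglongrightarrow> (\<integral>x. \<integral>y. G x y \<partial>\<rho> \<partial>\<sigma>)"
    by (rule tendsto_integral_discretisation[OF s cI rl \<pi>(3)])
  obtain M where M: "\<And>x. \<bar>G (fst x) (snd x)\<bar> \<le> M"
    using compact_imp_bounded[OF compact_continuous_image[OF c compact_Times[OF compact_space compact_space, simplified]]]
    unfolding bounded_iff by auto
  interpret R: finite_measure \<rho> using r by (simp add: fin_borel_def)
  have B: "(\<lambda>n. \<integral>y. \<integral>x. G (\<pi> n x) y \<partial>\<sigma> \<partial>\<rho>) \<longlonglongrightarrow> (\<integral>y. \<integral>x. G x y \<partial>\<sigma> \<partial>\<rho>)"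
  proof (rule integral_dominated_convergence[where w="\<lambda>_. M * measure \<sigma> UNIV"])
    show "(\<lambda>y. \<integral>x. G x y \<partial>\<sigma>) \<in> borel_measurable \<rho>"
      by (rule continuous_measurable[OF r continuous_integral[OF c s]])
    show "(\<lambda>y. \<integral>x. G (\<pi> n x) y \<partial>\<sigma>) \<in> borel_measurable \<rho>" for n
      unfolding integral_finite_range(1)[OF s rl, of "\<lambda>x. G x y" n for y]
      by (rule continuous_measurable[OF r]) (auto intro!: continuous_intros cs)
    show "AE y in \<rho>. (\<lambda>n. \<integral>x. G (\<pi> n x) y \<partial>\<sigma>) \<longlonglongrightarrow> (\<integral>x. G x y \<partial>\<sigma>)"
      by (intro AE_I2 tendsto_integral_discretisation[OF s cs(2) rl \<pi>(3)])
    show "AE y in \<rho>. norm (\<integral>x. G (\<pi> n x) y \<partial>\<sigma>) \<le> M * measure \<sigma> UNIV" for n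
      using M by (intro AE_I2) (simp add: integral_abs_bound[OF s] M[of "(_,_)", simplified])
  qed auto
  show ?thesis using LIMSEQ_unique[OF A B[folded eq]] by simp
qed

text \<open>Closed sets are an intersection-stable generator, and
  \<open>max 0 (1 - n * infdist x F)\<close> tends to the indicator of a nonempty closed F.\<close>

lemma measure_eqI_continuous:
  fixes \<sigma> \<rho> :: "'a measure"
  assumes s: "fin_borel \<sigma>" and r: "fin_borel \<rho>"
    and eq: "\<And>\<phi> :: 'a \<Rightarrow> real. cts \<phi> \<Longrightarrow> (\<integral>x. \<phi> x \<partial>\<sigma>) = (\<integral>x. \<phi> x \<partial>\<rho>)"
  shows "\<sigma> = \<rho>"
proof (rule measure_eqI_generator_eq[where E="Collect closed" and \<Omega>=UNIV and A="\<lambda>_. UNIV"])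
  have cF[continuous_intros]: "cts (\<lambda>x. max 0 (1 - real n * infdist x F))" for n and F :: "'a set"
    by (intro continuous_intros)
  have lim: "(\<lambda>n. \<integral>x. max 0 (1 - real n * infdist x F) \<partial>\<tau>) \<longlonglongrightarrow> measure \<tau> F"
    if F: "closed F" "F \<noteq> {}" and t: "fin_borel \<tau>" for F and \<tau> :: "'a measure"
  proof -
    interpret finite_measure \<tau> using t by (simp add: fin_borel_def)
    have "(\<lambda>n. \<integral>x. max 0 (1 - real n * infdist x F) \<partial>\<tau>) \<longlonglongrightarrow> (\<integral>x. indicator F x \<partial>\<tau>)"
    proof (rule integral_dominated_convergence[where w="\<lambda>_. 1"])
      show "indicator F \<in> borel_measurable \<tau>" using F t by (intro borel_measurable_indicator) (simp add: fin_borel_def)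
      show "(\<lambda>x. max 0 (1 - real n * infdist x F)) \<in> borel_measurable \<tau>" for n
        by (rule continuous_measurable[OF t cF])
      show "AE x in \<tau>. (\<lambda>n. max 0 (1 - real n * infdist x F)) \<longlonglongrightarrow> indicator F x"
      proof (intro AE_I2)
        fix x
        show "(\<lambda>n. max 0 (1 - real n * infdist x F)) \<longlonglongrightarrow> indicator F x"
        proof (cases "x \<in> F")
          case True
          then show ?thesis by simp
        next
          case False
          then have d: "infdist x F > 0" using in_closed_iff_infdist_zero[OF F] infdist_nonneg[of x F] by (simp add: less_le)
          obtain m where m: "real m * infdist x F > 1" using reals_Archimedean3[OF d] by blast
          have "max 0 (1 - real n * infdist x F) = indicator F x" if "n \<ge> m" for n
          proof -
            have "real m * infdist x F \<le> real n * infdist x F" using that d by (intro mult_right_mono) auto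
            then show ?thesis using m False by simp
          qed
          then show ?thesis by (intro tendsto_eventually eventually_sequentiallyI[of m])
        qed
      qed
      show "AE x in \<tau>. norm (max 0 (1 - real n * infdist x F)) \<le> 1" for n
        by (intro AE_I2) (simp add: infdist_nonneg)
    qed simp
    then show ?thesis using F t by (simp add: fin_borel_space fin_borel_def)
  qed
  interpret S: finite_measure \<sigma> using s by (simp add: fin_borel_def)
  interpret R: finite_measure \<rho> using r by (simp add: fin_borel_def)
  fix F :: "'a set" assume "F \<in> Collect closed"
  then have F: "closed F" by simp
  show "emeasure \<sigma> F = emeasure \<rho> F"
  proof (cases "F = {}")
    case False
    have "(\<integral>x. max 0 (1 - real n * infdist x F) \<partial>\<sigma>) = (\<integral>x. max 0 (1 - real n * infdist x F) \<partial>\<rho>)" for n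
      by (rule eq[OF cF])
    then have "measure \<sigma> F = measure \<rho> F"
      using LIMSEQ_unique[OF lim[OF F False s]] lim[OF F False r] by simp
    then show ?thesis by (simp add: S.emeasure_eq_measure R.emeasure_eq_measure)
  qed simp
next
  show "Int_stable (Collect (closed :: 'a set \<Rightarrow> bool))" by (auto simp: Int_stable_def)
  show "sets \<sigma> = sigma_sets UNIV (Collect closed)" "sets \<rho> = sigma_sets UNIV (Collect closed)"
    using s r by (simp_all add: fin_borel_def borel_eq_closed)
  show "emeasure \<sigma> UNIV \<noteq> \<infinity>" using s finite_measure.emeasure_finite[of \<sigma> UNIV] by (simp add: fin_borel_def)
qed auto

end

section \<open>Reproducing kernel Hilbert spaces\<close>

definition kquad :: "('a \<Rightarrow> 'a \<Rightarrow> real) \<Rightarrow> 'a set \<Rightarrow> ('a \<Rightarrow> real) \<Rightarrow> real" where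
  "kquad k S a = (\<Sum>x\<in>S. \<Sum>y\<in>S. a x * a y * k x y)"

text \<open>The homogeneous form of the norm bound: it makes sense before the supremum in
  \<open>rkhs_norm\<close> is known to be finite, and it passes to limits test by test.\<close>

definition rkhs_le :: "('a \<Rightarrow> 'a \<Rightarrow> real) \<Rightarrow> ('a \<Rightarrow> real) \<Rightarrow> real \<Rightarrow> bool" where
  "rkhs_le k g M \<longleftrightarrow> 0 \<le> M \<and> (\<forall>S a. finite S \<longrightarrow> \<bar>\<Sum>x\<in>S. a x * g x\<bar> \<le> M * sqrt (kquad k S a))"

locale psd_kernel =
  fixes k :: "'a \<Rightarrow> 'a \<Rightarrow> real"
  assumes pd: "pos_def_kernel k"
begin

lemma k_sym: "k x y = k y x"
  using pd by (simp add: pos_def_kernel_def)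

lemma kquad_nonneg: "finite S \<Longrightarrow> 0 \<le> kquad k S a"
  using pd by (simp add: pos_def_kernel_def kquad_def)

lemma kquad_scale: "kquad k S (\<lambda>x. r * a x) = r\<^sup>2 * kquad k S a"
  unfolding kquad_def by (simp add: sum_distrib_left power2_eq_square algebra_simps)

lemma kquad_add: "kquad k S (\<lambda>x. a x + c x) = kquad k S a + 2 * (\<Sum>x\<in>S. \<Sum>y\<in>S. a x * c y * k x y) + kquad k S c"
proof -
  have "(\<Sum>x\<in>S. \<Sum>y\<in>S. c x * a y * k x y) = (\<Sum>x\<in>S. \<Sum>y\<in>S. a x * c y * k x y)"
    by (subst sum.swap) (intro sum.cong refl, simp add: k_sym[of _ _] mult.commute[of "c _"] k_sym)
  then show ?thesis unfolding kquad_def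
    by (simp add: sum.distrib algebra_simps)
qed

lemma kquad_Cauchy_Schwarz:
  assumes S: "finite S"
  shows "\<bar>\<Sum>x\<in>S. \<Sum>y\<in>S. a x * c y * k x y\<bar> \<le> sqrt (kquad k S a) * sqrt (kquad k S c)"
proof -
  define A B C where "A = kquad k S a" and "B = (\<Sum>x\<in>S. \<Sum>y\<in>S. a x * c y * k x y)" and "C = kquad k S c"
  have q: "0 \<le> r\<^sup>2 * A + 2 * r * B + C" for r
  proof -
    have "(\<Sum>x\<in>S. \<Sum>y\<in>S. r * a x * c y * k x y) = r * B" by (simp add: B_def sum_distrib_left mult.assoc)
    then show ?thesis
      using kquad_nonneg[OF S, of "\<lambda>x. r * a x + c x"] unfolding kquad_add kquad_scale A_def C_def by simp
  qed
  have A: "A \<ge> 0" and C: "C \<ge> 0" unfolding A_def C_def by (simp_all add: kquad_nonneg S)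
  have "B\<^sup>2 \<le> A * C"
  proof (cases "A = 0")
    case True
    have "B = 0"
    proof (rule ccontr)
      assume "B \<noteq> 0"
      then have "2 * (- (C + 1) / (2 * B)) * B = - (C + 1)" by simp
      then show False using q[of "- (C + 1) / (2 * B)"] True by simp
    qed
    then show ?thesis using A C by simp
  next
    case False
    have "0 \<le> A * ((- B / A)\<^sup>2 * A + 2 * (- B / A) * B + C)" using q[of "- B / A"] A by (rule mult_nonneg_nonneg[rotated])
    also have "\<dots> = A * C - B\<^sup>2" using False by (simp add: field_simps power2_eq_square)
    finally show ?thesis by simp
  qed
  then have "sqrt (B\<^sup>2) \<le> sqrt (A * C)" by (rule real_sqrt_le_mono)
  then show ?thesis by (simp add: A_def B_def C_def real_sqrt_mult)
qed

lemma kquad_extend: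
  assumes "finite T" "S \<subseteq> T"
  shows "kquad k T (\<lambda>x. if x \<in> S then a x else 0) = kquad k S a"
    "(\<Sum>x\<in>T. (if x \<in> S then a x else 0) * g x) = (\<Sum>x\<in>S. a x * g x)"
proof -
  have *: "(\<Sum>x\<in>T. (if x \<in> S then a x else 0) * g x) = (\<Sum>x\<in>S. a x * g x)" for g
    using assms by (intro sum.mono_neutral_cong_right) auto
  show "(\<Sum>x\<in>T. (if x \<in> S then a x else 0) * g x) = (\<Sum>x\<in>S. a x * g x)" by (rule *)
  have "kquad k T (\<lambda>x. if x \<in> S then a x else 0) = (\<Sum>x\<in>T. (if x \<in> S then a x else 0) * (\<Sum>y\<in>T. (if y \<in> S then a y else 0) * k x y))"
    unfolding kquad_def by (simp add: sum_distrib_left mult.assoc)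
  also have "\<dots> = kquad k S a" unfolding * kquad_def by (simp add: sum_distrib_left mult.assoc)
  finally show "kquad k T (\<lambda>x. if x \<in> S then a x else 0) = kquad k S a" .
qed

lemma cross_bound:
  assumes "finite S" "finite T"
  shows "\<bar>\<Sum>x\<in>S. \<Sum>y\<in>T. a x * c y * k x y\<bar> \<le> sqrt (kquad k S a) * sqrt (kquad k T c)"
proof -
  let ?a = "\<lambda>x. if x \<in> S then a x else 0" and ?c = "\<lambda>x. if x \<in> T then c x else 0"
  have "(\<Sum>x\<in>S\<union>T. \<Sum>y\<in>S\<union>T. ?a x * ?c y * k x y) = (\<Sum>x\<in>S\<union>T. ?a x * (\<Sum>y\<in>S\<union>T. ?c y * k x y))"
    by (simp add: sum_distrib_left mult.assoc)
  also have "\<dots> = (\<Sum>x\<in>S. a x * (\<Sum>y\<in>T. c y * k x y))"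
    using assms by (simp add: kquad_extend(2))
  also have "\<dots> = (\<Sum>x\<in>S. \<Sum>y\<in>T. a x * c y * k x y)" by (simp add: sum_distrib_left mult.assoc)
  finally show ?thesis
    using kquad_Cauchy_Schwarz[of "S \<union> T" ?a ?c] assms by (simp add: kquad_extend(1))
qed

lemma rkhs_le_iff: "rkhs_le k g M \<longleftrightarrow> in_rkhs k g \<and> rkhs_norm k g \<le> M"
proof
  have mem: "v \<in> rkhs_vals k g \<longleftrightarrow> (\<exists>S a. finite S \<and> kquad k S a \<le> 1 \<and> v = (\<Sum>x\<in>S. a x * g x))" for v
    by (auto simp: rkhs_vals_def kquad_def)
  have "0 \<in> rkhs_vals k g" unfolding mem by (rule exI[of _ "{}"]) (simp add: kquad_def)
  then have ne: "rkhs_vals k g \<noteq> {}" by auto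
  {
    assume le: "rkhs_le k g M"
    have "v \<le> M" if "v \<in> rkhs_vals k g" for v
    proof -
      obtain S a where Sa: "finite S" "kquad k S a \<le> 1" "v = (\<Sum>x\<in>S. a x * g x)" using \<open>v \<in> _\<close> unfolding mem by blast
      have "v \<le> M * sqrt (kquad k S a)" using le Sa(1) unfolding rkhs_le_def Sa(3) by (meson abs_le_D1)
      also have "\<dots> \<le> M * 1" using le Sa(2) by (intro mult_left_mono) (auto simp: rkhs_le_def)
      finally show ?thesis by simp
    qed
    then show "in_rkhs k g \<and> rkhs_norm k g \<le> M"
      unfolding in_rkhs_def rkhs_norm_def using ne by (auto intro: bdd_aboveI[where M=M] cSup_least)
  }
  assume i: "in_rkhs k g \<and> rkhs_norm k g \<le> M"
  have ub: "(\<Sum>x\<in>S. a x * g x) \<le> M" if "finite S" "kquad k S a \<le> 1" for S a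
  proof -
    have "(\<Sum>x\<in>S. a x * g x) \<in> rkhs_vals k g" unfolding mem using that by blast
    then have "(\<Sum>x\<in>S. a x * g x) \<le> rkhs_norm k g"
      using i unfolding in_rkhs_def rkhs_norm_def by (intro cSup_upper) auto
    then show ?thesis using i by simp
  qed
  have M0: "M \<ge> 0" using ub[of "{}"] by (simp add: kquad_def)
  have le: "(\<Sum>x\<in>S. a x * g x) \<le> M * sqrt (kquad k S a)" if S: "finite S" for S a
  proof (cases "kquad k S a = 0")
    case True
    \<comment> \<open>A null combination can be scaled freely without leaving the unit ball, so its
      pairing with g cannot be positive.\<close>
    have "(\<Sum>x\<in>S. a x * g x) \<le> 0"
    proof (rule ccontr)
      assume "\<not> ?thesis"
      then have p: "(\<Sum>x\<in>S. a x * g x) > 0" by simp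
      define r where "r = (M + 1) / (\<Sum>x\<in>S. a x * g x)"
      have "(\<Sum>x\<in>S. r * a x * g x) \<le> M" by (rule ub[OF S]) (simp add: kquad_scale True)
      moreover have "(\<Sum>x\<in>S. r * a x * g x) = r * (\<Sum>x\<in>S. a x * g x)" by (simp add: sum_distrib_left mult.assoc)
      ultimately show False using p by (simp add: r_def)
    qed
    then show ?thesis using True by simp
  next
    case False
    then have q: "kquad k S a > 0" using kquad_nonneg[OF S, of a] by simp
    define r where "r = 1 / sqrt (kquad k S a)"
    have r: "r > 0" "r\<^sup>2 * kquad k S a = 1" using q by (simp_all add: r_def power_divide)
    have "(\<Sum>x\<in>S. r * a x * g x) \<le> M" by (rule ub[OF S]) (simp add: kquad_scale r)
    moreover have "(\<Sum>x\<in>S. r * a x * g x) = r * (\<Sum>x\<in>S. a x * g x)" by (simp add: sum_distrib_left mult.assoc)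
    ultimately have "r * (\<Sum>x\<in>S. a x * g x) \<le> M" by simp
    then show ?thesis using q by (simp add: r_def divide_le_eq)
  qed
  show "rkhs_le k g M" unfolding rkhs_le_def
  proof (intro conjI allI impI M0)
    fix S :: "'a set" and a assume S: "finite S"
    show "\<bar>\<Sum>x\<in>S. a x * g x\<bar> \<le> M * sqrt (kquad k S a)"
      using le[OF S, of a] le[OF S, of "\<lambda>x. - a x"] kquad_scale[of S "-1" a] by (simp add: sum_negf abs_le_iff)
  qed
qed

lemma in_rkhs_imp_le: "in_rkhs k g \<Longrightarrow> rkhs_le k g (rkhs_norm k g)"
  by (simp add: rkhs_le_iff)

lemma in_rkhs_iff: "in_rkhs k g \<longleftrightarrow> (\<exists>M. rkhs_le k g M)"
  using rkhs_le_iff by blast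

lemma rkhs_leD: "rkhs_le k g M \<Longrightarrow> finite S \<Longrightarrow> \<bar>\<Sum>x\<in>S. a x * g x\<bar> \<le> M * sqrt (kquad k S a)"
  by (simp add: rkhs_le_def)

lemma rkhs_le_nonneg: "rkhs_le k g M \<Longrightarrow> 0 \<le> M"
  by (simp add: rkhs_le_def)

lemma rkhs_le_mono: "rkhs_le k g M \<Longrightarrow> M \<le> M' \<Longrightarrow> rkhs_le k g M'"
  by (auto simp: rkhs_le_iff)

lemma rkhs_le_add: "rkhs_le k g M \<Longrightarrow> rkhs_le k h N \<Longrightarrow> rkhs_le k (\<lambda>x. g x + h x) (M + N)"
  unfolding rkhs_le_def
proof (intro conjI allI impI)
  assume g: "0 \<le> M \<and> (\<forall>S a. finite S \<longrightarrow> \<bar>\<Sum>x\<in>S. a x * g x\<bar> \<le> M * sqrt (kquad k S a))"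
    and h: "0 \<le> N \<and> (\<forall>S a. finite S \<longrightarrow> \<bar>\<Sum>x\<in>S. a x * h x\<bar> \<le> N * sqrt (kquad k S a))"
  fix S :: "'a set" and a assume S: "finite S"
  have "(\<Sum>x\<in>S. a x * (g x + h x)) = (\<Sum>x\<in>S. a x * g x) + (\<Sum>x\<in>S. a x * h x)" by (simp add: sum.distrib algebra_simps)
  then show "\<bar>\<Sum>x\<in>S. a x * (g x + h x)\<bar> \<le> (M + N) * sqrt (kquad k S a)"
    using g[THEN conjunct2, rule_format, OF S, of a] h[THEN conjunct2, rule_format, OF S, of a] by (simp add: distrib_right)
qed auto

lemma rkhs_le_scale: "rkhs_le k g M \<Longrightarrow> rkhs_le k (\<lambda>x. r * g x) (\<bar>r\<bar> * M)"
  unfolding rkhs_le_def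
proof (intro conjI allI impI)
  assume g: "0 \<le> M \<and> (\<forall>S a. finite S \<longrightarrow> \<bar>\<Sum>x\<in>S. a x * g x\<bar> \<le> M * sqrt (kquad k S a))"
  then show "0 \<le> \<bar>r\<bar> * M" by simp
  fix S :: "'a set" and a assume S: "finite S"
  have "(\<Sum>x\<in>S. a x * (r * g x)) = r * (\<Sum>x\<in>S. a x * g x)" by (simp add: sum_distrib_left algebra_simps)
  then show "\<bar>\<Sum>x\<in>S. a x * (r * g x)\<bar> \<le> \<bar>r\<bar> * M * sqrt (kquad k S a)"
    using g[THEN conjunct2, rule_format, OF S, of a] by (simp add: abs_mult mult.assoc mult_left_mono)
qed

lemma rkhs_le_diff: "rkhs_le k g M \<Longrightarrow> rkhs_le k h N \<Longrightarrow> rkhs_le k (\<lambda>x. g x - h x) (M + N)"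
  using rkhs_le_add[of g M "\<lambda>x. -1 * h x" N] rkhs_le_scale[of h N "-1"] by simp

text \<open>Lower semicontinuity of the norm: each test sum involves finitely many points, so
  pointwise convergence is enough.\<close>

lemma rkhs_le_tendsto:
  assumes g: "\<And>x. ((\<lambda>n. g n x) \<longlongrightarrow> h x) F" and M: "(M \<longlongrightarrow> M') F" and le: "\<forall>\<^sub>F n in F. rkhs_le k (g n) (M n)" and F: "F \<noteq> bot"
  shows "rkhs_le k h M'"
  unfolding rkhs_le_def
proof (intro conjI allI impI)
  show "0 \<le> M'" by (rule tendsto_lowerbound[OF M _ F]) (use le in \<open>auto elim!: eventually_mono simp: rkhs_le_def\<close>)
  fix S :: "'a set" and a assume S: "finite S"
  have A: "((\<lambda>n. \<bar>\<Sum>x\<in>S. a x * g n x\<bar>) \<longlongrightarrow> \<bar>\<Sum>x\<in>S. a x * h x\<bar>) F" by (intro tendsto_intros g)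
  have B: "((\<lambda>n. M n * sqrt (kquad k S a)) \<longlongrightarrow> M' * sqrt (kquad k S a)) F" by (intro tendsto_intros M)
  show "\<bar>\<Sum>x\<in>S. a x * h x\<bar> \<le> M' * sqrt (kquad k S a)"
    by (rule tendsto_le[OF F B A]) (use le S in \<open>auto elim!: eventually_mono simp: rkhs_le_def\<close>)
qed

lemma rkhs_le_span:
  assumes "finite S"
  shows "rkhs_le k (\<lambda>y. \<Sum>x\<in>S. a x * k x y) (sqrt (kquad k S a))"
  unfolding rkhs_le_def
proof (intro conjI allI impI)
  fix T :: "'a set" and c assume T: "finite T"
  have "(\<Sum>y\<in>T. c y * (\<Sum>x\<in>S. a x * k x y)) = (\<Sum>x\<in>S. \<Sum>y\<in>T. a x * c y * k x y)"
    by (subst sum.swap) (simp add: sum_distrib_left algebra_simps)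
  then show "\<bar>\<Sum>y\<in>T. c y * (\<Sum>x\<in>S. a x * k x y)\<bar> \<le> sqrt (kquad k S a) * sqrt (kquad k T c)"
    using cross_bound[OF assms T, of a c] by simp
qed (simp add: kquad_nonneg assms)

lemma rkhs_le_pointwise:
  assumes "rkhs_le k g M" shows "\<bar>g x\<bar> \<le> M * sqrt (k x x)"
  using rkhs_leD[OF assms, of "{x}" "\<lambda>_. 1"] by (simp add: kquad_def)

lemma rkhs_le_modulus:
  assumes "rkhs_le k g M" shows "\<bar>g x - g y\<bar> \<le> M * sqrt (k x x - 2 * k x y + k y y)"
proof (cases "x = y")
  case True then show ?thesis by (simp add: k_sym)
next
  case False
  then show ?thesis using rkhs_leD[OF assms, of "{x, y}" "\<lambda>z. if z = x then 1 else -1"]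
    by (simp add: kquad_def k_sym[of y x] algebra_simps)
qed

text \<open>A nearly optimal test combination a, rescaled by the norm of g, nearly represents g:
  perturbing a by \<theta> c and comparing with the optimum bounds the pairing of the remainder with
  c. This is the projection argument carried out without completeness. The last conclusion says that
  the approximant pairs with g almost like g itself.\<close>

lemma span_dense:
  assumes g: "in_rkhs k g" and e: "e > 0"
  obtains S a where "finite S" "rkhs_le k (\<lambda>y. g y - (\<Sum>x\<in>S. a x * k x y)) e"
    "\<bar>(\<Sum>x\<in>S. a x * g x) - (rkhs_norm k g)\<^sup>2\<bar> \<le> e"
proof -
  define N where "N = rkhs_norm k g"
  have gN: "rkhs_le k g N" unfolding N_def by (rule in_rkhs_imp_le[OF g])
  have N0: "N \<ge> 0" by (rule rkhs_le_nonneg[OF gN])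
  \<comment> \<open>The test is chosen optimal up to \<theta>^2, so that dividing the first-order
    comparison by \<theta> leaves an error of order \<theta>.\<close>
  define \<theta> where "\<theta> = min 1 (e / (1 + N))"
  have \<theta>: "\<theta> > 0" "\<theta> \<le> 1" "\<theta> * (1 + N) \<le> e"
  proof -
    show "\<theta> > 0" "\<theta> \<le> 1" using e N0 by (auto simp: \<theta>_def)
    have "\<theta> * (1 + N) \<le> e / (1 + N) * (1 + N)" using N0 by (intro mult_right_mono) (auto simp: \<theta>_def)
    then show "\<theta> * (1 + N) \<le> e" using N0 by simp
  qed
  have "N - \<theta>\<^sup>2 < N" using \<theta> by simp
  then obtain S a where Sa: "finite S" "kquad k S a \<le> 1" "N - \<theta>\<^sup>2 < (\<Sum>x\<in>S. a x * g x)"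
  proof -
    assume *: "\<And>S a. finite S \<Longrightarrow> kquad k S a \<le> 1 \<Longrightarrow> N - \<theta>\<^sup>2 < (\<Sum>x\<in>S. a x * g x) \<Longrightarrow> thesis"
    have "\<exists>v\<in>rkhs_vals k g. N - \<theta>\<^sup>2 < v"
    proof (rule less_cSupD)
      have "0 \<in> rkhs_vals k g" unfolding rkhs_vals_def by (auto intro!: exI[of _ "{}"])
      then show "rkhs_vals k g \<noteq> {}" by auto
      show "N - \<theta>\<^sup>2 < Sup (rkhs_vals k g)" using \<open>N - \<theta>\<^sup>2 < N\<close> by (simp add: N_def rkhs_norm_def)
    qed
    then show thesis using * by (auto simp: rkhs_vals_def kquad_def)
  qed
  have Se: "(\<Sum>x\<in>S. a x * g x) \<le> N"
  proof -
    have "(\<Sum>x\<in>S. a x * g x) \<le> N * sqrt (kquad k S a)" using rkhs_leD[OF gN Sa(1), of a] by simp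
    also have "\<dots> \<le> N * 1" using Sa(2) N0 by (intro mult_left_mono) auto
    finally show ?thesis by simp
  qed
  have key: "(\<Sum>y\<in>T. c y * (g y - (\<Sum>x\<in>S. N * a x * k x y))) \<le> e" if T: "finite T" "kquad k T c \<le> 1" for T c
  proof -
    define U where "U = S \<union> T"
    define a' where "a' x = (if x \<in> S then a x else 0)" for x
    define c' where "c' x = (if x \<in> T then c x else 0)" for x
    have U: "finite U" "S \<subseteq> U" "T \<subseteq> U" using Sa(1) T(1) by (auto simp: U_def)
    define P where "P = (\<Sum>y\<in>T. c y * g y)"
    define Q where "Q = (\<Sum>x\<in>S. \<Sum>y\<in>T. a x * c y * k x y)"
    have Q': "(\<Sum>x\<in>U. \<Sum>y\<in>U. a' x * c' y * k x y) = Q"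
    proof -
      have "(\<Sum>x\<in>U. \<Sum>y\<in>U. a' x * c' y * k x y) = (\<Sum>x\<in>U. a' x * (\<Sum>y\<in>U. c' y * k x y))"
        by (simp add: sum_distrib_left mult.assoc)
      also have "\<dots> = (\<Sum>x\<in>S. a x * (\<Sum>y\<in>T. c y * k x y))"
        unfolding a'_def c'_def by (simp only: kquad_extend(2)[OF U(1,2)] kquad_extend(2)[OF U(1,3)])
      finally show ?thesis by (simp add: Q_def sum_distrib_left mult.assoc)
    qed
    have ca: "kquad k U a' = kquad k S a" "kquad k U c' = kquad k T c"
      unfolding a'_def c'_def by (rule kquad_extend(1)[OF U(1,2)], rule kquad_extend(1)[OF U(1,3)])
    have "(\<Sum>x\<in>U. (a' x + \<theta> * c' x) * g x) = (\<Sum>x\<in>U. a' x * g x) + \<theta> * (\<Sum>x\<in>U. c' x * g x)"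
      by (simp add: sum.distrib sum_distrib_left algebra_simps)
    also have "\<dots> = (\<Sum>x\<in>S. a x * g x) + \<theta> * P"
      unfolding a'_def c'_def P_def by (simp only: kquad_extend(2)[OF U(1,2)] kquad_extend(2)[OF U(1,3)])
    finally have "(\<Sum>x\<in>S. a x * g x) + \<theta> * P \<le> N * sqrt (kquad k U (\<lambda>x. a' x + \<theta> * c' x))"
      using rkhs_leD[OF gN U(1), of "\<lambda>x. a' x + \<theta> * c' x"] by simp
    also have "kquad k U (\<lambda>x. a' x + \<theta> * c' x) = kquad k S a + 2 * \<theta> * Q + \<theta>\<^sup>2 * kquad k T c"
    proof -
      have "(\<Sum>x\<in>U. \<Sum>y\<in>U. a' x * (\<theta> * c' y) * k x y) = \<theta> * Q" unfolding Q'[symmetric] by (simp add: sum_distrib_left algebra_simps)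
      then show ?thesis unfolding kquad_add kquad_scale ca by simp
    qed
    also have "N * sqrt (kquad k S a + 2 * \<theta> * Q + \<theta>\<^sup>2 * kquad k T c) \<le> N * (1 + \<theta> * Q + \<theta>\<^sup>2 / 2)"
    proof (rule mult_left_mono[OF _ N0])
      have nn: "0 \<le> kquad k S a + 2 * \<theta> * Q + \<theta>\<^sup>2 * kquad k T c"
        using kquad_nonneg[OF U(1), of "\<lambda>x. a' x + \<theta> * c' x"] \<open>kquad k U (\<lambda>x. a' x + \<theta> * c' x) = _\<close> by simp
      have le: "kquad k S a + 2 * \<theta> * Q + \<theta>\<^sup>2 * kquad k T c \<le> 1 + 2 * \<theta> * Q + \<theta>\<^sup>2"
        using Sa(2) T(2) mult_left_mono[OF T(2), of "\<theta>\<^sup>2"] by simp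
      have "sqrt z \<le> (1 + z) / 2" if "z \<ge> 0" for z :: real
        using arith_geo_mean_sqrt[of 1 z] that by simp
      from this[OF nn] show "sqrt (kquad k S a + 2 * \<theta> * Q + \<theta>\<^sup>2 * kquad k T c) \<le> 1 + \<theta> * Q + \<theta>\<^sup>2 / 2"
        using le by simp
    qed
    finally have "\<theta> * (P - N * Q) \<le> \<theta>\<^sup>2 + N * \<theta>\<^sup>2 / 2" using Sa(3) by (simp add: algebra_simps)
    then have "\<theta> * (P - N * Q) \<le> \<theta> * (\<theta> * (1 + N / 2))" by (simp add: power2_eq_square algebra_simps)
    then have "P - N * Q \<le> \<theta> * (1 + N / 2)" using \<theta>(1) by simp
    also have "\<dots> \<le> \<theta> * (1 + N)" using \<theta> N0 by (intro mult_left_mono) auto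
    also have "\<dots> \<le> e" by (rule \<theta>(3))
    also have "P - N * Q = (\<Sum>y\<in>T. c y * (g y - (\<Sum>x\<in>S. N * a x * k x y)))"
    proof -
      have "N * Q = (\<Sum>y\<in>T. c y * (\<Sum>x\<in>S. N * a x * k x y))"
        unfolding Q_def by (subst sum.swap) (simp add: sum_distrib_left algebra_simps)
      then show ?thesis by (simp add: P_def right_diff_distrib sum_subtractf)
    qed
    finally show ?thesis .
  qed
  show ?thesis
  proof (rule that[of S "\<lambda>x. N * a x"])
    show "finite S" by (rule Sa(1))
    let ?h = "\<lambda>y. g y - (\<Sum>x\<in>S. N * a x * k x y)"
    have "\<And>v. v \<in> rkhs_vals k ?h \<Longrightarrow> v \<le> e" using key unfolding rkhs_vals_def kquad_def by blast
    moreover have "rkhs_vals k ?h \<noteq> {}"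
    proof -
      have "0 \<in> rkhs_vals k ?h" unfolding rkhs_vals_def by (auto intro!: exI[of _ "{}"])
      then show ?thesis by auto
    qed
    ultimately show "rkhs_le k ?h e" unfolding rkhs_le_iff in_rkhs_def rkhs_norm_def
      by (auto intro: bdd_aboveI[where M=e] cSup_least)
    have "(\<Sum>x\<in>S. N * a x * g x) = N * (\<Sum>x\<in>S. a x * g x)" by (simp add: sum_distrib_left mult.assoc)
    moreover have "\<bar>N * (\<Sum>x\<in>S. a x * g x) - N\<^sup>2\<bar> \<le> e"
    proof -
      have "\<bar>N * (\<Sum>x\<in>S. a x * g x) - N\<^sup>2\<bar> = N * \<bar>(\<Sum>x\<in>S. a x * g x) - N\<bar>"
        using N0 by (simp add: abs_mult[symmetric] power2_eq_square right_diff_distrib[symmetric] abs_mult)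
      also have "\<dots> \<le> N * \<theta>\<^sup>2" using Se Sa(3) N0 by (intro mult_left_mono) auto
      also have "\<dots> \<le> N * \<theta>" using \<theta> N0 by (intro mult_left_mono) (auto simp: power2_eq_square mult_left_le)
      also have "\<dots> \<le> e" using \<theta> N0 by (simp add: algebra_simps)
      finally show ?thesis .
    qed
    ultimately show "\<bar>(\<Sum>x\<in>S. N * a x * g x) - (rkhs_norm k g)\<^sup>2\<bar> \<le> e" by (simp add: N_def)
  qed
qed

end

section \<open>Potentials of finite measures under a universal kernel\<close>

locale kernel_space = compact_metric "TYPE('a)" + psd_kernel k
  for k :: "'a::metric_space \<Rightarrow> 'a \<Rightarrow> real" +
  assumes k_cont: "cts (\<lambda>p. k (fst p) (snd p))"
    and k_pos: "0 < k x y" and k_le_1: "k x y \<le> 1"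
    and univ: "universal_kernel k"
begin

text \<open>The kernel mean embedding, that is, the Riesz map of the RKHS restricted to
  measures.\<close>

definition Hk :: "'a measure \<Rightarrow> 'a \<Rightarrow> real" where
  "Hk \<sigma> y = (\<integral>x. k x y \<partial>\<sigma>)"

lemma k_cont1: "cts (\<lambda>x. k x y)" and k_cont2: "cts (\<lambda>y. k x y)"
  by (rule continuous_section[OF k_cont])+

lemma Hk_cont: "fin_borel \<sigma> \<Longrightarrow> cts (Hk \<sigma>)"
  unfolding Hk_def[abs_def] by (rule continuous_integral[OF k_cont])

lemma k_weighted_cont: "cts u \<Longrightarrow> cts (\<lambda>p. k (fst p) (snd p) * u (fst p))"
  for u :: "'a \<Rightarrow> real"
  by (rule continuous_on_mult[OF k_cont continuous_on_compose2[of UNIV u UNIV fst]]) (auto intro!: continuous_intros)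

lemma rkhs_le_cont: assumes "rkhs_le k g M" shows "cts g"
  unfolding continuous_on_def
proof
  fix x
  have "((\<lambda>y. M * sqrt (k y y - 2 * k y x + k x x)) \<longlongrightarrow> M * sqrt (k x x - 2 * k x x + k x x)) (at x)"
  proof (intro tendsto_intros)
    have "isCont (\<lambda>y. k y y) x"
      using continuous_on_compose2[OF k_cont, of UNIV "\<lambda>y. (y, y)"] by (simp add: continuous_on_Pair continuous_on_id continuous_on_eq_continuous_at)
    then show "((\<lambda>y. k y y) \<longlongrightarrow> k x x) (at x)" by (simp add: isCont_def)
    show "((\<lambda>y. k y x) \<longlongrightarrow> k x x) (at x)" using k_cont1[of x] by (simp add: continuous_on_eq_continuous_at isCont_def)
  qed
  then have "((\<lambda>y. M * sqrt (k y y - 2 * k y x + k x x)) \<longlongrightarrow> 0) (at x)" by simp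
  then have "((\<lambda>y. g y - g x) \<longlongrightarrow> 0) (at x)"
    by (rule Lim_null_comparison[rotated]) (use rkhs_le_modulus[OF assms] in auto)
  then show "(g \<longlongrightarrow> g x) (at x within UNIV)" by (simp add: LIM_zero_iff)
qed

lemma rkhs_le_bound: "rkhs_le k g M \<Longrightarrow> \<bar>g x\<bar> \<le> M"
proof -
  assume g: "rkhs_le k g M"
  have "\<bar>g x\<bar> \<le> M * sqrt (k x x)" by (rule rkhs_le_pointwise[OF g])
  also have "\<dots> \<le> M * 1" using k_le_1[of x x] rkhs_le_nonneg[OF g] by (intro mult_left_mono) auto
  finally show ?thesis by simp
qed

lemma span_dense_continuous:
  fixes \<phi> :: "'a \<Rightarrow> real"
  assumes "cts \<phi>" "e > 0"
  obtains S a where "finite S" "\<And>x. \<bar>\<phi> x - (\<Sum>z\<in>S. a z * k z x)\<bar> \<le> e"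
proof -
  obtain g where g: "in_rkhs k g" "\<And>x. \<bar>\<phi> x - g x\<bar> < e / 2"
    using univ assms unfolding universal_kernel_def by (meson half_gt_zero)
  obtain S a where S: "finite S" "rkhs_le k (\<lambda>y. g y - (\<Sum>x\<in>S. a x * k x y)) (e/2)"
    by (rule span_dense[OF g(1), of "e/2"]) (use assms(2) in auto)
  show ?thesis
  proof (rule that[OF S(1)])
    fix x show "\<bar>\<phi> x - (\<Sum>z\<in>S. a z * k z x)\<bar> \<le> e"
      using g(2)[of x] rkhs_le_bound[OF S(2), of x] by linarith
  qed
qed

lemma integral_span:
  assumes "fin_borel \<sigma>"
  shows "(\<integral>x. (\<Sum>z\<in>S. a z * k z x) \<partial>\<sigma>) = (\<Sum>z\<in>S. a z * Hk \<sigma> z)"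
proof -
  have "integrable \<sigma> (\<lambda>x. a z * k z x)" for z
    by (intro integrable_mult_right integrable_continuous[OF assms k_cont2])
  then show ?thesis by (simp add: Hk_def k_sym)
qed

text \<open>The error depends on \<sigma> only through its mass, which turns pointwise convergence
  of potentials into weak convergence for families of bounded mass.\<close>

lemma integral_approx_span:
  fixes \<phi> :: "'a \<Rightarrow> real"
  assumes c: "cts \<phi>" and e: "e > 0"
  obtains S a where "finite S" "\<And>\<sigma>. fin_borel \<sigma> \<Longrightarrow> \<bar>(\<integral>x. \<phi> x \<partial>\<sigma>) - (\<Sum>z\<in>S. a z * Hk \<sigma> z)\<bar> \<le> e * measure \<sigma> UNIV"
proof -
  obtain S a where S: "finite S" "\<And>x. \<bar>\<phi> x - (\<Sum>z\<in>S. a z * k z x)\<bar> \<le> e" by (rule span_dense_continuous[OF c e]) blast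
  show ?thesis
  proof (rule that[OF S(1)])
    fix \<sigma> :: "'a measure" assume s: "fin_borel \<sigma>"
    have "cts (\<lambda>x. \<Sum>z\<in>S. a z * k z x)" by (intro continuous_intros k_cont2)
    then have "(\<integral>x. \<phi> x \<partial>\<sigma>) - (\<Sum>z\<in>S. a z * Hk \<sigma> z) = (\<integral>x. \<phi> x - (\<Sum>z\<in>S. a z * k z x) \<partial>\<sigma>)"
      by (simp add: integral_span[OF s, symmetric] Bochner_Integration.integral_diff integrable_continuous[OF s] c)
    then show "\<bar>(\<integral>x. \<phi> x \<partial>\<sigma>) - (\<Sum>z\<in>S. a z * Hk \<sigma> z)\<bar> \<le> e * measure \<sigma> UNIV"
      using integral_abs_bound[OF s S(2)] by simp
  qed
qed

lemma weak_convergence: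
  fixes \<sigma> :: "'i \<Rightarrow> 'a measure" and \<phi> :: "'a \<Rightarrow> real"
  assumes s: "\<forall>\<^sub>F i in F. fin_borel (\<sigma> i) \<and> measure (\<sigma> i) UNIV \<le> C" and s': "fin_borel \<sigma>'"
    and H: "\<And>y. ((\<lambda>i. Hk (\<sigma> i) y) \<longlongrightarrow> Hk \<sigma>' y) F" and c: "cts \<phi>"
  shows "((\<lambda>i. \<integral>x. \<phi> x \<partial>\<sigma> i) \<longlongrightarrow> (\<integral>x. \<phi> x \<partial>\<sigma>')) F"
  unfolding tendsto_iff
proof (intro allI impI)
  fix r :: real assume r: "r > 0"
  define M where "M = 2 * \<bar>C\<bar> + 2 * measure \<sigma>' UNIV + 2"
  have M: "M > 0" unfolding M_def by (simp add: add_nonneg_pos)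
  define e where "e = r / M"
  have e: "e > 0" using r M by (simp add: e_def)
  obtain S a where S: "finite S" "\<And>\<sigma>. fin_borel \<sigma> \<Longrightarrow> \<bar>(\<integral>x. \<phi> x \<partial>\<sigma>) - (\<Sum>z\<in>S. a z * Hk \<sigma> z)\<bar> \<le> e * measure \<sigma> UNIV"
    by (rule integral_approx_span[OF c e]) blast
  have "((\<lambda>i. \<Sum>z\<in>S. a z * Hk (\<sigma> i) z) \<longlongrightarrow> (\<Sum>z\<in>S. a z * Hk \<sigma>' z)) F" by (intro tendsto_intros H)
  then have "\<forall>\<^sub>F i in F. dist (\<Sum>z\<in>S. a z * Hk (\<sigma> i) z) (\<Sum>z\<in>S. a z * Hk \<sigma>' z) < e" using e by (rule tendstoD)
  with s show "\<forall>\<^sub>F i in F. dist (\<integral>x. \<phi> x \<partial>\<sigma> i) (\<integral>x. \<phi> x \<partial>\<sigma>') < r"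
  proof eventually_elim
    case (elim i)
    have "e * measure (\<sigma> i) UNIV \<le> e * \<bar>C\<bar>" using elim e by (intro mult_left_mono) auto
    then have "dist (\<integral>x. \<phi> x \<partial>\<sigma> i) (\<integral>x. \<phi> x \<partial>\<sigma>') < e * \<bar>C\<bar> + e * measure \<sigma>' UNIV + e"
      using S(2)[of "\<sigma> i"] S(2)[OF s'] elim by (auto simp: dist_real_def)
    also have "\<dots> \<le> e * M" unfolding M_def using e by (simp add: algebra_simps)
    finally show ?case using M by (simp add: e_def)
  qed
qed

text \<open>The constant family \<sigma> has the potentials of \<rho>, so it converges weakly to
  \<rho>; both measures then integrate continuous functions alike.\<close>

lemma Hk_inj:
  assumes s: "fin_borel \<sigma>" and r: "fin_borel \<rho>" and eq: "\<And>y. Hk \<sigma> y = Hk \<rho> y"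
  shows "\<sigma> = \<rho>"
proof (rule measure_eqI_continuous[OF s r])
  fix \<phi> :: "'a \<Rightarrow> real" assume c: "cts \<phi>"
  have "((\<lambda>i::nat. \<integral>x. \<phi> x \<partial>\<sigma>) \<longlongrightarrow> (\<integral>x. \<phi> x \<partial>\<rho>)) sequentially"
    by (rule weak_convergence[OF _ r _ c, where C="measure \<sigma> UNIV"]) (auto simp: s eq)
  then show "(\<integral>x. \<phi> x \<partial>\<sigma>) = (\<integral>x. \<phi> x \<partial>\<rho>)" by (simp add: LIMSEQ_const_iff)
qed

text \<open>Weak-* compactness in elementary form: convergence of potentials at every point makes
  all integrals Cauchy, and the limit functional is represented by Riesz.\<close>

lemma weak_limit_exists:
  fixes \<sigma> :: "nat \<Rightarrow> 'a measure"
  assumes s: "\<And>n. fin_borel (\<sigma> n)" "\<And>n. measure (\<sigma> n) UNIV \<le> C" and H: "\<And>y. (\<lambda>n. Hk (\<sigma> n) y) \<longlonglongrightarrow> b y"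
  obtains \<sigma>' where "fin_borel \<sigma>'" "Hk \<sigma>' = b" "measure \<sigma>' UNIV \<le> C"
    "\<And>\<phi> :: 'a \<Rightarrow> real. cts \<phi> \<Longrightarrow> (\<lambda>n. \<integral>x. \<phi> x \<partial>\<sigma> n) \<longlonglongrightarrow> (\<integral>x. \<phi> x \<partial>\<sigma>')"
proof -
  have C0: "C \<ge> 0" using s(2)[of 0] measure_nonneg[of "\<sigma> 0" UNIV] by linarith
  have conv: "convergent (\<lambda>n. \<integral>x. \<phi> x \<partial>\<sigma> n)" if c: "cts \<phi>" for \<phi> :: "'a \<Rightarrow> real"
  proof (rule Cauchy_convergent, rule metric_CauchyI)
    fix r :: real assume r: "r > 0"
    define e where "e = r / (3 * (C + 1))"
    have e: "e > 0" "e * C < r / 3" using r C0 by (auto simp: e_def field_simps)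
    obtain S a where S: "finite S" "\<And>\<sigma>. fin_borel \<sigma> \<Longrightarrow> \<bar>(\<integral>x. \<phi> x \<partial>\<sigma>) - (\<Sum>z\<in>S. a z * Hk \<sigma> z)\<bar> \<le> e * measure \<sigma> UNIV"
      by (rule integral_approx_span[OF c e(1)]) blast
    have "(\<lambda>n. \<Sum>z\<in>S. a z * Hk (\<sigma> n) z) \<longlonglongrightarrow> (\<Sum>z\<in>S. a z * b z)" by (intro tendsto_intros H)
    then have "Cauchy (\<lambda>n. \<Sum>z\<in>S. a z * Hk (\<sigma> n) z)" by (rule LIMSEQ_imp_Cauchy)
    then obtain N where N: "\<And>m n. m \<ge> N \<Longrightarrow> n \<ge> N \<Longrightarrow> dist (\<Sum>z\<in>S. a z * Hk (\<sigma> m) z) (\<Sum>z\<in>S. a z * Hk (\<sigma> n) z) < r / 3"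
      using metric_CauchyD[of "\<lambda>n. \<Sum>z\<in>S. a z * Hk (\<sigma> n) z" "r/3"] r by auto
    have b: "e * measure (\<sigma> n) UNIV < r / 3" for n
      using mult_left_mono[OF s(2)[of n], of e] e by linarith
    show "\<exists>M. \<forall>m\<ge>M. \<forall>n\<ge>M. dist (\<integral>x. \<phi> x \<partial>\<sigma> m) (\<integral>x. \<phi> x \<partial>\<sigma> n) < r"
    proof (intro exI allI impI)
      fix m n assume "m \<ge> N" "n \<ge> N"
      then show "dist (\<integral>x. \<phi> x \<partial>\<sigma> m) (\<integral>x. \<phi> x \<partial>\<sigma> n) < r"
        using N[of m n] S(2)[OF s(1)[of m]] S(2)[OF s(1)[of n]] b[of m] b[of n] unfolding dist_real_def by linarith
    qed
  qed
  define L where "L \<phi> = lim (\<lambda>n. \<integral>x. \<phi> x \<partial>\<sigma> n)" for \<phi> :: "'a \<Rightarrow> real"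
  have L: "(\<lambda>n. \<integral>x. \<phi> x \<partial>\<sigma> n) \<longlonglongrightarrow> L \<phi>" if "cts \<phi>" for \<phi>
    unfolding L_def using conv[OF that] by (simp add: convergent_LIMSEQ_iff)
  note ic = integrable_continuous[OF s(1)]
  interpret P: positive_functional L
  proof
    show "compact (UNIV :: 'a set)" by (rule compact_space)
    fix \<phi> \<psi> :: "'a \<Rightarrow> real" and r :: real
    assume c: "cts \<phi>"
    show "L (\<lambda>x. r * \<phi> x) = r * L \<phi>"
      by (rule LIMSEQ_unique[OF L]) (use c L[OF c] in \<open>auto intro!: continuous_intros tendsto_intros\<close>)
    show "0 \<le> L \<phi>" if "\<And>x. 0 \<le> \<phi> x"
      by (rule LIMSEQ_le_const[OF L[OF c]]) (use that in \<open>auto intro!: integral_nonneg\<close>)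
    assume c': "cts \<psi>"
    have "(\<lambda>n. \<integral>x. \<phi> x + \<psi> x \<partial>\<sigma> n) \<longlonglongrightarrow> L \<phi> + L \<psi>"
      using tendsto_add[OF L[OF c] L[OF c']] by (simp add: Bochner_Integration.integral_add[OF ic[OF c] ic[OF c']])
    then show "L (\<lambda>x. \<phi> x + \<psi> x) = L \<phi> + L \<psi>"
      using LIMSEQ_unique[OF L[OF continuous_on_add[OF c c']]] by blast
  qed
  obtain \<sigma>' :: "'a measure" where s': "sets \<sigma>' = sets borel" "finite_measure \<sigma>'"
    "\<And>\<phi>. cts \<phi> \<Longrightarrow> (\<integral>x. \<phi> x \<partial>\<sigma>') = L \<phi>"
    by (rule P.representation) (rule that)
  have fb: "fin_borel \<sigma>'" using s' by (simp add: fin_borel_def)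
  have W: "(\<lambda>n. \<integral>x. \<phi> x \<partial>\<sigma> n) \<longlonglongrightarrow> (\<integral>x. \<phi> x \<partial>\<sigma>')" if "cts \<phi>" for \<phi> :: "'a \<Rightarrow> real"
    using L[OF that] s'(3)[OF that] by simp
  show ?thesis
  proof (rule that[OF fb _ _ W])
    show "Hk \<sigma>' = b"
    proof
      fix y show "Hk \<sigma>' y = b y"
        unfolding Hk_def by (rule LIMSEQ_unique[OF W[OF k_cont1] H[unfolded Hk_def]])
    qed
    have "(\<lambda>n. measure (\<sigma> n) UNIV) \<longlonglongrightarrow> measure \<sigma>' UNIV"
      using W[of "\<lambda>_. 1"] by (simp add: fin_borel_space[OF s(1)] fin_borel_space[OF fb])
    then show "measure \<sigma>' UNIV \<le> C" by (rule LIMSEQ_le_const2) (use s(2) in auto)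
  qed
qed

text \<open>\<open>Q\<close> is the squared dual norm of the signed measure \<sigma> - \<rho>.
  Discretising it gives finite combinations whose quadratic forms converge to \<open>Q\<close>;
  nonnegativity, the norm bound and the pairing estimate pass to the limit. Pairing \<delta> with
  its own measure then gives equality of the norm.\<close>

lemma dual_norm:
  fixes \<sigma> \<rho> :: "'a measure"
  assumes s: "fin_borel \<sigma>" and r: "fin_borel \<rho>"
  defines "\<delta> \<equiv> \<lambda>y. Hk \<sigma> y - Hk \<rho> y"
  defines "Q \<equiv> (\<integral>y. \<delta> y \<partial>\<sigma>) - (\<integral>y. \<delta> y \<partial>\<rho>)"
  shows "0 \<le> Q" "rkhs_le k \<delta> (sqrt Q)" "rkhs_norm k \<delta> = sqrt Q"
    "rkhs_le k g M \<Longrightarrow> \<bar>(\<integral>x. g x \<partial>\<sigma>) - (\<integral>x. g x \<partial>\<rho>)\<bar> \<le> M * sqrt Q"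
proof -
  obtain xs :: "nat \<Rightarrow> 'a" and N :: "nat \<Rightarrow> nat" and \<pi> :: "nat \<Rightarrow> 'a \<Rightarrow> 'a" where
    \<pi>: "\<And>n x. \<pi> n x \<in> xs ` {..N n}" "\<And>n z. \<pi> n -` {z} \<in> sets borel" "\<And>n x. dist x (\<pi> n x) < 1 / real (Suc n)"
    by (rule discretisation) (rule that)
  define S where "S n = xs ` {..N n}" for n
  have fS: "finite (S n)" for n by (simp add: S_def)
  note rl = fS \<pi>(1)[folded S_def] \<pi>(2)
  define a where "a n z = measure \<sigma> (\<pi> n -` {z}) - measure \<rho> (\<pi> n -` {z})" for n z
  have a: "(\<Sum>z\<in>S n. a n z * \<phi> z) = (\<integral>x. \<phi> (\<pi> n x) \<partial>\<sigma>) - (\<integral>x. \<phi> (\<pi> n x) \<partial>\<rho>)" for n and \<phi> :: "'a \<Rightarrow> real"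
    unfolding integral_finite_range(1)[OF s rl, of \<phi> n] integral_finite_range(1)[OF r rl, of \<phi> n] a_def
    by (simp add: sum_subtractf left_diff_distrib)
  have ac: "(\<lambda>n. \<Sum>z\<in>S n. a n z * \<phi> z) \<longlonglongrightarrow> (\<integral>x. \<phi> x \<partial>\<sigma>) - (\<integral>x. \<phi> x \<partial>\<rho>)" if "cts \<phi>" for \<phi> :: "'a \<Rightarrow> real"
    unfolding a by (intro tendsto_diff tendsto_integral_discretisation[OF s that rl \<pi>(3)] tendsto_integral_discretisation[OF r that rl \<pi>(3)])
  have \<delta>c: "cts \<delta>" unfolding \<delta>_def by (intro continuous_intros Hk_cont s r)
  define m where "m = measure \<sigma> UNIV + measure \<rho> UNIV + 1"
  have m: "m > 0" by (simp add: m_def add_nonneg_pos)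
  have bnd: "\<bar>(\<integral>x. \<phi> x \<partial>\<sigma>) - (\<integral>x. \<phi> x \<partial>\<rho>)\<bar> \<le> e * m" if "\<And>x. \<bar>\<phi> x\<bar> \<le> e" for \<phi> :: "'a \<Rightarrow> real" and e
  proof -
    have "e \<ge> 0" using that[of undefined] by linarith
    then show ?thesis using integral_abs_bound[OF s, of \<phi> e] integral_abs_bound[OF r, of \<phi> e] that
      by (auto simp: m_def distrib_left)
  qed
  have qc: "(\<lambda>n. kquad k (S n) (a n)) \<longlonglongrightarrow> Q"
  proof -
    \<comment> \<open>The potential of the discretised measure is uniformly close to \<delta> by
      uniform continuity of k, which controls the quadratic form.\<close>
    define \<delta>' where "\<delta>' n y = (\<Sum>x\<in>S n. a n x * k x y)" for n y
    have q: "kquad k (S n) (a n) = (\<Sum>y\<in>S n. a n y * \<delta>' n y)" for n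
      unfolding kquad_def \<delta>'_def by (subst sum.swap) (simp add: sum_distrib_left algebra_simps)
    have "(\<lambda>n. kquad k (S n) (a n) - (\<Sum>y\<in>S n. a n y * \<delta> y)) \<longlonglongrightarrow> 0"
    proof (rule LIMSEQ_I)
      fix r' :: real assume r': "r' > 0"
      define e where "e = r' / (2 * (m * m))"
      have e: "e > 0" using r' m by (simp add: e_def)
      obtain d where d: "d > 0" "\<And>x y x' y'. dist x x' < d \<Longrightarrow> dist y y' < d \<Longrightarrow> \<bar>k x y - k x' y'\<bar> < e"
        by (rule uniform_continuity2[OF k_cont e]) blast
      obtain n0 where n0: "1 / real (Suc n0) < d" using nat_approx_posE[OF d(1)] by blast
      have "norm (kquad k (S n) (a n) - (\<Sum>y\<in>S n. a n y * \<delta> y) - 0) < r'" if n: "n \<ge> n0" for n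
      proof -
        have dn: "dist (\<pi> n x) x < d" for x
        proof -
          have "1 / real (Suc n) \<le> 1 / real (Suc n0)" using n by (intro divide_left_mono) auto
          then show ?thesis using \<pi>(3)[of x n] n0 by (simp add: dist_commute)
        qed
        have 1: "\<bar>\<delta>' n y - \<delta> y\<bar> \<le> e * m" for y
        proof -
          have "\<delta>' n y - \<delta> y = (\<integral>x. k (\<pi> n x) y - k x y \<partial>\<sigma>) - (\<integral>x. k (\<pi> n x) y - k x y \<partial>\<rho>)"
            unfolding \<delta>'_def a \<delta>_def Hk_def
            using Bochner_Integration.integral_diff[OF integral_finite_range(2)[OF s rl] integrable_continuous[OF s k_cont1], of "\<lambda>x. k x y" n y]
              Bochner_Integration.integral_diff[OF integral_finite_range(2)[OF r rl] integrable_continuous[OF r k_cont1], of "\<lambda>x. k x y" n y]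
            by simp
          then show ?thesis using bnd[of "\<lambda>x. k (\<pi> n x) y - k x y" e] d(2)[OF dn, of y y] d(1) by (simp add: less_imp_le)
        qed
        have "kquad k (S n) (a n) - (\<Sum>y\<in>S n. a n y * \<delta> y) = (\<Sum>y\<in>S n. a n y * (\<delta>' n y - \<delta> y))"
          unfolding q by (simp add: right_diff_distrib sum_subtractf)
        also have "\<bar>\<dots>\<bar> \<le> e * m * m" unfolding a by (rule bnd) (rule 1)
        also have "\<dots> < r'" using r' m by (simp add: e_def)
        finally show ?thesis by simp
      qed
      then show "\<exists>no. \<forall>n\<ge>no. norm (kquad k (S n) (a n) - (\<Sum>y\<in>S n. a n y * \<delta> y) - 0) < r'" by blast
    qed
    from tendsto_add[OF this ac[OF \<delta>c]] show ?thesis by (simp add: Q_def)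
  qed
  have q0: "kquad k (S n) (a n) \<ge> 0" for n by (rule kquad_nonneg[OF fS])
  show Q0: "0 \<le> Q" by (rule LIMSEQ_le_const[OF qc]) (use q0 in auto)
  have sqc: "(\<lambda>n. sqrt (kquad k (S n) (a n))) \<longlonglongrightarrow> sqrt Q" by (intro tendsto_intros qc)
  show pair: "\<bar>(\<integral>x. g x \<partial>\<sigma>) - (\<integral>x. g x \<partial>\<rho>)\<bar> \<le> M * sqrt Q" if g: "rkhs_le k g M" for g M
    by (rule LIMSEQ_le[OF tendsto_rabs[OF ac[OF rkhs_le_cont[OF g]]] tendsto_mult[OF tendsto_const sqc]])
       (use rkhs_leD[OF g fS] in auto)
  show le: "rkhs_le k \<delta> (sqrt Q)"
  proof (rule rkhs_le_tendsto[OF _ sqc, where g="\<lambda>n y. \<Sum>x\<in>S n. a n x * k x y"])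
    show "(\<lambda>n. \<Sum>x\<in>S n. a n x * k x y) \<longlonglongrightarrow> \<delta> y" for y
      using ac[OF k_cont1[of y]] unfolding \<delta>_def Hk_def .
    show "\<forall>\<^sub>F n in sequentially. rkhs_le k (\<lambda>y. \<Sum>x\<in>S n. a n x * k x y) (sqrt (kquad k (S n) (a n)))"
      by (intro always_eventually allI rkhs_le_span fS)
  qed simp
  have "in_rkhs k \<delta>" using le in_rkhs_iff by blast
  note le' = in_rkhs_imp_le[OF this]
  have "Q \<le> rkhs_norm k \<delta> * sqrt Q" using pair[OF le'] Q0 unfolding Q_def by simp
  then have "sqrt Q * sqrt Q \<le> rkhs_norm k \<delta> * sqrt Q" using Q0 by simp
  then have "sqrt Q \<le> rkhs_norm k \<delta>"
    using rkhs_le_nonneg[OF le'] Q0 mult_le_cancel_right_pos[of "sqrt Q" "sqrt Q" "rkhs_norm k \<delta>"] by (cases "Q = 0") auto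
  moreover have "rkhs_norm k \<delta> \<le> sqrt Q" using le by (simp add: rkhs_le_iff)
  ultimately show "rkhs_norm k \<delta> = sqrt Q" by simp
qed

lemma fin_borel_null: "fin_borel (null_measure borel)"
  by (simp add: fin_borel_def finite_measureI)

lemma Hk_norm:
  assumes s: "fin_borel \<sigma>"
  shows "0 \<le> (\<integral>y. Hk \<sigma> y \<partial>\<sigma>)" "rkhs_le k (Hk \<sigma>) (sqrt (\<integral>y. Hk \<sigma> y \<partial>\<sigma>))"
    "rkhs_norm k (Hk \<sigma>) = sqrt (\<integral>y. Hk \<sigma> y \<partial>\<sigma>)"
    "rkhs_le k g M \<Longrightarrow> \<bar>\<integral>x. g x \<partial>\<sigma>\<bar> \<le> M * sqrt (\<integral>y. Hk \<sigma> y \<partial>\<sigma>)"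
  using dual_norm[OF s fin_borel_null] by (simp_all add: Hk_def[of "null_measure borel"])

lemma Hk_symm:
  assumes "fin_borel \<sigma>" "fin_borel \<rho>"
  shows "(\<integral>y. Hk \<sigma> y \<partial>\<rho>) = (\<integral>y. Hk \<rho> y \<partial>\<sigma>)"
  unfolding Hk_def using integral_swap[OF k_cont assms] by (simp add: k_sym)

text \<open>Universality makes Gram matrices definite: functions in the RKHS separate the points of
  S well enough to read off the largest coefficient.\<close>

lemma strictly_pd:
  assumes S: "finite S"
  obtains \<alpha> where "\<alpha> > 0" "\<And>a. \<alpha> * (\<Sum>x\<in>S. (a x)\<^sup>2) \<le> kquad k S a"
proof -
  \<comment> \<open>With fewer than n points and errors below 1 / (2 n), approximating the point
    indicators costs at most half of the largest coefficient.\<close>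
  define n where "n = real (card S) + 1"
  have n: "n > 0" by (simp add: n_def)
  have "\<exists>g M. rkhs_le k g M \<and> (\<forall>y\<in>S. \<bar>(if y = x then 1 else 0) - g y\<bar> < 1 / (2 * n))" for x
  proof -
    obtain d where d: "d > 0" "\<And>y. y \<in> S \<Longrightarrow> y \<noteq> x \<Longrightarrow> d \<le> dist x y"
      using finite_set_avoid[OF S] by metis
    define \<phi> where "\<phi> y = max 0 (1 - dist x y / d)" for y
    have "cts \<phi>" unfolding \<phi>_def using d(1) by (intro continuous_intros) auto
    then obtain g where g: "in_rkhs k g" "\<And>y. \<bar>\<phi> y - g y\<bar> < 1 / (2 * n)"
      using univ n unfolding universal_kernel_def by (metis divide_pos_pos mult_pos_pos zero_less_numeral zero_less_one)
    have "\<phi> y = (if y = x then 1 else 0)" if "y \<in> S" for y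
      using d(1) d(2)[OF that] by (cases "y = x") (auto simp: \<phi>_def max_def)
    then have "\<forall>y\<in>S. \<bar>(if y = x then 1 else 0) - g y\<bar> < 1 / (2 * n)" using g(2) by metis
    then show ?thesis using in_rkhs_imp_le[OF g(1)] by blast
  qed
  then obtain g M where g: "\<And>x. rkhs_le k (g x) (M x)" "\<And>x y. y \<in> S \<Longrightarrow> \<bar>(if y = x then 1 else 0) - g x y\<bar> < 1 / (2 * n)" by metis
  define K where "K = (\<Sum>x\<in>S. M x) + 1"
  have MK: "M x \<le> K" if "x \<in> S" for x
    using member_le_sum[OF that, of M] S rkhs_le_nonneg[OF g(1)] by (simp add: K_def)
  have K: "K > 0" unfolding K_def using rkhs_le_nonneg[OF g(1)] by (simp add: add_nonneg_pos sum_nonneg)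
  have key: "(\<Sum>x\<in>S. (a x)\<^sup>2) \<le> n * (2 * K)\<^sup>2 * kquad k S a" for a
  proof (cases "S = {}")
    case False
    define A where "A = Max ((\<lambda>x. \<bar>a x\<bar>) ` S)"
    obtain x where x: "x \<in> S" "\<bar>a x\<bar> = A"
    proof -
      have "A \<in> (\<lambda>x. \<bar>a x\<bar>) ` S" unfolding A_def using S False by (intro Max_in) auto
      then show ?thesis using that by auto
    qed
    have A: "\<bar>a y\<bar> \<le> A" if "y \<in> S" for y unfolding A_def using that S by (intro Max_ge) auto
    have A0: "A \<ge> 0" using x by linarith
    have "a x = (\<Sum>y\<in>S. a y * (if y = x then 1 else 0))" using S x by (simp add: if_distrib cong: if_cong)
    also have "\<dots> = (\<Sum>y\<in>S. a y * g x y) + (\<Sum>y\<in>S. a y * ((if y = x then 1 else 0) - g x y))"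
      by (simp add: sum.distrib[symmetric] distrib_left[symmetric])
    finally have "A \<le> \<bar>\<Sum>y\<in>S. a y * g x y\<bar> + \<bar>\<Sum>y\<in>S. a y * ((if y = x then 1 else 0) - g x y)\<bar>" using x by linarith
    moreover have "\<bar>\<Sum>y\<in>S. a y * ((if y = x then 1 else 0) - g x y)\<bar> \<le> (\<Sum>y\<in>S. A * (1 / (2 * n)))"
      by (rule order_trans[OF sum_abs sum_mono]) (use A A0 less_imp_le[OF g(2)] in \<open>auto simp only: abs_mult intro!: mult_mono abs_ge_zero\<close>)
    moreover have "(\<Sum>y\<in>S. A * (1 / (2 * n))) \<le> A / 2"
    proof -
      have "(\<Sum>y\<in>S. A * (1 / (2 * n))) = A / 2 * (real (card S) / n)" by simp
      also have "\<dots> \<le> A / 2 * 1" using A0 n by (intro mult_left_mono) (auto simp: n_def)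
      finally show ?thesis by simp
    qed
    moreover have "\<bar>\<Sum>y\<in>S. a y * g x y\<bar> \<le> K * sqrt (kquad k S a)"
      using rkhs_leD[OF g(1)[of x] S, of a] MK[OF x(1)] kquad_nonneg[OF S, of a] by (meson mult_right_mono order_trans real_sqrt_ge_zero)
    ultimately have "A \<le> 2 * K * sqrt (kquad k S a)" by linarith
    then have "A\<^sup>2 \<le> (2 * K * sqrt (kquad k S a))\<^sup>2" using A0 by (rule power_mono)
    then have A2: "A\<^sup>2 \<le> (2 * K)\<^sup>2 * kquad k S a" using kquad_nonneg[OF S, of a] by (simp add: power_mult_distrib)
    have "(\<Sum>x\<in>S. (a x)\<^sup>2) \<le> (\<Sum>x\<in>S. A\<^sup>2)" using A by (intro sum_mono) (metis abs_ge_zero power2_abs power_mono)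
    also have "\<dots> \<le> n * A\<^sup>2" by (simp add: n_def mult_right_mono)
    also have "\<dots> \<le> n * ((2 * K)\<^sup>2 * kquad k S a)" using A2 n by (intro mult_left_mono) auto
    finally show ?thesis by simp
  qed (simp add: kquad_def)
  show ?thesis
  proof (rule that[of "1 / (n * (2 * K)\<^sup>2)"])
    show "0 < 1 / (n * (2 * K)\<^sup>2)" using n K by simp
    show "1 / (n * (2 * K)\<^sup>2) * (\<Sum>x\<in>S. (a x)\<^sup>2) \<le> kquad k S a" for a
      using key[of a] n K by (simp add: field_simps)
  qed
qed

end

section \<open>Schroedinger potentials\<close>

context compact_metric
begin

text \<open>Fixed points are considered up to an additive constant, because the contraction holds in
  the oscillation seminorm, which is blind to constants.\<close>

lemma oscillation_fixed_point_unique: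
  fixes T :: "('a \<Rightarrow> real) \<Rightarrow> 'a \<Rightarrow> real"
  assumes osc: "\<And>f g \<Omega>. cts f \<Longrightarrow> cts g \<Longrightarrow> (\<And>x y. (f x - g x) - (f y - g y) \<le> \<Omega>) \<Longrightarrow>
      (\<And>x y. (T f x - T g x) - (T f y - T g y) \<le> q * \<Omega>)"
    and q: "q < 1"
    and f: "cts f" "\<And>x. T f x = f x + a" and g: "cts g" "\<And>x. T g x = g x + a'"
  shows "f x - g x = f y - g y"
proof -
  have c: "cts (\<lambda>x. f x - g x)" by (intro continuous_intros f g)
  obtain x1 where x1: "\<And>x. f x - g x \<le> f x1 - g x1"
    using continuous_attains_sup[OF compact_space _ c] by auto
  obtain x2 where x2: "\<And>x. f x2 - g x2 \<le> f x - g x"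
    using continuous_attains_inf[OF compact_space _ c] by auto
  define \<Omega> where "\<Omega> = (f x1 - g x1) - (f x2 - g x2)"
  have b: "(f x - g x) - (f y - g y) \<le> \<Omega>" for x y using x1[of x] x2[of y] by (simp add: \<Omega>_def)
  have "\<Omega> \<le> q * \<Omega>" using osc[OF f(1) g(1) b, of x1 x2] by (simp add: f(2) g(2) \<Omega>_def)
  then have "(1 - q) * \<Omega> \<le> 0" by (simp add: algebra_simps)
  then have "\<Omega> \<le> 0" using q by (simp add: mult_le_0_iff)
  then show ?thesis using b[of x y] b[of y x] by linarith
qed

lemma oscillation_fixed_point_exists:
  fixes T :: "('a \<Rightarrow> real) \<Rightarrow> 'a \<Rightarrow> real"
  assumes cont: "\<And>f. cts f \<Longrightarrow> cts (T f)"
    and osc: "\<And>f g \<Omega>. cts f \<Longrightarrow> cts g \<Longrightarrow> (\<And>x y. (f x - g x) - (f y - g y) \<le> \<Omega>) \<Longrightarrow>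
      (\<And>x y. (T f x - T g x) - (T f y - T g y) \<le> q * \<Omega>)"
    and q: "0 \<le> q" "q < 1"
  obtains f a where "cts f" "\<And>x. T f x = f x + a"
proof -
  define F where "F n = (T ^^ n) (\<lambda>_. 0)" for n
  have F0: "F 0 = (\<lambda>_. 0)" and FS: "F (Suc n) = T (F n)" for n by (simp_all add: F_def)
  have Fc: "cts (F n)" for n by (induction n) (auto simp: F0 FS cont)
  have Fc': "cts (\<lambda>x. F n x)" for n using Fc[of n] by simp
  obtain M where M: "\<And>x. \<bar>F 1 x\<bar> \<le> M" by (rule continuous_bounded[OF Fc[of 1]]) blast
  have M0: "M \<ge> 0" using M[of undefined] by linarith
  have inc: "(F (Suc n) x - F n x) - (F (Suc n) y - F n y) \<le> q ^ n * (2 * M)" for n x y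
  proof (induction n arbitrary: x y)
    case 0 then show ?case using M[of x] M[of y] by (simp add: F0)
  next
    case (Suc n)
    from osc[OF Fc Fc this, of x y] show ?case by (simp add: FS mult.assoc)
  qed
  define x0 :: 'a where "x0 = undefined"
  \<comment> \<open>Increments normalised at \<open>x0\<close> decay geometrically in the sup norm,
    while the additive constants of the raw iterates may drift.\<close>
  define d where "d n x = (F (Suc n) x - F n x) - (F (Suc n) x0 - F n x0)" for n x
  have db: "\<bar>d n x\<bar> \<le> q ^ n * (2 * M)" for n x using inc[of n x x0] inc[of n x0 x] by (auto simp: d_def)
  have part: "(\<Sum>i<n. d i x) = F n x - F n x0" for n x
    by (induction n) (auto simp: F0 d_def)
  have sm: "summable (\<lambda>n. q ^ n * (2 * M))" using q by (intro summable_mult2 summable_geometric) auto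
  define g where "g x = (\<Sum>i. d i x)" for x
  have ul: "uniform_limit UNIV (\<lambda>n x. \<Sum>i<n. d i x) g sequentially"
    unfolding g_def by (rule Weierstrass_m_test[OF _ sm]) (use db in auto)
  have gc: "cts g"
  proof (rule uniform_limit_theorem[OF _ ul])
    show "\<forall>\<^sub>F n in sequentially. cts (\<lambda>x. \<Sum>i<n. d i x)"
      unfolding part by (intro always_eventually allI continuous_intros Fc')
  qed simp
  have close: "(T g x - g x) - (T g y - g y) \<le> e" if e: "e > 0" for e x y
  proof -
    have "\<forall>\<^sub>F n in sequentially. \<forall>x\<in>UNIV. dist (\<Sum>i<n. d i x) (g x) < e / 4" by (rule uniform_limitD[OF ul]) (use e in simp)
    then have "\<forall>\<^sub>F n in sequentially. \<forall>x. \<bar>F n x - F n x0 - g x\<bar> < e / 4" by (simp add: part dist_real_def)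
    then obtain n0 where n0: "\<And>n x. n \<ge> n0 \<Longrightarrow> \<bar>F n x - F n x0 - g x\<bar> < e / 4" unfolding eventually_sequentially by blast
    have "(g x - F n0 x) - (g y - F n0 y) \<le> e / 2" for x y using n0[of n0 x] n0[of n0 y] unfolding abs_less_iff by simp
    from osc[OF gc Fc this, of x y] have "(T g x - F (Suc n0) x) - (T g y - F (Suc n0) y) \<le> q * (e / 2)" by (simp add: FS)
    moreover have "q * (e / 2) \<le> e / 2" using q e by (simp add: mult_left_le_one_le)
    moreover have "\<bar>F (Suc n0) x - F (Suc n0) x0 - g x\<bar> < e / 4" "\<bar>F (Suc n0) y - F (Suc n0) x0 - g y\<bar> < e / 4" by (rule n0, simp)+
    ultimately show ?thesis by argo
  qed
  have "T g x - g x = T g x0 - g x0" for x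
    by (rule antisym; rule field_le_epsilon) (use close[of _ x x0] close[of _ x0 x] in \<open>auto simp: algebra_simps\<close>)
  then have "T g x = g x + (T g x0 - g x0)" for x by (metis add_diff_cancel_left' diff_add_cancel add.commute)
  then show ?thesis by (rule that[OF gc])
qed

end

section \<open>Contraction of the Sinkhorn map and its fixed point\<close>

locale sinkhorn =
  fixes \<epsilon> :: real and c :: "'a::metric_space \<Rightarrow> 'a \<Rightarrow> real"
  assumes compact_univ: "compact (UNIV :: 'a set)"
    and eps_pos: "\<epsilon> > 0"
    and c_cont: "cts (\<lambda>(x, y). c x y)"
    and c_nonneg: "\<forall>x y. c x y \<ge> 0"
    and kc_pd: "pos_def_kernel (kc \<epsilon> c)"
    and kc_univ: "universal_kernel (kc \<epsilon> c)"
begin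

abbreviation "k \<equiv> kc \<epsilon> c"

sublocale kernel_space k
proof
  show "compact (UNIV :: 'a set)" by (rule compact_univ)
  show "pos_def_kernel k" by (rule kc_pd)
  show "universal_kernel k" by (rule kc_univ)
  show "0 < k x y" for x y by (simp add: kc_def)
  show "k x y \<le> 1" for x y using c_nonneg eps_pos by (simp add: kc_def)
  have "cts (\<lambda>p. c (fst p) (snd p))" using c_cont by (simp add: case_prod_unfold)
  then show "cts (\<lambda>p. k (fst p) (snd p))" unfolding kc_def using eps_pos by (intro continuous_intros) auto
qed

lemma k_lower:
  obtains \<kappa> where "\<kappa> > 0" "\<And>x y. \<kappa> \<le> k x y"
proof -
  have "compact (UNIV :: ('a \<times> 'a) set)" using compact_Times[OF compact_space compact_space] by simp
  from continuous_attains_inf[OF this _ k_cont] obtain p where "\<forall>q. k (fst p) (snd p) \<le> k (fst q) (snd q)" by auto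
  then show ?thesis using that[of "k (fst p) (snd p)"] k_pos by (metis fst_conv snd_conv)
qed

definition \<kappa> :: real where "\<kappa> = (SOME \<kappa>. \<kappa> > 0 \<and> (\<forall>x y. \<kappa> \<le> k x y))"

lemma \<kappa>_pos: "\<kappa> > 0" and \<kappa>_le: "\<kappa> \<le> k x y"
proof -
  have "\<exists>\<kappa>. \<kappa> > 0 \<and> (\<forall>x y. \<kappa> \<le> k x y)" using k_lower by metis
  from someI_ex[OF this] show "\<kappa> > 0" "\<kappa> \<le> k x y" unfolding \<kappa>_def by auto
qed

lemma \<kappa>_le_1: "\<kappa> \<le> 1"
  using \<kappa>_le k_le_1 order_trans by blast

lemma Probs_fin_borel: "(\<mu> :: 'a measure) \<in> Probs \<Longrightarrow> fin_borel \<mu>"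
  by (simp add: Probs_def fin_borel_def prob_space.finite_measure)

lemma Probs_measure: "(\<mu> :: 'a measure) \<in> Probs \<Longrightarrow> measure \<mu> UNIV = 1"
  using prob_space.prob_space[of \<mu>] fin_borel_space[OF Probs_fin_borel[of \<mu>]] by (simp add: Probs_def)

lemma Teps_kernel: "Teps \<epsilon> c f \<mu> y = - \<epsilon> * ln (\<integral>x. exp (f x / \<epsilon>) * k x y \<partial>\<mu>)"
  by (simp add: Teps_def kc_def exp_add[symmetric] diff_divide_distrib)

lemma weighted_cont: "cts u \<Longrightarrow> fin_borel \<mu> \<Longrightarrow> cts (\<lambda>y. \<integral>x. u x * k x y \<partial>\<mu>)"
  for u :: "'a \<Rightarrow> real"
  using continuous_integral[of "\<lambda>x y. k x y * u x" \<mu>] k_weighted_cont[of u] by (simp add: mult.commute)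

lemma weighted_integrable: "cts u \<Longrightarrow> fin_borel \<mu> \<Longrightarrow> integrable \<mu> (\<lambda>x. u x * k x y)"
  for u :: "'a \<Rightarrow> real"
  by (intro integrable_continuous continuous_on_mult k_cont1)

lemma integral_pos:
  fixes u :: "'a \<Rightarrow> real"
  assumes m: "\<mu> \<in> Probs" and u: "cts u" "\<And>x. 0 < u x"
  shows "0 < (\<integral>x. u x \<partial>\<mu>)"
proof -
  obtain x0 where x0: "\<And>x. u x0 \<le> u x" using continuous_attains_inf[OF compact_space _ u(1)] by auto
  note fb = Probs_fin_borel[OF m]
  interpret finite_measure \<mu> using fb by (simp add: fin_borel_def)
  have "(\<integral>x. u x0 \<partial>\<mu>) \<le> (\<integral>x. u x \<partial>\<mu>)" by (rule integral_mono) (use x0 integrable_continuous[OF fb u(1)] in auto)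
  moreover have "(\<integral>x. u x0 \<partial>\<mu>) = u x0" using Probs_measure[OF m] fin_borel_space[OF fb] by simp
  ultimately show ?thesis using u(2)[of x0] by simp
qed

lemma Teps_cont:
  assumes f: "cts f" and m: "\<mu> \<in> Probs"
  shows "cts (Teps \<epsilon> c f \<mu>)"
proof -
  have u: "cts (\<lambda>x. exp (f x / \<epsilon>))" using f eps_pos by (intro continuous_intros) auto
  have "cts (\<lambda>y. - \<epsilon> * ln (\<integral>x. exp (f x / \<epsilon>) * k x y \<partial>\<mu>))"
  proof (intro continuous_intros weighted_cont[OF u Probs_fin_borel[OF m]])
    show "\<forall>y\<in>UNIV. (\<integral>x. exp (f x / \<epsilon>) * k x y \<partial>\<mu>) \<noteq> 0"
      using integral_pos[OF m continuous_on_mult[OF u k_cont1]] k_pos by (metis exp_gt_zero less_irrefl mult_pos_pos)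
  qed
  then show ?thesis by (simp add: Teps_kernel[abs_def])
qed

lemma Teps_shift: "\<mu> \<in> Probs \<Longrightarrow> cts f \<Longrightarrow> Teps \<epsilon> c (\<lambda>x. f x + a) \<mu> y = Teps \<epsilon> c f \<mu> y - a"
proof -
  assume m: "\<mu> \<in> Probs" and f: "cts f"
  have u: "cts (\<lambda>x. exp (f x / \<epsilon>))" using f eps_pos by (intro continuous_intros) auto
  have "(\<integral>x. exp ((f x + a) / \<epsilon>) * k x y \<partial>\<mu>) = exp (a / \<epsilon>) * (\<integral>x. exp (f x / \<epsilon>) * k x y \<partial>\<mu>)"
    by (subst integral_mult_right_zero[symmetric]) (simp add: add_divide_distrib exp_add mult_ac)
  moreover have "0 < (\<integral>x. exp (f x / \<epsilon>) * k x y \<partial>\<mu>)"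
    by (rule integral_pos[OF m continuous_on_mult[OF u k_cont1]]) (simp add: k_pos)
  ultimately show ?thesis using eps_pos by (simp add: Teps_kernel ln_mult algebra_simps)
qed

text \<open>The ratio \<open>F = N / Z\<close> is an average of \<open>h\<close>, the exponential of
  (f - g) / \<epsilon>. Kernel values at two points differ by at most a factor \<kappa>, so the
  excess of F over the minimum of h is comparable at any two points up to \<kappa>^2. Convexity of
  exp turns this Harnack bound into the factor 1 - \<kappa>^2 for logarithms.\<close>

lemma Teps_oscillation:
  assumes m: "\<mu> \<in> Probs" and f: "cts f" and g: "cts g"
    and \<Omega>: "\<And>x y. (f x - g x) - (f y - g y) \<le> \<Omega>"
  shows "(Teps \<epsilon> c f \<mu> y - Teps \<epsilon> c g \<mu> y) - (Teps \<epsilon> c f \<mu> y' - Teps \<epsilon> c g \<mu> y') \<le> (1 - \<kappa>\<^sup>2) * \<Omega>"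
proof -
  note fb = Probs_fin_borel[OF m]
  define w h where "w x = exp (g x / \<epsilon>)" and "h x = exp ((f x - g x) / \<epsilon>)" for x
  have wc: "cts w" and hc: "cts h"
    unfolding w_def h_def using f g eps_pos by (intro continuous_intros; simp)+
  have wp: "w x > 0" for x by (simp add: w_def)
  have hw: "exp (f x / \<epsilon>) = h x * w x" for x by (simp add: h_def w_def exp_add[symmetric] diff_divide_distrib)
  obtain x0 where x0: "\<And>x. h x0 \<le> h x" using continuous_attains_inf[OF compact_space _ hc] by auto
  define a where "a = h x0"
  have a: "a > 0" "\<And>x. a \<le> h x" using x0 by (simp_all add: a_def h_def)
  define E where "E = exp (\<Omega> / \<epsilon>)"
  have hE: "h x \<le> a * E" for x
    using \<Omega>[of x x0] eps_pos by (simp add: a_def h_def E_def exp_add[symmetric] add_divide_distrib[symmetric] divide_right_mono)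
  define Z N where "Z y = (\<integral>x. w x * k x y \<partial>\<mu>)" and "N y = (\<integral>x. h x * w x * k x y \<partial>\<mu>)" for y
  have Zp: "Z y > 0" for y unfolding Z_def by (rule integral_pos[OF m continuous_on_mult[OF wc k_cont1]]) (simp add: wp k_pos)
  have Np: "N y > 0" for y unfolding N_def
    by (rule integral_pos[OF m continuous_on_mult[OF continuous_on_mult[OF hc wc] k_cont1]]) (use a in \<open>simp add: wp k_pos less_le_trans[of 0 a]\<close>)
  define F where "F y = N y / Z y" for y
  have Fp: "F y > 0" for y using Np Zp by (simp add: F_def)
  have diff: "N y - a * Z y = (\<integral>x. (h x - a) * w x * k x y \<partial>\<mu>)" for y
    unfolding N_def Z_def
    using Bochner_Integration.integral_diff[OF weighted_integrable[OF continuous_on_mult[OF hc wc] fb, of y] integrable_mult_right[OF weighted_integrable[OF wc fb, of y], of a]]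
    by (simp add: algebra_simps)
  have ZZ: "\<kappa> * Z y \<le> Z y'" for y y'
  proof -
    have "\<kappa> * Z y = (\<integral>x. \<kappa> * (w x * k x y) \<partial>\<mu>)" by (simp add: Z_def)
    also have "\<dots> \<le> Z y'" unfolding Z_def
    proof (rule integral_mono)
      fix x
      have "\<kappa> * k x y \<le> \<kappa> * 1" using \<kappa>_pos k_le_1 by (intro mult_left_mono) auto
      then have "\<kappa> * k x y \<le> k x y'" using \<kappa>_le[of x y'] by simp
      then show "\<kappa> * (w x * k x y) \<le> w x * k x y'" using wp[of x] by (simp add: mult.left_commute)
    qed (auto intro!: integrable_mult_right weighted_integrable[OF wc fb])
    finally show ?thesis .
  qed
  have NN: "\<kappa> * (N y - a * Z y) \<le> N y' - a * Z y'" for y y'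
  proof -
    have "\<kappa> * (N y - a * Z y) = (\<integral>x. \<kappa> * ((h x - a) * w x * k x y) \<partial>\<mu>)" unfolding diff by simp
    also have "\<dots> \<le> N y' - a * Z y'" unfolding diff
    proof (rule integral_mono)
      fix x
      have "\<kappa> * k x y \<le> \<kappa> * 1" using \<kappa>_pos k_le_1 by (intro mult_left_mono) auto
      then have "\<kappa> * k x y \<le> k x y'" using \<kappa>_le[of x y'] by simp
      moreover have "0 \<le> (h x - a) * w x" using a wp[of x] by simp
      ultimately show "\<kappa> * ((h x - a) * w x * k x y) \<le> (h x - a) * w x * k x y'"
        by (metis mult.left_commute mult_left_mono)
    qed (auto intro!: integrable_mult_right weighted_integrable[OF _ fb] continuous_intros hc wc)
    finally show ?thesis .
  qed
  have Fa: "F y - a = (N y - a * Z y) / Z y" for y using Zp[of y] by (simp add: F_def field_simps)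
  have N0: "0 \<le> N y - a * Z y" for y unfolding diff
    using a wp k_pos by (intro Bochner_Integration.integral_nonneg) (simp add: less_imp_le)
  \<comment> \<open>One factor \<kappa> comes from the numerator and one from the
    denominator.\<close>
  have key: "\<kappa>\<^sup>2 * (F y' - a) \<le> F y - a"
  proof -
    have "\<kappa>\<^sup>2 * (F y' - a) = \<kappa> * (N y' - a * Z y') * (\<kappa> / Z y')" by (simp add: Fa power2_eq_square)
    also have "\<dots> \<le> (N y - a * Z y) * (\<kappa> / Z y')" using NN Zp[of y'] \<kappa>_pos by (intro mult_right_mono) auto
    also have "\<dots> \<le> (N y - a * Z y) * (1 / Z y)"
      using N0 Zp[of y] Zp[of y'] ZZ[of y y'] by (intro mult_left_mono) (auto simp: field_simps)
    finally show ?thesis by (simp add: Fa)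
  qed
  have Fb: "F y' \<le> a * E"
  proof -
    have "N y' \<le> (\<integral>x. (a * E) * (w x * k x y') \<partial>\<mu>)" unfolding N_def
    proof (rule integral_mono)
      show "h x * w x * k x y' \<le> (a * E) * (w x * k x y')" for x
        using hE[of x] wp[of x] k_pos[of x y'] by (simp add: mult.assoc mult_right_mono)
    qed (auto intro!: integrable_mult_right weighted_integrable[OF _ fb] continuous_intros hc wc)
    then show ?thesis using Zp[of y'] by (simp add: F_def Z_def divide_le_eq)
  qed
  define r where "r = F y' / a"
  have r1: "1 \<le> r" using N0[of y'] Fa[of y'] Zp[of y'] a(1) by (simp add: r_def) (metis diff_ge_0_iff_ge divide_nonneg_pos)
  have rE: "ln r \<le> \<Omega> / \<epsilon>" using Fb a(1) r1 ln_le_cancel_iff[of r E] by (simp add: r_def E_def divide_le_eq mult.commute)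
  have k2: "0 \<le> \<kappa>\<^sup>2" "\<kappa>\<^sup>2 \<le> 1" using \<kappa>_pos \<kappa>_le_1 by (simp_all add: power_le_one)
  have Fr: "a * ((1 - \<kappa>\<^sup>2) + \<kappa>\<^sup>2 * r) \<le> F y"
    using key a(1) by (simp add: r_def algebra_simps)
  \<comment> \<open>Weighted arithmetic-geometric mean for 1 and r with weight \<kappa>^2 on
    r.\<close>
  have "exp (\<kappa>\<^sup>2 * ln r) \<le> (1 - \<kappa>\<^sup>2) + \<kappa>\<^sup>2 * r"
    using convex_onD[OF exp_convex, of "\<kappa>\<^sup>2" 0 "ln r"] k2 r1 by simp
  then have "a * exp (\<kappa>\<^sup>2 * ln r) \<le> F y" using Fr a(1) by (meson mult_le_cancel_left_pos order_trans)
  then have "ln (a * exp (\<kappa>\<^sup>2 * ln r)) \<le> ln (F y)" using a(1) Fp by (subst ln_le_cancel_iff) auto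
  then have l1: "ln a + \<kappa>\<^sup>2 * ln r \<le> ln (F y)" using a(1) by (simp add: ln_mult)
  have l2: "ln (F y') = ln a + ln r" using a(1) Fp[of y'] r1 by (simp add: r_def ln_div)
  have "ln (F y') - ln (F y) \<le> (1 - \<kappa>\<^sup>2) * ln r" using l1 l2 by (simp add: algebra_simps)
  also have "\<dots> \<le> (1 - \<kappa>\<^sup>2) * (\<Omega> / \<epsilon>)" using rE k2 by (intro mult_left_mono) auto
  finally have fin: "\<epsilon> * (ln (F y') - ln (F y)) \<le> (1 - \<kappa>\<^sup>2) * \<Omega>" using eps_pos by (simp add: field_simps)
  have T: "Teps \<epsilon> c f \<mu> y - Teps \<epsilon> c g \<mu> y = - \<epsilon> * ln (F y)" for y
  proof -
    have "Teps \<epsilon> c f \<mu> y = - \<epsilon> * ln (N y)" "Teps \<epsilon> c g \<mu> y = - \<epsilon> * ln (Z y)"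
      by (simp_all add: Teps_kernel N_def Z_def hw w_def)
    then show ?thesis using Np[of y] Zp[of y] by (simp add: F_def ln_div algebra_simps)
  qed
  show ?thesis unfolding T using fin by (simp add: algebra_simps)
qed

lemma contraction_factor: "0 \<le> 1 - \<kappa>\<^sup>2" "1 - \<kappa>\<^sup>2 < 1"
  using \<kappa>_pos \<kappa>_le_1 by (simp_all add: power_le_one)

text \<open>Each component of a pair is fixed by the map applied twice, so it differs from f by a
  constant. The components are f + s and f - s, and equality of the two integrals gives s = -
  s.\<close>

lemma schr_pair_unique:
  assumes m: "\<mu> \<in> Probs" and f: "cts f" "Teps \<epsilon> c f \<mu> = f"
  shows "schr_pair \<epsilon> c \<mu> \<mu> = (f, f)"
proof -
  let ?T = "\<lambda>f. Teps \<epsilon> c f \<mu>"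
  have "(THE p. case p of (f', g) \<Rightarrow> cts f' \<and> cts g \<and>
      f' = ?T g \<and> g = ?T f' \<and> (\<integral>x. f' x \<partial>\<mu>) = (\<integral>x. g x \<partial>\<mu>)) = (f, f)"
  proof (rule the_equality)
    fix p assume *: "case p of (f', g) \<Rightarrow> cts f' \<and> cts g \<and>
      f' = ?T g \<and> g = ?T f' \<and> (\<integral>x. f' x \<partial>\<mu>) = (\<integral>x. g x \<partial>\<mu>)"
    obtain f' g where p1: "p = (f', g)" by (cases p)
    from * have p: "cts f'" "cts g" "f' = ?T g" "g = ?T f'" "(\<integral>x. f' x \<partial>\<mu>) = (\<integral>x. g x \<partial>\<mu>)"
      unfolding p1 prod.case by blast+
    have T1: "?T (?T f') x = f' x + 0" and T2: "?T (?T f) x = f x + 0" for x using p(3,4) f(2) by simp_all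
    have "f' x - f x = f' y - f y" for x y
    proof (rule oscillation_fixed_point_unique[where T="\<lambda>f. ?T (?T f)" and q="(1 - \<kappa>\<^sup>2) * (1 - \<kappa>\<^sup>2)" and a=0 and a'=0])
      fix f g :: "'a \<Rightarrow> real" and \<Omega> x y assume "cts f" "cts g" "\<And>x y. (f x - g x) - (f y - g y) \<le> \<Omega>"
      then show "?T (?T f) x - ?T (?T g) x - (?T (?T f) y - ?T (?T g) y) \<le> (1 - \<kappa>\<^sup>2) * (1 - \<kappa>\<^sup>2) * \<Omega>"
        unfolding mult.assoc by (intro Teps_oscillation[OF m Teps_cont[OF _ m] Teps_cont[OF _ m]] Teps_oscillation[OF m])
    next
      have "(1 - \<kappa>\<^sup>2) * (1 - \<kappa>\<^sup>2) \<le> (1 - \<kappa>\<^sup>2) * 1" using contraction_factor by (intro mult_left_mono) auto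
      then show "(1 - \<kappa>\<^sup>2) * (1 - \<kappa>\<^sup>2) < 1" using contraction_factor(2) by (simp only: mult_1_right)
    next
      show "cts f'" "cts f" by (rule p f)+
      show "?T (?T f') x = f' x + 0" "?T (?T f) x = f x + 0" for x by (rule T1 T2)+
    qed
    then have eq: "f' x = f x + (f' undefined - f undefined)" for x by (metis add.commute diff_add_cancel)
    define s where "s = f' undefined - f undefined"
    have f': "f' = (\<lambda>x. f x + s)" using eq unfolding s_def by (rule ext)
    have g: "g = (\<lambda>x. f x - s)" unfolding p(4) f' using Teps_shift[OF m f(1), of s] by (simp add: fun_eq_iff f(2))
    note fb = Probs_fin_borel[OF m]
    interpret prob_space \<mu> using m by (simp add: Probs_def)
    have "(\<integral>x. f x \<partial>\<mu>) + s = (\<integral>x. f x \<partial>\<mu>) - s"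
      using p(5) integrable_continuous[OF fb f(1)] unfolding f' g by (simp add: prob_space)
    then show "p = (f, f)" using p1 f' g by simp
  qed (use f in auto)
  then show ?thesis unfolding schr_pair_def .
qed

text \<open>The contraction yields T f = f + a only. Since T (f + b) = T f - b, adding a / 2 absorbs
  the constant.\<close>

lemma fpot_exists:
  assumes m: "\<mu> \<in> Probs"
  shows "cts (fpot \<epsilon> c \<mu>)" "Teps \<epsilon> c (fpot \<epsilon> c \<mu>) \<mu> = fpot \<epsilon> c \<mu>"
proof -
  obtain f a where f: "cts f" "\<And>x. Teps \<epsilon> c f \<mu> x = f x + a"
  proof (rule oscillation_fixed_point_exists[where T="\<lambda>f. Teps \<epsilon> c f \<mu>" and q="1 - \<kappa>\<^sup>2"])
    show "0 \<le> 1 - \<kappa>\<^sup>2" "1 - \<kappa>\<^sup>2 < 1" by (rule contraction_factor)+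
  qed (auto intro: Teps_cont[OF _ m] Teps_oscillation[OF m])
  define g where "g x = f x + a / 2" for x
  have g: "cts g" "Teps \<epsilon> c g \<mu> = g"
    unfolding g_def using f Teps_shift[OF m f(1), of "a/2"] by (auto intro!: continuous_intros)
  have "fpot \<epsilon> c \<mu> = g" unfolding fpot_def schr_pair_unique[OF m g] by simp
  then show "cts (fpot \<epsilon> c \<mu>)" "Teps \<epsilon> c (fpot \<epsilon> c \<mu>) \<mu> = fpot \<epsilon> c \<mu>" using g by simp_all
qed

section \<open>The embedding B and its inverse\<close>

abbreviation "B \<equiv> Bemb \<epsilon> c"

lemma B_pos: "0 < B \<mu> x"
  by (simp add: Bemb_def)

lemma B_cont: "\<mu> \<in> Probs \<Longrightarrow> cts (B \<mu>)"
  unfolding Bemb_def using fpot_exists(1)[of \<mu>] eps_pos by (intro continuous_intros) auto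

lemma B_eq:
  assumes m: "\<mu> \<in> Probs"
  shows "B \<mu> y = (\<integral>x. 1 / B \<mu> x * k x y \<partial>\<mu>)"
proof -
  let ?f = "fpot \<epsilon> c \<mu>"
  have u: "cts (\<lambda>x. exp (?f x / \<epsilon>))" using fpot_exists(1)[OF m] eps_pos by (intro continuous_intros) auto
  have p: "0 < (\<integral>x. exp (?f x / \<epsilon>) * k x y \<partial>\<mu>)"
    by (rule integral_pos[OF m continuous_on_mult[OF u k_cont1]]) (simp add: k_pos)
  have "?f y = - \<epsilon> * ln (\<integral>x. exp (?f x / \<epsilon>) * k x y \<partial>\<mu>)"
    using fun_cong[OF fpot_exists(2)[OF m], of y] by (simp add: Teps_kernel)
  then have "- ?f y / \<epsilon> = ln (\<integral>x. exp (?f x / \<epsilon>) * k x y \<partial>\<mu>)" using eps_pos by (simp add: field_simps)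
  then have "B \<mu> y = (\<integral>x. exp (?f x / \<epsilon>) * k x y \<partial>\<mu>)" using p by (simp add: Bemb_def)
  then show ?thesis by (simp add: Bemb_def exp_minus inverse_eq_divide)
qed

lemma B_eqI:
  assumes m: "\<mu> \<in> Probs" and b: "cts b" "\<And>x. 0 < b x" "\<And>y. b y = (\<integral>x. 1 / b x * k x y \<partial>\<mu>)"
  shows "B \<mu> = b"
proof -
  define f where "f x = - \<epsilon> * ln (b x)" for x
  have fc: "cts f" unfolding f_def using b by (intro continuous_intros) (metis less_irrefl)+
  have e: "exp (f x / \<epsilon>) = 1 / b x" for x using b(2)[of x] eps_pos by (simp add: f_def exp_minus inverse_eq_divide)
  have "Teps \<epsilon> c f \<mu> = f"
  proof
    fix y show "Teps \<epsilon> c f \<mu> y = f y" unfolding Teps_kernel e using b(3)[of y] by (simp add: f_def)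
  qed
  then have "fpot \<epsilon> c \<mu> = f" unfolding fpot_def using schr_pair_unique[OF m fc] by simp
  then show ?thesis using b(2) eps_pos by (simp add: Bemb_def fun_eq_iff f_def)
qed

end

lemma (in compact_metric) integral_density_continuous:
  fixes w \<phi> :: "'a \<Rightarrow> real"
  assumes s: "fin_borel \<sigma>" and w: "cts w" "\<And>x. 0 \<le> w x"
  shows "fin_borel (density \<sigma> (\<lambda>x. ennreal (w x)))"
    "cts \<phi> \<Longrightarrow> (\<integral>x. \<phi> x \<partial>density \<sigma> (\<lambda>x. ennreal (w x))) = (\<integral>x. w x * \<phi> x \<partial>\<sigma>)"
proof -
  have "emeasure (density \<sigma> (\<lambda>x. ennreal (w x))) UNIV = (\<integral>\<^sup>+x. ennreal (w x) \<partial>\<sigma>)"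
    using continuous_measurable[OF s w(1)] fin_borel_space[OF s] sets.top[of \<sigma>] by (subst emeasure_density) auto
  also have "\<dots> = ennreal (\<integral>x. w x \<partial>\<sigma>)"
    using integrable_continuous[OF s w(1)] w(2) by (intro nn_integral_eq_integral) auto
  finally show "fin_borel (density \<sigma> (\<lambda>x. ennreal (w x)))"
    unfolding fin_borel_def using s fin_borel_space[OF s] by (auto simp: fin_borel_def intro!: finite_measureI)
  assume "cts \<phi>"
  then show "(\<integral>x. \<phi> x \<partial>density \<sigma> (\<lambda>x. ennreal (w x))) = (\<integral>x. w x * \<phi> x \<partial>\<sigma>)"
    using integral_density[of \<phi> \<sigma> w] continuous_measurable[OF s] w by simp
qed

context sinkhorn
begin

text \<open>The measure called \<sigma> in the overview; \<mu> is recovered from it by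
  \<open>Sg_integral_B\<close>.\<close>

definition Sg :: "'a measure \<Rightarrow> 'a measure" where
  "Sg \<mu> = density \<mu> (\<lambda>x. ennreal (1 / B \<mu> x))"

lemma B_nz: "B \<mu> x \<noteq> 0"
  by (simp add: Bemb_def)

lemma B_inverse_cont: "\<mu> \<in> Probs \<Longrightarrow> cts (\<lambda>x. 1 / B \<mu> x)"
  using B_cont[of \<mu>] B_pos by (intro continuous_intros) (metis less_irrefl)+

lemma Sg_fin_borel: "\<mu> \<in> Probs \<Longrightarrow> fin_borel (Sg \<mu>)"
  unfolding Sg_def by (intro integral_density_continuous Probs_fin_borel B_inverse_cont) (simp_all add: less_imp_le[OF B_pos])

lemma Sg_integral:
  fixes \<phi> :: "'a \<Rightarrow> real"
  assumes "\<mu> \<in> Probs" "cts \<phi>"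
  shows "(\<integral>x. \<phi> x \<partial>Sg \<mu>) = (\<integral>x. \<phi> x / B \<mu> x \<partial>\<mu>)"
  unfolding Sg_def using B_pos integral_density_continuous(2)[OF Probs_fin_borel B_inverse_cont, of \<mu> \<mu> \<phi>] assms
  by (simp add: less_imp_le)

lemma Sg_integral_B:
  fixes \<phi> :: "'a \<Rightarrow> real"
  assumes "\<mu> \<in> Probs" "cts \<phi>"
  shows "(\<integral>x. \<phi> x * B \<mu> x \<partial>Sg \<mu>) = (\<integral>x. \<phi> x \<partial>\<mu>)"
proof -
  have "(\<integral>x. \<phi> x * B \<mu> x \<partial>Sg \<mu>) = (\<integral>x. \<phi> x * B \<mu> x / B \<mu> x \<partial>\<mu>)"
    by (rule Sg_integral[OF assms(1) continuous_on_mult[OF assms(2) B_cont[OF assms(1)]]])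
  also have "(\<lambda>x. \<phi> x * B \<mu> x / B \<mu> x) = \<phi>" by (rule ext) (rule nonzero_mult_div_cancel_right[OF B_nz])
  finally show ?thesis .
qed

lemma Hk_Sg: "\<mu> \<in> Probs \<Longrightarrow> Hk (Sg \<mu>) = B \<mu>"
proof (rule ext)
  fix y assume m: "\<mu> \<in> Probs"
  show "Hk (Sg \<mu>) y = B \<mu> y" unfolding Hk_def Sg_integral[OF m k_cont1]
    by (rule trans[OF _ B_eq[OF m, symmetric]]) simp
qed

lemma B_norm: "\<mu> \<in> Probs \<Longrightarrow> (\<integral>x. B \<mu> x \<partial>Sg \<mu>) = 1"
  using Sg_integral_B[of \<mu> "\<lambda>_. 1"] Probs_measure[of \<mu>] fin_borel_space[OF Probs_fin_borel, of \<mu>] by simp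

lemma B_rkhs: "\<mu> \<in> Probs \<Longrightarrow> rkhs_le k (B \<mu>) 1"
  using Hk_norm(2)[OF Sg_fin_borel] by (simp add: Hk_Sg B_norm)

lemma B_le_1: "\<mu> \<in> Probs \<Longrightarrow> B \<mu> x \<le> 1"
  using rkhs_le_bound[OF B_rkhs, of \<mu> x] by simp

text \<open>\<open>B \<le> 1\<close> and \<integral> B d\<sigma> = 1 force mass at least 1; the
  lower bound of k turns this into the lower bound for B and, with \<open>B \<le> 1\<close> again,
  into the upper bound for the mass.\<close>

lemma Sg_mass: assumes m: "\<mu> \<in> Probs" shows "1 \<le> measure (Sg \<mu>) UNIV" "\<kappa> * measure (Sg \<mu>) UNIV \<le> B \<mu> x" "\<kappa> \<le> B \<mu> x"
  "measure (Sg \<mu>) UNIV \<le> 1 / \<kappa>"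
proof -
  note s = Sg_fin_borel[OF m]
  interpret finite_measure "Sg \<mu>" using s by (simp add: fin_borel_def)
  have "(\<integral>x. B \<mu> x \<partial>Sg \<mu>) \<le> (\<integral>x. 1 \<partial>Sg \<mu>)"
    by (rule integral_mono) (use integrable_continuous[OF s B_cont[OF m]] B_le_1[OF m] in auto)
  then show 1: "1 \<le> measure (Sg \<mu>) UNIV" by (simp add: B_norm[OF m] fin_borel_space[OF s])
  have "(\<integral>y. \<kappa> \<partial>Sg \<mu>) \<le> (\<integral>y. k y x \<partial>Sg \<mu>)"
    by (rule integral_mono) (use integrable_continuous[OF s k_cont1] \<kappa>_le in auto)
  then show 2: "\<kappa> * measure (Sg \<mu>) UNIV \<le> B \<mu> x"
    by (simp add: Hk_Sg[OF m, symmetric] Hk_def fin_borel_space[OF s] mult.commute)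
  have "\<kappa> * 1 \<le> \<kappa> * measure (Sg \<mu>) UNIV" using 1 \<kappa>_pos by (intro mult_left_mono) auto
  then show "\<kappa> \<le> B \<mu> x" using 2 by simp
  have "\<kappa> * measure (Sg \<mu>) UNIV \<le> 1" using 2 B_le_1[OF m, of x] by simp
  then show "measure (Sg \<mu>) UNIV \<le> 1 / \<kappa>" using \<kappa>_pos by (simp add: field_simps)
qed

lemma Hk_pos:
  assumes s: "fin_borel \<sigma>" and n: "(\<integral>x. Hk \<sigma> x \<partial>\<sigma>) = 1"
  shows "0 < Hk \<sigma> y"
proof -
  interpret finite_measure \<sigma> using s by (simp add: fin_borel_def)
  have "measure \<sigma> UNIV \<noteq> 0"
  proof
    assume z: "measure \<sigma> UNIV = 0"
    have "Hk \<sigma> x = 0" for x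
      using integral_abs_bound[OF s, of "\<lambda>y. k y x" 1] k_pos k_le_1 z by (auto simp: Hk_def abs_of_pos)
    then show False using n by simp
  qed
  then have "0 < \<kappa> * measure \<sigma> UNIV" using \<kappa>_pos by (simp add: less_le)
  also have "\<dots> = (\<integral>x. \<kappa> \<partial>\<sigma>)" by (simp add: fin_borel_space[OF s])
  also have "\<dots> \<le> Hk \<sigma> y" unfolding Hk_def
    by (rule integral_mono) (use integrable_continuous[OF s k_cont1] \<kappa>_le in auto)
  finally show ?thesis .
qed

text \<open>Surjectivity of B onto the unit vectors that are potentials: for b = Hk \<sigma>, the
  measure b \<sigma> satisfies the integral equation that characterises B.\<close>

lemma measure_of_potential:
  assumes s: "fin_borel \<sigma>" and n: "(\<integral>x. Hk \<sigma> x \<partial>\<sigma>) = 1"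
  defines "\<mu> \<equiv> density \<sigma> (\<lambda>x. ennreal (Hk \<sigma> x))"
  shows "\<mu> \<in> Probs" "B \<mu> = Hk \<sigma>" "Sg \<mu> = \<sigma>"
proof -
  note H = Hk_cont[OF s] Hk_pos[OF s n]
  have fb: "fin_borel \<mu>" and int: "\<And>\<phi> :: 'a \<Rightarrow> real. cts \<phi> \<Longrightarrow> (\<integral>x. \<phi> x \<partial>\<mu>) = (\<integral>x. Hk \<sigma> x * \<phi> x \<partial>\<sigma>)"
    unfolding \<mu>_def using integral_density_continuous[OF s H(1)] less_imp_le[OF H(2)] by blast+
  interpret finite_measure \<mu> using fb by (simp add: fin_borel_def)
  have "measure \<mu> UNIV = 1" using int[of "\<lambda>_. 1"] n by (simp add: fin_borel_space[OF fb])
  then have "prob_space \<mu>" by (intro prob_spaceI) (simp add: emeasure_eq_measure fin_borel_space[OF fb])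
  then show p: "\<mu> \<in> Probs" using fb by (simp add: Probs_def fin_borel_def)
  have cont: "cts (\<lambda>x. 1 / Hk \<sigma> x)" using H by (intro continuous_intros) (metis less_irrefl)+
  show b: "B \<mu> = Hk \<sigma>"
  proof (rule B_eqI[OF p H])
    fix y
    have "(\<integral>x. 1 / Hk \<sigma> x * k x y \<partial>\<mu>) = (\<integral>x. Hk \<sigma> x * (1 / Hk \<sigma> x * k x y) \<partial>\<sigma>)"
      by (rule int) (intro continuous_on_mult cont k_cont1)
    also have "\<dots> = (\<integral>x. k x y \<partial>\<sigma>)" using H(2) by (simp add: less_imp_neq[THEN not_sym])
    finally show "Hk \<sigma> y = (\<integral>x. 1 / Hk \<sigma> x * k x y \<partial>\<mu>)" by (simp add: Hk_def)
  qed
  show "Sg \<mu> = \<sigma>"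
    by (rule Hk_inj[OF Sg_fin_borel[OF p] s]) (simp add: Hk_Sg[OF p] b)
qed

lemma B_inj:
  assumes m: "\<mu> \<in> Probs" and n: "\<nu> \<in> Probs" and eq: "B \<mu> = B \<nu>"
  shows "\<mu> = \<nu>"
proof (rule measure_eqI_continuous[OF Probs_fin_borel[OF m] Probs_fin_borel[OF n]])
  have "Sg \<mu> = Sg \<nu>" by (rule Hk_inj) (use m n eq in \<open>simp_all add: Sg_fin_borel Hk_Sg\<close>)
  then show "(\<integral>x. \<phi> x \<partial>\<mu>) = (\<integral>x. \<phi> x \<partial>\<nu>)" if "cts \<phi>" for \<phi> :: "'a \<Rightarrow> real"
    using Sg_integral_B[OF m that] Sg_integral_B[OF n that] eq by simp
qed

lemma B_dist:
  assumes m: "\<mu> \<in> Probs" and n: "\<nu> \<in> Probs"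
  defines "\<delta> \<equiv> \<lambda>y. B \<mu> y - B \<nu> y"
  defines "Q \<equiv> (\<integral>y. \<delta> y \<partial>Sg \<mu>) - (\<integral>y. \<delta> y \<partial>Sg \<nu>)"
  shows "0 \<le> Q" "rkhs_le k \<delta> (sqrt Q)" "rkhs_norm k \<delta> = sqrt Q"
    "rkhs_le k g M \<Longrightarrow> \<bar>(\<integral>x. g x \<partial>Sg \<mu>) - (\<integral>x. g x \<partial>Sg \<nu>)\<bar> \<le> M * sqrt Q"
  using dual_norm[OF Sg_fin_borel[OF m] Sg_fin_borel[OF n]] unfolding Hk_Sg[OF m] Hk_Sg[OF n] \<delta>_def Q_def by auto

lemma B_dist_rkhs: "\<mu> \<in> Probs \<Longrightarrow> \<nu> \<in> Probs \<Longrightarrow> rkhs_le k (\<lambda>y. B \<mu> y - B \<nu> y) (rkhs_norm k (\<lambda>y. B \<mu> y - B \<nu> y))"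
  by (simp add: B_dist(2,3))

lemma Sg_pairing: "\<mu> \<in> Probs \<Longrightarrow> \<nu> \<in> Probs \<Longrightarrow> rkhs_le k g M \<Longrightarrow>
    \<bar>(\<integral>x. g x \<partial>Sg \<mu>) - (\<integral>x. g x \<partial>Sg \<nu>)\<bar> \<le> M * rkhs_norm k (\<lambda>y. B \<mu> y - B \<nu> y)"
  by (simp add: B_dist(3,4))

subsection \<open>The Markov operator\<close>

lemma kmu_eq: "kmu \<epsilon> c \<mu> x y = k x y / (B \<mu> x * B \<mu> y)"
  by (simp add: kmu_def kc_def Bemb_def exp_minus exp_add exp_diff add_divide_distrib diff_divide_distrib field_simps)

text \<open>\<open>kmu\<close> is k divided by B in both arguments, so multiplication by
  \<open>B \<mu>\<close> is an isometry from the RKHS of \<open>kmu\<close> onto that of k; test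
  coefficients are divided by B.\<close>

lemma rkhs_vals_kmu: "rkhs_vals (kmu \<epsilon> c \<mu>) \<phi> = rkhs_vals k (\<lambda>x. B \<mu> x * \<phi> x)"
proof -
  have nz: "B \<mu> x \<noteq> 0" for x using B_pos by (metis less_irrefl)
  have 1: "(\<Sum>x\<in>S. \<Sum>y\<in>S. a x * a y * kmu \<epsilon> c \<mu> x y) = (\<Sum>x\<in>S. \<Sum>y\<in>S. (a x / B \<mu> x) * (a y / B \<mu> y) * k x y)"
    "(\<Sum>x\<in>S. a x * \<phi> x) = (\<Sum>x\<in>S. (a x / B \<mu> x) * (B \<mu> x * \<phi> x))" for S and a
    using nz by (simp_all add: kmu_eq)
  have 2: "(\<Sum>x\<in>S. \<Sum>y\<in>S. a x * a y * k x y) = (\<Sum>x\<in>S. \<Sum>y\<in>S. (a x * B \<mu> x) * (a y * B \<mu> y) * kmu \<epsilon> c \<mu> x y)"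
    "(\<Sum>x\<in>S. a x * (B \<mu> x * \<phi> x)) = (\<Sum>x\<in>S. (a x * B \<mu> x) * \<phi> x)" for S and a
    using nz by (simp_all add: kmu_eq mult.assoc)
  show ?thesis
  proof
    show "rkhs_vals (kmu \<epsilon> c \<mu>) \<phi> \<subseteq> rkhs_vals k (\<lambda>x. B \<mu> x * \<phi> x)"
    proof
      fix v assume "v \<in> rkhs_vals (kmu \<epsilon> c \<mu>) \<phi>"
      then obtain S a where "finite S" "v = (\<Sum>x\<in>S. a x * \<phi> x)" "(\<Sum>x\<in>S. \<Sum>y\<in>S. a x * a y * kmu \<epsilon> c \<mu> x y) \<le> 1"
        unfolding rkhs_vals_def by blast
      then show "v \<in> rkhs_vals k (\<lambda>x. B \<mu> x * \<phi> x)" unfolding rkhs_vals_def mem_Collect_eq 1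
        by (intro exI[of _ S] exI[of _ "\<lambda>x. a x / B \<mu> x"]) simp
    qed
    show "rkhs_vals k (\<lambda>x. B \<mu> x * \<phi> x) \<subseteq> rkhs_vals (kmu \<epsilon> c \<mu>) \<phi>"
    proof
      fix v assume "v \<in> rkhs_vals k (\<lambda>x. B \<mu> x * \<phi> x)"
      then obtain S a where "finite S" "v = (\<Sum>x\<in>S. a x * (B \<mu> x * \<phi> x))" "(\<Sum>x\<in>S. \<Sum>y\<in>S. a x * a y * k x y) \<le> 1"
        unfolding rkhs_vals_def by blast
      then show "v \<in> rkhs_vals (kmu \<epsilon> c \<mu>) \<phi>" unfolding rkhs_vals_def mem_Collect_eq 2
        by (intro exI[of _ S] exI[of _ "\<lambda>x. a x * B \<mu> x"]) simp
    qed
  qed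
qed

lemma in_rkhs_kmu: "in_rkhs (kmu \<epsilon> c \<mu>) \<phi> \<longleftrightarrow> in_rkhs k (\<lambda>x. B \<mu> x * \<phi> x)"
  and rkhs_norm_kmu: "rkhs_norm (kmu \<epsilon> c \<mu>) \<phi> = rkhs_norm k (\<lambda>x. B \<mu> x * \<phi> x)"
  by (simp_all add: in_rkhs_def rkhs_norm_def rkhs_vals_kmu)

abbreviation "K \<equiv> Kop \<epsilon> c"

lemma Kop_eq:
  fixes \<phi> :: "'a \<Rightarrow> real"
  assumes m: "\<mu> \<in> Probs" and p: "cts \<phi>"
  shows "K \<mu> \<phi> y = (\<integral>x. \<phi> x * k x y \<partial>Sg \<mu>) / B \<mu> y"
  unfolding Kop_def Sg_integral[OF m continuous_on_mult[OF p k_cont1]] kmu_eq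
  by (subst integral_divide_zero[symmetric]) (simp add: mult_ac)

lemma kmu_cont: "\<mu> \<in> Probs \<Longrightarrow> cts (\<lambda>x. kmu \<epsilon> c \<mu> x y)"
  unfolding kmu_eq using B_pos by (intro continuous_intros k_cont1 B_cont) (metis less_irrefl mult_pos_pos)+

text \<open>A Doeblin minorisation of the Markov kernel, available because \<open>B \<le> 1\<close>;
  it yields the contraction factor 1 - \<kappa> of K.\<close>

lemma kmu_lower: "\<mu> \<in> Probs \<Longrightarrow> \<kappa> \<le> kmu \<epsilon> c \<mu> x y"
proof -
  assume m: "\<mu> \<in> Probs"
  have "B \<mu> x * B \<mu> y \<le> 1 * 1" using B_le_1[OF m] B_pos[of \<mu> y] by (intro mult_mono) (auto simp: less_imp_le)
  then have "\<kappa> * (B \<mu> x * B \<mu> y) \<le> \<kappa> * 1" using \<kappa>_pos by (intro mult_left_mono) auto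
  then have "\<kappa> * (B \<mu> x * B \<mu> y) \<le> k x y" using \<kappa>_le[of x y] by simp
  then show ?thesis using B_pos[of \<mu> x] B_pos[of \<mu> y] by (simp add: kmu_eq pos_le_divide_eq)
qed

lemma Kop_cont:
  fixes \<phi> :: "'a \<Rightarrow> real"
  assumes m: "\<mu> \<in> Probs" and p: "cts \<phi>"
  shows "cts (K \<mu> \<phi>)"
proof -
  have "cts (\<lambda>y. (\<integral>x. \<phi> x * k x y \<partial>Sg \<mu>) / B \<mu> y)"
    using B_pos by (intro continuous_intros weighted_cont p Sg_fin_borel m B_cont) (metis less_irrefl)+
  then show ?thesis by (simp add: Kop_eq[OF m p, abs_def])
qed

lemma kmu_integrable: "\<mu> \<in> Probs \<Longrightarrow> cts \<phi> \<Longrightarrow> integrable \<mu> (\<lambda>x. kmu \<epsilon> c \<mu> x y * \<phi> x)"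
  for \<phi> :: "'a \<Rightarrow> real"
  by (intro integrable_continuous Probs_fin_borel continuous_on_mult kmu_cont)

lemma Kop_const: "\<mu> \<in> Probs \<Longrightarrow> K \<mu> (\<lambda>_. r) y = r"
  using Hk_Sg[of \<mu>] B_pos[of \<mu> y] by (subst Kop_eq) (auto simp: Hk_def fun_eq_iff)

lemma Kop_linear:
  fixes \<phi> \<psi> :: "'a \<Rightarrow> real"
  assumes m: "\<mu> \<in> Probs" and p: "cts \<phi>" "cts \<psi>"
  shows "K \<mu> (\<lambda>x. r * \<phi> x + s * \<psi> x) y = r * K \<mu> \<phi> y + s * K \<mu> \<psi> y"
proof -
  have "K \<mu> (\<lambda>x. r * \<phi> x + s * \<psi> x) y = (\<integral>x. r * (kmu \<epsilon> c \<mu> x y * \<phi> x) + s * (kmu \<epsilon> c \<mu> x y * \<psi> x) \<partial>\<mu>)"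
    unfolding Kop_def by (simp add: algebra_simps)
  also have "\<dots> = r * K \<mu> \<phi> y + s * K \<mu> \<psi> y"
    unfolding Kop_def using kmu_integrable[OF m p(1)] kmu_integrable[OF m p(2)] by (subst Bochner_Integration.integral_add) auto
  finally show ?thesis .
qed

lemma Kop_mono_nonneg:
  fixes \<phi> :: "'a \<Rightarrow> real"
  assumes m: "\<mu> \<in> Probs" and p: "cts \<phi>" "\<And>x. 0 \<le> \<phi> x"
  shows "\<kappa> * (\<integral>x. \<phi> x \<partial>\<mu>) \<le> K \<mu> \<phi> y"
proof -
  have "(\<integral>x. \<kappa> * \<phi> x \<partial>\<mu>) \<le> K \<mu> \<phi> y" unfolding Kop_def
    using kmu_lower[OF m] p(2) by (intro integral_mono kmu_integrable m p integrable_mult_right integrable_continuous Probs_fin_borel)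
      (simp add: mult_right_mono)
  then show ?thesis by simp
qed

lemma Kop_symm:
  fixes \<phi> \<psi> :: "'a \<Rightarrow> real"
  assumes m: "\<mu> \<in> Probs" and p: "cts \<phi>" "cts \<psi>"
  shows "(\<integral>y. \<psi> y * K \<mu> \<phi> y \<partial>\<mu>) = (\<integral>y. \<phi> y * K \<mu> \<psi> y \<partial>\<mu>)"
proof -
  note s = Sg_fin_borel[OF m]
  have e: "(\<integral>y. \<psi> y * K \<mu> \<phi> y \<partial>\<mu>) = (\<integral>y. \<integral>x. \<phi> x * \<psi> y * k x y \<partial>Sg \<mu> \<partial>Sg \<mu>)"
    if p: "cts \<phi>" "cts \<psi>" for \<phi> \<psi> :: "'a \<Rightarrow> real"
  proof -
    have "(\<integral>y. \<psi> y * K \<mu> \<phi> y \<partial>\<mu>) = (\<integral>y. \<psi> y * K \<mu> \<phi> y * B \<mu> y \<partial>Sg \<mu>)"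
      by (rule Sg_integral_B[OF m continuous_on_mult[OF p(2) Kop_cont[OF m p(1)]], symmetric])
    also have "\<dots> = (\<integral>y. \<psi> y * (\<integral>x. \<phi> x * k x y \<partial>Sg \<mu>) \<partial>Sg \<mu>)"
      by (simp add: Kop_eq[OF m p(1)] B_nz)
    also have "\<dots> = (\<integral>y. \<integral>x. \<phi> x * \<psi> y * k x y \<partial>Sg \<mu> \<partial>Sg \<mu>)"
      by (subst integral_mult_right_zero[symmetric]) (simp add: mult_ac)
    finally show ?thesis .
  qed
  have c: "cts (\<lambda>q. \<phi> (fst q) * \<psi> (snd q) * k (fst q) (snd q))"
    by (intro continuous_on_mult k_cont continuous_on_compose2[OF p(1)] continuous_on_compose2[OF p(2)] continuous_on_fst continuous_on_snd continuous_on_id) auto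
  show ?thesis unfolding e[OF p] e[OF p(2,1)] using integral_swap[OF c s s] by (simp add: k_sym mult_ac)
qed

lemma Kop_oscillation:
  fixes \<phi> :: "'a \<Rightarrow> real"
  assumes m: "\<mu> \<in> Probs" and p: "cts \<phi>" and \<Omega>: "\<And>x y. \<phi> x - \<phi> y \<le> \<Omega>"
  shows "K \<mu> \<phi> x - K \<mu> \<phi> y \<le> (1 - \<kappa>) * \<Omega>"
proof -
  obtain x1 where x1: "\<And>x. \<phi> x \<le> \<phi> x1" using continuous_attains_sup[OF compact_space _ p] by auto
  obtain x2 where x2: "\<And>x. \<phi> x2 \<le> \<phi> x" using continuous_attains_inf[OF compact_space _ p] by auto
  define M l where "M = \<phi> x1" and "l = \<phi> x2"
  note i = integrable_continuous[OF Probs_fin_borel[OF m] p]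
  interpret prob_space \<mu> using m by (simp add: Probs_def)
  have 1: "\<kappa> * ((\<integral>x. \<phi> x \<partial>\<mu>) - l) \<le> K \<mu> \<phi> y - l"
  proof -
    have "\<kappa> * (\<integral>x. \<phi> x - l \<partial>\<mu>) \<le> K \<mu> (\<lambda>x. 1 * \<phi> x + (- l) * 1) y"
      using Kop_mono_nonneg[OF m, of "\<lambda>x. \<phi> x - l" y] x2 p by (simp add: l_def continuous_on_diff)
    also have "\<dots> = K \<mu> \<phi> y - l" by (subst Kop_linear[OF m p]) (simp_all add: Kop_const[OF m])
    finally show ?thesis using i by (simp add: prob_space)
  qed
  have 2: "\<kappa> * (M - (\<integral>x. \<phi> x \<partial>\<mu>)) \<le> M - K \<mu> \<phi> x"
  proof -
    have "\<kappa> * (\<integral>x. M - \<phi> x \<partial>\<mu>) \<le> K \<mu> (\<lambda>x. (-1) * \<phi> x + M * 1) x"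
      using Kop_mono_nonneg[OF m, of "\<lambda>x. M - \<phi> x" x] x1 p by (simp add: M_def continuous_on_diff)
    also have "\<dots> = M - K \<mu> \<phi> x" by (subst Kop_linear[OF m p]) (simp_all add: Kop_const[OF m])
    finally show ?thesis using i by (simp add: prob_space)
  qed
  have "K \<mu> \<phi> x - K \<mu> \<phi> y \<le> (1 - \<kappa>) * (M - l)" using 1 2 by (simp add: algebra_simps)
  also have "\<dots> \<le> (1 - \<kappa>) * \<Omega>" using \<Omega>[of x1 x2] \<kappa>_le_1 by (intro mult_left_mono) (auto simp: M_def l_def)
  finally show ?thesis .
qed

lemma Kop2_oscillation:
  fixes u f g :: "'a \<Rightarrow> real"
  assumes m: "\<mu> \<in> Probs" and p: "cts f" "cts g" and \<Omega>: "\<And>x y. (f x - g x) - (f y - g y) \<le> \<Omega>"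
  shows "(u x + K \<mu> (K \<mu> f) x - (u x + K \<mu> (K \<mu> g) x)) - (u y + K \<mu> (K \<mu> f) y - (u y + K \<mu> (K \<mu> g) y)) \<le> (1 - \<kappa>)\<^sup>2 * \<Omega>"
proof -
  have lin: "K \<mu> (\<lambda>x. h x - h' x) = (\<lambda>x. K \<mu> h x - K \<mu> h' x)" if "cts h" "cts h'" for h h'
    using Kop_linear[OF m that, of 1 "-1"] by auto
  have c: "cts (\<lambda>x. f x - g x)" by (intro continuous_intros p)
  have "K \<mu> (\<lambda>x. f x - g x) x - K \<mu> (\<lambda>x. f x - g x) y \<le> (1 - \<kappa>) * \<Omega>" for x y
    by (rule Kop_oscillation[OF m c \<Omega>])
  from Kop_oscillation[OF m Kop_cont[OF m c] this, of x y] show ?thesis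
    unfolding lin[OF p] lin[OF Kop_cont[OF m p(1)] Kop_cont[OF m p(2)]] by (simp add: power2_eq_square)
qed

lemma Kinv_factor: "0 \<le> (1 - \<kappa>)\<^sup>2" "(1 - \<kappa>)\<^sup>2 < 1"
  using \<kappa>_pos \<kappa>_le_1 by (simp_all add: power_less_one_iff abs_square_less_1)

text \<open>Inverting Id - K^2 modulo constants is a fixed point problem modulo constants for v
  \<mapsto> u + K (K v), which contracts the oscillation. So the choice in \<open>Kinv\<close> has a
  witness.\<close>

lemma Kinv_spec:
  fixes u :: "'a \<Rightarrow> real"
  assumes m: "\<mu> \<in> Probs" and u: "cts u"
  shows "cts (Kinv \<epsilon> c \<mu> u)"
    "\<exists>C. \<forall>x. Kinv \<epsilon> c \<mu> u x - K \<mu> (K \<mu> (Kinv \<epsilon> c \<mu> u)) x = u x + C"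
proof -
  let ?P = "\<lambda>v. cts v \<and> (\<exists>C. \<forall>x. v x - K \<mu> (K \<mu> v) x = u x + C)"
  obtain v a where v: "cts v" "\<And>x. u x + K \<mu> (K \<mu> v) x = v x + a"
  proof (rule oscillation_fixed_point_exists[where T="\<lambda>v x. u x + K \<mu> (K \<mu> v) x" and q="(1 - \<kappa>)\<^sup>2"])
    show "0 \<le> (1 - \<kappa>)\<^sup>2" "(1 - \<kappa>)\<^sup>2 < 1" by (rule Kinv_factor)+
    show "cts (\<lambda>x. u x + K \<mu> (K \<mu> f) x)" if "cts f" for f
      by (intro continuous_on_add u Kop_cont m that)
  qed (use Kop2_oscillation[OF m, where u=u] in blast)+
  have "v x - K \<mu> (K \<mu> v) x = u x + (- a)" for x using v(2)[of x] by linarith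
  then have "?P v" using v(1) by blast
  from someI[of ?P, OF this] show "cts (Kinv \<epsilon> c \<mu> u)"
    "\<exists>C. \<forall>x. Kinv \<epsilon> c \<mu> u x - K \<mu> (K \<mu> (Kinv \<epsilon> c \<mu> u)) x = u x + C" unfolding Kinv_def by blast+
qed

lemma Kinv_unique:
  fixes u v :: "'a \<Rightarrow> real"
  assumes m: "\<mu> \<in> Probs" and u: "cts u" and v: "cts v" "\<And>x. v x - K \<mu> (K \<mu> v) x = u x + C"
  obtains r where "Kinv \<epsilon> c \<mu> u = (\<lambda>x. v x + r)"
proof -
  let ?w = "Kinv \<epsilon> c \<mu> u"
  obtain C' where C': "\<And>x. ?w x - K \<mu> (K \<mu> ?w) x = u x + C'" using Kinv_spec(2)[OF m u] by blast
  have "?w x - v x = ?w y - v y" for x y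
  proof (rule oscillation_fixed_point_unique[where T="\<lambda>v x. u x + K \<mu> (K \<mu> v) x" and q="(1 - \<kappa>)\<^sup>2" and a="- C'" and a'="- C"])
    show "(1 - \<kappa>)\<^sup>2 < 1" by (rule Kinv_factor)
    show "u x + K \<mu> (K \<mu> ?w) x = ?w x + - C'" for x using C'[of x] by simp
    show "u x + K \<mu> (K \<mu> v) x = v x + - C" for x using v(2)[of x] by simp
  qed (use Kop2_oscillation[OF m, where u=u] v Kinv_spec(1)[OF m u] in blast)+
  then have "?w x = v x + (?w undefined - v undefined)" for x by (metis add.commute diff_add_cancel)
  then show ?thesis using that by blast
qed

text \<open>Excludes the eigenvalue -1, which later allows cancelling Id + K: w would be fixed by K
  applied twice, hence constant, hence equal to - w.\<close>

lemma Kop_antifixed: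
  fixes w :: "'a \<Rightarrow> real"
  assumes m: "\<mu> \<in> Probs" and w: "cts w" "\<And>x. w x + K \<mu> w x = 0"
  shows "w x = 0"
proof -
  have Kw: "K \<mu> w = (\<lambda>x. (-1) * w x + 0 * w x)" using w(2) by (auto simp: fun_eq_iff add_eq_0_iff2)
  have KKw: "K \<mu> (K \<mu> w) x = w x" for x
    unfolding Kw Kop_linear[OF m w(1) w(1)] using w(2)[of x] by simp
  have K0: "K \<mu> (\<lambda>_. 0) = (\<lambda>_. 0)" using Kop_const[OF m] by auto
  have "w x - (\<lambda>_. 0) x = w y - (\<lambda>_. 0) y" for x y
  proof (rule oscillation_fixed_point_unique[where T="\<lambda>v x. 0 + K \<mu> (K \<mu> v) x" and q="(1 - \<kappa>)\<^sup>2" and a=0 and a'=0])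
    show "(1 - \<kappa>)\<^sup>2 < 1" by (rule Kinv_factor)
  qed (use Kop2_oscillation[OF m, where u="\<lambda>_. 0"] w(1) KKw K0 in auto)
  then have c: "w y = w x" for y by simp
  then have "w = (\<lambda>_. w x)" by blast
  then have "K \<mu> w x = w x" using Kop_const[OF m, of "w x" x] by metis
  then show ?thesis using w(2)[of x] by simp
qed

text \<open>Jensen's inequality for the Markov operator and invariance of \<mu> show that K does not
  increase the L2 norm; Young's inequality then bounds \<integral> v K v by \<integral> v^2.\<close>

lemma Dirichlet_nonneg:
  fixes v :: "'a \<Rightarrow> real"
  assumes m: "\<mu> \<in> Probs" and v: "cts v"
  shows "0 \<le> (\<integral>x. v x * (v x - K \<mu> v x) \<partial>\<mu>)"
proof -
  note i = integrable_continuous[OF Probs_fin_borel[OF m]] and Kc = Kop_cont[OF m]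
  have v2: "cts (\<lambda>x. (v x)\<^sup>2)" by (intro continuous_intros v)
  have J: "(K \<mu> v y)\<^sup>2 \<le> K \<mu> (\<lambda>x. (v x)\<^sup>2) y" for y
  proof -
    define t where "t = K \<mu> v y"
    have c: "cts (\<lambda>x. (-2 * t) * v x + t\<^sup>2 * 1)" by (intro continuous_intros v)
    have "0 \<le> (\<integral>x. (v x - t)\<^sup>2 \<partial>\<mu>)" by simp
    then have "0 \<le> \<kappa> * (\<integral>x. (v x - t)\<^sup>2 \<partial>\<mu>)" using \<kappa>_pos by simp
    also have "\<dots> \<le> K \<mu> (\<lambda>x. (v x - t)\<^sup>2) y" by (rule Kop_mono_nonneg[OF m]) (auto intro!: continuous_intros v)
    also have "(\<lambda>x. (v x - t)\<^sup>2) = (\<lambda>x. 1 * (v x)\<^sup>2 + 1 * ((-2 * t) * v x + t\<^sup>2 * 1))"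
      by (auto simp: power2_eq_square algebra_simps)
    also have "K \<mu> \<dots> y = K \<mu> (\<lambda>x. (v x)\<^sup>2) y - t\<^sup>2"
      unfolding Kop_linear[OF m v2 c] Kop_linear[OF m v continuous_on_const] by (simp add: Kop_const[OF m] t_def[symmetric] power2_eq_square)
    finally show ?thesis by (simp add: t_def)
  qed
  have "(\<integral>y. K \<mu> (\<lambda>x. (v x)\<^sup>2) y \<partial>\<mu>) = (\<integral>y. (v y)\<^sup>2 \<partial>\<mu>)"
    using Kop_symm[OF m v2, of "\<lambda>_. 1"] by (simp add: Kop_const[OF m])
  then have 1: "(\<integral>y. (K \<mu> v y)\<^sup>2 \<partial>\<mu>) \<le> (\<integral>y. (v y)\<^sup>2 \<partial>\<mu>)"
    using integral_mono[of \<mu> "\<lambda>y. (K \<mu> v y)\<^sup>2" "K \<mu> (\<lambda>x. (v x)\<^sup>2)"] J i Kc[OF v2] Kc[OF v] by (simp add: continuous_on_power)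
  have "(\<integral>x. v x * K \<mu> v x \<partial>\<mu>) \<le> (\<integral>x. (1/2) * (v x)\<^sup>2 + (1/2) * (K \<mu> v x)\<^sup>2 \<partial>\<mu>)"
  proof (rule integral_mono)
    show "v x * K \<mu> v x \<le> (1/2) * (v x)\<^sup>2 + (1/2) * (K \<mu> v x)\<^sup>2" for x
      using sum_squares_bound[of "v x" "K \<mu> v x"] by simp
  qed (intro i continuous_intros v Kc)+
  also have "\<dots> = (1/2) * (\<integral>x. (v x)\<^sup>2 \<partial>\<mu>) + (1/2) * (\<integral>x. (K \<mu> v x)\<^sup>2 \<partial>\<mu>)"
    using i[OF v2] i[OF continuous_on_power[OF Kc[OF v]], of 2] by simp
  finally have "(\<integral>x. v x * K \<mu> v x \<partial>\<mu>) \<le> (\<integral>x. (v x)\<^sup>2 \<partial>\<mu>)" using 1 by simp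
  then show ?thesis using i[OF v2] i[OF continuous_on_mult[OF v Kc[OF v]]]
    by (simp add: right_diff_distrib power2_eq_square[symmetric])
qed

end

section \<open>Admissible curves\<close>

text \<open>A Cauchy criterion along a filter, where the constant may depend on e: the constants for
  errors 1 / (n + 1) form a Cauchy sequence.\<close>

lemma tendsto_approx:
  fixes Q :: "'i \<Rightarrow> real"
  assumes F: "F \<noteq> bot" and ap: "\<And>e. e > 0 \<Longrightarrow> \<exists>c. \<forall>\<^sub>F s in F. \<bar>Q s - c\<bar> \<le> e"
  obtains L where "(Q \<longlongrightarrow> L) F"
proof -
  have "\<exists>c. \<forall>\<^sub>F s in F. \<bar>Q s - c\<bar> \<le> 1 / real (Suc n)" for n by (rule ap) simp
  then obtain c where c: "\<And>n. \<forall>\<^sub>F s in F. \<bar>Q s - c n\<bar> \<le> 1 / real (Suc n)" by metis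
  have cc: "\<bar>c n - c m\<bar> \<le> 1 / real (Suc n) + 1 / real (Suc m)" for n m
  proof -
    have "\<forall>\<^sub>F s in F. \<bar>c n - c m\<bar> \<le> 1 / real (Suc n) + 1 / real (Suc m)"
      using c[of n] c[of m] by eventually_elim linarith
    then show ?thesis using F by (simp add: eventually_const_iff)
  qed
  have "Cauchy c"
  proof (rule metric_CauchyI)
    fix e :: real assume "e > 0"
    then obtain N where N: "1 / real (Suc N) < e / 2" using nat_approx_posE[of "e / 2"] by auto
    have "dist (c m) (c n) < e" if "m \<ge> N" "n \<ge> N" for m n
    proof -
      have "1 / real (Suc m) \<le> 1 / real (Suc N)" "1 / real (Suc n) \<le> 1 / real (Suc N)" using that by (simp_all add: frac_le)
      then show ?thesis using cc[of m n] N unfolding dist_real_def by linarith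
    qed
    then show "\<exists>M. \<forall>m\<ge>M. \<forall>n\<ge>M. dist (c m) (c n) < e" by blast
  qed
  then obtain L where L: "c \<longlonglongrightarrow> L" using Cauchy_convergent convergent_def by blast
  have "(Q \<longlongrightarrow> L) F" unfolding tendsto_iff
  proof (intro allI impI)
    fix e :: real assume e: "e > 0"
    have "\<forall>\<^sub>F n in sequentially. dist (c n) L < e / 2" using L e by (intro tendstoD) auto
    moreover have "\<forall>\<^sub>F n in sequentially. 1 / real (Suc n) < e / 2"
      using LIMSEQ_Suc[OF lim_1_over_n] e by (intro order_tendstoD) auto
    ultimately have "\<forall>\<^sub>F n in sequentially. dist (c n) L < e / 2 \<and> 1 / real (Suc n) < e / 2" by (rule eventually_conj)
    then obtain n where n: "dist (c n) L < e / 2" "1 / real (Suc n) < e / 2" unfolding eventually_sequentially by blast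
    show "\<forall>\<^sub>F s in F. dist (Q s) L < e"
      using c[of n]
    proof eventually_elim
      case (elim s)
      then show ?case using n unfolding dist_real_def by linarith
    qed
  qed
  then show ?thesis by (rule that)
qed

context kernel_space
begin

text \<open>The modulus of continuity depends only on k and M, through the kernel distance of the
  two points.\<close>

lemma rkhs_equicontinuous:
  assumes "M \<ge> 0" "e > 0"
  obtains \<eta> where "\<eta> > 0" "\<And>f x y. rkhs_le k f M \<Longrightarrow> dist x y < \<eta> \<Longrightarrow> \<bar>f x - f y\<bar> \<le> e"
proof -
  define e' where "e' = (e / (M + 1))\<^sup>2"
  have e': "e' > 0" using assms by (simp add: e'_def)
  obtain d where d: "d > 0" "\<And>x y x' y'. dist x x' < d \<Longrightarrow> dist y y' < d \<Longrightarrow> \<bar>k x y - k x' y'\<bar> < e' / 2"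
    by (rule uniform_continuity2[OF k_cont, of "e' / 2"]) (use e' in auto)
  show ?thesis
  proof (rule that[OF d(1)])
    fix f and x y :: 'a assume f: "rkhs_le k f M" and xy: "dist x y < d"
    have "k x x - 2 * k x y + k y y \<le> \<bar>k x x - k x y\<bar> + \<bar>k y y - k x y\<bar>" by linarith
    also have "\<dots> \<le> e'" using d(2)[of x x x y] d(2)[of y x y y] xy d(1) by (simp add: dist_commute)
    finally have "sqrt (k x x - 2 * k x y + k y y) \<le> sqrt e'" by (rule real_sqrt_le_mono)
    also have "sqrt e' = e / (M + 1)" using assms by (simp add: e'_def)
    finally have "M * sqrt (k x x - 2 * k x y + k y y) \<le> M * (e / (M + 1))" using assms by (intro mult_left_mono) auto
    also have "\<dots> \<le> e" using assms by (simp add: field_simps)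
    finally show "\<bar>f x - f y\<bar> \<le> e" using rkhs_le_modulus[OF f, of x y] by linarith
  qed
qed

text \<open>Equicontinuity reduces uniform convergence to convergence on a finite net.\<close>

lemma rkhs_uniform_limit:
  assumes f: "\<forall>\<^sub>F i in F. rkhs_le k (f i) M" and lim: "\<And>x. ((\<lambda>i. f i x) \<longlongrightarrow> g x) F" and F: "F \<noteq> bot"
  shows "uniform_limit UNIV f g F"
proof (rule uniform_limitI)
  fix e :: real assume e: "e > 0"
  have g: "rkhs_le k g M" by (rule rkhs_le_tendsto[OF lim tendsto_const f F])
  obtain \<eta> where \<eta>: "\<eta> > 0" "\<And>f x y. rkhs_le k f M \<Longrightarrow> dist x y < \<eta> \<Longrightarrow> \<bar>f x - f y\<bar> \<le> e / 4"
    by (rule rkhs_equicontinuous[OF rkhs_le_nonneg[OF g], of "e / 4"]) (use e in auto)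
  obtain xs :: "nat \<Rightarrow> 'a" where xs: "\<And>e. e > 0 \<Longrightarrow> \<exists>N. \<forall>x. \<exists>j\<le>N. dist x (xs j) < e" by (rule dense_sequence) (rule that)
  obtain N where N: "\<And>x. \<exists>j\<le>N. dist x (xs j) < \<eta>" using xs[OF \<eta>(1)] by blast
  have "\<forall>\<^sub>F i in F. \<forall>j\<in>{..N}. \<bar>f i (xs j) - g (xs j)\<bar> < e / 4"
    by (rule eventually_ball_finite) (use tendstoD[OF lim, of "e / 4"] e in \<open>auto simp: dist_real_def\<close>)
  with f show "\<forall>\<^sub>F i in F. \<forall>x\<in>UNIV. dist (f i x) (g x) < e"
  proof eventually_elim
    case (elim i)
    show ?case
    proof
      fix x
      obtain j where "j \<le> N" "dist x (xs j) < \<eta>" using N by blast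
      then have "\<bar>f i x - f i (xs j)\<bar> \<le> e / 4" "\<bar>g x - g (xs j)\<bar> \<le> e / 4" "\<bar>f i (xs j) - g (xs j)\<bar> < e / 4"
        using \<eta>(2)[OF elim(1)] \<eta>(2)[OF g] elim(2) by auto
      then show "dist (f i x) (g x) < e" using e unfolding dist_real_def by linarith
    qed
  qed
qed

text \<open>The integral splits into \<integral> g d\<sigma>, which converges weakly, and
  \<integral> (f - g) d\<sigma>, which is small by the mass bound. It serves the product rules in
  which function and measure both move.\<close>

lemma weak_strong:
  fixes \<sigma> :: "'i \<Rightarrow> 'a measure" and f :: "'i \<Rightarrow> 'a \<Rightarrow> real"
  assumes s: "\<forall>\<^sub>F i in F. fin_borel (\<sigma> i) \<and> measure (\<sigma> i) UNIV \<le> C" and C: "C \<ge> 0"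
    and w: "((\<lambda>i. \<integral>x. g x \<partial>\<sigma> i) \<longlongrightarrow> L) F"
    and f: "\<forall>\<^sub>F i in F. cts (f i)" and g: "cts g" and u: "uniform_limit UNIV f g F"
  shows "((\<lambda>i. \<integral>x. f i x \<partial>\<sigma> i) \<longlongrightarrow> L) F"
proof -
  have "((\<lambda>i. (\<integral>x. f i x \<partial>\<sigma> i) - (\<integral>x. g x \<partial>\<sigma> i)) \<longlongrightarrow> 0) F"
    unfolding tendsto_iff
  proof (intro allI impI)
    fix e :: real assume e: "e > 0"
    define e' where "e' = e / (C + 1)"
    have e': "e' > 0" "e' * C < e" using e C by (auto simp: e'_def field_simps)
    show "\<forall>\<^sub>F i in F. dist ((\<integral>x. f i x \<partial>\<sigma> i) - (\<integral>x. g x \<partial>\<sigma> i)) 0 < e"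
      using s f uniform_limitD[OF u e'(1)]
    proof eventually_elim
      case (elim i)
      have fb: "fin_borel (\<sigma> i)" using elim(1) by simp
      have "(\<integral>x. f i x \<partial>\<sigma> i) - (\<integral>x. g x \<partial>\<sigma> i) = (\<integral>x. f i x - g x \<partial>\<sigma> i)"
        using Bochner_Integration.integral_diff[OF integrable_continuous[OF fb elim(2)] integrable_continuous[OF fb g]] by simp
      also have "\<bar>\<dots>\<bar> \<le> e' * measure (\<sigma> i) UNIV"
        by (rule integral_abs_bound[OF fb]) (use elim(3) in \<open>auto simp: dist_real_def intro: less_imp_le\<close>)
      also have "\<dots> \<le> e' * C" using elim e' by (intro mult_left_mono) auto
      finally show ?case using e' by (simp add: dist_real_def)
    qed
  qed
  from tendsto_add[OF this w] show ?thesis by simp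
qed

end

context sinkhorn
begin

definition dist_B :: "'a measure \<Rightarrow> 'a measure \<Rightarrow> real" where
  "dist_B \<mu> \<nu> = rkhs_norm k (\<lambda>x. B \<mu> x - B \<nu> x)"

lemma dist_B_rkhs: "\<mu> \<in> Probs \<Longrightarrow> \<nu> \<in> Probs \<Longrightarrow> rkhs_le k (\<lambda>x. B \<mu> x - B \<nu> x) (dist_B \<mu> \<nu>)"
  by (simp add: dist_B_def B_dist_rkhs)

lemma dist_B_le: "rkhs_le k (\<lambda>x. B \<mu> x - B \<nu> x) M \<Longrightarrow> dist_B \<mu> \<nu> \<le> M"
  by (simp add: dist_B_def rkhs_le_iff)

lemma dist_B_nonneg: "\<mu> \<in> Probs \<Longrightarrow> \<nu> \<in> Probs \<Longrightarrow> 0 \<le> dist_B \<mu> \<nu>"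
  using dist_B_rkhs rkhs_le_nonneg by blast

lemma dist_B_commute: assumes "\<mu> \<in> Probs" "\<nu> \<in> Probs" shows "dist_B \<mu> \<nu> = dist_B \<nu> \<mu>"
proof -
  have "dist_B \<mu> \<nu> \<le> dist_B \<nu> \<mu>" if "\<mu> \<in> Probs" "\<nu> \<in> Probs" for \<mu> \<nu>
    using rkhs_le_scale[OF dist_B_rkhs[OF that(2,1)], of "-1"] by (intro dist_B_le) simp
  then show ?thesis using assms by (intro antisym)
qed

lemma dist_B_triangle: "\<mu> \<in> Probs \<Longrightarrow> \<nu> \<in> Probs \<Longrightarrow> \<rho> \<in> Probs \<Longrightarrow> dist_B \<mu> \<rho> \<le> dist_B \<mu> \<nu> + dist_B \<nu> \<rho>"
  using rkhs_le_add[OF dist_B_rkhs[of \<mu> \<nu>] dist_B_rkhs[of \<nu> \<rho>]] by (intro dist_B_le) simp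

text \<open>\<open>wder \<mu> t d M\<close>: \<open>d\<close> is the weak derivative at \<open>t\<close> of the Hilbert-valued curve \<open>B (\<mu> s)\<close>. For difference quotients
  bounded in RKHS norm by \<open>M\<close>, weak convergence is the same as uniform convergence of functions.\<close>
definition wder :: "(real \<Rightarrow> 'a measure) \<Rightarrow> real \<Rightarrow> ('a \<Rightarrow> real) \<Rightarrow> real \<Rightarrow> bool" where
  "wder \<mu> t d M \<longleftrightarrow> rkhs_le k d M \<and>
     (\<forall>\<^sub>F s in at t. rkhs_le k (\<lambda>x. (B (\<mu> s) x - B (\<mu> t) x) / (s - t)) M) \<and>
     uniform_limit UNIV (\<lambda>s x. (B (\<mu> s) x - B (\<mu> t) x) / (s - t)) d (at t)"

lemma wder_pointwise: "wder \<mu> t d M \<Longrightarrow> ((\<lambda>s. B (\<mu> s) x) has_real_derivative d x) (at t)"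
  unfolding wder_def has_field_derivative_iff by (auto intro: tendsto_uniform_limitI)

lemma eventually_at_nonneg: "t > 0 \<Longrightarrow> \<forall>\<^sub>F s in at t. (s::real) > 0 \<and> s \<noteq> t"
  by (intro eventually_conj eventually_neq_at_within order_tendstoD(1)[OF tendsto_ident_at])

end

section \<open>Weak derivatives of curves of measures\<close>

locale prob_curve = sinkhorn \<epsilon> c for \<epsilon> and c :: "'a::metric_space \<Rightarrow> 'a \<Rightarrow> real" +
  fixes \<mu> :: "real \<Rightarrow> 'a measure"
  assumes P: "t \<ge> 0 \<Longrightarrow> \<mu> t \<in> Probs"
begin

lemma ev_P: "t > 0 \<Longrightarrow> \<forall>\<^sub>F s in at t. \<mu> s \<in> Probs \<and> s > 0 \<and> s \<noteq> t"
  using eventually_at_nonneg by (rule eventually_mono) (auto intro: P)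

lemma ev_Sg: "t > 0 \<Longrightarrow> \<forall>\<^sub>F s in at t. fin_borel (Sg (\<mu> s)) \<and> measure (Sg (\<mu> s)) UNIV \<le> 1 / \<kappa>"
  using ev_P by (rule eventually_mono) (auto intro: Sg_fin_borel Sg_mass)

text \<open>Differentiability makes the potentials continuous in time, and with the mass bound 1 /
  \<kappa> this is weak continuity of the measures.\<close>

lemma wder_weak_limit:
  fixes \<phi> :: "'a \<Rightarrow> real"
  assumes t: "t > 0" and w: "wder \<mu> t d M" and \<phi>: "cts \<phi>"
  shows "((\<lambda>s. \<integral>x. \<phi> x \<partial>Sg (\<mu> s)) \<longlongrightarrow> (\<integral>x. \<phi> x \<partial>Sg (\<mu> t))) (at t)"
proof (rule weak_convergence[OF ev_Sg[OF t] Sg_fin_borel _ \<phi>])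
  show "\<mu> t \<in> Probs" using t by (intro P) simp
  fix y
  have "((\<lambda>s. B (\<mu> s) y) \<longlongrightarrow> B (\<mu> t) y) (at t)"
    using DERIV_isCont[OF wder_pointwise[OF w]] by (simp add: isCont_def)
  then have "((\<lambda>s. Hk (Sg (\<mu> s)) y) \<longlongrightarrow> B (\<mu> t) y) (at t)"
    by (rule Lim_transform_eventually) (use ev_P[OF t] in \<open>eventually_elim, simp add: Hk_Sg\<close>)
  then show "((\<lambda>s. Hk (Sg (\<mu> s)) y) \<longlongrightarrow> Hk (Sg (\<mu> t)) y) (at t)"
    using P[of t] t by (simp add: Hk_Sg)
qed

lemma wder_pairing_strong:
  fixes \<phi> :: "'a \<Rightarrow> real"
  assumes t: "t > 0" and w: "wder \<mu> t d M" and \<phi>: "cts \<phi>"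
  shows "((\<lambda>s. \<integral>x. \<phi> x * ((B (\<mu> s) x - B (\<mu> t) x) / (s - t)) \<partial>Sg (\<mu> s)) \<longlongrightarrow> (\<integral>x. \<phi> x * d x \<partial>Sg (\<mu> t))) (at t)"
proof (rule weak_strong[OF ev_Sg[OF t]])
  have dc: "cts d" using w rkhs_le_cont unfolding wder_def by blast
  show c: "cts (\<lambda>x. \<phi> x * d x)" by (intro continuous_intros \<phi> dc)
  show "((\<lambda>s. \<integral>x. \<phi> x * d x \<partial>Sg (\<mu> s)) \<longlongrightarrow> (\<integral>x. \<phi> x * d x \<partial>Sg (\<mu> t))) (at t)" by (rule wder_weak_limit[OF t w c])
  show "\<forall>\<^sub>F s in at t. cts (\<lambda>x. \<phi> x * ((B (\<mu> s) x - B (\<mu> t) x) / (s - t)))"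
    using ev_P[OF t] by eventually_elim (intro continuous_intros \<phi> B_cont P, use t in auto)
  show "0 \<le> 1 / \<kappa>" using \<kappa>_pos by simp
  obtain N where N: "N > 0" "\<And>x. \<bar>\<phi> x\<bar> \<le> N" by (rule continuous_bounded[OF \<phi>]) (rule that)
  have u: "uniform_limit UNIV (\<lambda>s x. (B (\<mu> s) x - B (\<mu> t) x) / (s - t)) d (at t)" using w unfolding wder_def by blast
  show "uniform_limit UNIV (\<lambda>s x. \<phi> x * ((B (\<mu> s) x - B (\<mu> t) x) / (s - t))) (\<lambda>x. \<phi> x * d x) (at t)"
  proof (rule uniform_limitI)
    fix e :: real assume "e > 0"
    then have "e / N > 0" using N by simp
    from uniform_limitD[OF u this] show "\<forall>\<^sub>F s in at t. \<forall>x\<in>UNIV. dist (\<phi> x * ((B (\<mu> s) x - B (\<mu> t) x) / (s - t))) (\<phi> x * d x) < e"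
    proof eventually_elim
      case (elim s)
      show ?case
      proof
        fix x
        have "dist (\<phi> x * ((B (\<mu> s) x - B (\<mu> t) x) / (s - t))) (\<phi> x * d x) = \<bar>\<phi> x\<bar> * \<bar>(B (\<mu> s) x - B (\<mu> t) x) / (s - t) - d x\<bar>"
          by (simp add: dist_real_def abs_mult[symmetric] right_diff_distrib)
        also have "\<dots> \<le> N * \<bar>(B (\<mu> s) x - B (\<mu> t) x) / (s - t) - d x\<bar>" by (rule mult_right_mono[OF N(2)]) simp
        also have "\<dots> < N * (e / N)" using elim N(1) by (intro mult_strict_left_mono) (auto simp: dist_real_def)
        finally show "dist (\<phi> x * ((B (\<mu> s) x - B (\<mu> t) x) / (s - t))) (\<phi> x * d x) < e" using N(1) by simp
      qed
    qed
  qed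
qed

lemma wder_pairing_fixed:
  assumes t: "t > 0" and w: "wder \<mu> t d M" and r: "fin_borel \<rho>"
  shows "((\<lambda>s. \<integral>x. (B (\<mu> s) x - B (\<mu> t) x) / (s - t) \<partial>\<rho>) \<longlongrightarrow> (\<integral>x. d x \<partial>\<rho>)) (at t)"
proof (rule weak_strong)
  show "\<forall>\<^sub>F i in at t. fin_borel \<rho> \<and> measure \<rho> UNIV \<le> measure \<rho> UNIV" by (simp add: r)
  show "cts d" using w rkhs_le_cont unfolding wder_def by blast
  show "\<forall>\<^sub>F s in at t. cts (\<lambda>x. (B (\<mu> s) x - B (\<mu> t) x) / (s - t))"
    using ev_P[OF t] by eventually_elim (intro continuous_intros B_cont P, use t in auto)
  show "uniform_limit UNIV (\<lambda>s x. (B (\<mu> s) x - B (\<mu> t) x) / (s - t)) d (at t)" using w unfolding wder_def by blast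
qed auto

text \<open>Difference quotients of \<integral> \<psi> d\<sigma> are bounded by the norm of \<psi>
  times M, uniformly in s, and converge explicitly for combinations of kernel sections; density of
  these gives the limit. D is the RKHS pairing of \<psi> with d, which the third property records
  without an inner product.\<close>

lemma wder_derivative:
  assumes t: "t > 0" and w: "wder \<mu> t d M" and \<psi>: "rkhs_le k \<psi> N"
  obtains D where "((\<lambda>s. \<integral>x. \<psi> x \<partial>Sg (\<mu> s)) has_real_derivative D) (at t)" "\<bar>D\<bar> \<le> N * M"
    "\<And>S a. finite S \<Longrightarrow> rkhs_le k (\<lambda>x. \<psi> x - (\<Sum>z\<in>S. a z * k z x)) e \<Longrightarrow> \<bar>D - (\<Sum>z\<in>S. a z * d z)\<bar> \<le> e * M"
proof -
  define Q where "Q f s = ((\<integral>x. f x \<partial>Sg (\<mu> s)) - (\<integral>x. f x \<partial>Sg (\<mu> t))) / (s - t)" for f :: "'a \<Rightarrow> real" and s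
  have Pt: "\<mu> t \<in> Probs" using t by (intro P) simp
  have bound: "\<forall>\<^sub>F s in at t. \<forall>f N. rkhs_le k f N \<longrightarrow> \<bar>Q f s\<bar> \<le> N * M"
  proof -
    have "\<forall>\<^sub>F s in at t. rkhs_le k (\<lambda>x. (B (\<mu> s) x - B (\<mu> t) x) / (s - t)) M" using w unfolding wder_def by blast
    with ev_P[OF t] show ?thesis
    proof eventually_elim
      case (elim s)
      have "rkhs_le k (\<lambda>x. (s - t) * ((B (\<mu> s) x - B (\<mu> t) x) / (s - t))) (\<bar>s - t\<bar> * M)" by (rule rkhs_le_scale[OF elim(2)])
      then have "dist_B (\<mu> s) (\<mu> t) \<le> \<bar>s - t\<bar> * M" using elim(1) by (intro dist_B_le) simp
      then have "\<bar>Q f s\<bar> \<le> N * M" if f: "rkhs_le k f N" for f N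
      proof -
        have "\<bar>(\<integral>x. f x \<partial>Sg (\<mu> s)) - (\<integral>x. f x \<partial>Sg (\<mu> t))\<bar> \<le> N * dist_B (\<mu> s) (\<mu> t)"
          using Sg_pairing[OF _ Pt f, of "\<mu> s"] elim(1) by (simp add: dist_B_def)
        also have "\<dots> \<le> N * (\<bar>s - t\<bar> * M)" using \<open>dist_B (\<mu> s) (\<mu> t) \<le> \<bar>s - t\<bar> * M\<close> rkhs_le_nonneg[OF f] by (rule mult_left_mono)
        finally show ?thesis using elim(1) by (simp add: Q_def field_simps)
      qed
      then show ?case by blast
    qed
  qed
  have span: "((\<lambda>s. Q (\<lambda>x. \<Sum>z\<in>S. a z * k z x) s) \<longlongrightarrow> (\<Sum>z\<in>S. a z * d z)) (at t)" for S a
  proof -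
    have "((\<lambda>s. \<Sum>z\<in>S. a z * ((B (\<mu> s) z - B (\<mu> t) z) / (s - t))) \<longlongrightarrow> (\<Sum>z\<in>S. a z * d z)) (at t)"
      by (intro tendsto_intros) (use wder_pointwise[OF w] in \<open>auto simp: has_field_derivative_iff\<close>)
    moreover have "\<forall>\<^sub>F s in at t. (\<Sum>z\<in>S. a z * ((B (\<mu> s) z - B (\<mu> t) z) / (s - t))) = Q (\<lambda>x. \<Sum>z\<in>S. a z * k z x) s"
      using ev_P[OF t]
    proof eventually_elim
      case (elim s)
      then have s: "\<mu> s \<in> Probs" by simp
      show ?case unfolding Q_def integral_span[OF Sg_fin_borel[OF s]] integral_span[OF Sg_fin_borel[OF Pt]] Hk_Sg[OF s] Hk_Sg[OF Pt]
        by (simp add: sum_subtractf[symmetric] right_diff_distrib[symmetric] sum_divide_distrib)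
    qed
    ultimately show ?thesis using tendsto_cong by fast
  qed
  have sub: "\<forall>\<^sub>F s in at t. \<bar>Q \<psi> s - Q (\<lambda>x. \<Sum>z\<in>S. a z * k z x) s\<bar> \<le> e * M"
    if S: "finite S" "rkhs_le k (\<lambda>x. \<psi> x - (\<Sum>z\<in>S. a z * k z x)) e" for S a e
    using bound ev_P[OF t]
  proof eventually_elim
    case (elim s)
    then have s: "\<mu> s \<in> Probs" by simp
    have c: "cts (\<lambda>x. \<Sum>z\<in>S. a z * k z x)" by (intro continuous_intros k_cont2)
    have "Q \<psi> s - Q (\<lambda>x. \<Sum>z\<in>S. a z * k z x) s = Q (\<lambda>x. \<psi> x - (\<Sum>z\<in>S. a z * k z x)) s"
      using Bochner_Integration.integral_diff[OF integrable_continuous[OF Sg_fin_borel[OF s] rkhs_le_cont[OF \<psi>]] integrable_continuous[OF Sg_fin_borel[OF s] c]]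
        Bochner_Integration.integral_diff[OF integrable_continuous[OF Sg_fin_borel[OF Pt] rkhs_le_cont[OF \<psi>]] integrable_continuous[OF Sg_fin_borel[OF Pt] c]]
      unfolding Q_def by (simp add: diff_divide_distrib)
    then show ?case using elim(1) S(2) by auto
  qed
  have M: "M \<ge> 0" using w rkhs_le_nonneg unfolding wder_def by blast
  obtain D where D: "((\<lambda>s. Q \<psi> s) \<longlongrightarrow> D) (at t)"
  proof (rule tendsto_approx[of "at t" "Q \<psi>"])
    fix e :: real assume e: "e > 0"
    define e' where "e' = e / (2 * (M + 1))"
    have e': "e' > 0" "e' * M \<le> e / 2" using e M by (auto simp: e'_def field_simps)
    have "in_rkhs k \<psi>" using \<psi> in_rkhs_iff by blast
    then obtain S a where S: "finite S" "rkhs_le k (\<lambda>x. \<psi> x - (\<Sum>z\<in>S. a z * k z x)) e'" using span_dense[OF _ e'(1)] by metis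
    have "\<forall>\<^sub>F s in at t. \<bar>Q (\<lambda>x. \<Sum>z\<in>S. a z * k z x) s - (\<Sum>z\<in>S. a z * d z)\<bar> < e / 2"
      using tendstoD[OF span, of "e / 2"] e by (simp add: dist_real_def)
    with sub[OF S] have "\<forall>\<^sub>F s in at t. \<bar>Q \<psi> s - (\<Sum>z\<in>S. a z * d z)\<bar> \<le> e"
      by eventually_elim (use e'(2) in linarith)
    then show "\<exists>c. \<forall>\<^sub>F s in at t. \<bar>Q \<psi> s - c\<bar> \<le> e" by blast
  qed simp_all
  show ?thesis
  proof (rule that)
    show "((\<lambda>s. \<integral>x. \<psi> x \<partial>Sg (\<mu> s)) has_real_derivative D) (at t)" using D unfolding Q_def has_field_derivative_iff .
    show "\<bar>D\<bar> \<le> N * M" by (rule tendsto_upperbound[OF tendsto_rabs[OF D]]) (use bound \<psi> in \<open>auto elim!: eventually_mono\<close>)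
    fix S a assume S: "finite S" "rkhs_le k (\<lambda>x. \<psi> x - (\<Sum>z\<in>S. a z * k z x)) e"
    show "\<bar>D - (\<Sum>z\<in>S. a z * d z)\<bar> \<le> e * M"
      by (rule tendsto_upperbound[OF tendsto_rabs[OF tendsto_diff[OF D span]] sub[OF S]]) simp
  qed
qed

text \<open>D is the squared RKHS norm of d: the combination that approximates d pairs with d like
  the square of its norm, up to e'.\<close>

lemma wder_self_nonneg:
  assumes t: "t > 0" and w: "wder \<mu> t d M" and D: "((\<lambda>s. \<integral>x. d x \<partial>Sg (\<mu> s)) has_real_derivative D) (at t)"
  shows "0 \<le> D"
proof (rule field_le_epsilon)
  fix e :: real assume e: "e > 0"
  have dM: "rkhs_le k d M" using w unfolding wder_def by blast
  then have ir: "in_rkhs k d" using in_rkhs_iff by blast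
  define e' where "e' = e / (M + 1)"
  have M: "M \<ge> 0" by (rule rkhs_le_nonneg[OF dM])
  have "e' * (M + 1) = e" using M by (simp add: e'_def)
  then have e': "e' > 0" "e' * M + e' \<le> e" using e M by (simp_all add: e'_def distrib_left)
  obtain S a where S: "finite S" "rkhs_le k (\<lambda>y. d y - (\<Sum>x\<in>S. a x * k x y)) e'" "\<bar>(\<Sum>x\<in>S. a x * d x) - (rkhs_norm k d)\<^sup>2\<bar> \<le> e'"
    by (rule span_dense[OF ir e'(1)])
  obtain D' where D': "((\<lambda>s. \<integral>x. d x \<partial>Sg (\<mu> s)) has_real_derivative D') (at t)"
    "\<And>S a. finite S \<Longrightarrow> rkhs_le k (\<lambda>x. d x - (\<Sum>z\<in>S. a z * k z x)) e' \<Longrightarrow> \<bar>D' - (\<Sum>z\<in>S. a z * d z)\<bar> \<le> e' * M"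
    by (rule wder_derivative[OF t w dM, of e']) (rule that)
  have "D' = D" using DERIV_unique[OF D'(1) D] .
  moreover have "(\<Sum>x\<in>S. a x * d x) \<ge> - e'" using S(3) zero_le_power2[of "rkhs_norm k d"] by linarith
  ultimately show "0 \<le> D + e" using D'(2)[OF S(1,2)] e'(2) by linarith
qed

text \<open>The potentials move on the unit sphere, so the derivative is orthogonal to the
  position.\<close>

lemma wder_orthogonal:
  assumes t: "t > 0" and w: "wder \<mu> t d M"
  shows "(\<integral>x. d x \<partial>Sg (\<mu> t)) = 0"
proof -
  have Pt: "\<mu> t \<in> Probs" using t by (intro P) simp
  let ?q = "\<lambda>s x. (B (\<mu> s) x - B (\<mu> t) x) / (s - t)"
  \<comment> \<open>The increment of B is integrated against the sum of the measures at s and t: the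
    cross terms cancel by symmetry and 1 - 1 remains.\<close>
  have "((\<lambda>s. (\<integral>x. 1 * ?q s x \<partial>Sg (\<mu> s)) + (\<integral>x. ?q s x \<partial>Sg (\<mu> t))) \<longlongrightarrow> (\<integral>x. 1 * d x \<partial>Sg (\<mu> t)) + (\<integral>x. d x \<partial>Sg (\<mu> t))) (at t)"
    by (intro tendsto_add wder_pairing_strong[OF t w] wder_pairing_fixed[OF t w] Sg_fin_borel Pt) simp
  moreover have "\<forall>\<^sub>F s in at t. (\<integral>x. 1 * ?q s x \<partial>Sg (\<mu> s)) + (\<integral>x. ?q s x \<partial>Sg (\<mu> t)) = 0"
    using ev_P[OF t]
  proof eventually_elim
    case (elim s)
    then have Ps: "\<mu> s \<in> Probs" by simp
    have "(\<integral>x. ?q s x \<partial>Sg \<rho>) = ((\<integral>x. B (\<mu> s) x \<partial>Sg \<rho>) - (\<integral>x. B (\<mu> t) x \<partial>Sg \<rho>)) / (s - t)" if "\<rho> \<in> Probs" for \<rho>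
      using Bochner_Integration.integral_diff[OF integrable_continuous[OF Sg_fin_borel[OF that] B_cont[OF Ps]] integrable_continuous[OF Sg_fin_borel[OF that] B_cont[OF Pt]]]
      by simp
    moreover have "(\<integral>x. B (\<mu> t) x \<partial>Sg (\<mu> s)) = (\<integral>x. B (\<mu> s) x \<partial>Sg (\<mu> t))"
      using Hk_symm[OF Sg_fin_borel[OF Pt] Sg_fin_borel[OF Ps]] by (simp add: Hk_Sg Pt Ps)
    ultimately show ?case using Ps Pt elim by (auto simp: B_norm add_divide_distrib[symmetric])
  qed
  ultimately have "((\<lambda>s. 0::real) \<longlongrightarrow> (\<integral>x. 1 * d x \<partial>Sg (\<mu> t)) + (\<integral>x. d x \<partial>Sg (\<mu> t))) (at t)"
    using tendsto_cong by fast
  then show ?thesis by (simp add: tendsto_const_iff)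
qed

lemma wder_tangent:
  assumes t: "t > 0" and w: "wder \<mu> t d M" and \<phi>: "rkhs_le k (\<lambda>x. B (\<mu> t) x * \<phi> x) N"
    and D: "((\<lambda>s. \<integral>x. B (\<mu> t) x * \<phi> x \<partial>Sg (\<mu> s)) has_real_derivative D) (at t)"
  shows "((\<lambda>s. \<integral>x. \<phi> x \<partial>\<mu> s) has_real_derivative (\<integral>x. \<phi> x * d x \<partial>Sg (\<mu> t)) + D) (at t)" "cts \<phi>"
proof -
  have Pt: "\<mu> t \<in> Probs" using t by (intro P) simp
  have "cts (\<lambda>x. 1 / B (\<mu> t) x * (B (\<mu> t) x * \<phi> x))"
    by (rule continuous_on_mult[OF B_inverse_cont[OF Pt] rkhs_le_cont[OF \<phi>]])
  then show c: "cts \<phi>" by (simp add: B_nz)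
  let ?q = "\<lambda>s x. (B (\<mu> s) x - B (\<mu> t) x) / (s - t)"
  have "((\<lambda>s. (\<integral>x. \<phi> x * ?q s x \<partial>Sg (\<mu> s)) + ((\<integral>x. B (\<mu> t) x * \<phi> x \<partial>Sg (\<mu> s)) - (\<integral>x. B (\<mu> t) x * \<phi> x \<partial>Sg (\<mu> t))) / (s - t))
     \<longlongrightarrow> (\<integral>x. \<phi> x * d x \<partial>Sg (\<mu> t)) + D) (at t)"
    using D unfolding has_field_derivative_iff by (intro tendsto_add wder_pairing_strong[OF t w c])
  moreover have "\<forall>\<^sub>F s in at t. (\<integral>x. \<phi> x * ?q s x \<partial>Sg (\<mu> s)) + ((\<integral>x. B (\<mu> t) x * \<phi> x \<partial>Sg (\<mu> s)) - (\<integral>x. B (\<mu> t) x * \<phi> x \<partial>Sg (\<mu> t))) / (s - t)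
     = ((\<integral>x. \<phi> x \<partial>\<mu> s) - (\<integral>x. \<phi> x \<partial>\<mu> t)) / (s - t)"
    using ev_P[OF t]
  proof eventually_elim
    case (elim s)
    then have Ps: "\<mu> s \<in> Probs" by simp
    note i = integrable_continuous[OF Sg_fin_borel[OF Ps]]
    have "(\<integral>x. \<phi> x * ?q s x \<partial>Sg (\<mu> s)) = (\<integral>x. \<phi> x * B (\<mu> s) x - B (\<mu> t) x * \<phi> x \<partial>Sg (\<mu> s)) / (s - t)"
      by (subst integral_divide_zero[symmetric]) (simp add: algebra_simps)
    also have "\<dots> = ((\<integral>x. \<phi> x \<partial>\<mu> s) - (\<integral>x. B (\<mu> t) x * \<phi> x \<partial>Sg (\<mu> s))) / (s - t)"
      using Bochner_Integration.integral_diff[OF i[OF continuous_on_mult[OF c B_cont[OF Ps]]] i[OF continuous_on_mult[OF B_cont[OF Pt] c]]]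
      by (simp add: Sg_integral_B[OF Ps c])
    finally show ?case using Sg_integral_B[OF Pt c] unfolding mult.commute[of "B (\<mu> t) _"] by (simp add: add_divide_distrib[symmetric] del: divide_cancel_right)
  qed
  ultimately show "((\<lambda>s. \<integral>x. \<phi> x \<partial>\<mu> s) has_real_derivative (\<integral>x. \<phi> x * d x \<partial>Sg (\<mu> t)) + D) (at t)"
    unfolding has_field_derivative_iff using tendsto_cong by fast
qed

end

section \<open>Almost everywhere differentiability of admissible curves\<close>

locale adm_curve = prob_curve \<epsilon> c \<mu> for \<epsilon> and c :: "'a::metric_space \<Rightarrow> 'a \<Rightarrow> real" and \<mu> +
  fixes m :: "real \<Rightarrow> real"
  assumes m_int: "m absolutely_integrable_on {0..T}"
    and m_sq: "(\<lambda>t. (m t)\<^sup>2) integrable_on {0..T}"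
    and m_dist: "0 \<le> s \<Longrightarrow> s \<le> t \<Longrightarrow> dist_B (\<mu> t) (\<mu> s) \<le> integral {s..t} m"
begin

lemma m_integrable: "0 \<le> s \<Longrightarrow> m integrable_on {s..t}"
  using set_lebesgue_integral_eq_integral(1)[OF m_int[of t]] by (rule integrable_on_subinterval) auto

lemma m_primitive: "0 \<le> s \<Longrightarrow> s \<le> t \<Longrightarrow> integral {0..t} m - integral {0..s} m = integral {s..t} m"
  using Henstock_Kurzweil_Integration.integral_combine[of 0 s t m] m_integrable[of 0 t] by simp

lemma dist_B_primitive:
  assumes "0 \<le> s" "0 \<le> t"
  shows "dist_B (\<mu> s) (\<mu> t) \<le> \<bar>integral {0..s} m - integral {0..t} m\<bar>"
proof (cases "s \<le> t")
  case True
  then show ?thesis using m_dist[of s t] m_primitive[of s t] assms dist_B_commute[OF P P, of s t] by simp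
next
  case False
  then show ?thesis using m_dist[of t s] m_primitive[of t s] assms by simp
qed

lemma B_abs_continuous: "0 \<le> a \<Longrightarrow> a \<le> b \<Longrightarrow> \<bar>B (\<mu> b) x - B (\<mu> a) x\<bar> \<le> integral {a..b} m"
  using rkhs_le_bound[OF dist_B_rkhs[OF P P], of b a x] m_dist[of a b] by simp

lemma B_rkhs_primitive:
  assumes "0 \<le> s" "0 \<le> t" "s \<noteq> t"
  shows "rkhs_le k (\<lambda>x. (B (\<mu> s) x - B (\<mu> t) x) / (s - t)) ((integral {0..s} m - integral {0..t} m) / (s - t))"
proof -
  \<comment> \<open>The primitive of m dominates distances, so it is nondecreasing and its quotients
    are nonnegative for either order of s and t.\<close>
  have mono: "integral {0..a} m \<le> integral {0..b} m" if "0 \<le> a" "a \<le> b" for a b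
    using m_dist[OF that] m_primitive[OF that] dist_B_nonneg[OF P P, of b a] that by simp
  have "\<bar>integral {0..s} m - integral {0..t} m\<bar> = \<bar>s - t\<bar> * ((integral {0..s} m - integral {0..t} m) / (s - t))"
    using mono[of s t] mono[of t s] assms by (cases "s \<le> t") (auto simp: abs_if field_simps)
  then have "rkhs_le k (\<lambda>x. B (\<mu> s) x - B (\<mu> t) x) (\<bar>s - t\<bar> * ((integral {0..s} m - integral {0..t} m) / (s - t)))"
    using rkhs_le_mono[OF dist_B_rkhs[OF P[OF assms(1)] P[OF assms(2)]] dist_B_primitive[OF assms(1,2)]] by simp
  from rkhs_le_scale[OF this, of "1 / (s - t)"] show ?thesis using assms(3) by (simp add: abs_divide)
qed

text \<open>At almost every time all functions s \<mapsto> B (\<mu> s) (xs j) and the primitive of m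
  are differentiable. The difference quotients are then bounded in norm near t, and equicontinuity
  carries convergence from the dense points to all points.\<close>

lemma AE_wder: "AE t in lborel. t > 0 \<longrightarrow> (\<exists>d. wder \<mu> t d (m t + 1) \<and> rkhs_le k d (m t))"
proof -
  obtain xs :: "nat \<Rightarrow> 'a" where xs: "\<And>e. e > 0 \<Longrightarrow> \<exists>N. \<forall>x. \<exists>j\<le>N. dist x (xs j) < e" by (rule dense_sequence) (rule that)
  have "AE t in lborel. t > 0 \<longrightarrow> (\<exists>D. ((\<lambda>s. B (\<mu> s) (xs j)) has_real_derivative D) (at t))" for j
  proof -
    have "\<exists>g. (\<forall>T. g absolutely_integrable_on {0..T}) \<and>
      (\<forall>a b. 0 \<le> a \<longrightarrow> a \<le> b \<longrightarrow> B (\<mu> b) (xs j) - B (\<mu> a) (xs j) = integral {a..b} g) \<and>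
      (AE t in lborel. t > 0 \<longrightarrow> ((\<lambda>s. B (\<mu> s) (xs j)) has_real_derivative g t) (at t))"
      by (rule AC_differentiable_ae[of m]) (use m_int B_abs_continuous in auto)
    then obtain g where "AE t in lborel. t > 0 \<longrightarrow> ((\<lambda>s. B (\<mu> s) (xs j)) has_real_derivative g t) (at t)" by blast
    then show ?thesis by eventually_elim blast
  qed
  then have "AE t in lborel. \<forall>j. t > 0 \<longrightarrow> (\<exists>D. ((\<lambda>s. B (\<mu> s) (xs j)) has_real_derivative D) (at t))" by (subst AE_all_countable) blast
  with AE_has_derivative_indefinite_integral[of m, OF m_int] show ?thesis
  proof eventually_elim
    case (elim t)
    show ?case
    proof
      assume t: "t > 0"
      define q where "q s x = (B (\<mu> s) x - B (\<mu> t) x) / (s - t)" for s x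
      define M where "M s = (integral {0..s} m - integral {0..t} m) / (s - t)" for s
      have M: "(M \<longlongrightarrow> m t) (at t)" using elim(1) t unfolding M_def[abs_def] has_field_derivative_iff by blast
      have qM: "\<forall>\<^sub>F s in at t. rkhs_le k (q s) (M s)"
        using ev_P[OF t] by eventually_elim (use t B_rkhs_primitive in \<open>auto simp: q_def[abs_def] M_def\<close>)
      \<comment> \<open>The quotient bounds only tend to \<open>m t\<close>, hence the slack 1 for
        the quotients; the limit d itself obeys the bound \<open>m t\<close>.\<close>
      have qM1: "\<forall>\<^sub>F s in at t. rkhs_le k (q s) (m t + 1)"
        using qM order_tendstoD(2)[OF M less_add_one] by eventually_elim (auto intro: rkhs_le_mono)
      have "\<forall>\<^sub>F s in at t. M s \<ge> 0" using qM by eventually_elim (rule rkhs_le_nonneg)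
      then have m0: "m t \<ge> 0" by (rule tendsto_lowerbound[OF M]) simp
      have "\<exists>L. ((\<lambda>s. q s x) \<longlongrightarrow> L) (at t)" for x
      proof -
        obtain L where "((\<lambda>s. q s x) \<longlongrightarrow> L) (at t)"
        proof (rule tendsto_approx[of "at t" "\<lambda>s. q s x"])
          fix e :: real assume e: "e > 0"
          obtain \<eta> where \<eta>: "\<eta> > 0" "\<And>f x y. rkhs_le k f (m t + 1) \<Longrightarrow> dist x y < \<eta> \<Longrightarrow> \<bar>f x - f y\<bar> \<le> e / 2"
            by (rule rkhs_equicontinuous[of "m t + 1" "e / 2"]) (use m0 e in auto)
          obtain j where j: "dist x (xs j) < \<eta>" using xs[OF \<eta>(1)] by blast
          obtain D where D: "((\<lambda>s. B (\<mu> s) (xs j)) has_real_derivative D) (at t)" using elim(2) t by blast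
          then have "\<forall>\<^sub>F s in at t. dist (q s (xs j)) D < e / 2"
            using e unfolding q_def has_field_derivative_iff by (intro tendstoD) auto
          with qM1 have "\<forall>\<^sub>F s in at t. \<bar>q s x - D\<bar> \<le> e"
          proof eventually_elim
            case (elim s)
            then show ?case using \<eta>(2)[OF elim(1) j] unfolding dist_real_def by linarith
          qed
          then show "\<exists>c. \<forall>\<^sub>F s in at t. \<bar>q s x - c\<bar> \<le> e" by blast
        qed simp_all
        then show ?thesis by blast
      qed
      then obtain d where d: "\<And>x. ((\<lambda>s. q s x) \<longlongrightarrow> d x) (at t)" by metis
      have dm: "rkhs_le k d (m t)" by (rule rkhs_le_tendsto[OF d M qM]) simp
      have "uniform_limit UNIV q d (at t)" by (rule rkhs_uniform_limit[OF qM1 d]) simp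
      then have "wder \<mu> t d (m t + 1)"
        using qM1 rkhs_le_mono[OF dm, of "m t + 1"] unfolding wder_def q_def[abs_def] by simp
      then show "\<exists>d. wder \<mu> t d (m t + 1) \<and> rkhs_le k d (m t)" using dm by blast
    qed
  qed
qed

end

section \<open>The distance between two admissible curves\<close>

context sinkhorn
begin

lemma dist_B_le_2: "\<mu> \<in> Probs \<Longrightarrow> \<nu> \<in> Probs \<Longrightarrow> dist_B \<mu> \<nu> \<le> 2"
  using rkhs_le_diff[OF B_rkhs[of \<mu>] B_rkhs[of \<nu>]] by (intro dist_B_le) simp

lemma dist_B_square:
  assumes "\<mu> \<in> Probs" "\<nu> \<in> Probs"
  shows "(dist_B \<mu> \<nu>)\<^sup>2 = 2 - 2 * (\<integral>x. B \<mu> x \<partial>Sg \<nu>)"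
proof -
  have i: "(\<integral>y. B \<mu> y - B \<nu> y \<partial>Sg \<rho>) = (\<integral>y. B \<mu> y \<partial>Sg \<rho>) - (\<integral>y. B \<nu> y \<partial>Sg \<rho>)" if "\<rho> \<in> Probs" for \<rho>
    by (intro Bochner_Integration.integral_diff integrable_continuous Sg_fin_borel B_cont assms that)
  have "(\<integral>x. B \<nu> x \<partial>Sg \<mu>) = (\<integral>x. B \<mu> x \<partial>Sg \<nu>)"
    using Hk_symm[OF Sg_fin_borel[OF assms(2)] Sg_fin_borel[OF assms(1)]] by (simp add: Hk_Sg assms)
  then show ?thesis using B_dist(1,3)[OF assms] unfolding dist_B_def by (simp add: i assms B_norm)
qed

text \<open>For unit vectors the squared distance is 2 minus twice the pairing. The increment of the
  pairing is split so that the quotient of the first curve meets the moving measure of the second,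
  and the quotient of the second meets the fixed measure of the first.\<close>

lemma wder_pair_derivative:
  assumes "prob_curve \<epsilon> c \<mu>1" "prob_curve \<epsilon> c \<mu>2" and t: "t > 0" and w: "wder \<mu>1 t d1 M1" "wder \<mu>2 t d2 M2"
  shows "((\<lambda>s. (dist_B (\<mu>1 s) (\<mu>2 s))\<^sup>2) has_real_derivative
      - 2 * ((\<integral>x. d1 x \<partial>Sg (\<mu>2 t)) + (\<integral>x. d2 x \<partial>Sg (\<mu>1 t)))) (at t)"
proof -
  interpret C1: prob_curve \<epsilon> c \<mu>1 by fact
  interpret C2: prob_curve \<epsilon> c \<mu>2 by fact
  let ?q1 = "\<lambda>s x. (B (\<mu>1 s) x - B (\<mu>1 t) x) / (s - t)" and ?q2 = "\<lambda>s x. (B (\<mu>2 s) x - B (\<mu>2 t) x) / (s - t)"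
  have P1t: "\<mu>1 t \<in> Probs" and P2t: "\<mu>2 t \<in> Probs" using t C1.P C2.P by simp_all
  have c1: "cts d1" using w(1) rkhs_le_cont unfolding wder_def by blast
  have "((\<lambda>s. \<integral>x. ?q1 s x \<partial>Sg (\<mu>2 s)) \<longlongrightarrow> (\<integral>x. d1 x \<partial>Sg (\<mu>2 t))) (at t)"
  proof (rule weak_strong[OF C2.ev_Sg[OF t]])
    show "((\<lambda>s. \<integral>x. d1 x \<partial>Sg (\<mu>2 s)) \<longlongrightarrow> (\<integral>x. d1 x \<partial>Sg (\<mu>2 t))) (at t)" by (rule C2.wder_weak_limit[OF t w(2) c1])
    show "\<forall>\<^sub>F s in at t. cts (?q1 s)"
      using C1.ev_P[OF t] by eventually_elim (intro continuous_intros B_cont P1t, auto)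
    show "uniform_limit UNIV ?q1 d1 (at t)" using w(1) unfolding wder_def by blast
  qed (use c1 \<kappa>_pos in auto)
  then have "((\<lambda>s. - 2 * ((\<integral>x. ?q1 s x \<partial>Sg (\<mu>2 s)) + (\<integral>x. ?q2 s x \<partial>Sg (\<mu>1 t)))) \<longlongrightarrow> - 2 * ((\<integral>x. d1 x \<partial>Sg (\<mu>2 t)) + (\<integral>x. d2 x \<partial>Sg (\<mu>1 t)))) (at t)"
    by (intro tendsto_intros C2.wder_pairing_fixed[OF t w(2) Sg_fin_borel[OF P1t]])
  moreover have "\<forall>\<^sub>F s in at t. - 2 * ((\<integral>x. ?q1 s x \<partial>Sg (\<mu>2 s)) + (\<integral>x. ?q2 s x \<partial>Sg (\<mu>1 t)))
      = ((dist_B (\<mu>1 s) (\<mu>2 s))\<^sup>2 - (dist_B (\<mu>1 t) (\<mu>2 t))\<^sup>2) / (s - t)"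
    using C1.ev_P[OF t] C2.ev_P[OF t]
  proof eventually_elim
    case (elim s)
    then have P1s: "\<mu>1 s \<in> Probs" and P2s: "\<mu>2 s \<in> Probs" by simp_all
    have i: "(\<integral>x. (B \<rho> x - B \<rho>' x) / (s - t) \<partial>Sg \<nu>) = ((\<integral>x. B \<rho> x \<partial>Sg \<nu>) - (\<integral>x. B \<rho>' x \<partial>Sg \<nu>)) / (s - t)"
      if "\<rho> \<in> Probs" "\<rho>' \<in> Probs" "\<nu> \<in> Probs" for \<rho> \<rho>' \<nu>
      unfolding integral_divide_zero
      by (rule arg_cong[where f="\<lambda>z. z / (s - t)"]) (intro Bochner_Integration.integral_diff integrable_continuous Sg_fin_borel B_cont that)
    have sy: "(\<integral>x. B \<nu> x \<partial>Sg \<rho>) = (\<integral>x. B \<rho> x \<partial>Sg \<nu>)" if "\<rho> \<in> Probs" "\<nu> \<in> Probs" for \<rho> \<nu>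
      using Hk_symm[OF Sg_fin_borel[OF that(2)] Sg_fin_borel[OF that(1)]] by (simp add: Hk_Sg that)
    show ?case unfolding dist_B_square[OF P1s P2s] dist_B_square[OF P1t P2t] i[OF P1s P1t P2s] i[OF P2s P2t P1t] sy[OF P1t P2s] sy[OF P1t P2t]
      by (simp add: add_divide_distrib[symmetric] diff_divide_distrib[symmetric] algebra_simps)
  qed
  ultimately show ?thesis unfolding has_field_derivative_iff by (rule Lim_transform_eventually)
qed

lemma dist_B_square_AC:
  assumes "adm_curve \<epsilon> c \<mu>1 m1" "adm_curve \<epsilon> c \<mu>2 m2" and ab: "0 \<le> a" "a \<le> b"
  shows "\<bar>(dist_B (\<mu>1 b) (\<mu>2 b))\<^sup>2 - (dist_B (\<mu>1 a) (\<mu>2 a))\<^sup>2\<bar> \<le> integral {a..b} (\<lambda>t. 4 * (m1 t + m2 t))"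
proof -
  interpret C1: adm_curve \<epsilon> c \<mu>1 m1 by fact
  interpret C2: adm_curve \<epsilon> c \<mu>2 m2 by fact
  have Pa: "\<mu>1 a \<in> Probs" "\<mu>2 a \<in> Probs" "\<mu>1 b \<in> Probs" "\<mu>2 b \<in> Probs" using ab C1.P C2.P by simp_all
  define x y where "x = dist_B (\<mu>1 b) (\<mu>2 b)" and "y = dist_B (\<mu>1 a) (\<mu>2 a)"
  have xy: "0 \<le> x" "x \<le> 2" "0 \<le> y" "y \<le> 2" unfolding x_def y_def using dist_B_nonneg dist_B_le_2 Pa by auto
  have "\<bar>x - y\<bar> \<le> dist_B (\<mu>1 b) (\<mu>1 a) + dist_B (\<mu>2 b) (\<mu>2 a)"
    using dist_B_triangle[OF Pa(3,1,4)] dist_B_triangle[OF Pa(1,2,4)] dist_B_triangle[OF Pa(1,3,2)] dist_B_triangle[OF Pa(3,4,2)]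
      dist_B_commute[OF Pa(2,4)] dist_B_commute[OF Pa(1,3)] unfolding x_def y_def by linarith
  also have "\<dots> \<le> integral {a..b} m1 + integral {a..b} m2" using C1.m_dist[OF ab] C2.m_dist[OF ab] by simp
  also have "\<dots> = integral {a..b} (\<lambda>t. m1 t + m2 t)"
    using C1.m_integrable[OF ab(1)] C2.m_integrable[OF ab(1)] by (simp add: Henstock_Kurzweil_Integration.integral_add)
  finally have 1: "\<bar>x - y\<bar> \<le> integral {a..b} (\<lambda>t. m1 t + m2 t)" .
  have "\<bar>x\<^sup>2 - y\<^sup>2\<bar> = \<bar>x - y\<bar> * (x + y)" using xy by (simp add: power2_eq_square square_diff_square_factored abs_mult)
  \<comment> \<open>Both distances are at most 2.\<close>
  also have "\<dots> \<le> \<bar>x - y\<bar> * 4" using xy by (intro mult_left_mono) auto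
  finally have "\<bar>x\<^sup>2 - y\<^sup>2\<bar> \<le> 4 * integral {a..b} (\<lambda>t. m1 t + m2 t)" using 1 by simp
  then show ?thesis by (simp only: x_def y_def integral_mult_right)
qed

end

section \<open>The flow equation\<close>

context compact_metric
begin

lemma vanishes_on_msupp:
  fixes q :: "'a \<Rightarrow> real"
  assumes s: "fin_borel \<mu>" and q: "cts q" "\<And>x. 0 \<le> q x" and i: "(\<integral>x. q x \<partial>\<mu>) = 0" and x: "x \<in> msupp \<mu>"
  shows "q x = 0"
proof (rule ccontr)
  assume "q x \<noteq> 0"
  then have pos: "q x > 0" using q(2)[of x] by simp
  then obtain e where e: "e > 0" "\<And>y. dist y x < e \<Longrightarrow> \<bar>q y - q x\<bar> < q x"
    using q(1) unfolding continuous_on_iff by (metis UNIV_I dist_real_def)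
  have "AE y in \<mu>. q y = 0"
    using integral_nonneg_eq_0_iff_AE[OF integrable_continuous[OF s q(1)]] q(2) i by simp
  then have "AE y in \<mu>. y \<notin> ball x e"
  proof eventually_elim
    case (elim y)
    then show ?case using e(2)[of y] pos by (auto simp: dist_commute)
  qed
  then have "emeasure \<mu> (ball x e) = 0"
    using s by (subst (asm) AE_iff_measurable[of "ball x e"]) (auto simp: fin_borel_def fin_borel_space[OF s])
  then show False using x e(1) by (auto simp: msupp_def)
qed

text \<open>The set where p is nonzero is exhausted by compact sets where its modulus is at least 1
  / (n + 1); each is covered by finitely many null balls.\<close>

lemma AE_zero_of_zero_on_msupp:
  fixes p :: "'a \<Rightarrow> real"
  assumes s: "fin_borel \<mu>" and p: "cts p" "\<And>x. x \<in> msupp \<mu> \<Longrightarrow> p x = 0"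
  shows "AE x in \<mu>. p x = 0"
proof -
  have "AE x in \<mu>. \<not> 1 / real (Suc n) \<le> \<bar>p x\<bar>" for n
  proof -
    define F where "F = {x. 1 / real (Suc n) \<le> \<bar>p x\<bar>}"
    have "closed F" unfolding F_def using p(1) by (intro closed_Collect_le continuous_intros)
    then have F: "compact F" using compact_space by (metis compact_Int_closed inf_top_left)
    have "\<exists>e>0. emeasure \<mu> (ball x e) = 0" if "x \<in> F" for x
    proof -
      have "x \<notin> msupp \<mu>" using that p(2)[of x] by (auto simp: F_def)
      then show ?thesis by (auto simp: msupp_def not_less)
    qed
    then obtain e where e: "\<And>x. x \<in> F \<Longrightarrow> e x > 0 \<and> emeasure \<mu> (ball x (e x)) = 0" by metis
    have "F \<subseteq> (\<Union>x\<in>F. ball x (e x))" using e by force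
    then obtain C where C: "C \<subseteq> F" "finite C" "F \<subseteq> (\<Union>x\<in>C. ball x (e x))"
      by (rule compactE_image[OF F open_ball]) (rule that)
    have "(\<Union>x\<in>C. ball x (e x)) \<in> null_sets \<mu>"
      using C e s by (intro null_sets.finite_UN) (auto simp: null_sets_def fin_borel_def)
    then show ?thesis by (rule AE_I') (use C(3) in \<open>auto simp: F_def\<close>)
  qed
  then have "AE x in \<mu>. \<forall>n. \<not> 1 / real (Suc n) \<le> \<bar>p x\<bar>" by (subst AE_all_countable) blast
  then show ?thesis
  proof eventually_elim
    case (elim x)
    show ?case
    proof (rule ccontr)
      assume "p x \<noteq> 0"
      then obtain n where "1 / real (Suc n) < \<bar>p x\<bar>" using nat_approx_posE[of "\<bar>p x\<bar>"] by auto
      then show False using elim by (meson less_imp_le)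
    qed
  qed
qed

end

context sinkhorn
begin

lemma Press_zero:
  assumes m: "\<mu> \<in> Probs" and p: "p \<in> Press \<mu>"
  shows "cts p" "p x \<le> 0" "AE x in \<mu>. p x = 0" "K \<mu> p x = 0"
proof -
  have ps: "\<And>x. x \<in> msupp \<mu> \<Longrightarrow> p x = 0" using p by (simp add: Press_def)
  show "cts p" "p x \<le> 0" using p by (simp_all add: Press_def)
  from AE_zero_of_zero_on_msupp[OF Probs_fin_borel[OF m] this(1) ps] show z: "AE x in \<mu>. p x = 0" .
  show "K \<mu> p x = 0" unfolding Kop_def by (rule integral_eq_zero_AE) (use z in eventually_elim, simp)
qed

text \<open>Adding M makes the weight nonnegative. The resulting density has mass at most 2 M times
  that of \<sigma>, and the correction by M Hk \<sigma> contributes the third M.\<close>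

lemma weighted_rkhs:
  fixes u :: "'a \<Rightarrow> real"
  assumes s: "fin_borel \<sigma>" and u: "cts u" and M: "\<And>x. \<bar>u x\<bar> \<le> M"
  shows "rkhs_le k (\<lambda>y. \<integral>x. u x * k x y \<partial>\<sigma>) (3 * M * measure \<sigma> UNIV)"
proof -
  have M0: "M \<ge> 0" using M[of undefined] by linarith
  have norm: "rkhs_le k (Hk \<rho>) (measure \<rho> UNIV)" if r: "fin_borel \<rho>" for \<rho>
  proof (rule rkhs_le_mono[OF Hk_norm(2)[OF r]])
    have "\<bar>Hk \<rho> y\<bar> \<le> 1 * measure \<rho> UNIV" for y
      unfolding Hk_def by (rule integral_abs_bound[OF r]) (use k_pos k_le_1 in \<open>simp add: abs_of_pos\<close>)
    then have "\<bar>\<integral>y. Hk \<rho> y \<partial>\<rho>\<bar> \<le> (1 * measure \<rho> UNIV) * measure \<rho> UNIV" by (rule integral_abs_bound[OF r])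
    then show "sqrt (\<integral>y. Hk \<rho> y \<partial>\<rho>) \<le> measure \<rho> UNIV" by (intro real_le_lsqrt) (auto simp: power2_eq_square)
  qed
  have w: "cts (\<lambda>x. u x + M)" "\<And>x. 0 \<le> u x + M"
    using M by (auto intro!: continuous_intros u simp: abs_le_iff) (smt (verit) M)
  define \<rho> where "\<rho> = density \<sigma> (\<lambda>x. ennreal (u x + M))"
  have r: "fin_borel \<rho>" and ri: "\<And>\<phi> :: 'a \<Rightarrow> real. cts \<phi> \<Longrightarrow> (\<integral>x. \<phi> x \<partial>\<rho>) = (\<integral>x. (u x + M) * \<phi> x \<partial>\<sigma>)"
    unfolding \<rho>_def using integral_density_continuous[OF s w] by auto
  have eq: "(\<integral>x. u x * k x y \<partial>\<sigma>) = Hk \<rho> y - M * Hk \<sigma> y" for y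
    unfolding Hk_def ri[OF k_cont1] using weighted_integrable[OF u s, of y] integrable_continuous[OF s k_cont1, of y]
    by (simp add: distrib_right)
  have "measure \<rho> UNIV = (\<integral>x. u x + M \<partial>\<sigma>)" using ri[of "\<lambda>_. 1"] by (simp add: fin_borel_space[OF r])
  also have "\<dots> \<le> \<bar>\<integral>x. u x + M \<partial>\<sigma>\<bar>" by simp
  also have "\<dots> \<le> (2 * M) * measure \<sigma> UNIV" by (rule integral_abs_bound[OF s]) (use w(2) M in \<open>auto simp: abs_le_iff\<close>)
  finally have "rkhs_le k (Hk \<rho>) (2 * M * measure \<sigma> UNIV)" by (intro rkhs_le_mono[OF norm[OF r]])
  from rkhs_le_diff[OF this rkhs_le_scale[OF norm[OF s], of M]] show ?thesis unfolding eq using M0 by (simp add: algebra_simps)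
qed

text \<open>In the RKHS pairing, b \<mapsto> V b and b \<mapsto> H[V \<sigma>] are adjoint to each
  other, so that their difference is skew.\<close>

lemma skew_zero:
  fixes V :: "'a \<Rightarrow> real"
  assumes V: "cts V" and s: "fin_borel \<sigma>" and r: "fin_borel \<rho>"
  shows "(\<integral>y. V y * Hk \<sigma> y \<partial>\<rho>) = (\<integral>x. (\<integral>y. V y * k y x \<partial>\<rho>) \<partial>\<sigma>)"
proof -
  have "(\<integral>y. V y * Hk \<sigma> y \<partial>\<rho>) = (\<integral>y. \<integral>x. k x y * V y \<partial>\<sigma> \<partial>\<rho>)"
    unfolding Hk_def by (subst integral_mult_right_zero[symmetric]) (simp add: mult.commute)
  also have "\<dots> = (\<integral>x. \<integral>y. k x y * V y \<partial>\<rho> \<partial>\<sigma>)"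
    by (rule integral_swap[OF _ s r]) (intro continuous_on_mult k_cont continuous_on_compose2[OF V] continuous_on_snd continuous_on_id, auto)
  finally show ?thesis by (simp add: mult.commute k_sym)
qed

text \<open>For the derivative \<open>d\<close> of \<open>B \<mu>\<close>, the pressure is \<open>p = - multiplier V \<mu> d / B \<mu>\<close>.\<close>
definition multiplier :: "('a \<Rightarrow> real) \<Rightarrow> 'a measure \<Rightarrow> ('a \<Rightarrow> real) \<Rightarrow> 'a \<Rightarrow> real" where
  "multiplier V \<mu> d x = \<epsilon> / 2 * d x + V x * B \<mu> x - (\<integral>z. V z * k z x \<partial>Sg \<mu>)"

lemma multiplier_cont: "\<mu> \<in> Probs \<Longrightarrow> cts d \<Longrightarrow> cts V \<Longrightarrow> cts (multiplier V \<mu> d)"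
  unfolding multiplier_def by (intro continuous_intros B_cont weighted_cont Sg_fin_borel)

text \<open>The V terms cancel for \<nu> = \<mu>, and for two measures they cancel after adding the
  identity with the roles exchanged.\<close>

lemma multiplier_integral:
  assumes m: "\<mu> \<in> Probs" and n: "\<nu> \<in> Probs" and d: "cts d" and V: "cts V"
  shows "(\<integral>x. multiplier V \<mu> d x \<partial>Sg \<nu>) = \<epsilon> / 2 * (\<integral>x. d x \<partial>Sg \<nu>) + (\<integral>x. V x * B \<mu> x \<partial>Sg \<nu>) - (\<integral>x. V x * B \<nu> x \<partial>Sg \<mu>)"
proof -
  note i = integrable_continuous[OF Sg_fin_borel[OF n]]
  have "(\<integral>x. multiplier V \<mu> d x \<partial>Sg \<nu>) = \<epsilon> / 2 * (\<integral>x. d x \<partial>Sg \<nu>) + (\<integral>x. V x * B \<mu> x \<partial>Sg \<nu>) - (\<integral>x. (\<integral>z. V z * k z x \<partial>Sg \<mu>) \<partial>Sg \<nu>)"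
    unfolding multiplier_def
    using i[OF continuous_on_mult[OF V B_cont[OF m]]] i[OF d] i[OF weighted_cont[OF V Sg_fin_borel[OF m]]] by simp
  then show ?thesis using skew_zero[OF V Sg_fin_borel[OF n] Sg_fin_borel[OF m]] by (simp add: Hk_Sg[OF n])
qed

end

section \<open>Equivalence of the flow equation with the complementarity problem\<close>

context prob_curve
begin

text \<open>For t > 0 the filter \<open>at t within {0..}\<close> is the two-sided one, so a tangent
  functional is determined on the RKHS of \<open>kmu\<close>.\<close>

lemma tangent_imp_eq:
  assumes t: "t > 0" and D: "tangent \<epsilon> c \<mu> t D" and \<phi>: "in_rkhs k (\<lambda>x. B (\<mu> t) x * \<phi> x)"
    and E: "((\<lambda>s. \<integral>x. \<phi> x \<partial>\<mu> s) has_real_derivative E) (at t)"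
  shows "D \<phi> = E"
proof -
  have "((\<lambda>s. \<integral>x. \<phi> x \<partial>\<mu> s) has_real_derivative D \<phi>) (at t within {0..})"
    using D \<phi> unfolding tangent_def in_rkhs_kmu by blast
  moreover have "at t within {0..} = at t" using t by (intro at_within_interior) simp
  ultimately show ?thesis using DERIV_unique E by simp
qed

text \<open>On the RKHS of \<open>kmu\<close> the product rule provides the derivative and its
  bound: one term is controlled by the lower bound \<kappa> of B and the mass of \<sigma>, the other
  is an RKHS pairing.\<close>

lemma tangent_exists:
  assumes t: "t > 0" and w: "wder \<mu> t d M"
  shows "tangent \<epsilon> c \<mu> t (\<lambda>\<phi>. THE D. ((\<lambda>s. \<integral>x. \<phi> x \<partial>\<mu> s) has_real_derivative D) (at t))" (is "tangent _ _ _ _ ?D")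
proof -
  have Pt: "\<mu> t \<in> Probs" using t by (intro P) simp
  have dM: "rkhs_le k d M" using w unfolding wder_def by blast
  have M: "M \<ge> 0" by (rule rkhs_le_nonneg[OF dM])
  have dB: "\<bar>d x\<bar> \<le> M" for x by (rule rkhs_le_bound[OF dM])
  have key: "((\<lambda>s. \<integral>x. \<phi> x \<partial>\<mu> s) has_real_derivative ?D \<phi>) (at t) \<and> \<bar>?D \<phi>\<bar> \<le> (M / \<kappa> * (1 / \<kappa>) + M) * N"
    if \<phi>: "rkhs_le k (\<lambda>x. B (\<mu> t) x * \<phi> x) N" for \<phi> N
  proof -
    obtain E where E: "((\<lambda>s. \<integral>x. B (\<mu> t) x * \<phi> x \<partial>Sg (\<mu> s)) has_real_derivative E) (at t)" "\<bar>E\<bar> \<le> N * M"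
      by (rule wder_derivative[OF t w \<phi>]) (rule that)
    note W = wder_tangent[OF t w \<phi> E(1)]
    have eq: "?D \<phi> = (\<integral>x. \<phi> x * d x \<partial>Sg (\<mu> t)) + E" by (rule the_equality[of "\<lambda>D. ((\<lambda>s. \<integral>x. \<phi> x \<partial>\<mu> s) has_real_derivative D) (at t)", OF W(1)]) (rule DERIV_unique[OF _ W(1)])
    have "\<bar>\<phi> x * d x\<bar> \<le> N / \<kappa> * M" for x
    proof -
      have "\<kappa> * \<bar>\<phi> x\<bar> \<le> B (\<mu> t) x * \<bar>\<phi> x\<bar>" using Sg_mass(3)[OF Pt] by (intro mult_right_mono) auto
      also have "\<dots> \<le> N" using rkhs_le_bound[OF \<phi>, of x] B_pos[of "\<mu> t" x] by (simp add: abs_mult)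
      finally have "\<bar>\<phi> x\<bar> \<le> N / \<kappa>" using \<kappa>_pos by (simp add: field_simps)
      then show ?thesis unfolding abs_mult using dB[of x] by (intro mult_mono) (auto intro: order_trans[OF abs_ge_zero])
    qed
    then have "\<bar>\<integral>x. \<phi> x * d x \<partial>Sg (\<mu> t)\<bar> \<le> N / \<kappa> * M * measure (Sg (\<mu> t)) UNIV" by (rule integral_abs_bound[OF Sg_fin_borel[OF Pt]])
    also have "\<dots> \<le> N / \<kappa> * M * (1 / \<kappa>)" using Sg_mass(4)[OF Pt] rkhs_le_nonneg[OF \<phi>] M \<kappa>_pos by (intro mult_left_mono) auto
    finally show ?thesis using W(1) E(2) unfolding eq by (auto simp: algebra_simps)
  qed
  show ?thesis unfolding tangent_def in_rkhs_kmu rkhs_norm_kmu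
  proof (intro conjI allI impI exI[of _ "M / \<kappa> * (1 / \<kappa>) + M"])
    fix \<phi> assume "in_rkhs k (\<lambda>x. B (\<mu> t) x * \<phi> x)"
    from key[OF in_rkhs_imp_le[OF this]]
    show "((\<lambda>s. \<integral>x. \<phi> x \<partial>\<mu> s) has_real_derivative ?D \<phi>) (at t within {0..})"
      "\<bar>?D \<phi>\<bar> \<le> (M / \<kappa> * (1 / \<kappa>) + M) * rkhs_norm k (\<lambda>x. B (\<mu> t) x * \<phi> x)"
      using has_field_derivative_at_within by blast+
  qed
qed

text \<open>B times a section of \<open>kmu\<close> is a multiple of a section of k. So in the
  product rule the \<sigma> part is d / B and the B part is K (d / B): the Riesz map of the tangent
  is (Id + K) (d / B).\<close>

lemma Hmu_eq:
  assumes t: "t > 0" and w: "wder \<mu> t d M" and D: "tangent \<epsilon> c \<mu> t D"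
  shows "Hmu \<epsilon> c (\<mu> t) D y = d y / B (\<mu> t) y + K (\<mu> t) (\<lambda>x. d x / B (\<mu> t) x) y"
proof -
  have Pt: "\<mu> t \<in> Probs" using t by (intro P) simp
  have dM: "rkhs_le k d M" using w unfolding wder_def by blast
  define \<phi> where "\<phi> x = kmu \<epsilon> c (\<mu> t) x y" for x
  have e: "(\<lambda>x. B (\<mu> t) x * \<phi> x) = (\<lambda>x. (1 / B (\<mu> t) y) * k y x)"
    by (simp add: \<phi>_def kmu_eq B_nz k_sym fun_eq_iff)
  have "rkhs_le k (\<lambda>x. k y x) (sqrt (k y y))"
    using rkhs_le_span[of "{y}" "\<lambda>_. 1"] by (simp add: kquad_def)
  from rkhs_le_scale[OF this, of "1 / B (\<mu> t) y"] obtain N where N: "rkhs_le k (\<lambda>x. B (\<mu> t) x * \<phi> x) N" unfolding e by blast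
  have "((\<lambda>s. B (\<mu> s) y / B (\<mu> t) y) has_real_derivative d y / B (\<mu> t) y) (at t)"
    by (intro DERIV_cdivide wder_pointwise[OF w])
  then have "((\<lambda>s. \<integral>x. B (\<mu> t) x * \<phi> x \<partial>Sg (\<mu> s)) has_real_derivative d y / B (\<mu> t) y) (at t)"
  proof (rule has_field_derivative_transform_within_open[of _ _ _ "{0<..}"])
    fix s :: real assume "s \<in> {0<..}"
    then have "\<mu> s \<in> Probs" by (intro P) simp
    then show "B (\<mu> s) y / B (\<mu> t) y = (\<integral>x. B (\<mu> t) x * \<phi> x \<partial>Sg (\<mu> s))"
      unfolding e by (simp add: Hk_Sg[symmetric] Hk_def k_sym)
  qed (use t in auto)
  from wder_tangent(1)[OF t w N this]
  have "D \<phi> = (\<integral>x. \<phi> x * d x \<partial>Sg (\<mu> t)) + d y / B (\<mu> t) y"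
    by (rule tangent_imp_eq[OF t D, rotated]) (use N in_rkhs_iff in blast)
  moreover have "(\<integral>x. \<phi> x * d x \<partial>Sg (\<mu> t)) = K (\<mu> t) (\<lambda>x. d x / B (\<mu> t) x) y"
  proof -
    have "cts (\<lambda>x. d x / B (\<mu> t) x)" using continuous_on_mult[OF rkhs_le_cont[OF dM] B_inverse_cont[OF Pt]] by simp
    then have "K (\<mu> t) (\<lambda>x. d x / B (\<mu> t) x) y = (\<integral>x. d x / B (\<mu> t) x * k x y \<partial>Sg (\<mu> t)) / B (\<mu> t) y" by (rule Kop_eq[OF Pt])
    also have "\<dots> = (\<integral>x. \<phi> x * d x \<partial>Sg (\<mu> t))"
      unfolding integral_divide_zero[symmetric] by (simp add: \<phi>_def kmu_eq mult_ac)
    finally show ?thesis by simp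
  qed
  ultimately show ?thesis unfolding Hmu_def \<phi>_def by simp
qed

lemma Hmu_potential:
  assumes "t > 0" "wder \<mu> t d M" "tangent \<epsilon> c \<mu> t D"
  shows "cts (\<lambda>x. d x / B (\<mu> t) x)"
    "Hmu \<epsilon> c (\<mu> t) D = (\<lambda>x. d x / B (\<mu> t) x + K (\<mu> t) (\<lambda>x. d x / B (\<mu> t) x) x)"
    "cts (Hmu \<epsilon> c (\<mu> t) D)"
proof -
  have Pt: "\<mu> t \<in> Probs" using assms(1) by (intro P) simp
  have "cts d" using assms(2) rkhs_le_cont unfolding wder_def by blast
  from continuous_on_mult[OF this B_inverse_cont[OF Pt]] show hc: "cts (\<lambda>x. d x / B (\<mu> t) x)" by simp
  show u: "Hmu \<epsilon> c (\<mu> t) D = (\<lambda>x. d x / B (\<mu> t) x + K (\<mu> t) (\<lambda>x. d x / B (\<mu> t) x) x)"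
    using Hmu_eq[OF assms] by (simp add: fun_eq_iff)
  show "cts (Hmu \<epsilon> c (\<mu> t) D)" unfolding u by (intro continuous_on_add hc Kop_cont[OF Pt])
qed

text \<open>With h = d / B, the factor Id + K cancels from (Id - K^2) v = (Id + K) h + C' and leaves
  (Id - K) v = h + C' / 2. Inserting v from the flow equation, where K p = 0, expresses the
  multiplier by - p B up to a multiple of C' B.\<close>

lemma flow_equation_imp_multiplier:
  assumes t: "t > 0" and w: "wder \<mu> t d M" and D: "tangent \<epsilon> c \<mu> t D" and V: "cts V"
    and p: "p \<in> Press (\<mu> t)" and eq: "\<And>x. \<epsilon> / 2 * Kinv \<epsilon> c (\<mu> t) (Hmu \<epsilon> c (\<mu> t) D) x + V x + p x = C"
  shows "0 \<le> multiplier V (\<mu> t) d x" "(\<integral>x. multiplier V (\<mu> t) d x \<partial>Sg (\<mu> t)) = 0"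
proof -
  have Pt: "\<mu> t \<in> Probs" using t by (intro P) simp
  let ?B = "B (\<mu> t)" and ?K = "K (\<mu> t)"
  have dc: "cts d" using w rkhs_le_cont unfolding wder_def by blast
  note pc = Press_zero(1)[OF Pt p] and p0 = Press_zero(2)[OF Pt p]
  define h where "h x = d x / ?B x" for x
  note hc = Hmu_potential(1)[OF t w D, folded h_def[abs_def]] and u = Hmu_potential(2)[OF t w D, folded h_def h_def[abs_def]]
    and uc = Hmu_potential(3)[OF t w D]
  define v where "v = Kinv \<epsilon> c (\<mu> t) (Hmu \<epsilon> c (\<mu> t) D)"
  have vc: "cts v" unfolding v_def by (rule Kinv_spec(1)[OF Pt uc])
  obtain C' where C': "\<And>x. v x - ?K (?K v) x = h x + ?K h x + C'" using Kinv_spec(2)[OF Pt uc] unfolding v_def[symmetric] by (auto simp: u)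
  \<comment> \<open>The defect of the cancelled equation satisfies z + K z = 0; half of C' appears
    because Id + K doubles constants.\<close>
  define z where "z x = v x - ?K v x - h x - C' / 2" for x
  have zc: "cts z" unfolding z_def by (intro continuous_intros vc Kop_cont[OF Pt] hc)
  have "?K z x = ?K v x - ?K (?K v) x - ?K h x - C' / 2" for x
  proof -
    have c1: "cts (\<lambda>x. 1 * v x + (-1) * ?K v x)" by (intro continuous_intros vc Kop_cont[OF Pt])
    have c2: "cts (\<lambda>x. 1 * h x + (C'/2) * 1)" by (intro continuous_intros hc)
    have "z = (\<lambda>x. 1 * (1 * v x + (-1) * ?K v x) + (-1) * (1 * h x + (C'/2) * 1))" by (simp add: z_def fun_eq_iff)
    then have "?K z x = 1 * ?K (\<lambda>x. 1 * v x + (-1) * ?K v x) x + (-1) * ?K (\<lambda>x. 1 * h x + (C'/2) * 1) x"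
      using Kop_linear[OF Pt c1 c2, of 1 "-1" x] by simp
    then show ?thesis
      using Kop_linear[OF Pt vc Kop_cont[OF Pt vc], of 1 "-1" x] Kop_linear[OF Pt hc continuous_on_const, of 1 "C'/2" 1 x] Kop_const[OF Pt, of 1 x] by simp
  qed
  then have "z x + ?K z x = 0" for x using C'[of x] by (simp add: z_def)
  from Kop_antifixed[OF Pt zc this] have z0: "z x = 0" for x .
  have vK: "v x - ?K v x = h x + C' / 2" for x using z0[of x] unfolding z_def by linarith
  define \<alpha> where "\<alpha> = 2 / \<epsilon>"
  have \<alpha>: "\<epsilon> / 2 * (\<alpha> * y) = y" "\<alpha> * (\<epsilon> / 2 * y) = y" for y using eps_pos by (simp_all add: \<alpha>_def)
  note pAE = Press_zero(3)[OF Pt p] and Kp = Press_zero(4)[OF Pt p]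
  have pB: "(\<integral>x. p x * ?B x \<partial>Sg (\<mu> t)) = 0"
    unfolding Sg_integral_B[OF Pt pc] by (rule integral_eq_zero_AE[OF pAE])
  have veq: "v = (\<lambda>x. \<alpha> * (C * 1 + (-1) * V x) + (- \<alpha>) * p x)"
  proof
    fix x
    have e: "\<epsilon> / 2 * v x = C - V x - p x" using eq[of x] by (simp add: v_def[symmetric])
    have "v x = \<alpha> * (C - V x - p x)" using \<alpha>(2)[of "v x"] unfolding e by simp
    then show "v x = \<alpha> * (C * 1 + (-1) * V x) + (- \<alpha>) * p x" by (simp add: algebra_simps)
  qed
  have cV: "cts (\<lambda>x. C * 1 + (-1) * V x)" by (intro continuous_intros V)
  have Kv: "?K v x = \<alpha> * (C - ?K V x)" for x
    unfolding veq Kop_linear[OF Pt cV pc] Kop_linear[OF Pt continuous_on_const V] by (simp add: Kp Kop_const[OF Pt])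
  have q: "multiplier V (\<mu> t) d x = - p x * ?B x - \<epsilon> / 4 * C' * ?B x" for x
  proof -
    have "\<alpha> * (?K V x - V x - p x) = h x + C' / 2" using vK[of x] unfolding Kv by (simp add: veq algebra_simps)
    then have "?K V x - V x - p x = \<epsilon> / 2 * (h x + C' / 2)" using \<alpha>(1)[of "?K V x - V x - p x"] by simp
    then have "\<epsilon> / 2 * h x = ?K V x - V x - p x - \<epsilon> / 4 * C'" by (simp add: algebra_simps)
    then have "\<epsilon> / 2 * h x * ?B x = (?K V x - V x - p x - \<epsilon> / 4 * C') * ?B x" by simp
    then have "\<epsilon> / 2 * d x = ?K V x * ?B x - V x * ?B x - p x * ?B x - \<epsilon> / 4 * C' * ?B x"
      using B_nz[of "\<mu> t" x] by (simp add: h_def algebra_simps)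
    moreover have "?K V x * ?B x = (\<integral>z. V z * k z x \<partial>Sg (\<mu> t))" using B_nz[of "\<mu> t" x] by (simp add: Kop_eq[OF Pt V])
    ultimately show ?thesis unfolding multiplier_def by (simp add: field_simps)
  qed
  show q0: "(\<integral>x. multiplier V (\<mu> t) d x \<partial>Sg (\<mu> t)) = 0"
    unfolding multiplier_integral[OF Pt Pt dc V] using wder_orthogonal[OF t w] by simp
  have "(\<integral>x. multiplier V (\<mu> t) d x \<partial>Sg (\<mu> t)) = - (\<integral>x. p x * ?B x \<partial>Sg (\<mu> t)) - \<epsilon> / 4 * C' * (\<integral>x. ?B x \<partial>Sg (\<mu> t))"
    unfolding q using integrable_continuous[OF Sg_fin_borel[OF Pt] continuous_on_mult[OF pc B_cont[OF Pt]]] integrable_continuous[OF Sg_fin_borel[OF Pt] B_cont[OF Pt]]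
    by simp
  \<comment> \<open>Integration against \<open>Sg (\<mu> t)\<close> kills the multiplier and the
    pressure term, while \<integral> B d\<sigma> = 1 isolates C'.\<close>
  then have "C' = 0" using q0 pB B_norm[OF Pt] eps_pos by simp
  then show "0 \<le> multiplier V (\<mu> t) d x" unfolding q using p0[of x] B_pos[of "\<mu> t" x] by (simp add: mult_nonpos_nonneg)
qed

text \<open>The integral of q against \<sigma> vanishes by orthogonality of d and skewness, so p = -
  q / B vanishes on the support. Then v = - (2 / \<epsilon>) (V + p) solves (Id - K^2) v = Hmu D,
  and uniqueness modulo constants identifies it with \<open>Kinv\<close>.\<close>

lemma multiplier_imp_flow_equation:
  assumes t: "t > 0" and w: "wder \<mu> t d M" and D: "tangent \<epsilon> c \<mu> t D" and V: "cts V"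
    and q: "\<And>x. 0 \<le> multiplier V (\<mu> t) d x"
  obtains p C where "p \<in> Press (\<mu> t)" "\<And>x. \<epsilon> / 2 * Kinv \<epsilon> c (\<mu> t) (Hmu \<epsilon> c (\<mu> t) D) x + V x + p x = C"
    "\<And>x. p x = - multiplier V (\<mu> t) d x / B (\<mu> t) x"
    "\<And>x. B (\<mu> t) x * (V x + p x) = (\<integral>z. V z * k z x \<partial>Sg (\<mu> t)) - \<epsilon> / 2 * d x"
proof -
  have Pt: "\<mu> t \<in> Probs" using t by (intro P) simp
  let ?B = "B (\<mu> t)" and ?K = "K (\<mu> t)" and ?q = "multiplier V (\<mu> t) d"
  have dc: "cts d" using w rkhs_le_cont unfolding wder_def by blast
  note qc = multiplier_cont[OF Pt dc V]
  define p where "p x = - ?q x / ?B x" for x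
  have pc: "cts p" unfolding p_def using continuous_on_mult[OF continuous_on_minus[OF qc] B_inverse_cont[OF Pt]] by simp
  have qB: "cts (\<lambda>x. ?q x / ?B x)" using continuous_on_mult[OF qc B_inverse_cont[OF Pt]] by simp
  have "(\<integral>x. ?q x \<partial>Sg (\<mu> t)) = 0"
    unfolding multiplier_integral[OF Pt Pt dc V] using wder_orthogonal[OF t w] by simp
  then have q0: "(\<integral>x. ?q x / ?B x \<partial>\<mu> t) = 0" by (simp add: Sg_integral[OF Pt qc])
  have "?q x / ?B x = 0" if "x \<in> msupp (\<mu> t)" for x
    by (rule vanishes_on_msupp[OF Probs_fin_borel[OF Pt] qB _ q0 that]) (use q B_pos in \<open>simp add: less_imp_le\<close>)
  then have ps: "p x = 0" if "x \<in> msupp (\<mu> t)" for x using that by (simp add: p_def)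
  have Pr: "p \<in> Press (\<mu> t)" unfolding Press_def using pc ps q B_pos by (auto simp: p_def less_imp_le)
  note Kp = Press_zero(4)[OF Pt Pr]
  have Bp: "?B x * (V x + p x) = (\<integral>z. V z * k z x \<partial>Sg (\<mu> t)) - \<epsilon> / 2 * d x" for x
    using B_nz[of "\<mu> t" x] by (simp add: p_def multiplier_def distrib_left)
  define h where "h x = d x / ?B x" for x
  note hc = Hmu_potential(1)[OF t w D, folded h_def[abs_def]] and u = Hmu_potential(2)[OF t w D, folded h_def h_def[abs_def]]
    and uc = Hmu_potential(3)[OF t w D]
  define \<alpha> where "\<alpha> = 2 / \<epsilon>"
  have \<alpha>: "\<epsilon> / 2 * (\<alpha> * y) = y" "\<alpha> * (\<epsilon> / 2 * y) = y" for y using eps_pos by (simp_all add: \<alpha>_def)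
  define v where "v x = (- \<alpha>) * V x + (- \<alpha>) * p x" for x
  have vc: "cts v" unfolding v_def by (intro continuous_intros V pc)
  have Kv: "?K v x = (- \<alpha>) * ?K V x" for x
    unfolding v_def Kop_linear[OF Pt V pc] by (simp add: Kp)
  have vKv: "1 * v x + (-1) * ?K v x = h x" for x
  proof -
    have "?K V x * ?B x = (\<integral>z. V z * k z x \<partial>Sg (\<mu> t))" using B_nz[of "\<mu> t" x] by (simp add: Kop_eq[OF Pt V])
    then have "(V x + p x - ?K V x) * ?B x = - (\<epsilon> / 2) * d x" using Bp[of x] by (simp add: algebra_simps)
    also have "\<dots> = (- (\<epsilon> / 2) * h x) * ?B x" using B_nz[of "\<mu> t" x] by (simp add: h_def)
    finally have "V x + p x - ?K V x = - (\<epsilon> / 2) * h x" using B_nz[of "\<mu> t" x] mult_right_cancel by blast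
    then have "(- \<alpha>) * (V x + p x - ?K V x) = h x" using \<alpha>(2)[of "h x"] by simp
    then show ?thesis unfolding Kv v_def by (simp add: algebra_simps)
  qed
  have "v x - ?K (?K v) x = Hmu \<epsilon> c (\<mu> t) D x + 0" for x
  proof -
    have "?K h x = ?K v x - ?K (?K v) x" using Kop_linear[OF Pt vc Kop_cont[OF Pt vc], of 1 "-1" x] unfolding vKv by simp
    then show ?thesis using vKv[of x] by (simp add: u)
  qed
  then obtain r where r: "Kinv \<epsilon> c (\<mu> t) (Hmu \<epsilon> c (\<mu> t) D) = (\<lambda>x. v x + r)" by (rule Kinv_unique[OF Pt uc vc])
  show ?thesis
  proof (rule that[OF Pr])
    show "\<epsilon> / 2 * Kinv \<epsilon> c (\<mu> t) (Hmu \<epsilon> c (\<mu> t) D) x + V x + p x = \<epsilon> / 2 * r" for x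
      unfolding r v_def using \<alpha>(1)[of "V x"] \<alpha>(1)[of "p x"] by (simp only: distrib_left)
  qed (use Bp in \<open>simp_all add: p_def\<close>)
qed

end

section \<open>Non-expansiveness and uniqueness of flows\<close>

context sinkhorn
begin

text \<open>Complementarity, \<integral> q d\<sigma> = 0, is implied through
  \<open>wder_orthogonal\<close> and skewness. The bounds M + 1 and M are those of
  \<open>AE_wder\<close>.\<close>

definition flow_at :: "('a \<Rightarrow> real) \<Rightarrow> (real \<Rightarrow> 'a measure) \<Rightarrow> real \<Rightarrow> ('a \<Rightarrow> real) \<Rightarrow> real \<Rightarrow> bool" where
  "flow_at V \<mu> t d M \<longleftrightarrow> wder \<mu> t d (M + 1) \<and> rkhs_le k d M \<and> (\<forall>x. 0 \<le> multiplier V (\<mu> t) d x)"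

lemma admissible_iff: "admissible \<epsilon> c \<mu> \<longleftrightarrow> (\<exists>m. adm_curve \<epsilon> c \<mu> m)"
proof
  assume "admissible \<epsilon> c \<mu>"
  then have P: "\<forall>t\<ge>0. \<mu> t \<in> Probs" and "\<exists>m::real \<Rightarrow> real. (\<forall>T. m absolutely_integrable_on {0..T} \<and> (\<lambda>t. (m t)\<^sup>2) integrable_on {0..T}) \<and>
      (\<forall>s t. 0 \<le> s \<longrightarrow> s \<le> t \<longrightarrow> dist_B (\<mu> t) (\<mu> s) \<le> integral {s..t} m)"
    unfolding admissible_def dist_B_def by (rule conjunct1, rule conjunct2)
  then obtain m :: "real \<Rightarrow> real" where m: "\<forall>T. m absolutely_integrable_on {0..T} \<and> (\<lambda>t. (m t)\<^sup>2) integrable_on {0..T}"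
    "\<forall>s t. 0 \<le> s \<longrightarrow> s \<le> t \<longrightarrow> dist_B (\<mu> t) (\<mu> s) \<le> integral {s..t} m" by (elim exE conjE)
  have "adm_curve \<epsilon> c \<mu> m" by unfold_locales (use P m in auto)
  then show "\<exists>m. adm_curve \<epsilon> c \<mu> m" by blast
next
  assume "\<exists>m. adm_curve \<epsilon> c \<mu> m"
  then obtain m where "adm_curve \<epsilon> c \<mu> m" by blast
  then interpret adm_curve \<epsilon> c \<mu> m .
  show "admissible \<epsilon> c \<mu>" unfolding admissible_def dist_B_def[symmetric]
    using P m_int m_sq m_dist by (intro conjI exI[of _ m]) auto
qed

lemma sinkhorn_flow_iff:
  assumes A: "adm_curve \<epsilon> c \<mu> m" and V: "cts V"
  shows "sinkhorn_flow \<epsilon> c V \<nu> \<mu> \<longleftrightarrow> \<mu> 0 = \<nu> \<and> (AE t in lborel. t > 0 \<longrightarrow> (\<exists>d. flow_at V \<mu> t d (m t)))"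
proof -
  interpret adm_curve \<epsilon> c \<mu> m by (rule A)
  let ?D = "\<lambda>t D. \<exists>p\<in>Press (\<mu> t). \<exists>C. \<forall>x. \<epsilon> / 2 * Kinv \<epsilon> c (\<mu> t) (Hmu \<epsilon> c (\<mu> t) D) x + V x + p x = C"
  have "(AE t in lborel. t \<ge> 0 \<longrightarrow> (\<exists>D. tangent \<epsilon> c \<mu> t D \<and> ?D t D)) \<longleftrightarrow> (AE t in lborel. t > 0 \<longrightarrow> (\<exists>d. flow_at V \<mu> t d (m t)))" (is "?L \<longleftrightarrow> ?R")
  proof
    assume ?L
    then show ?R using AE_wder
    proof eventually_elim
      case (elim t)
      show ?case
      proof
        assume t: "t > 0"
        then obtain d where d: "wder \<mu> t d (m t + 1)" "rkhs_le k d (m t)" using elim(2) by blast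
        obtain D p C where D: "tangent \<epsilon> c \<mu> t D" "p \<in> Press (\<mu> t)"
          "\<And>x. \<epsilon> / 2 * Kinv \<epsilon> c (\<mu> t) (Hmu \<epsilon> c (\<mu> t) D) x + V x + p x = C" using elim(1) t by (meson less_imp_le)
        have "0 \<le> multiplier V (\<mu> t) d x" for x by (rule flow_equation_imp_multiplier(1)[OF t d(1) D(1) V D(2,3)])
        then show "\<exists>d. flow_at V \<mu> t d (m t)" using d unfolding flow_at_def by blast
      qed
    qed
  next
    assume ?R
    \<comment> \<open>Time 0, where a two-sided derivative is not at hand, is discarded as a null
      set.\<close>
    then show ?L using AE_lborel_singleton[of 0]
    proof eventually_elim
      case (elim t)
      show ?case
      proof
        assume "t \<ge> 0"
        then have t: "t > 0" using elim(2) by simp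
        then obtain d where d: "wder \<mu> t d (m t + 1)" "\<And>x. 0 \<le> multiplier V (\<mu> t) d x" using elim(1) unfolding flow_at_def by blast
        let ?T = "\<lambda>\<phi>. THE D. ((\<lambda>s. \<integral>x. \<phi> x \<partial>\<mu> s) has_real_derivative D) (at t)"
        have T: "tangent \<epsilon> c \<mu> t ?T" by (rule tangent_exists[OF t d(1)])
        obtain p C where "p \<in> Press (\<mu> t)" "\<And>x. \<epsilon> / 2 * Kinv \<epsilon> c (\<mu> t) (Hmu \<epsilon> c (\<mu> t) ?T) x + V x + p x = C"
          by (rule multiplier_imp_flow_equation[OF t d(1) T V d(2)]) (rule that)
        then show "\<exists>D. tangent \<epsilon> c \<mu> t D \<and> ?D t D" using T by blast
      qed
    qed
  qed
  then show ?thesis using A admissible_iff unfolding sinkhorn_flow_def by blast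
qed

text \<open>The multiplier of each flow is integrated against the measure of the other. The sum is
  nonnegative, and by skewness it is a positive multiple of minus the derivative of the squared
  distance.\<close>

lemma flow_dist_nonincreasing:
  assumes V: "cts V" and f1: "sinkhorn_flow \<epsilon> c V \<nu>1 \<mu>1" and f2: "sinkhorn_flow \<epsilon> c V \<nu>2 \<mu>2"
    and ab: "0 \<le> a" "a \<le> b"
  shows "dist_B (\<mu>1 b) (\<mu>2 b) \<le> dist_B (\<mu>1 a) (\<mu>2 a)"
proof -
  obtain m1 m2 where A1: "adm_curve \<epsilon> c \<mu>1 m1" and A2: "adm_curve \<epsilon> c \<mu>2 m2"
    using f1 f2 admissible_iff unfolding sinkhorn_flow_def by blast
  interpret C1: adm_curve \<epsilon> c \<mu>1 m1 by (rule A1)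
  interpret C2: adm_curve \<epsilon> c \<mu>2 m2 by (rule A2)
  have F1: "AE t in lborel. t > 0 \<longrightarrow> (\<exists>d. flow_at V \<mu>1 t d (m1 t))" and F2: "AE t in lborel. t > 0 \<longrightarrow> (\<exists>d. flow_at V \<mu>2 t d (m2 t))"
    using f1 f2 sinkhorn_flow_iff[OF A1 V] sinkhorn_flow_iff[OF A2 V] by auto
  have "(dist_B (\<mu>1 b) (\<mu>2 b))\<^sup>2 \<le> (dist_B (\<mu>1 a) (\<mu>2 a))\<^sup>2"
  proof (rule AC_nonincreasing[where F="\<lambda>t. (dist_B (\<mu>1 t) (\<mu>2 t))\<^sup>2" and G="\<lambda>t. 4 * (m1 t + m2 t)"])
    show "(\<lambda>t. 4 * (m1 t + m2 t)) absolutely_integrable_on {0..T}" for T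
      by (intro set_integrable_mult_right set_integral_add(1) C1.m_int C2.m_int)
    show "\<bar>(dist_B (\<mu>1 b) (\<mu>2 b))\<^sup>2 - (dist_B (\<mu>1 a) (\<mu>2 a))\<^sup>2\<bar> \<le> integral {a..b} (\<lambda>t. 4 * (m1 t + m2 t))" if "0 \<le> a" "a \<le> b" for a b
      by (rule dist_B_square_AC[OF A1 A2 that])
    show "AE t in lborel. t > 0 \<longrightarrow> (\<forall>D. ((\<lambda>t. (dist_B (\<mu>1 t) (\<mu>2 t))\<^sup>2) has_real_derivative D) (at t) \<longrightarrow> D \<le> 0)"
      using F1 F2
    proof eventually_elim
      case (elim t)
      show ?case
      proof (intro impI allI)
        fix D assume t: "t > 0" and D: "((\<lambda>t. (dist_B (\<mu>1 t) (\<mu>2 t))\<^sup>2) has_real_derivative D) (at t)"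
        obtain d1 d2 where d1: "wder \<mu>1 t d1 (m1 t + 1)" "\<And>x. 0 \<le> multiplier V (\<mu>1 t) d1 x"
          and d2: "wder \<mu>2 t d2 (m2 t + 1)" "\<And>x. 0 \<le> multiplier V (\<mu>2 t) d2 x"
          using elim t unfolding flow_at_def by blast
        have P1: "\<mu>1 t \<in> Probs" and P2: "\<mu>2 t \<in> Probs" using t C1.P C2.P by simp_all
        have c: "cts d1" "cts d2" using d1(1) d2(1) rkhs_le_cont unfolding wder_def by blast+
        define X Y where "X = (\<integral>x. d1 x \<partial>Sg (\<mu>2 t))" and "Y = (\<integral>x. d2 x \<partial>Sg (\<mu>1 t))"
        have D: "D = - 2 * (X + Y)" unfolding X_def Y_def
          by (rule DERIV_unique[OF D wder_pair_derivative[OF C1.prob_curve_axioms C2.prob_curve_axioms t d1(1) d2(1)]])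
        have "0 \<le> (\<integral>x. multiplier V (\<mu>1 t) d1 x \<partial>Sg (\<mu>2 t)) + (\<integral>x. multiplier V (\<mu>2 t) d2 x \<partial>Sg (\<mu>1 t))"
          using d1(2) d2(2) by (intro add_nonneg_nonneg Bochner_Integration.integral_nonneg)
        then have "0 \<le> \<epsilon> / 2 * (X + Y)"
          unfolding multiplier_integral[OF P1 P2 c(1) V] multiplier_integral[OF P2 P1 c(2) V] X_def[symmetric] Y_def[symmetric] distrib_left
          by linarith
        then have "0 \<le> X + Y" using eps_pos zero_le_mult_iff[of "\<epsilon> / 2" "X + Y"] by linarith
        then show "D \<le> 0" unfolding D by simp
      qed
    qed
  qed (use ab in auto)
  then show ?thesis
    by (rule power2_le_imp_le[OF _ dist_B_nonneg[OF C1.P[OF ab(1)] C2.P[OF ab(1)]]])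
qed

lemma flow_unique:
  assumes V: "cts V" and f1: "sinkhorn_flow \<epsilon> c V \<nu> \<mu>1" and f2: "sinkhorn_flow \<epsilon> c V \<nu> \<mu>2" and t: "t \<ge> 0"
  shows "\<mu>1 t = \<mu>2 t"
proof -
  have P: "\<mu>1 t \<in> Probs" "\<mu>2 t \<in> Probs" "\<nu> \<in> Probs" using f1 f2 t unfolding sinkhorn_flow_def admissible_def by auto
  have "dist_B \<nu> \<nu> \<le> 0" by (rule dist_B_le) (simp add: rkhs_le_def)
  then have "dist_B (\<mu>1 t) (\<mu>2 t) \<le> 0"
    using flow_dist_nonincreasing[OF V f1 f2, of 0 t] t f1 f2 unfolding sinkhorn_flow_def by simp
  then have "rkhs_le k (\<lambda>x. B (\<mu>1 t) x - B (\<mu>2 t) x) 0" using dist_B_rkhs[OF P(1,2)] rkhs_le_mono by blast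
  from rkhs_le_bound[OF this] have "B (\<mu>1 t) = B (\<mu>2 t)" by (simp add: fun_eq_iff)
  then show ?thesis by (rule B_inj[OF P(1,2)])
qed

end

section \<open>Energy along a flow\<close>

text \<open>On a uniform partition the rates at left end points exceed the integral by an error that
  telescopes to (\<Phi> a - \<Phi> b) times the mesh. The end point 0 is reached by continuity,
  because \<Phi> may be unbounded there.\<close>

lemma nonincreasing_rate_bound:
  fixes \<Phi> :: "real \<Rightarrow> real" and D :: "real \<Rightarrow> real \<Rightarrow> real"
  assumes tri: "\<And>a b c. 0 \<le> a \<Longrightarrow> a \<le> b \<Longrightarrow> b \<le> c \<Longrightarrow> D a c \<le> D a b + D b c"
    and refl: "\<And>a. 0 \<le> a \<Longrightarrow> D a a \<le> 0" and cont: "((\<lambda>s. D 0 s) \<longlongrightarrow> 0) (at_right 0)"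
    and rate: "\<And>s t. 0 < s \<Longrightarrow> s < t \<Longrightarrow> D s t \<le> \<Phi> s * (t - s)"
    and mono: "\<And>s t. 0 < s \<Longrightarrow> s \<le> t \<Longrightarrow> \<Phi> t \<le> \<Phi> s"
    and int: "\<And>T. \<Phi> integrable_on {0..T}" and ab: "0 \<le> a" "a \<le> b"
  shows "D a b \<le> integral {a..b} \<Phi>"
proof -
  have pos: "D a b \<le> integral {a..b} \<Phi>" if ab: "0 < a" "a < b" for a b
  proof -
    have I: "\<Phi> integrable_on {s..t}" if "0 < s" for s t
      using that by (intro integrable_on_subinterval[OF int[of t]]) auto
    have step: "D a b \<le> integral {a..b} \<Phi> + (\<Phi> a - \<Phi> b) * ((b - a) / real (Suc n))" for n
    proof -
      define h where "h = (b - a) / real (Suc n)"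
      have h: "h > 0" using ab by (simp add: h_def)
      have "D a (a + real j * h) \<le> integral {a..a + real j * h} \<Phi> + (\<Phi> a - \<Phi> (a + real j * h)) * h" for j
      proof (induction j)
        case 0 then show ?case using refl ab by simp
      next
        case (Suc j)
        define s t where "s = a + real j * h" and "t = a + real (Suc j) * h"
        have st: "0 < s" "s < t" "t - s = h" "a \<le> s" using ab h by (auto simp: s_def t_def algebra_simps add_pos_nonneg)
        have "\<Phi> t * h \<le> integral {s..t} \<Phi>"
        proof -
          have "integral {s..t} (\<lambda>_. \<Phi> t) \<le> integral {s..t} \<Phi>"
            by (rule integral_le) (use I mono st in auto)
          then show ?thesis using st by (simp add: mult.commute)
        qed
        moreover have "D s t \<le> \<Phi> s * h" using rate[OF st(1,2)] st by simp
        moreover have "D a t \<le> D a s + D s t" using tri[of a s t] ab st by simp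
        moreover have "integral {a..s} \<Phi> + integral {s..t} \<Phi> = integral {a..t} \<Phi>"
          using st I[of a t] ab by (intro Henstock_Kurzweil_Integration.integral_combine) auto
        ultimately show ?case using Suc unfolding s_def[symmetric] t_def[symmetric] left_diff_distrib by linarith
      qed
      from this[of "Suc n"] show ?thesis by (simp add: h_def)
    qed
    have "(\<lambda>n. (b - a) / real (Suc n)) \<longlonglongrightarrow> 0" by (intro LIMSEQ_Suc[OF tendsto_divide_0[OF tendsto_const]] filterlim_at_top_imp_at_infinity filterlim_real_sequentially)
    then have "(\<lambda>n. integral {a..b} \<Phi> + (\<Phi> a - \<Phi> b) * ((b - a) / real (Suc n))) \<longlonglongrightarrow> integral {a..b} \<Phi> + (\<Phi> a - \<Phi> b) * 0"
      by (intro tendsto_intros)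
    then show ?thesis using step by (auto intro: LIMSEQ_le_const)
  qed
  show ?thesis
  proof (cases "a = 0 \<and> 0 < b")
    case True
    have c: "continuous_on {0..b} (\<lambda>s. integral {0..s} \<Phi>)" by (rule indefinite_integral_continuous_1[OF int])
    have "((\<lambda>s. integral {0..s} \<Phi>) \<longlongrightarrow> integral {0..0} \<Phi>) (at 0 within {0..b})"
      by (rule continuous_on_def[THEN iffD1, rule_format, OF c]) (use True in auto)
    then have "((\<lambda>s. integral {0..s} \<Phi>) \<longlongrightarrow> integral {0..0} \<Phi>) (at_right 0)"
      using True by (simp add: at_within_Icc_at_right)
    from tendsto_diff[OF cont this] have "((\<lambda>s. D 0 s - integral {0..s} \<Phi>) \<longlongrightarrow> 0) (at_right 0)" by simp
    moreover have "\<forall>\<^sub>F s in at_right 0. D 0 b - integral {0..b} \<Phi> \<le> D 0 s - integral {0..s} \<Phi>"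
    proof (rule eventually_mono[OF eventually_at_right_real[of 0 b]])
      fix s assume s: "s \<in> {0<..<b}"
      then have "integral {0..s} \<Phi> + integral {s..b} \<Phi> = integral {0..b} \<Phi>"
        using int by (intro Henstock_Kurzweil_Integration.integral_combine) auto
      then show "D 0 b - integral {0..b} \<Phi> \<le> D 0 s - integral {0..s} \<Phi>" using pos[of s b] tri[of 0 s b] s by simp
    qed (use True in simp)
    ultimately have "D 0 b - integral {0..b} \<Phi> \<le> 0" by (rule tendsto_lowerbound) simp
    then show ?thesis using True by simp
  next
    case False
    then show ?thesis using ab pos[of a b] refl[of a] by (cases "a = b") auto
  qed
qed

text \<open>The constructed flow has a nonincreasing speed bound; by uniqueness, what is proved for
  it holds for the flow.\<close>

locale energy_curve = adm_curve \<epsilon> c \<mu> m for \<epsilon> and c :: "'a::metric_space \<Rightarrow> 'a \<Rightarrow> real" and \<mu> m +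
  fixes V :: "'a \<Rightarrow> real"
  assumes V: "cts V"
    and flow: "AE t in lborel. t > 0 \<longrightarrow> (\<exists>d. flow_at V \<mu> t d (m t))"
    and m_nonneg: "0 < t \<Longrightarrow> 0 \<le> m t"
    and m_mono: "0 < s \<Longrightarrow> s \<le> t \<Longrightarrow> m t \<le> m s"
begin

lemma dist_continuous: "0 \<le> t \<Longrightarrow> ((\<lambda>s. dist_B (\<mu> s) (\<mu> t)) \<longlongrightarrow> 0) (at t within {0..})"
proof -
  assume t: "0 \<le> t"
  have "continuous_on {0..t + 1} (\<lambda>s. integral {0..s} m)"
    by (rule indefinite_integral_continuous_1) (rule m_integrable, simp)
  then have "((\<lambda>s. integral {0..s} m) \<longlongrightarrow> integral {0..t} m) (at t within {0..t + 1})"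
    using t by (auto simp: continuous_on_def)
  moreover have "at t within {0..t + 1} = at t within {0..}"
    by (rule at_within_nhd[of t "{..<t + 1}"]) (use t in auto)
  ultimately have "((\<lambda>s. \<bar>integral {0..s} m - integral {0..t} m\<bar>) \<longlongrightarrow> \<bar>integral {0..t} m - integral {0..t} m\<bar>) (at t within {0..})"
    by (intro tendsto_intros) simp
  then have "((\<lambda>s. \<bar>integral {0..s} m - integral {0..t} m\<bar>) \<longlongrightarrow> 0) (at t within {0..})" by simp
  then show ?thesis
    by (rule Lim_null_comparison[rotated])
       (use t in \<open>auto simp: eventually_at_filter dist_B_nonneg[OF P P] intro!: always_eventually dist_B_primitive\<close>)
qed

text \<open>Continuity at every time is what later transports estimates from almost every time. E =
  \<integral> V B d\<sigma> pairs a weakly convergent measure with a uniformly convergent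
  function.\<close>

lemma energy_continuous: "0 \<le> t \<Longrightarrow> ((\<lambda>s. Energy V (\<mu> s)) \<longlongrightarrow> Energy V (\<mu> t)) (at t within {0..})"
proof -
  assume t: "0 \<le> t"
  have ev: "\<forall>\<^sub>F s in at t within {0..}. s \<ge> 0" by (simp add: eventually_at_filter)
  have q: "rkhs_le k (\<lambda>x. B (\<mu> s) x - B (\<mu> t) x) (dist_B (\<mu> s) (\<mu> t))" if "s \<ge> 0" for s
    by (rule dist_B_rkhs[OF P[OF that] P[OF t]])
  have lim: "((\<lambda>s. B (\<mu> s) x) \<longlongrightarrow> B (\<mu> t) x) (at t within {0..})" for x
  proof -
    have "((\<lambda>s. B (\<mu> s) x - B (\<mu> t) x) \<longlongrightarrow> 0) (at t within {0..})"
      by (rule Lim_null_comparison[OF _ dist_continuous[OF t]])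
         (use ev in eventually_elim, use rkhs_le_bound[OF q] in auto)
    then show ?thesis by (simp add: LIM_zero_iff)
  qed
  have evS: "\<forall>\<^sub>F s in at t within {0..}. fin_borel (Sg (\<mu> s)) \<and> measure (Sg (\<mu> s)) UNIV \<le> 1 / \<kappa>"
    using ev by eventually_elim (auto intro: Sg_fin_borel Sg_mass P)
  note Pt = P[OF t]
  have c: "cts (\<lambda>x. V x * B (\<mu> t) x)" by (intro continuous_intros V B_cont Pt)
  have W: "((\<lambda>s. \<integral>x. V x * B (\<mu> t) x \<partial>Sg (\<mu> s)) \<longlongrightarrow> (\<integral>x. V x * B (\<mu> t) x \<partial>Sg (\<mu> t))) (at t within {0..})"
  proof (rule weak_convergence[OF evS Sg_fin_borel[OF Pt] _ c])
    fix y show "((\<lambda>s. Hk (Sg (\<mu> s)) y) \<longlongrightarrow> Hk (Sg (\<mu> t)) y) (at t within {0..})"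
      unfolding Hk_Sg[OF Pt]
      by (rule Lim_transform_eventually[OF lim]) (use ev in eventually_elim, simp add: Hk_Sg P)
  qed
  obtain M where M: "M > 0" "\<And>x. \<bar>V x\<bar> \<le> M" by (rule continuous_bounded[OF V]) (rule that)
  have "((\<lambda>s. \<integral>x. V x * B (\<mu> s) x \<partial>Sg (\<mu> s)) \<longlongrightarrow> (\<integral>x. V x * B (\<mu> t) x \<partial>Sg (\<mu> t))) (at t within {0..})"
  proof (rule weak_strong[OF evS _ W _ c])
    show "\<forall>\<^sub>F s in at t within {0..}. cts (\<lambda>x. V x * B (\<mu> s) x)"
      using ev by eventually_elim (intro continuous_intros V B_cont P)
    show "uniform_limit UNIV (\<lambda>s x. V x * B (\<mu> s) x) (\<lambda>x. V x * B (\<mu> t) x) (at t within {0..})"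
    proof (rule uniform_limitI)
      fix e :: real assume e: "e > 0"
      then have "\<forall>\<^sub>F s in at t within {0..}. dist_B (\<mu> s) (\<mu> t) < e / M"
        using M(1) by (intro order_tendstoD(2)[OF dist_continuous[OF t]]) simp
      with ev show "\<forall>\<^sub>F s in at t within {0..}. \<forall>x\<in>UNIV. dist (V x * B (\<mu> s) x) (V x * B (\<mu> t) x) < e"
      proof eventually_elim
        case (elim s)
        have "dist (V x * B (\<mu> s) x) (V x * B (\<mu> t) x) < e" for x
        proof -
          have "dist (V x * B (\<mu> s) x) (V x * B (\<mu> t) x) = \<bar>V x\<bar> * \<bar>B (\<mu> s) x - B (\<mu> t) x\<bar>"
            by (simp add: dist_real_def abs_mult[symmetric] right_diff_distrib)
          also have "\<dots> \<le> M * dist_B (\<mu> s) (\<mu> t)" using M rkhs_le_bound[OF q[OF elim(1)]] by (intro mult_mono) auto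
          also have "\<dots> < e" using elim(2) M(1) by (simp add: pos_less_divide_eq mult.commute)
          finally show ?thesis .
        qed
        then show ?case by blast
      qed
    qed
  qed (use \<kappa>_pos in simp)
  then have "((\<lambda>s. \<integral>x. V x * B (\<mu> s) x \<partial>Sg (\<mu> s)) \<longlongrightarrow> Energy V (\<mu> t)) (at t within {0..})"
    by (simp add: Sg_integral_B[OF Pt V] Energy_def)
  then show ?thesis
    by (rule Lim_transform_eventually) (use ev in eventually_elim, simp add: Sg_integral_B[OF P V] Energy_def)
qed

text \<open>\<phi> = V + p lies below V and has the same integral under \<mu> t, so the energy
  difference is at most the difference of the integrals of \<phi>. By the flow equation B \<phi> =
  H[V \<sigma>] - (\<epsilon> / 2) d lies in the RKHS with a norm affine in \<open>m t\<close>,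
  which bounds that difference by the distance of the potentials.\<close>

lemma energy_lower_bound:
  obtains L where "L \<ge> 0" "\<And>t d \<nu>. 0 < t \<Longrightarrow> flow_at V \<mu> t d (m t) \<Longrightarrow> \<nu> \<in> Probs \<Longrightarrow>
     Energy V (\<mu> t) - Energy V \<nu> \<le> L * (1 + m t) * dist_B \<nu> (\<mu> t)"
proof -
  obtain M where M: "M > 0" "\<And>x. \<bar>V x\<bar> \<le> M" by (rule continuous_bounded[OF V]) (rule that)
  \<comment> \<open>3 M / \<kappa> comes from \<open>weighted_rkhs\<close> with mass at most 1 /
    \<kappa>, and \<epsilon> covers the factor \<epsilon> / 2 of d. In \<open>L\<close>, one factor
    1 / \<kappa> passes from B \<phi> to \<phi>, the other is the mass of
    \<open>Sg \<nu>\<close>.\<close>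
  define L0 where "L0 = 3 * M * (1 / \<kappa>) + \<epsilon>"
  define L where "L = L0 / \<kappa> / \<kappa> + L0"
  have L0: "L0 \<ge> 0" using M(1) \<kappa>_pos eps_pos by (simp add: L0_def)
  show ?thesis
  proof (rule that[of L])
    show "L \<ge> 0" using L0 \<kappa>_pos by (simp add: L_def)
    fix t d and \<nu> :: "'a measure" assume t: "0 < t" and f: "flow_at V \<mu> t d (m t)" and n: "\<nu> \<in> Probs"
    have Pt: "\<mu> t \<in> Probs" using t by (intro P) simp
    let ?B = "B (\<mu> t)" and ?q = "multiplier V (\<mu> t) d"
    have w: "wder \<mu> t d (m t + 1)" and dm: "rkhs_le k d (m t)" and q: "\<And>x. 0 \<le> ?q x" using f by (auto simp: flow_at_def)
    have dc: "cts d" by (rule rkhs_le_cont[OF dm])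
    note qc = multiplier_cont[OF Pt dc V]
    define \<phi> where "\<phi> x = V x - ?q x / ?B x" for x
    have qB: "cts (\<lambda>x. ?q x / ?B x)" using continuous_on_mult[OF qc B_inverse_cont[OF Pt]] by simp
    have \<phi>c: "cts \<phi>" unfolding \<phi>_def by (intro continuous_on_diff V qB)
    have "?B x * \<phi> x = ?B x * V x - ?q x" for x
      using B_nz[of "\<mu> t" x] by (simp add: \<phi>_def right_diff_distrib)
    then have B\<phi>: "(\<lambda>x. ?B x * \<phi> x) = (\<lambda>x. (\<integral>z. V z * k z x \<partial>Sg (\<mu> t)) - \<epsilon> / 2 * d x)"
      by (simp add: multiplier_def fun_eq_iff)
    have "rkhs_le k (\<lambda>x. \<integral>z. V z * k z x \<partial>Sg (\<mu> t)) (3 * M * (1 / \<kappa>))"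
      by (rule rkhs_le_mono[OF weighted_rkhs[OF Sg_fin_borel[OF Pt] V M(2)]]) (use Sg_mass(4)[OF Pt] M(1) in \<open>intro mult_left_mono, auto\<close>)
    from rkhs_le_diff[OF this rkhs_le_scale[OF dm, of "\<epsilon> / 2"]]
    have r: "rkhs_le k (\<lambda>x. ?B x * \<phi> x) (L0 * (1 + m t))" unfolding B\<phi>
      by (rule rkhs_le_mono) (use eps_pos M(1) \<kappa>_pos m_nonneg[OF t] in \<open>simp add: L0_def distrib_left distrib_right\<close>)
    define N where "N = L0 * (1 + m t)"
    have N: "N \<ge> 0" using rkhs_le_nonneg[OF r] by (simp add: N_def)
    have \<phi>b: "\<bar>\<phi> x\<bar> \<le> N / \<kappa>" for x
    proof -
      have "\<kappa> * \<bar>\<phi> x\<bar> \<le> ?B x * \<bar>\<phi> x\<bar>" using Sg_mass(3)[OF Pt] by (intro mult_right_mono) auto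
      also have "\<dots> \<le> N" using rkhs_le_bound[OF r, of x] B_pos[of "\<mu> t" x] by (simp add: abs_mult N_def)
      finally show ?thesis using \<kappa>_pos by (simp add: field_simps)
    qed
    let ?D = "dist_B \<nu> (\<mu> t)"
    have D0: "?D \<ge> 0" by (rule dist_B_nonneg[OF n Pt])
    note i = integrable_continuous[OF Sg_fin_borel[OF n]]
    have "(\<integral>x. \<phi> x \<partial>\<mu> t) - (\<integral>x. \<phi> x \<partial>\<nu>) \<le> L * (1 + m t) * ?D"
    proof -
      have "(\<integral>x. \<phi> x \<partial>\<nu>) - (\<integral>x. ?B x * \<phi> x \<partial>Sg \<nu>) = (\<integral>x. \<phi> x * (B \<nu> x - ?B x) \<partial>Sg \<nu>)"
        using Bochner_Integration.integral_diff[OF i[OF continuous_on_mult[OF \<phi>c B_cont[OF n]]] i[OF continuous_on_mult[OF B_cont[OF Pt] \<phi>c]]]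
        by (simp add: Sg_integral_B[OF n \<phi>c] right_diff_distrib mult.commute)
      moreover have "\<bar>\<integral>x. \<phi> x * (B \<nu> x - ?B x) \<partial>Sg \<nu>\<bar> \<le> N / \<kappa> * ?D * measure (Sg \<nu>) UNIV"
        by (rule integral_abs_bound[OF Sg_fin_borel[OF n]])
           (unfold abs_mult, intro mult_mono \<phi>b rkhs_le_bound[OF dist_B_rkhs[OF n Pt]], use N \<kappa>_pos in auto)
      moreover have "N / \<kappa> * ?D * measure (Sg \<nu>) UNIV \<le> N / \<kappa> * ?D * (1 / \<kappa>)"
        using Sg_mass(4)[OF n] N \<kappa>_pos D0 by (intro mult_left_mono) auto
      moreover have "\<bar>(\<integral>x. ?B x * \<phi> x \<partial>Sg \<nu>) - (\<integral>x. ?B x * \<phi> x \<partial>Sg (\<mu> t))\<bar> \<le> N * ?D"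
        using Sg_pairing[OF n Pt r] by (simp add: dist_B_def N_def)
      moreover have "(\<integral>x. ?B x * \<phi> x \<partial>Sg (\<mu> t)) = (\<integral>x. \<phi> x \<partial>\<mu> t)"
        using Sg_integral_B[OF Pt \<phi>c] by (simp add: mult.commute)
      moreover have "L * (1 + m t) * ?D = N / \<kappa> * ?D * (1 / \<kappa>) + N * ?D" by (simp add: L_def N_def distrib_right)
      ultimately show ?thesis by linarith
    qed
    moreover have "(\<integral>x. \<phi> x \<partial>\<mu> t) = Energy V (\<mu> t)"
    proof -
      have "(\<integral>x. ?q x / ?B x \<partial>\<mu> t) = 0"
        using multiplier_integral[OF Pt Pt dc V] wder_orthogonal[OF t w] by (simp add: Sg_integral[OF Pt qc, symmetric])
      then show ?thesis unfolding \<phi>_def Energy_def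
        using Bochner_Integration.integral_diff[OF integrable_continuous[OF Probs_fin_borel[OF Pt] V] integrable_continuous[OF Probs_fin_borel[OF Pt] qB]] by simp
    qed
    moreover have "(\<integral>x. \<phi> x \<partial>\<nu>) \<le> Energy V \<nu>" unfolding Energy_def
      by (rule integral_mono) (use integrable_continuous[OF Probs_fin_borel[OF n]] \<phi>c V q B_pos in \<open>auto simp: \<phi>_def less_imp_le\<close>)
    ultimately show "Energy V (\<mu> t) - Energy V \<nu> \<le> L * (1 + m t) * ?D" by linarith
  qed
qed

lemma AE_dense:
  assumes "AE t in lborel. t > 0 \<longrightarrow> Q t" "0 < a" "a < b"
  obtains t where "a < t" "t < b" "Q (t::real)"
proof (rule ccontr)
  assume "\<not> thesis"
  then have "\<not> Q t" if "a < t" "t < b" for t using that \<open>\<And>t. a < t \<Longrightarrow> t < b \<Longrightarrow> Q t \<Longrightarrow> thesis\<close> by blast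
  have "AE t in lborel. t \<notin> {a<..<b}" using assms(1)
    by eventually_elim (use \<open>\<And>t. a < t \<Longrightarrow> t < b \<Longrightarrow> \<not> Q t\<close> assms(2) in force)
  then have "emeasure lborel {a<..<b} = 0" by (subst (asm) AE_iff_measurable[of "{a<..<b}"]) auto
  then show False using assms(3) by simp
qed

text \<open>Using the one-sided bound at each of two good times, with the other measure as
  competitor, bounds the absolute difference. Arbitrary times are approached by good times from the
  right, where the speed bound is still at most \<open>m s\<close>.\<close>

lemma energy_rate:
  obtains L where "L \<ge> 0" "\<And>s t. 0 < s \<Longrightarrow> s < t \<Longrightarrow> \<bar>Energy V (\<mu> t) - Energy V (\<mu> s)\<bar> \<le> L * (1 + m s) * m s * (t - s)"
proof -
  obtain L where L: "L \<ge> 0" "\<And>t d \<nu>. 0 < t \<Longrightarrow> flow_at V \<mu> t d (m t) \<Longrightarrow> \<nu> \<in> Probs \<Longrightarrow>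
     Energy V (\<mu> t) - Energy V \<nu> \<le> L * (1 + m t) * dist_B \<nu> (\<mu> t)" by (rule energy_lower_bound) (rule that)
  let ?E = "\<lambda>t. Energy V (\<mu> t)"
  let ?G = "\<lambda>t. \<exists>d. flow_at V \<mu> t d (m t)"
  have dm: "dist_B (\<mu> t) (\<mu> s) \<le> m s * (t - s)" if "0 < s" "s \<le> t" for s t
  proof -
    have "dist_B (\<mu> t) (\<mu> s) \<le> integral {s..t} m" using m_dist that by simp
    also have "\<dots> \<le> integral {s..t} (\<lambda>_. m s)"
      by (rule integral_le) (use m_integrable m_mono that in auto)
    finally show ?thesis using that by (simp add: mult.commute)
  qed
  have good: "\<bar>?E t - ?E s\<bar> \<le> L * (1 + m r) * m r * (t - s)"
    if r: "0 < r" "r \<le> s" and st: "s < t" and G: "?G s" "?G t" for r s t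
  proof -
    have s0: "0 < s" "0 < t" using r st by auto
    have Ps: "\<mu> s \<in> Probs" and Pt: "\<mu> t \<in> Probs" using s0 by (auto intro: P)
    have ms: "m s \<le> m r" "m t \<le> m r" "0 \<le> m s" "0 \<le> m t" "0 \<le> m r" using m_mono m_nonneg r s0 st by auto
    have d: "dist_B (\<mu> t) (\<mu> s) \<le> m r * (t - s)"
    proof -
      have "m s * (t - s) \<le> m r * (t - s)" using ms st by (intro mult_right_mono) auto
      then show ?thesis using dm[OF s0(1) less_imp_le[OF st]] by linarith
    qed
    have D0: "0 \<le> dist_B (\<mu> t) (\<mu> s)" by (rule dist_B_nonneg[OF Pt Ps])
    have "L * (1 + z) * dist_B (\<mu> t) (\<mu> s) \<le> L * (1 + m r) * (m r * (t - s))" if "0 \<le> z" "z \<le> m r" for z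
      using that L(1) d D0 by (intro mult_mono) auto
    from this[OF ms(3,1)] this[OF ms(4,2)]
    show ?thesis using L(2)[OF s0(1) _ Pt] L(2)[OF s0(2) _ Ps] G dist_B_commute[OF Ps Pt] by (fastforce simp: abs_le_iff mult.assoc)
  qed
  show ?thesis
  proof (rule that[OF L(1)])
    fix s t :: real assume st: "0 < s" "s < t"
    have "\<exists>s'. s < s' \<and> s' < s + (t - s) / real (Suc (Suc n)) \<and> ?G s'" for n
      using AE_dense[OF flow st(1), of "s + (t - s) / real (Suc (Suc n))"] st by (smt (verit) divide_pos_pos of_nat_0_less_iff zero_less_Suc)
    then obtain S where S: "\<And>n. s < S n" "\<And>n. S n < s + (t - s) / real (Suc (Suc n))" "\<And>n. ?G (S n)" by metis
    have "\<exists>t'. t < t' \<and> t' < t + 1 / real (Suc n) \<and> ?G t'" for n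
      using AE_dense[OF flow, of t "t + 1 / real (Suc n)"] st by (smt (verit) divide_pos_pos of_nat_0_less_iff zero_less_Suc)
    then obtain T where T: "\<And>n. t < T n" "\<And>n. T n < t + 1 / real (Suc n)" "\<And>n. ?G (T n)" by metis
    have lim0: "(\<lambda>n. x / real (Suc n)) \<longlonglongrightarrow> 0" for x
      by (intro LIMSEQ_Suc[OF tendsto_divide_0[OF tendsto_const]] filterlim_at_top_imp_at_infinity filterlim_real_sequentially)
    have Sl: "S \<longlonglongrightarrow> s"
    proof (rule tendsto_sandwich[OF _ _ tendsto_const])
      show "(\<lambda>n. s + (t - s) / real (Suc (Suc n))) \<longlonglongrightarrow> s" using tendsto_add[OF tendsto_const LIMSEQ_Suc[OF lim0], of s "t - s"] by simp
    qed (use S in \<open>auto intro!: always_eventually less_imp_le\<close>)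
    have Tl: "T \<longlonglongrightarrow> t"
    proof (rule tendsto_sandwich[OF _ _ tendsto_const])
      show "(\<lambda>n. t + 1 / real (Suc n)) \<longlonglongrightarrow> t" using tendsto_add[OF tendsto_const lim0, of t 1] by simp
    qed (use T in \<open>auto intro!: always_eventually less_imp_le\<close>)
    have ST: "S n < T n" for n
    proof -
      have "(t - s) / real (Suc (Suc n)) \<le> (t - s) / 1" using st by (intro divide_left_mono) auto
      then show ?thesis using S(2)[of n] T(1)[of n] by simp
    qed
    have E: "(\<lambda>n. ?E (X n)) \<longlonglongrightarrow> ?E x" if "X \<longlonglongrightarrow> x" "0 < x" "\<And>n. x < X n" for X x
    proof -
      have "filterlim X (at x within {0..}) sequentially"
        unfolding filterlim_at using that less_imp_neq[OF that(3)] by (auto intro!: always_eventually order.trans[OF less_imp_le[OF that(2)] less_imp_le[OF that(3)]])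
      from filterlim_compose[OF energy_continuous this] that(2) show ?thesis by simp
    qed
    show "\<bar>?E t - ?E s\<bar> \<le> L * (1 + m s) * m s * (t - s)"
    proof (rule LIMSEQ_le)
      show "(\<lambda>n. \<bar>?E (T n) - ?E (S n)\<bar>) \<longlonglongrightarrow> \<bar>?E t - ?E s\<bar>"
        by (intro tendsto_intros E Sl Tl S T) (use st in auto)
      show "(\<lambda>n. L * (1 + m s) * m s * (T n - S n)) \<longlonglongrightarrow> L * (1 + m s) * m s * (t - s)" by (intro tendsto_intros Sl Tl)
      show "\<exists>N. \<forall>n\<ge>N. \<bar>?E (T n) - ?E (S n)\<bar> \<le> L * (1 + m s) * m s * (T n - S n)"
        using good[OF st(1) less_imp_le[OF S(1)] ST S(3) T(3)] by blast
    qed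
  qed
qed

lemma energy_AC:
  obtains G where "\<And>T. G absolutely_integrable_on {0..T}"
    "\<And>a b. 0 \<le> a \<Longrightarrow> a \<le> b \<Longrightarrow> \<bar>Energy V (\<mu> b) - Energy V (\<mu> a)\<bar> \<le> integral {a..b} G"
proof -
  obtain L where L: "L \<ge> 0" "\<And>s t. 0 < s \<Longrightarrow> s < t \<Longrightarrow> \<bar>Energy V (\<mu> t) - Energy V (\<mu> s)\<bar> \<le> L * (1 + m s) * m s * (t - s)"
    by (rule energy_rate) (rule that)
  let ?E = "\<lambda>t. Energy V (\<mu> t)"
  \<comment> \<open>\<open>L * (1 + m s) * m s\<close> splits into these two terms; square
    integrability of m enters here.\<close>
  define G where "G t = L * m t + L * (m t)\<^sup>2" for t
  have msq: "(\<lambda>t. (m t)\<^sup>2) absolutely_integrable_on {0..T}" for T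
    by (rule nonnegative_absolutely_integrable_1[OF m_sq]) simp
  have Gi: "G absolutely_integrable_on {0..T}" for T
    unfolding G_def by (intro set_integral_add(1) set_integrable_mult_right m_int msq)
  have Gi': "G integrable_on {0..T}" for T using set_lebesgue_integral_eq_integral(1)[OF Gi] .
  have E0: "((\<lambda>s. \<bar>?E s - ?E 0\<bar>) \<longlongrightarrow> 0) (at_right 0)"
  proof -
    have "(?E \<longlongrightarrow> ?E 0) (at_right 0)" by (rule tendsto_within_subset[OF energy_continuous]) auto
    then have "((\<lambda>s. \<bar>?E s - ?E 0\<bar>) \<longlongrightarrow> \<bar>?E 0 - ?E 0\<bar>) (at_right 0)" by (intro tendsto_intros)
    then show ?thesis by simp
  qed
  show ?thesis
  proof (rule that[OF Gi])
    fix a b :: real assume ab: "0 \<le> a" "a \<le> b"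
    show "\<bar>?E b - ?E a\<bar> \<le> integral {a..b} G"
    proof (rule nonincreasing_rate_bound[where D="\<lambda>a b. \<bar>?E b - ?E a\<bar>", OF _ _ E0 _ _ Gi' ab])
      show "\<bar>?E t - ?E s\<bar> \<le> G s * (t - s)" if "0 < s" "s < t" for s t
        using L(2)[OF that] by (simp add: G_def algebra_simps power2_eq_square)
      show "G t \<le> G s" if "0 < s" "s \<le> t" for s t
        unfolding G_def using m_mono[OF that] m_nonneg[of t] that L(1) by (intro add_mono mult_left_mono power_mono) auto
    qed auto
  qed
qed

end

section \<open>Dissipation and long-time behaviour\<close>

context energy_curve
begin

text \<open>With \<phi> = V + p frozen at time t, the difference of E and \<integral> \<phi> d\<mu>
  s is minimal at s = t, so both have the same derivative there. The derivative for \<phi> is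
  computable since B \<phi> lies in the RKHS, whereas B V need not. The flow equation says
  (\<epsilon> / 2) \<open>Kinv\<close> = C - \<phi>, which turns it into minus the metric.\<close>

lemma AE_dissipation:
  assumes t: "0 < t" and f: "flow_at V \<mu> t d (m t)" and D: "tangent \<epsilon> c \<mu> t D"
    and E: "((\<lambda>s. Energy V (\<mu> s)) has_real_derivative E) (at t)"
  shows "E = - gmet \<epsilon> c (\<mu> t) D D" "E \<le> 0"
proof -
  have Pt: "\<mu> t \<in> Probs" using t by (intro P) simp
  let ?B = "B (\<mu> t)" and ?q = "multiplier V (\<mu> t) d"
  define M where "M = m t + 1"
  have w: "wder \<mu> t d M" and dm: "rkhs_le k d (m t)" and q: "\<And>x. 0 \<le> ?q x" using f by (auto simp: flow_at_def M_def)
  have dc: "cts d" by (rule rkhs_le_cont[OF dm])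
  obtain p C where p: "p \<in> Press (\<mu> t)" "\<And>x. \<epsilon> / 2 * Kinv \<epsilon> c (\<mu> t) (Hmu \<epsilon> c (\<mu> t) D) x + V x + p x = C"
    "\<And>x. p x = - ?q x / ?B x" "\<And>x. ?B x * (V x + p x) = (\<integral>z. V z * k z x \<partial>Sg (\<mu> t)) - \<epsilon> / 2 * d x"
    by (rule multiplier_imp_flow_equation[OF t w D V q]) (rule that)
  note pc = Press_zero(1)[OF Pt p(1)] and p0 = Press_zero(2)[OF Pt p(1)] and pAE = Press_zero(3)[OF Pt p(1)]
  define \<phi> where "\<phi> x = V x + p x" for x
  have \<phi>c: "cts \<phi>" unfolding \<phi>_def by (intro continuous_intros V pc)
  obtain N where "\<And>x. \<bar>V x\<bar> \<le> N" by (rule continuous_bounded[OF V]) (rule that)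
  then have HV: "rkhs_le k (\<lambda>x. \<integral>z. V z * k z x \<partial>Sg (\<mu> t)) (3 * N * measure (Sg (\<mu> t)) UNIV)" by (rule weighted_rkhs[OF Sg_fin_borel[OF Pt] V])
  obtain N' where r: "rkhs_le k (\<lambda>x. ?B x * \<phi> x) N'"
    using rkhs_le_diff[OF HV rkhs_le_scale[OF dm, of "\<epsilon> / 2"]] unfolding \<phi>_def p(4) by blast
  obtain Dd where Dd: "((\<lambda>s. \<integral>x. d x \<partial>Sg (\<mu> s)) has_real_derivative Dd) (at t)"
    by (rule wder_derivative[OF t w dm]) (rule that)
  \<comment> \<open>By adjointness the integral of H[V \<sigma>] against the moving measure is that
    of V B (\<mu> s) against the fixed one, so only d enters the derivative.\<close>
  have DV: "((\<lambda>s. \<integral>x. (\<integral>z. V z * k z x \<partial>Sg (\<mu> t)) \<partial>Sg (\<mu> s)) has_real_derivative (\<integral>x. V x * d x \<partial>Sg (\<mu> t))) (at t)"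
  proof -
    have e: "(\<integral>x. (\<integral>z. V z * k z x \<partial>Sg (\<mu> t)) \<partial>Sg (\<mu> s)) = (\<integral>x. V x * B (\<mu> s) x \<partial>Sg (\<mu> t))" if "s > 0" for s
      using skew_zero[OF V Sg_fin_borel[OF P] Sg_fin_borel[OF Pt], of s] that by (simp add: Hk_Sg P)
    have fb: "fin_borel (Sg (\<mu> t))" by (rule Sg_fin_borel[OF Pt])
    have "((\<lambda>s. \<integral>x. V x * ((B (\<mu> s) x - ?B x) / (s - t)) \<partial>Sg (\<mu> t)) \<longlongrightarrow> (\<integral>x. V x * d x \<partial>Sg (\<mu> t))) (at t)"
    proof (rule weak_strong[where C="1 / \<kappa>"])
      show "\<forall>\<^sub>F s in at t. fin_borel (Sg (\<mu> t)) \<and> measure (Sg (\<mu> t)) UNIV \<le> 1 / \<kappa>" using fb Sg_mass(4)[OF Pt] by simp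
      show "\<forall>\<^sub>F s in at t. cts (\<lambda>x. V x * ((B (\<mu> s) x - ?B x) / (s - t)))"
        using ev_P[OF t] by eventually_elim (intro continuous_intros V B_cont Pt, auto)
      show "cts (\<lambda>x. V x * d x)" by (intro continuous_intros V dc)
      have u: "uniform_limit UNIV (\<lambda>s x. (B (\<mu> s) x - ?B x) / (s - t)) d (at t)" using w unfolding wder_def by blast
      have "bounded (range V)" "bounded (range d)"
        using compact_imp_bounded[OF compact_continuous_image[OF V compact_space]] compact_imp_bounded[OF compact_continuous_image[OF dc compact_space]] .
      then show "uniform_limit UNIV (\<lambda>s x. V x * ((B (\<mu> s) x - ?B x) / (s - t))) (\<lambda>x. V x * d x) (at t)"
        by (intro uniform_lim_mult uniform_limit_const u)
    qed (use \<kappa>_pos in auto)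
    then show ?thesis unfolding has_field_derivative_iff
    proof (rule Lim_transform_eventually)
      show "\<forall>\<^sub>F s in at t. (\<integral>x. V x * ((B (\<mu> s) x - ?B x) / (s - t)) \<partial>Sg (\<mu> t)) =
        ((\<integral>x. (\<integral>z. V z * k z x \<partial>Sg (\<mu> t)) \<partial>Sg (\<mu> s)) - (\<integral>x. (\<integral>z. V z * k z x \<partial>Sg (\<mu> t)) \<partial>Sg (\<mu> t))) / (s - t)"
        using ev_P[OF t]
      proof eventually_elim
        case (elim s)
        then have Ps: "\<mu> s \<in> Probs" by simp
        have "(\<integral>x. V x * ((B (\<mu> s) x - ?B x) / (s - t)) \<partial>Sg (\<mu> t)) = (\<integral>x. V x * B (\<mu> s) x - V x * ?B x \<partial>Sg (\<mu> t)) / (s - t)"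
          unfolding integral_divide_zero[symmetric] by (simp add: right_diff_distrib)
        also have "(\<integral>x. V x * B (\<mu> s) x - V x * ?B x \<partial>Sg (\<mu> t)) = (\<integral>x. V x * B (\<mu> s) x \<partial>Sg (\<mu> t)) - (\<integral>x. V x * ?B x \<partial>Sg (\<mu> t))"
          by (intro Bochner_Integration.integral_diff integrable_continuous fb continuous_intros V B_cont Ps Pt)
        finally show ?case using e[of s] e[of t] elim t by simp
      qed
    qed
  qed
  define X where "X = (\<integral>x. V x * d x \<partial>Sg (\<mu> t))"
  have r': "((\<lambda>s. \<integral>x. ?B x * \<phi> x \<partial>Sg (\<mu> s)) has_real_derivative X - \<epsilon> / 2 * Dd) (at t)"
  proof -
    have "((\<lambda>s. (\<integral>x. (\<integral>z. V z * k z x \<partial>Sg (\<mu> t)) \<partial>Sg (\<mu> s)) - \<epsilon> / 2 * (\<integral>x. d x \<partial>Sg (\<mu> s))) has_real_derivative X - \<epsilon> / 2 * Dd) (at t)"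
      unfolding X_def by (intro DERIV_diff DV DERIV_cmult Dd)
    then show ?thesis
    proof (rule has_field_derivative_transform_within_open[of _ _ _ "{0<..}"])
      fix s :: real assume "s \<in> {0<..}"
      then have Ps: "\<mu> s \<in> Probs" by (intro P) simp
      note i = integrable_continuous[OF Sg_fin_borel[OF Ps]]
      show "(\<integral>x. (\<integral>z. V z * k z x \<partial>Sg (\<mu> t)) \<partial>Sg (\<mu> s)) - \<epsilon> / 2 * (\<integral>x. d x \<partial>Sg (\<mu> s)) = (\<integral>x. ?B x * \<phi> x \<partial>Sg (\<mu> s))"
        unfolding \<phi>_def p(4) using i[OF rkhs_le_cont[OF HV]] i[OF dc] by simp
    qed (use t in auto)
  qed
  define Y where "Y = (\<integral>x. \<phi> x * d x \<partial>Sg (\<mu> t))"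
  have \<phi>d: "((\<lambda>s. \<integral>x. \<phi> x \<partial>\<mu> s) has_real_derivative Y + (X - \<epsilon> / 2 * Dd)) (at t)"
    unfolding Y_def by (rule wder_tangent(1)[OF t w r r'])
  note iP = integrable_continuous[OF Probs_fin_borel]
  have E\<phi>: "E = Y + (X - \<epsilon> / 2 * Dd)"
  proof -
    have "((\<lambda>s. Energy V (\<mu> s) - (\<integral>x. \<phi> x \<partial>\<mu> s)) has_real_derivative E - (Y + (X - \<epsilon> / 2 * Dd))) (at t)"
      by (intro DERIV_diff E \<phi>d)
    moreover have "\<forall>s. \<bar>t - s\<bar> < t \<longrightarrow> Energy V (\<mu> t) - (\<integral>x. \<phi> x \<partial>\<mu> t) \<le> Energy V (\<mu> s) - (\<integral>x. \<phi> x \<partial>\<mu> s)"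
    proof (intro allI impI)
      fix s assume "\<bar>t - s\<bar> < t"
      then have Ps: "\<mu> s \<in> Probs" by (intro P) linarith
      have "(\<integral>x. \<phi> x \<partial>\<mu> s) \<le> Energy V (\<mu> s)" unfolding Energy_def
        by (rule integral_mono) (use iP[OF Ps] \<phi>c V p0 in \<open>auto simp: \<phi>_def\<close>)
      moreover have "(\<integral>x. \<phi> x \<partial>\<mu> t) = Energy V (\<mu> t)" unfolding Energy_def
        by (rule integral_cong_AE) (use pAE continuous_measurable[OF Probs_fin_borel[OF Pt]] \<phi>c V in \<open>auto simp: \<phi>_def\<close>)
      ultimately show "Energy V (\<mu> t) - (\<integral>x. \<phi> x \<partial>\<mu> t) \<le> Energy V (\<mu> s) - (\<integral>x. \<phi> x \<partial>\<mu> s)" by simp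
    qed
    ultimately have "E - (Y + (X - \<epsilon> / 2 * Dd)) = 0" by (rule DERIV_local_min[OF _ t])
    then show ?thesis by simp
  qed
  show "E = - gmet \<epsilon> c (\<mu> t) D D"
  proof -
    define v where "v = Kinv \<epsilon> c (\<mu> t) (Hmu \<epsilon> c (\<mu> t) D)"
    define \<alpha> where "\<alpha> = 2 / \<epsilon>"
    have v: "v = (\<lambda>x. \<alpha> * (C - \<phi> x))"
    proof
      fix x
      have e: "\<epsilon> / 2 * v x = C - \<phi> x" using p(2)[of x] by (simp add: v_def \<phi>_def)
      have "\<alpha> * (\<epsilon> / 2 * v x) = v x" using eps_pos by (simp add: \<alpha>_def)
      then show "v x = \<alpha> * (C - \<phi> x)" unfolding e by simp
    qed
    have "((\<lambda>s. \<alpha> * (C - (\<integral>x. \<phi> x \<partial>\<mu> s))) has_real_derivative \<alpha> * (0 - E)) (at t)"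
      unfolding E\<phi> by (intro DERIV_cmult DERIV_diff \<phi>d DERIV_const)
    then have dv: "((\<lambda>s. \<integral>x. v x \<partial>\<mu> s) has_real_derivative \<alpha> * (0 - E)) (at t)"
    proof (rule has_field_derivative_transform_within_open[of _ _ _ "{0<..}"])
      fix s :: real assume "s \<in> {0<..}"
      then have Ps: "\<mu> s \<in> Probs" by (intro P) simp
      interpret S: prob_space "\<mu> s" using Ps by (simp add: Probs_def)
      show "\<alpha> * (C - (\<integral>x. \<phi> x \<partial>\<mu> s)) = (\<integral>x. v x \<partial>\<mu> s)"
        unfolding v using iP[OF Ps \<phi>c] by (simp add: S.prob_space)
    qed (use t in auto)
    have "rkhs_le k (\<lambda>x. \<alpha> * (C * ?B x - ?B x * \<phi> x)) (\<bar>\<alpha>\<bar> * (\<bar>C\<bar> * 1 + N'))"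
      by (intro rkhs_le_scale rkhs_le_diff r B_rkhs Pt)
    then have "in_rkhs k (\<lambda>x. ?B x * v x)" unfolding v in_rkhs_iff by (auto simp: algebra_simps)
    then have "D v = \<alpha> * (0 - E)" by (rule tangent_imp_eq[OF t D _ dv])
    then show ?thesis unfolding gmet_def v_def[symmetric] using eps_pos by (simp add: \<alpha>_def)
  qed
  have YX: "Y = X"
  proof -
    have i: "(\<integral>x. \<psi> x * d x \<partial>Sg (\<mu> t)) = (\<integral>x. \<psi> x * d x / ?B x \<partial>\<mu> t)" if "cts \<psi>" for \<psi> :: "'a \<Rightarrow> real"
      by (rule Sg_integral[OF Pt]) (intro continuous_intros that dc)
    have cm: "(\<lambda>x. \<psi> x * d x / ?B x) \<in> borel_measurable (\<mu> t)" if "cts \<psi>" for \<psi> :: "'a \<Rightarrow> real"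
      using continuous_measurable[OF Probs_fin_borel[OF Pt] continuous_on_mult[OF continuous_on_mult[OF that dc] B_inverse_cont[OF Pt]]] by simp
    show ?thesis unfolding X_def Y_def i[OF V] i[OF \<phi>c]
      by (rule integral_cong_AE[OF cm[OF \<phi>c] cm[OF V]]) (use pAE in \<open>eventually_elim, simp add: \<phi>_def\<close>)
  qed
  \<comment> \<open>The pressure vanishes almost everywhere under \<mu> t; there (\<epsilon> / 2) d
    = B (K V - V), which makes X a negative multiple of the Dirichlet form of V.\<close>
  have "\<epsilon> / 2 * X = - (\<integral>x. V x * (V x - K (\<mu> t) V x) \<partial>\<mu> t)"
  proof -
    have ed: "\<epsilon> / 2 * d x = ?q x - V x * ?B x + (\<integral>z. V z * k z x \<partial>Sg (\<mu> t))" for x by (simp add: multiplier_def)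
    have KV: "(\<integral>z. V z * k z x \<partial>Sg (\<mu> t)) = K (\<mu> t) V x * ?B x" for x using B_nz[of "\<mu> t" x] by (simp add: Kop_eq[OF Pt V])
    have qp: "?q x = - p x * ?B x" for x using B_nz[of "\<mu> t" x] by (simp add: p(3))
    have c: "cts (\<lambda>x. V x * (- p x - V x + K (\<mu> t) V x))" by (intro continuous_intros V pc Kop_cont Pt)
    have "\<epsilon> / 2 * X = (\<integral>x. \<epsilon> / 2 * (V x * d x) \<partial>Sg (\<mu> t))" unfolding X_def by simp
    also have "\<dots> = (\<integral>x. V x * (- p x - V x + K (\<mu> t) V x) * ?B x \<partial>Sg (\<mu> t))"
    proof (rule Bochner_Integration.integral_cong[OF refl])
      fix x
      have "\<epsilon> / 2 * (V x * d x) = V x * (\<epsilon> / 2 * d x)" by simp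
      then show "\<epsilon> / 2 * (V x * d x) = V x * (- p x - V x + K (\<mu> t) V x) * ?B x" unfolding ed KV qp by (simp add: algebra_simps)
    qed
    also have "\<dots> = (\<integral>x. V x * (- p x - V x + K (\<mu> t) V x) \<partial>\<mu> t)" by (rule Sg_integral_B[OF Pt c])
    also have "\<dots> = (\<integral>x. - (V x * (V x - K (\<mu> t) V x)) \<partial>\<mu> t)"
    proof (rule integral_cong_AE)
      show "(\<lambda>x. V x * (- p x - V x + K (\<mu> t) V x)) \<in> borel_measurable (\<mu> t)" by (rule continuous_measurable[OF Probs_fin_borel[OF Pt] c])
      show "(\<lambda>x. - (V x * (V x - K (\<mu> t) V x))) \<in> borel_measurable (\<mu> t)"
        by (intro continuous_measurable[OF Probs_fin_borel[OF Pt]] continuous_intros V Kop_cont Pt)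
      show "AE x in \<mu> t. V x * (- p x - V x + K (\<mu> t) V x) = - (V x * (V x - K (\<mu> t) V x))"
        using pAE by eventually_elim (simp add: algebra_simps)
    qed
    finally show ?thesis by simp
  qed
  then have "\<epsilon> / 2 * X \<le> 0" using Dirichlet_nonneg[OF Pt V] by simp
  then have "X \<le> 0" using eps_pos by (simp add: mult_le_0_iff)
  moreover have "0 \<le> \<epsilon> / 2 * Dd" using wder_self_nonneg[OF t w Dd] eps_pos by simp
  ultimately show "E \<le> 0" unfolding E\<phi> YX by linarith
qed

lemma energy_loc_abs_cont: "loc_abs_cont (\<lambda>t. Energy V (\<mu> t))"
  and energy_dissipation: "AE t in lborel. t \<ge> 0 \<longrightarrow> (\<forall>D. tangent \<epsilon> c \<mu> t D \<longrightarrow>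
      ((\<lambda>s. Energy V (\<mu> s)) has_real_derivative - gmet \<epsilon> c (\<mu> t) D D) (at t))"
  and energy_antimono: "antimono_on {0..} (\<lambda>t. Energy V (\<mu> t))"
proof -
  let ?E = "\<lambda>t. Energy V (\<mu> t)"
  obtain G where G: "\<And>T. G absolutely_integrable_on {0..T}"
    "\<And>a b. 0 \<le> a \<Longrightarrow> a \<le> b \<Longrightarrow> \<bar>?E b - ?E a\<bar> \<le> integral {a..b} G" by (rule energy_AC) (rule that)
  have "\<exists>g. (\<forall>T. g absolutely_integrable_on {0..T}) \<and> (\<forall>a b. 0 \<le> a \<longrightarrow> a \<le> b \<longrightarrow> ?E b - ?E a = integral {a..b} g) \<and>
    (AE t in lborel. t > 0 \<longrightarrow> (?E has_real_derivative g t) (at t))"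
    by (rule AC_differentiable_ae[of G]) (use G in auto)
  then obtain g where g: "\<forall>T. g absolutely_integrable_on {0..T}" "\<forall>a b. 0 \<le> a \<longrightarrow> a \<le> b \<longrightarrow> ?E b - ?E a = integral {a..b} g"
    "AE t in lborel. t > 0 \<longrightarrow> (?E has_real_derivative g t) (at t)" by blast
  show "loc_abs_cont ?E" unfolding loc_abs_cont_def using g(1,2) by blast
  have "AE t in lborel. t > 0 \<longrightarrow> (\<forall>E. (?E has_real_derivative E) (at t) \<longrightarrow> E \<le> 0)"
    using flow
  proof eventually_elim
    case (elim t)
    show ?case
    proof (intro impI allI)
      fix E assume t: "t > 0" and E: "(?E has_real_derivative E) (at t)"
      obtain d where d: "flow_at V \<mu> t d (m t)" using elim t by blast
      then have w: "wder \<mu> t d (m t + 1)" by (simp add: flow_at_def)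
      show "E \<le> 0" by (rule AE_dissipation(2)[OF t d tangent_exists[OF t w] E])
    qed
  qed
  then have "?E b \<le> ?E a" if "0 \<le> a" "a \<le> b" for a b
    by (intro AC_nonincreasing[where F="?E" and G=G]) (use G that in auto)
  then show "antimono_on {0..} ?E" by (auto simp: monotone_on_def)
  show "AE t in lborel. t \<ge> 0 \<longrightarrow> (\<forall>D. tangent \<epsilon> c \<mu> t D \<longrightarrow> (?E has_real_derivative - gmet \<epsilon> c (\<mu> t) D D) (at t))"
    using flow g(3) AE_lborel_singleton[of 0]
  proof eventually_elim
    case (elim t)
    show ?case
    proof (intro impI allI)
      fix D assume "t \<ge> 0" and D: "tangent \<epsilon> c \<mu> t D"
      then have t: "t > 0" using elim(3) by simp
      obtain d where d: "flow_at V \<mu> t d (m t)" using elim t by blast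
      have E: "(?E has_real_derivative g t) (at t)" using elim t by blast
      show "(?E has_real_derivative - gmet \<epsilon> c (\<mu> t) D D) (at t)"
        using E AE_dissipation(1)[OF t d D E] by simp
    qed
  qed
qed

lemma energy_limit:
  assumes x0: "\<And>x. V x0 \<le> V x"
  shows "((\<lambda>t. Energy V (\<mu> t)) \<longlongrightarrow> V x0) at_top"
proof -
  let ?E = "\<lambda>t. Energy V (\<mu> t)"
  have lower: "V x0 \<le> ?E t" if "t \<ge> 0" for t
  proof -
    interpret S: prob_space "\<mu> t" using P[OF that] by (simp add: Probs_def)
    have "(\<integral>x. V x0 \<partial>\<mu> t) \<le> ?E t" unfolding Energy_def
      by (rule integral_mono) (use x0 integrable_continuous[OF Probs_fin_borel[OF P[OF that]] V] in auto)
    then show ?thesis by (simp add: S.prob_space)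
  qed
  have anti: "?E t \<le> ?E s" if "0 \<le> s" "s \<le> t" for s t
    using monotone_onD[OF energy_antimono, of s t] that by simp
  have "\<exists>T\<ge>0. ?E T < V x0 + e" if e: "e > 0" for e
  proof (rule ccontr)
    assume "\<not> ?thesis"
    then have ge: "V x0 + e \<le> ?E t" if "t \<ge> 0" for t using that by (meson not_less)
    \<comment> \<open>If the energy stays e above the minimum, the multiplier inequality at
      \<open>x0\<close> forces \<open>B (\<mu> t) x0\<close> to grow at least at this rate.\<close>
    define \<beta> where "\<beta> = 2 / \<epsilon> * (\<kappa> * e)"
    have \<beta>: "\<beta> > 0" using eps_pos \<kappa>_pos e by (simp add: \<beta>_def)
    have inc: "\<beta> * b - B (\<mu> b) x0 \<le> \<beta> * a - B (\<mu> a) x0" if ab: "0 \<le> a" "a \<le> b" for a b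
    proof (rule AC_nonincreasing[where G="\<lambda>t. \<beta> + m t", OF _ _ _ ab])
      show "(\<lambda>t. \<beta> + m t) absolutely_integrable_on {0..T}" for T
        by (intro set_integral_add(1) m_int absolutely_integrable_on_const lmeasurable_interval)
      show "\<bar>\<beta> * b - B (\<mu> b) x0 - (\<beta> * a - B (\<mu> a) x0)\<bar> \<le> integral {a..b} (\<lambda>t. \<beta> + m t)" if "0 \<le> a" "a \<le> b" for a b
      proof -
        have "integral {a..b} (\<lambda>t. \<beta> + m t) = \<beta> * (b - a) + integral {a..b} m"
          using m_integrable[OF that(1)] that by (subst Henstock_Kurzweil_Integration.integral_add) auto
        moreover have "\<bar>\<beta> * (b - a)\<bar> = \<beta> * (b - a)" using \<beta> that by simp
        ultimately show ?thesis using B_abs_continuous[OF that, of x0] by (simp add: right_diff_distrib)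
      qed
      show "AE t in lborel. t > 0 \<longrightarrow> (\<forall>D. ((\<lambda>t. \<beta> * t - B (\<mu> t) x0) has_real_derivative D) (at t) \<longrightarrow> D \<le> 0)"
        using flow
      proof eventually_elim
        case (elim t)
        show ?case
        proof (intro impI allI)
          fix D assume t: "t > 0" and D: "((\<lambda>t. \<beta> * t - B (\<mu> t) x0) has_real_derivative D) (at t)"
          have Pt: "\<mu> t \<in> Probs" using t by (intro P) simp
          obtain d where w: "wder \<mu> t d (m t + 1)" and q: "\<And>x. 0 \<le> multiplier V (\<mu> t) d x" using elim t by (auto simp: flow_at_def)
          have "((\<lambda>t. \<beta> * t - B (\<mu> t) x0) has_real_derivative \<beta> - d x0) (at t)"
            using wder_pointwise[OF w, of x0] by (auto intro!: derivative_eq_intros)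
          then have "D = \<beta> - d x0" by (rule DERIV_unique[OF D])
          moreover have "\<beta> \<le> d x0"
          proof -
            note i = integrable_continuous[OF Sg_fin_borel[OF Pt]]
            have "\<kappa> * e \<le> \<kappa> * (?E t - V x0)" using ge[of t] t \<kappa>_pos by (intro mult_left_mono) auto
            also have "\<dots> = (\<integral>x. \<kappa> * ((V x - V x0) * B (\<mu> t) x) \<partial>Sg (\<mu> t))"
            proof -
              interpret S: prob_space "\<mu> t" using Pt by (simp add: Probs_def)
              have c: "cts (\<lambda>x. V x - V x0)" by (intro continuous_intros V)
              have "(\<integral>x. (V x - V x0) * B (\<mu> t) x \<partial>Sg (\<mu> t)) = (\<integral>x. V x - V x0 \<partial>\<mu> t)" by (rule Sg_integral_B[OF Pt c])
              also have "\<dots> = ?E t - V x0" using integrable_continuous[OF Probs_fin_borel[OF Pt] V] by (simp add: Energy_def S.prob_space)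
              finally show ?thesis by simp
            qed
            also have "\<dots> \<le> (\<integral>x. V x * k x x0 - V x0 * k x x0 \<partial>Sg (\<mu> t))"
            proof (rule integral_mono)
              fix x
              have "\<kappa> * B (\<mu> t) x \<le> k x x0" using mult_mono[OF \<kappa>_le[of x x0] B_le_1[OF Pt, of x]] k_pos[of x x0] B_pos[of "\<mu> t" x] by simp
              then have "(V x - V x0) * (\<kappa> * B (\<mu> t) x) \<le> (V x - V x0) * k x x0" using x0[of x] by (intro mult_left_mono) auto
              then show "\<kappa> * ((V x - V x0) * B (\<mu> t) x) \<le> V x * k x x0 - V x0 * k x x0" by (simp add: algebra_simps)
            qed (intro i continuous_intros V B_cont Pt k_cont1)+
            also have "\<dots> = (\<integral>x. V x * k x x0 \<partial>Sg (\<mu> t)) - V x0 * B (\<mu> t) x0"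
              using i[OF continuous_on_mult[OF V k_cont1]] i[OF k_cont1] by (simp add: Hk_Sg[OF Pt, symmetric] Hk_def)
            also have "\<dots> \<le> \<epsilon> / 2 * d x0" using q[of x0] by (simp add: multiplier_def)
            finally show ?thesis unfolding \<beta>_def using eps_pos by (simp add: field_simps)
          qed
          ultimately show "D \<le> 0" by simp
        qed
      qed
    qed
    \<comment> \<open>By time 2 / \<beta> the potential at \<open>x0\<close> would have grown by 2,
      although it stays between 0 and 1.\<close>
    define T where "T = 2 / \<beta>"
    have T: "T \<ge> 0" "\<beta> * T = 2" using \<beta> by (simp_all add: T_def)
    show False using inc[of 0 T] T B_le_1[OF P[OF T(1)], of x0] B_pos[of "\<mu> 0" x0] by simp
  qed note ex = this
  show ?thesis unfolding tendsto_iff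
  proof (intro allI impI)
    fix e :: real assume "e > 0"
    then obtain T where T: "T \<ge> 0" "?E T < V x0 + e" using ex by blast
    show "\<forall>\<^sub>F t in at_top. dist (?E t) (V x0) < e"
      unfolding eventually_at_top_linorder
    proof (intro exI[of _ T] allI impI)
      fix t assume "t \<ge> T"
      then show "dist (?E t) (V x0) < e" using anti[of T t] lower[of t] T by (simp add: dist_real_def)
    qed
  qed
qed

text \<open>Where \<phi> differs from \<phi> xs by at least e, compactness bounds V - V xs from
  below. So the deviation of \<phi> is at most e plus a multiple of V - V xs, whose integral tends
  to 0 by the energy limit.\<close>

lemma converges_to_minimizer:
  fixes \<phi> :: "'a \<Rightarrow> real"
  assumes xs: "\<And>x. x \<noteq> xs \<Longrightarrow> V xs < V x" and \<phi>: "cts \<phi>"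
  shows "((\<lambda>t. \<integral>x. \<phi> x \<partial>\<mu> t) \<longlongrightarrow> \<phi> xs) at_top"
proof -
  have min: "V xs \<le> V x" for x using xs[of x] by (cases "x = xs") auto
  have appr: "\<exists>M>0. \<forall>x. \<bar>\<phi> x - \<phi> xs\<bar> \<le> e + M * (V x - V xs)" if e: "e > 0" for e
  proof -
    obtain N where N: "N > 0" "\<And>x. \<bar>\<phi> x\<bar> \<le> N" by (rule continuous_bounded[OF \<phi>]) (rule that)
    define F where "F = {x. e \<le> \<bar>\<phi> x - \<phi> xs\<bar>}"
    have "closed F" unfolding F_def using \<phi> by (intro closed_Collect_le continuous_intros)
    then have F: "compact F" using compact_space by (metis compact_Int_closed inf_top_left)
    obtain \<eta> where \<eta>: "\<eta> > 0" "\<And>x. x \<in> F \<Longrightarrow> \<eta> \<le> V x - V xs"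
    proof (cases "F = {}")
      case False
      obtain x1 where x1: "x1 \<in> F" "\<And>x. x \<in> F \<Longrightarrow> V x1 \<le> V x"
        using continuous_attains_inf[OF F False continuous_on_subset[OF V]] by auto
      have "x1 \<noteq> xs" using x1(1) e by (auto simp: F_def)
      then show ?thesis using that[of "V x1 - V xs"] x1 xs by auto
    qed (use that[of 1] in auto)
    show ?thesis
    proof (intro exI[of _ "2 * N / \<eta>"] conjI allI)
      show "2 * N / \<eta> > 0" using N \<eta> by simp
      fix x
      have nn: "0 \<le> 2 * N / \<eta> * (V x - V xs)" using N \<eta> min[of x] by simp
      show "\<bar>\<phi> x - \<phi> xs\<bar> \<le> e + 2 * N / \<eta> * (V x - V xs)"
      proof (cases "x \<in> F")
        case True
        have "2 * N = 2 * N / \<eta> * \<eta>" using \<eta> by simp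
        also have "\<dots> \<le> 2 * N / \<eta> * (V x - V xs)" using \<eta>(2)[OF True] N \<eta>(1) by (intro mult_left_mono) auto
        finally show ?thesis using N(2)[of x] N(2)[of xs] e by linarith
      next
        case False then show ?thesis using nn by (simp add: F_def)
      qed
    qed
  qed
  show ?thesis unfolding tendsto_iff
  proof (intro allI impI)
    fix e :: real assume e: "e > 0"
    obtain M where M: "M > 0" "\<And>x. \<bar>\<phi> x - \<phi> xs\<bar> \<le> e / 2 + M * (V x - V xs)" using appr[of "e / 2"] e by auto
    have "\<forall>\<^sub>F t in at_top. dist (Energy V (\<mu> t)) (V xs) < e / (2 * M)"
      using e M by (intro tendstoD[OF energy_limit[OF min]]) simp
    with eventually_ge_at_top[of 0] show "\<forall>\<^sub>F t in at_top. dist (\<integral>x. \<phi> x \<partial>\<mu> t) (\<phi> xs) < e"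
    proof eventually_elim
      case (elim t)
      note Pt = P[OF elim(1)]
      note i = integrable_continuous[OF Probs_fin_borel[OF Pt]]
      interpret S: prob_space "\<mu> t" using Pt by (simp add: Probs_def)
      have "(\<integral>x. \<phi> x \<partial>\<mu> t) - \<phi> xs = (\<integral>x. \<phi> x - \<phi> xs \<partial>\<mu> t)" using i[OF \<phi>] by (simp add: S.prob_space)
      also have "\<bar>\<dots>\<bar> \<le> (\<integral>x. \<bar>\<phi> x - \<phi> xs\<bar> \<partial>\<mu> t)" by (rule Bochner_Integration.integral_abs_bound)
      also have "\<dots> \<le> (\<integral>x. e / 2 + M * (V x - V xs) \<partial>\<mu> t)"
        by (rule integral_mono[OF _ _ M(2)]) (intro i continuous_intros \<phi> V)+
      also have "\<dots> = e / 2 + M * (Energy V (\<mu> t) - V xs)" using i[OF V] by (simp add: S.prob_space Energy_def)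
      also have "\<dots> < e" using elim(2) M(1) by (simp add: dist_real_def field_simps abs_less_iff)
      finally show ?case by (simp add: dist_real_def)
    qed
  qed
qed

end

section \<open>Existence\<close>

text \<open>Projected iteration s \<mapsto> max 0 (s - \<theta> (A s - h)): strong monotonicity of A
  makes it a Euclidean contraction for small \<theta>, and its fixed points solve the
  complementarity problem.\<close>

lemma monotone_complementarity:
  fixes A :: "'a \<Rightarrow> 'a \<Rightarrow> real" and h :: "'a \<Rightarrow> real"
  assumes S: "finite S" and \<alpha>: "\<alpha> > 0" and mono: "\<And>s. \<alpha> * (\<Sum>x\<in>S. (s x)\<^sup>2) \<le> (\<Sum>y\<in>S. s y * (\<Sum>x\<in>S. A x y * s x))"
  obtains s where "\<And>x. x \<in> S \<Longrightarrow> 0 \<le> s x" "\<And>y. y \<in> S \<Longrightarrow> 0 \<le> (\<Sum>x\<in>S. A x y * s x) - h y"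
    "\<And>y. y \<in> S \<Longrightarrow> s y * ((\<Sum>x\<in>S. A x y * s x) - h y) = 0"
proof -
  define n2 where "n2 s = (\<Sum>x\<in>S. (s x)\<^sup>2)" for s :: "'a \<Rightarrow> real"
  define L where "L s y = (\<Sum>x\<in>S. A x y * s x)" for s y
  have n2_nonneg: "n2 s \<ge> 0" for s unfolding n2_def by (intro sum_nonneg) auto
  \<comment> \<open>The squared Hilbert-Schmidt norm of A; adding \<alpha>^2 ensures positivity and
    that the factor \<open>r\<close> below is nonnegative.\<close>
  define \<Lambda> where "\<Lambda> = (\<Sum>y\<in>S. \<Sum>x\<in>S. (A x y)\<^sup>2) + \<alpha>\<^sup>2"
  have \<Lambda>: "\<Lambda> > 0" "\<alpha>\<^sup>2 \<le> \<Lambda>" using \<alpha> by (auto simp: \<Lambda>_def add_nonneg_pos sum_nonneg)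
  have LL: "n2 (L s) \<le> \<Lambda> * n2 s" for s
  proof -
    have "(L s y)\<^sup>2 \<le> (\<Sum>x\<in>S. (A x y)\<^sup>2) * n2 s" for y
      unfolding L_def n2_def by (rule Cauchy_Schwarz_ineq_sum)
    then have "n2 (L s) \<le> (\<Sum>y\<in>S. (\<Sum>x\<in>S. (A x y)\<^sup>2) * n2 s)" unfolding n2_def[of "L s"] by (intro sum_mono)
    also have "\<dots> = (\<Sum>y\<in>S. \<Sum>x\<in>S. (A x y)\<^sup>2) * n2 s" by (rule sum_distrib_right[symmetric])
    also have "\<dots> \<le> \<Lambda> * n2 s" using n2_nonneg by (intro mult_right_mono) (auto simp: \<Lambda>_def)
    finally show ?thesis .
  qed
  \<comment> \<open>This value minimises 1 - 2 \<theta> \<alpha> + \<theta>^2 \<Lambda>; the minimum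
    is \<open>r\<close>.\<close>
  define \<theta> where "\<theta> = \<alpha> / \<Lambda>"
  have \<theta>: "\<theta> > 0" using \<alpha> \<Lambda> by (simp add: \<theta>_def)
  define r where "r = 1 - \<alpha>\<^sup>2 / \<Lambda>"
  have r: "0 \<le> r" "r < 1" using \<alpha> \<Lambda> by (simp_all add: r_def)
  define T where "T s y = max 0 (s y - \<theta> * (L s y - h y))" for s y
  have contr: "n2 (\<lambda>x. T s x - T s' x) \<le> r * n2 (\<lambda>x. s x - s' x)" for s s'
  proof -
    define d where "d x = s x - s' x" for x
    have Ld: "L s y - L s' y = L d y" for y by (simp add: L_def d_def sum_subtractf right_diff_distrib)
    have "n2 (\<lambda>x. T s x - T s' x) \<le> n2 (\<lambda>y. d y - \<theta> * L d y)"
      unfolding n2_def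
    proof (rule sum_mono)
      fix y
      have "\<bar>T s y - T s' y\<bar> \<le> \<bar>(s y - \<theta> * (L s y - h y)) - (s' y - \<theta> * (L s' y - h y))\<bar>"
        unfolding T_def by (auto simp: max_def)
      also have "(s y - \<theta> * (L s y - h y)) - (s' y - \<theta> * (L s' y - h y)) = d y - \<theta> * L d y"
        unfolding Ld[symmetric] d_def by (simp add: algebra_simps)
      finally show "(T s y - T s' y)\<^sup>2 \<le> (d y - \<theta> * L d y)\<^sup>2" by (simp add: abs_le_square_iff)
    qed
    also have "n2 (\<lambda>y. d y - \<theta> * L d y) = n2 d - 2 * \<theta> * (\<Sum>y\<in>S. d y * L d y) + \<theta>\<^sup>2 * n2 (L d)"
      unfolding n2_def by (simp add: power2_eq_square algebra_simps sum.distrib sum_subtractf sum_distrib_left)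
    also have "\<dots> \<le> n2 d - 2 * \<theta> * (\<alpha> * n2 d) + \<theta>\<^sup>2 * (\<Lambda> * n2 d)"
    proof -
      have "2 * \<theta> * (\<alpha> * n2 d) \<le> 2 * \<theta> * (\<Sum>y\<in>S. d y * L d y)"
        using mono[of d] \<theta> by (intro mult_left_mono) (auto simp: n2_def L_def)
      moreover have "\<theta>\<^sup>2 * n2 (L d) \<le> \<theta>\<^sup>2 * (\<Lambda> * n2 d)" using LL by (intro mult_left_mono) auto
      ultimately show ?thesis by linarith
    qed
    also have "\<dots> = r * n2 d" using \<Lambda>(1) by (simp add: r_def \<theta>_def field_simps power2_eq_square)
    finally show ?thesis by (simp add: d_def[abs_def])
  qed
  define s where "s i = (T ^^ i) (\<lambda>_. 0)" for i
  have sS: "s (Suc i) = T (s i)" for i by (simp add: s_def)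
  define D where "D = n2 (\<lambda>x. s 1 x - s 0 x)"
  have geo: "n2 (\<lambda>x. s (Suc i) x - s i x) \<le> r ^ i * D" for i
  proof (induction i)
    case (Suc i)
    have "n2 (\<lambda>x. s (Suc (Suc i)) x - s (Suc i) x) \<le> r * n2 (\<lambda>x. s (Suc i) x - s i x)" using contr[of "s (Suc i)" "s i"] by (simp only: sS)
    also have "\<dots> \<le> r * (r ^ i * D)" using Suc r by (intro mult_left_mono)
    finally show ?case by simp
  qed (simp add: D_def)
  have conv: "\<exists>l. (\<lambda>i. s i x) \<longlonglongrightarrow> l" if "x \<in> S" for x
  proof -
    have le: "norm (s (Suc i) x - s i x) \<le> sqrt D * sqrt r ^ i" for i
    proof -
      have "(s (Suc i) x - s i x)\<^sup>2 \<le> n2 (\<lambda>x. s (Suc i) x - s i x)" unfolding n2_def using that S by (intro member_le_sum) auto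
      then have "(s (Suc i) x - s i x)\<^sup>2 \<le> r ^ i * D" using geo[of i] by linarith
      then have "sqrt ((s (Suc i) x - s i x)\<^sup>2) \<le> sqrt (r ^ i * D)" by (rule real_sqrt_le_mono)
      then show ?thesis unfolding real_sqrt_abs by (simp add: real_sqrt_mult real_sqrt_power mult.commute)
    qed
    have "summable (\<lambda>i. sqrt D * sqrt r ^ i)" using r by (intro summable_mult summable_geometric) auto
    then have "summable (\<lambda>i. s (Suc i) x - s i x)" by (rule summable_comparison_test'[where N=0]) (rule le)
    then have "convergent (\<lambda>n. s n x - s 0 x)" unfolding summable_iff_convergent by (simp only: sum_lessThan_telescope[of "\<lambda>i. s i x"])
    then obtain l where "(\<lambda>n. s n x - s 0 x) \<longlonglongrightarrow> l" unfolding convergent_def by blast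
    from tendsto_add[OF this tendsto_const[of "s 0 x"]] show ?thesis by auto
  qed
  then obtain l where l: "\<And>x. x \<in> S \<Longrightarrow> (\<lambda>i. s i x) \<longlonglongrightarrow> l x" by metis
  have fix_pt: "T l x = l x" if "x \<in> S" for x
  proof -
    have "(\<lambda>i. T (s i) x) \<longlonglongrightarrow> T l x" unfolding T_def L_def by (intro tendsto_intros l that)
    then show ?thesis using LIMSEQ_unique[OF LIMSEQ_Suc[OF l[OF that]]] by (simp add: sS)
  qed
  have key: "0 \<le> l y \<and> 0 \<le> L l y - h y \<and> l y * (L l y - h y) = 0" if "y \<in> S" for y
    using fix_pt[OF that] \<theta> unfolding T_def max_def by (auto split: if_splits simp: mult_le_0_iff zero_le_mult_iff)
  show ?thesis by (rule that[of l]) (use key in \<open>auto simp: L_def\<close>)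
qed

definition disc :: "'a::metric_space set \<Rightarrow> ('a \<Rightarrow> real) \<Rightarrow> 'a measure" where
  "disc S s = distr (point_measure S (\<lambda>x. ennreal (s x))) borel (\<lambda>x. x)"

lemma disc:
  assumes S: "finite S" and s: "\<And>x. x \<in> S \<Longrightarrow> 0 \<le> s x"
  shows "fin_borel (disc S s)" "\<phi> \<in> borel_measurable borel \<Longrightarrow> (\<integral>x. \<phi> x \<partial>disc S s) = (\<Sum>x\<in>S. s x * \<phi> x)"
proof -
  have m: "(\<lambda>x. x) \<in> measurable (point_measure S (\<lambda>x. ennreal (s x))) borel" by (simp add: measurable_point_measure_eq1)
  have "emeasure (disc S s) (space (disc S s)) = (\<Sum>x\<in>S. ennreal (s x))"
    unfolding disc_def using S by (simp add: emeasure_distr[OF m] space_point_measure emeasure_point_measure_finite)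
  then show "fin_borel (disc S s)" unfolding fin_borel_def
    using S by (auto intro!: finite_measureI simp: disc_def)
  assume "\<phi> \<in> borel_measurable borel"
  then show "(\<integral>x. \<phi> x \<partial>disc S s) = (\<Sum>x\<in>S. s x * \<phi> x)"
    unfolding disc_def using S s by (simp add: integral_distr[OF m] lebesgue_integral_point_measure_finite)
qed

context kernel_space
begin

definition ip :: "'a measure \<Rightarrow> 'a measure \<Rightarrow> real" where
  "ip \<sigma> \<rho> = (\<integral>x. Hk \<sigma> x \<partial>\<rho>)"

text \<open>The squared RKHS distance of the potentials, expanded in pairings.\<close>

definition nsq :: "'a measure \<Rightarrow> 'a measure \<Rightarrow> real" where
  "nsq \<sigma> \<rho> = ip \<sigma> \<sigma> - 2 * ip \<sigma> \<rho> + ip \<rho> \<rho>"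

lemma ip_commute: "fin_borel \<sigma> \<Longrightarrow> fin_borel \<rho> \<Longrightarrow> ip \<sigma> \<rho> = ip \<rho> \<sigma>"
  unfolding ip_def by (rule Hk_symm)

lemma nsq:
  assumes s: "fin_borel \<sigma>" and r: "fin_borel \<rho>"
  shows "0 \<le> nsq \<sigma> \<rho>" "rkhs_le k (\<lambda>x. Hk \<sigma> x - Hk \<rho> x) (sqrt (nsq \<sigma> \<rho>))"
    "rkhs_norm k (\<lambda>x. Hk \<sigma> x - Hk \<rho> x) = sqrt (nsq \<sigma> \<rho>)"
    "rkhs_le k g M \<Longrightarrow> \<bar>(\<integral>x. g x \<partial>\<sigma>) - (\<integral>x. g x \<partial>\<rho>)\<bar> \<le> M * sqrt (nsq \<sigma> \<rho>)"
proof -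
  have "(\<integral>y. Hk \<sigma> y - Hk \<rho> y \<partial>\<nu>) = ip \<sigma> \<nu> - ip \<rho> \<nu>" if "fin_borel \<nu>" for \<nu>
    unfolding ip_def by (intro Bochner_Integration.integral_diff integrable_continuous Hk_cont that s r)
  then have "(\<integral>y. Hk \<sigma> y - Hk \<rho> y \<partial>\<sigma>) - (\<integral>y. Hk \<sigma> y - Hk \<rho> y \<partial>\<rho>) = nsq \<sigma> \<rho>"
    using s r ip_commute[OF s r] by (simp add: nsq_def)
  then show "0 \<le> nsq \<sigma> \<rho>" "rkhs_le k (\<lambda>x. Hk \<sigma> x - Hk \<rho> x) (sqrt (nsq \<sigma> \<rho>))"
    "rkhs_norm k (\<lambda>x. Hk \<sigma> x - Hk \<rho> x) = sqrt (nsq \<sigma> \<rho>)"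
    "rkhs_le k g M \<Longrightarrow> \<bar>(\<integral>x. g x \<partial>\<sigma>) - (\<integral>x. g x \<partial>\<rho>)\<bar> \<le> M * sqrt (nsq \<sigma> \<rho>)"
    using dual_norm[OF s r] by auto
qed

lemma nsq_triangle:
  assumes "fin_borel \<sigma>" "fin_borel \<rho>" "fin_borel \<tau>"
  shows "sqrt (nsq \<sigma> \<tau>) \<le> sqrt (nsq \<sigma> \<rho>) + sqrt (nsq \<rho> \<tau>)"
  using rkhs_le_add[OF nsq(2)[OF assms(1,2)] nsq(2)[OF assms(2,3)]] nsq(3)[OF assms(1,3)] by (simp add: rkhs_le_iff)

text \<open>With \<gamma> = 2 \<tau> / \<epsilon> this is \<gamma> times the multiplier in which d
  is replaced by the backward difference quotient of the potentials over time \<tau>.\<close>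

definition resid :: "('a \<Rightarrow> real) \<Rightarrow> real \<Rightarrow> 'a measure \<Rightarrow> 'a measure \<Rightarrow> 'a \<Rightarrow> real" where
  "resid V \<gamma> \<sigma>' \<sigma> y = Hk \<sigma> y - Hk \<sigma>' y + \<gamma> * (V y * Hk \<sigma> y - (\<integral>x. V x * k x y \<partial>\<sigma>))"

text \<open>An implicit Euler step on the grid S. The unit norm is not imposed; its loss is measured
  by \<open>step_norm\<close>.\<close>

definition step :: "('a \<Rightarrow> real) \<Rightarrow> real \<Rightarrow> 'a set \<Rightarrow> 'a measure \<Rightarrow> 'a measure \<Rightarrow> bool" where
  "step V \<gamma> S \<sigma>' \<sigma> \<longleftrightarrow> (\<exists>s. (\<forall>x\<in>S. 0 \<le> s x) \<and> \<sigma> = disc S s) \<and> (\<forall>y\<in>S. 0 \<le> resid V \<gamma> \<sigma>' \<sigma> y) \<and> (\<integral>y. resid V \<gamma> \<sigma>' \<sigma> y \<partial>\<sigma>) = 0"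

lemma Hk_disc:
  assumes "finite S" "\<And>x. x \<in> S \<Longrightarrow> 0 \<le> s x"
  shows "Hk (disc S s) y = (\<Sum>x\<in>S. s x * k x y)"
  unfolding Hk_def by (rule disc(2)[OF assms borel_measurable_continuous_onI[OF k_cont1]])

lemma wk_cont: "fin_borel \<sigma> \<Longrightarrow> cts V \<Longrightarrow> cts (\<lambda>y. \<integral>x. V x * k x y \<partial>\<sigma>)" for V :: "'a \<Rightarrow> real"
  using continuous_integral[of "\<lambda>x y. k x y * V x" \<sigma>] k_weighted_cont[of V] by (simp add: mult.commute)

lemma resid_cont:
  assumes "cts V" "fin_borel \<sigma>'" "fin_borel \<sigma>"
  shows "cts (resid V \<gamma> \<sigma>' \<sigma>)"
  unfolding resid_def by (intro continuous_intros Hk_cont wk_cont assms)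

text \<open>The matrix on the grid is k x y (1 + \<gamma> (V y - V x)). Its second part is skew, so
  its quadratic form is \<open>kquad\<close>, and \<open>strictly_pd\<close> supplies
  \<alpha>.\<close>

lemma step_exists:
  fixes V :: "'a \<Rightarrow> real"
  assumes V: "cts V" and S: "finite S" and s': "fin_borel \<sigma>'"
  obtains \<sigma> where "step V \<gamma> S \<sigma>' \<sigma>"
proof -
  obtain \<alpha> where \<alpha>: "\<alpha> > 0" "\<And>a. \<alpha> * (\<Sum>x\<in>S. (a x)\<^sup>2) \<le> kquad k S a" by (rule strictly_pd[OF S]) (rule that)
  define A where "A x y = k x y * (1 + \<gamma> * (V y - V x))" for x y
  have mono: "\<alpha> * (\<Sum>x\<in>S. (s x)\<^sup>2) \<le> (\<Sum>y\<in>S. s y * (\<Sum>x\<in>S. A x y * s x))" for s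
  proof -
    have "(\<Sum>y\<in>S. \<Sum>x\<in>S. V y * (s x * s y * k x y)) = (\<Sum>y\<in>S. \<Sum>x\<in>S. V x * (s x * s y * k x y))"
      by (subst sum.swap) (simp add: k_sym mult_ac)
    then have "(\<Sum>y\<in>S. s y * (\<Sum>x\<in>S. A x y * s x)) = kquad k S s"
      unfolding A_def kquad_def by (simp add: sum_distrib_left algebra_simps sum.distrib sum_subtractf k_sym flip: sum_distrib_left)
        (simp add: sum_distrib_left algebra_simps k_sym)
    then show ?thesis using \<alpha>(2) by simp
  qed
  obtain s where s: "\<And>x. x \<in> S \<Longrightarrow> 0 \<le> s x" "\<And>y. y \<in> S \<Longrightarrow> 0 \<le> (\<Sum>x\<in>S. A x y * s x) - Hk \<sigma>' y"
    "\<And>y. y \<in> S \<Longrightarrow> s y * ((\<Sum>x\<in>S. A x y * s x) - Hk \<sigma>' y) = 0"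
    by (rule monotone_complementarity[OF S \<alpha>(1) mono]) (rule that)
  have r: "resid V \<gamma> \<sigma>' (disc S s) y = (\<Sum>x\<in>S. A x y * s x) - Hk \<sigma>' y" for y
  proof -
    have m: "(\<lambda>x. V x * k x y) \<in> borel_measurable borel" by (intro borel_measurable_continuous_onI continuous_on_mult V k_cont1)
    have "(\<integral>x. V x * k x y \<partial>disc S s) = (\<Sum>x\<in>S. s x * (V x * k x y))" by (rule disc(2)[OF S s(1) m])
    moreover have "Hk (disc S s) y = (\<Sum>x\<in>S. s x * k x y)" by (rule Hk_disc[OF S s(1)])
    ultimately show ?thesis unfolding resid_def A_def
      by (simp add: sum_distrib_left sum.distrib sum_subtractf algebra_simps)
  qed
  show ?thesis
  proof (rule that[of "disc S s"])
    have m: "resid V \<gamma> \<sigma>' (disc S s) \<in> borel_measurable borel"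
      by (rule borel_measurable_continuous_onI[OF resid_cont[OF V s' disc(1)[OF S s(1)]]])
    have "(\<integral>y. resid V \<gamma> \<sigma>' (disc S s) y \<partial>disc S s) = (\<Sum>y\<in>S. s y * resid V \<gamma> \<sigma>' (disc S s) y)" by (rule disc(2)[OF S s(1) m])
    also have "\<dots> = 0" unfolding r by (intro sum.neutral ballI s(3))
    finally show "step V \<gamma> S \<sigma>' (disc S s)" unfolding step_def
      using s(1,2)[folded r] by blast
  qed
qed

lemma supported_nonneg:
  fixes f :: "'a \<Rightarrow> real"
  assumes "finite S" "\<forall>x\<in>S. 0 \<le> s x" "cts f" "\<And>y. y \<in> S \<Longrightarrow> 0 \<le> f y"
  shows "0 \<le> (\<integral>x. f x \<partial>disc S s)"
proof -
  have "(\<integral>x. f x \<partial>disc S s) = (\<Sum>x\<in>S. s x * f x)"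
    by (rule disc(2)[OF assms(1) _ borel_measurable_continuous_onI[OF assms(3)]]) (use assms(2) in auto)
  then show ?thesis using assms(2,4) by (auto intro!: sum_nonneg)
qed

lemma resid_integral:
  assumes V: "cts V" and s: "fin_borel \<sigma>'" "fin_borel \<sigma>" and r: "fin_borel \<rho>" and w: "cts w"
  shows "(\<integral>y. w y * resid V \<gamma> \<sigma>' \<sigma> y \<partial>\<rho>) = (\<integral>y. w y * Hk \<sigma> y \<partial>\<rho>) - (\<integral>y. w y * Hk \<sigma>' y \<partial>\<rho>)
     + \<gamma> * ((\<integral>y. w y * V y * Hk \<sigma> y \<partial>\<rho>) - (\<integral>x. V x * (\<integral>y. w y * k y x \<partial>\<rho>) \<partial>\<sigma>))"
proof -
  note i = integrable_continuous[OF r]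
  have c1: "cts (\<lambda>y. w y * Hk \<sigma> y)" and c2: "cts (\<lambda>y. w y * Hk \<sigma>' y)"
    and c3: "cts (\<lambda>y. w y * V y * Hk \<sigma> y)" and c4: "cts (\<lambda>y. w y * (\<integral>x. V x * k x y \<partial>\<sigma>))"
    by (intro continuous_intros w V Hk_cont wk_cont s)+
  have "(\<integral>y. w y * resid V \<gamma> \<sigma>' \<sigma> y \<partial>\<rho>) = (\<integral>y. w y * Hk \<sigma> y - w y * Hk \<sigma>' y + \<gamma> * (w y * V y * Hk \<sigma> y - w y * (\<integral>x. V x * k x y \<partial>\<sigma>)) \<partial>\<rho>)"
    unfolding resid_def by (simp add: algebra_simps)
  also have "\<dots> = (\<integral>y. w y * Hk \<sigma> y \<partial>\<rho>) - (\<integral>y. w y * Hk \<sigma>' y \<partial>\<rho>) + \<gamma> * ((\<integral>y. w y * V y * Hk \<sigma> y \<partial>\<rho>) - (\<integral>y. w y * (\<integral>x. V x * k x y \<partial>\<sigma>) \<partial>\<rho>))"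
    using i[OF c1] i[OF c2] i[OF c3] i[OF c4] by simp
  also have "(\<integral>y. w y * (\<integral>x. V x * k x y \<partial>\<sigma>) \<partial>\<rho>) = (\<integral>x. V x * (\<integral>y. w y * k y x \<partial>\<rho>) \<partial>\<sigma>)"
  proof -
    have "(\<integral>y. \<integral>x. k x y * V x * w y \<partial>\<sigma> \<partial>\<rho>) = (\<integral>x. \<integral>y. k x y * V x * w y \<partial>\<rho> \<partial>\<sigma>)"
      by (rule integral_swap[OF _ s(2) r])
         (intro continuous_on_mult k_cont continuous_on_compose2[OF V] continuous_on_compose2[OF w] continuous_on_fst continuous_on_snd continuous_on_id, auto)
    moreover have "(\<integral>y. \<integral>x. k x y * V x * w y \<partial>\<sigma> \<partial>\<rho>) = (\<integral>y. w y * (\<integral>x. V x * k x y \<partial>\<sigma>) \<partial>\<rho>)"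
      by (subst integral_mult_right_zero[symmetric]) (simp add: mult_ac)
    moreover have "(\<integral>x. \<integral>y. k x y * V x * w y \<partial>\<rho> \<partial>\<sigma>) = (\<integral>x. V x * (\<integral>y. w y * k y x \<partial>\<rho>) \<partial>\<sigma>)"
      by (subst integral_mult_right_zero[symmetric]) (simp add: mult_ac k_sym)
    ultimately show ?thesis by simp
  qed
  finally show ?thesis .
qed

end

text \<open>The smallness of \<gamma> keeps 1 + \<gamma> V and 1 - \<gamma> V nonnegative, so that
  residuals can be tested with these weights.\<close>

locale euler_step = kernel_space k for k :: "'a::metric_space \<Rightarrow> 'a \<Rightarrow> real" +
  fixes V :: "'a \<Rightarrow> real" and \<gamma> :: real and S :: "'a set"
  assumes V: "cts V" and S: "finite S" and \<gamma>: "\<gamma> > 0" and \<gamma>V: "\<And>x. \<gamma> * \<bar>V x\<bar> \<le> 1"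
begin

definition supp :: "'a measure \<Rightarrow> bool" where
  "supp \<sigma> \<longleftrightarrow> (\<exists>s. (\<forall>x\<in>S. 0 \<le> s x) \<and> \<sigma> = disc S s)"

lemma supp_fin_borel: "supp \<sigma> \<Longrightarrow> fin_borel \<sigma>"
  unfolding supp_def using disc(1)[OF S] by auto

lemma supp_nonneg: "supp \<sigma> \<Longrightarrow> cts f \<Longrightarrow> (\<And>y. y \<in> S \<Longrightarrow> 0 \<le> f y) \<Longrightarrow> 0 \<le> (\<integral>x. f x \<partial>\<sigma>)" for f :: "'a \<Rightarrow> real"
  unfolding supp_def by (elim exE conjE) (simp add: supported_nonneg[OF S])

lemma step_supp: "step V \<gamma> S \<sigma>' \<sigma> \<Longrightarrow> supp \<sigma>"
  by (simp add: step_def supp_def)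

lemma resid_integral_1:
  assumes s: "fin_borel \<sigma>'" "fin_borel \<sigma>" and r: "fin_borel \<rho>"
  shows "(\<integral>y. resid V \<gamma> \<sigma>' \<sigma> y \<partial>\<rho>) = ip \<sigma> \<rho> - ip \<sigma>' \<rho> + \<gamma> * ((\<integral>y. V y * Hk \<sigma> y \<partial>\<rho>) - (\<integral>x. V x * Hk \<rho> x \<partial>\<sigma>))"
  using resid_integral[OF V s r continuous_on_const, of 1] by (simp add: ip_def Hk_def)

text \<open>When the residual is tested against the new measure itself, the skew part drops
  out.\<close>

lemma step_norm:
  assumes s: "fin_borel \<sigma>'" and st: "step V \<gamma> S \<sigma>' \<sigma>"
  shows "ip \<sigma> \<sigma> = ip \<sigma>' \<sigma>" "nsq \<sigma> \<sigma>' = ip \<sigma>' \<sigma>' - ip \<sigma> \<sigma>"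
proof -
  note f = supp_fin_borel[OF step_supp[OF st]]
  show "ip \<sigma> \<sigma> = ip \<sigma>' \<sigma>" using st resid_integral_1[OF s f f] by (simp add: step_def)
  then show "nsq \<sigma> \<sigma>' = ip \<sigma>' \<sigma>' - ip \<sigma> \<sigma>" by (simp add: nsq_def ip_commute[OF f s])
qed

text \<open>The residual of each step is integrated against the new measure of the other, as for two
  flows; the pairing estimate then plays the part of Cauchy-Schwarz.\<close>

lemma step_contraction:
  assumes s: "supp \<sigma>'" "supp \<rho>'" and st: "step V \<gamma> S \<sigma>' \<sigma>" "step V \<gamma> S \<rho>' \<rho>"
  shows "nsq \<sigma> \<rho> \<le> nsq \<sigma>' \<rho>'"
proof -
  note f = supp_fin_borel[OF step_supp[OF st(1)]] supp_fin_borel[OF step_supp[OF st(2)]] s[THEN supp_fin_borel]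
  have a: "0 \<le> (\<integral>y. resid V \<gamma> \<sigma>' \<sigma> y \<partial>\<rho>)" "0 \<le> (\<integral>y. resid V \<gamma> \<rho>' \<rho> y \<partial>\<sigma>)"
    by (rule supp_nonneg[OF step_supp[OF st(2)] resid_cont[OF V f(3,1)]], use st in \<open>simp add: step_def\<close>)
       (rule supp_nonneg[OF step_supp[OF st(1)] resid_cont[OF V f(4,2)]], use st in \<open>simp add: step_def\<close>)
  have "nsq \<sigma> \<rho> \<le> (ip \<sigma>' \<sigma> - ip \<rho>' \<sigma>) - (ip \<sigma>' \<rho> - ip \<rho>' \<rho>)"
    using a step_norm(1)[OF f(3) st(1)] step_norm(1)[OF f(4) st(2)] ip_commute[OF f(1,2)]
    unfolding resid_integral_1[OF f(3,1,2)] resid_integral_1[OF f(4,2,1)] nsq_def by (simp add: right_diff_distrib)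
  also have "\<dots> \<le> sqrt (nsq \<sigma>' \<rho>') * sqrt (nsq \<sigma> \<rho>)"
  proof -
    have "(\<integral>y. Hk \<sigma>' y - Hk \<rho>' y \<partial>\<nu>) = ip \<sigma>' \<nu> - ip \<rho>' \<nu>" if "fin_borel \<nu>" for \<nu>
      unfolding ip_def by (intro Bochner_Integration.integral_diff integrable_continuous Hk_cont that f)
    then show ?thesis using nsq(4)[OF f(1,2) nsq(2)[OF f(3,4)]] f by simp
  qed
  finally have le: "sqrt (nsq \<sigma> \<rho>) * sqrt (nsq \<sigma> \<rho>) \<le> sqrt (nsq \<sigma>' \<rho>') * sqrt (nsq \<sigma> \<rho>)" using nsq(1)[OF f(1,2)] by simp
  show ?thesis
  proof (cases "nsq \<sigma> \<rho> = 0")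
    case True then show ?thesis using nsq(1)[OF f(3,4)] by simp
  next
    case False
    then have "0 < sqrt (nsq \<sigma> \<rho>)" using nsq(1)[OF f(1,2)] by simp
    then have "sqrt (nsq \<sigma> \<rho>) \<le> sqrt (nsq \<sigma>' \<rho>')" using le mult_le_cancel_right_pos by blast
    then show ?thesis by simp
  qed
qed

text \<open>The energy as a quadratic function of \<sigma>; for \<open>Sg \<mu>\<close> it equals
  \<open>Energy V \<mu>\<close>.\<close>

definition en :: "'a measure \<Rightarrow> real" where
  "en \<sigma> = (\<integral>x. V x * Hk \<sigma> x \<partial>\<sigma>)"

lemma weighted_bound:
  fixes u :: "'a \<Rightarrow> real"
  assumes s: "supp \<sigma>" and r: "supp \<rho>" and u: "cts u" "\<And>x. \<bar>u x\<bar> \<le> M" and w: "cts w" "\<And>x. \<bar>w x\<bar> \<le> M'"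
  shows "\<bar>\<integral>x. u x * (\<integral>y. w y * k y x \<partial>\<rho>) \<partial>\<sigma>\<bar> \<le> M * M' * ip \<rho> \<sigma>"
proof -
  note f = supp_fin_borel[OF s] supp_fin_borel[OF r]
  have M: "0 \<le> M" "0 \<le> M'" using u(2)[of undefined] w(2)[of undefined] by linarith+
  have b: "\<bar>u x * (\<integral>y. w y * k y x \<partial>\<rho>)\<bar> \<le> M * M' * Hk \<rho> x" for x
  proof -
    have "\<bar>\<integral>y. w y * k y x \<partial>\<rho>\<bar> \<le> (\<integral>y. \<bar>w y * k y x\<bar> \<partial>\<rho>)" by (rule Bochner_Integration.integral_abs_bound)
    also have "\<dots> \<le> (\<integral>y. M' * k y x \<partial>\<rho>)"
      by (rule integral_mono) (use w k_pos in \<open>auto intro!: integrable_continuous f continuous_intros k_cont1 simp: abs_mult abs_of_pos mult_right_mono less_imp_le\<close>)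
    finally have "\<bar>\<integral>y. w y * k y x \<partial>\<rho>\<bar> \<le> M' * Hk \<rho> x" by (simp add: Hk_def)
    then show ?thesis unfolding abs_mult mult.assoc using u(2)[of x] M by (intro mult_mono) auto
  qed
  have "\<bar>\<integral>x. u x * (\<integral>y. w y * k y x \<partial>\<rho>) \<partial>\<sigma>\<bar> \<le> (\<integral>x. \<bar>u x * (\<integral>y. w y * k y x \<partial>\<rho>)\<bar> \<partial>\<sigma>)" by (rule Bochner_Integration.integral_abs_bound)
  also have "\<dots> \<le> (\<integral>x. M * M' * Hk \<rho> x \<partial>\<sigma>)"
    by (rule integral_mono[OF _ _ b]) (intro integrable_continuous f continuous_intros u wk_cont w Hk_cont)+
  finally show ?thesis by (simp add: ip_def)
qed

text \<open>The energy is quadratic in \<sigma>, so V times the residual is integrated against the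
  old and the new measure. Against the new one the result is 0, squeezed by the weights 1 + \<gamma>
  V and 1 - \<gamma> V. Against the old one, \<gamma> times it is at most the plain integral of the
  residual, which contributes - nsq. What remains is of second order in \<gamma>.\<close>

lemma step_energy:
  assumes s: "supp \<sigma>'" and st: "step V \<gamma> S \<sigma>' \<sigma>" and M: "\<And>x. \<bar>V x\<bar> \<le> M" and N: "ip \<sigma>' \<sigma>' \<le> N"
  shows "\<gamma> * (en \<sigma> - en \<sigma>') + nsq \<sigma> \<sigma>' \<le> 4 * \<gamma>\<^sup>2 * M\<^sup>2 * N"
proof -
  note ss = step_supp[OF st]
  note f = supp_fin_borel[OF s] supp_fin_borel[OF ss]
  define q where "q = resid V \<gamma> \<sigma>' \<sigma>"
  have qc: "cts q" unfolding q_def by (rule resid_cont[OF V f])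
  have q0: "\<And>y. y \<in> S \<Longrightarrow> 0 \<le> q y" "(\<integral>y. q y \<partial>\<sigma>) = 0" using st by (auto simp: step_def q_def)
  have M0: "M \<ge> 0" using M[of undefined] by linarith
  have cV: "cts (\<lambda>y. V y * q y)" by (intro continuous_intros V qc)
  have Vq: "\<gamma> * V y * q y \<le> q y" "0 \<le> q y + \<gamma> * V y * q y" if "y \<in> S" for y
  proof -
    have "\<bar>\<gamma> * V y\<bar> \<le> 1" using \<gamma>V[of y] \<gamma> by (simp add: abs_mult)
    then have "\<gamma> * V y \<le> 1" "-1 \<le> \<gamma> * V y" by linarith+
    then show "\<gamma> * V y * q y \<le> q y" "0 \<le> q y + \<gamma> * V y * q y"
      using q0(1)[OF that] mult_right_mono[of "\<gamma> * V y" 1 "q y"] mult_right_mono[of "-1" "\<gamma> * V y" "q y"] by auto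
  qed
  have i': "(\<integral>y. q y - \<gamma> * (V y * q y) \<partial>\<sigma>') = (\<integral>y. q y \<partial>\<sigma>') - \<gamma> * (\<integral>y. V y * q y \<partial>\<sigma>')"
    using integrable_continuous[OF f(1) qc] integrable_continuous[OF f(1) cV] by simp
  have i1: "(\<integral>y. q y + \<gamma> * (V y * q y) \<partial>\<sigma>) = (\<integral>y. q y \<partial>\<sigma>) + \<gamma> * (\<integral>y. V y * q y \<partial>\<sigma>)"
    and i2: "(\<integral>y. q y - \<gamma> * (V y * q y) \<partial>\<sigma>) = (\<integral>y. q y \<partial>\<sigma>) - \<gamma> * (\<integral>y. V y * q y \<partial>\<sigma>)"
    using integrable_continuous[OF f(2) qc] integrable_continuous[OF f(2) cV] by simp_all
  have "0 \<le> (\<integral>y. q y - \<gamma> * (V y * q y) \<partial>\<sigma>')" by (rule supp_nonneg[OF s]) (use Vq in \<open>auto intro!: continuous_intros qc cV simp: mult.assoc\<close>)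
  then have A: "\<gamma> * (\<integral>y. V y * q y \<partial>\<sigma>') \<le> (\<integral>y. q y \<partial>\<sigma>')" unfolding i' by simp
  have "0 \<le> (\<integral>y. q y + \<gamma> * (V y * q y) \<partial>\<sigma>)" "0 \<le> (\<integral>y. q y - \<gamma> * (V y * q y) \<partial>\<sigma>)"
    by (rule supp_nonneg[OF ss]; use Vq in \<open>auto intro!: continuous_intros qc cV simp: mult.assoc\<close>)+
  then have B: "\<gamma> * (\<integral>y. V y * q y \<partial>\<sigma>) = 0" unfolding i1 i2 q0(2) by simp
  define X where "X = (\<integral>x. V x * Hk \<sigma> x \<partial>\<sigma>')"
  define X' where "X' = (\<integral>x. V x * Hk \<sigma>' x \<partial>\<sigma>)"
  define a1 where "a1 = (\<integral>y. V y * V y * Hk \<sigma> y \<partial>\<sigma>')"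
  define a2 where "a2 = (\<integral>x. V x * (\<integral>y. V y * k y x \<partial>\<sigma>') \<partial>\<sigma>)"
  define a3 where "a3 = (\<integral>y. V y * V y * Hk \<sigma> y \<partial>\<sigma>)"
  define a4 where "a4 = (\<integral>x. V x * (\<integral>y. V y * k y x \<partial>\<sigma>) \<partial>\<sigma>)"
  have e1: "(\<integral>y. V y * q y \<partial>\<sigma>') = X - en \<sigma>' + \<gamma> * (a1 - a2)"
    unfolding q_def resid_integral[OF V f f(1) V] X_def en_def a1_def a2_def ..
  have e2: "(\<integral>y. V y * q y \<partial>\<sigma>) = en \<sigma> - X' + \<gamma> * (a3 - a4)"
    unfolding q_def resid_integral[OF V f f(2) V] X'_def en_def a3_def a4_def ..
  have e3: "(\<integral>y. q y \<partial>\<sigma>') = ip \<sigma> \<sigma>' - ip \<sigma>' \<sigma>' + \<gamma> * (X - X')"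
    unfolding q_def resid_integral_1[OF f f(1)] X_def X'_def ..
  have n: "ip \<sigma> \<sigma>' = ip \<sigma> \<sigma>" "nsq \<sigma> \<sigma>' = ip \<sigma>' \<sigma>' - ip \<sigma> \<sigma>" using step_norm[OF f(1) st] ip_commute[OF f] by simp_all
  have nN: "ip \<sigma> \<sigma> \<le> N" using n nsq(1)[OF f(2,1)] N by linarith
  have VV: "\<bar>V x * V x\<bar> \<le> M\<^sup>2" for x unfolding abs_mult power2_eq_square using M M0 by (intro mult_mono) auto
  have cVV: "cts (\<lambda>x. V x * V x)" by (intro continuous_intros V)
  have "\<bar>a1\<bar> \<le> M\<^sup>2 * 1 * ip \<sigma> \<sigma>'" "\<bar>a3\<bar> \<le> M\<^sup>2 * 1 * ip \<sigma> \<sigma>"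
    using weighted_bound[OF s ss cVV VV continuous_on_const, of 1 1] weighted_bound[OF ss ss cVV VV continuous_on_const, of 1 1]
    unfolding a1_def a3_def by (simp_all add: Hk_def)
  moreover have "\<bar>a2\<bar> \<le> M * M * ip \<sigma>' \<sigma>" "\<bar>a4\<bar> \<le> M * M * ip \<sigma> \<sigma>"
    unfolding a2_def a4_def by (rule weighted_bound[OF ss s V M V M] weighted_bound[OF ss ss V M V M])+
  moreover have "M\<^sup>2 * ip \<sigma> \<sigma> \<le> M\<^sup>2 * N" using nN by (intro mult_left_mono) auto
  ultimately have "\<bar>a1\<bar> \<le> M\<^sup>2 * N" "\<bar>a2\<bar> \<le> M\<^sup>2 * N" "\<bar>a3\<bar> \<le> M\<^sup>2 * N" "\<bar>a4\<bar> \<le> M\<^sup>2 * N"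
    using n(1) ip_commute[OF f] by (simp_all add: power2_eq_square)
  then have "a2 - a1 + a4 - a3 \<le> 4 * (M\<^sup>2 * N)" by linarith
  then have C: "\<gamma>\<^sup>2 * (a2 - a1 + a4 - a3) \<le> \<gamma>\<^sup>2 * (4 * (M\<^sup>2 * N))" by (intro mult_left_mono) auto
  have "\<gamma> * (en \<sigma> - en \<sigma>') = \<gamma> * (\<integral>y. V y * q y \<partial>\<sigma>') + \<gamma> * (\<integral>y. V y * q y \<partial>\<sigma>) - \<gamma> * (X - X') + \<gamma>\<^sup>2 * (a2 - a1 + a4 - a3)"
    unfolding e1 e2 by (simp add: algebra_simps power2_eq_square)
  also have "\<dots> \<le> (ip \<sigma> \<sigma>' - ip \<sigma>' \<sigma>') + \<gamma>\<^sup>2 * (4 * (M\<^sup>2 * N))" using A B C unfolding e3 by linarith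
  finally show ?thesis using n by simp
qed

end

section \<open>A priori estimates along the discrete scheme\<close>

locale euler_scheme = euler_step k V \<gamma> S for k :: "'a::metric_space \<Rightarrow> 'a \<Rightarrow> real" and V \<gamma> S +
  fixes s :: "nat \<Rightarrow> 'a measure" and M N :: real
  assumes s0: "supp (s 0)" and st: "step V \<gamma> S (s j) (s (Suc j))"
    and M: "\<And>x. \<bar>V x\<bar> \<le> M" and N: "ip (s 0) (s 0) \<le> N"
begin

lemma supp_s: "supp (s j)"
  using s0 step_supp[OF st] by (cases j) auto

lemmas fin_s = supp_fin_borel[OF supp_s]

definition \<delta> :: "nat \<Rightarrow> real" where
  "\<delta> j = nsq (s (Suc j)) (s j)"

lemma \<delta>_nonneg: "0 \<le> \<delta> j"
  unfolding \<delta>_def by (rule nsq(1)[OF fin_s fin_s])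

text \<open>Consecutive iterates are two runs of the same step, so the contraction applies to
  them.\<close>

lemma \<delta>_antimono: "i \<le> j \<Longrightarrow> \<delta> j \<le> \<delta> i"
  by (rule lift_Suc_antimono_le[of \<delta>]) (use step_contraction[OF supp_s supp_s st st] in \<open>simp_all add: \<delta>_def\<close>)

lemma norm_telescope: "ip (s J) (s J) = ip (s 0) (s 0) - (\<Sum>j<J. \<delta> j)"
  by (induction J) (use step_norm(2)[OF fin_s st] in \<open>simp_all add: \<delta>_def\<close>)

lemma ip_le: "ip (s J) (s J) \<le> N"
  using norm_telescope[of J] sum_nonneg[of "{..<J}" \<delta>] \<delta>_nonneg N by fastforce

lemma N_nonneg: "0 \<le> N" and M_nonneg: "0 \<le> M"
  using order_trans[OF Hk_norm(1)[OF fin_s] ip_le[unfolded ip_def]] order_trans[OF abs_ge_zero M] by blast+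

lemma energy_bound: "\<bar>en (s j)\<bar> \<le> M * N"
proof -
  have "\<bar>en (s j)\<bar> \<le> M * ip (s j) (s j)"
    using weighted_bound[OF supp_s supp_s V M continuous_on_const, of 1 1 j j] by (simp add: en_def Hk_def)
  also have "\<dots> \<le> M * N" using ip_le M_nonneg by (intro mult_left_mono)
  finally show ?thesis .
qed

text \<open>The energy inequality is summed; the telescoped energy is at least - 2 M N.\<close>

lemma sum_\<delta>_le: "(\<Sum>j<J. \<delta> j) \<le> \<gamma> * (2 * M * N + 4 * J * \<gamma> * M\<^sup>2 * N)"
proof -
  have "\<gamma> * (en (s J) - en (s 0)) + (\<Sum>j<J. \<delta> j) \<le> J * (4 * \<gamma>\<^sup>2 * M\<^sup>2 * N)"
  proof (induction J)
    case (Suc J)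
    show ?case using Suc step_energy[OF supp_s st M ip_le, of J] by (simp add: \<delta>_def algebra_simps)
  qed simp
  moreover have "- (2 * (M * N)) \<le> en (s J) - en (s 0)" using energy_bound[of J] energy_bound[of 0] by linarith
  then have "\<gamma> * - (2 * (M * N)) \<le> \<gamma> * (en (s J) - en (s 0))" using \<gamma> by (intro mult_left_mono) auto
  ultimately show ?thesis by (simp add: algebra_simps power2_eq_square)
qed

lemma chain: "sqrt (nsq (s (i + l)) (s i)) \<le> (\<Sum>j<l. sqrt (\<delta> (i + j)))"
proof (induction l)
  case 0 show ?case by (simp add: nsq_def)
next
  case (Suc l)
  show ?case using nsq_triangle[OF fin_s fin_s fin_s, of "i + Suc l" i "i + l"] Suc by (simp add: \<delta>_def)
qed

text \<open>Cauchy-Schwarz over l steps. Combined with \<open>sum_\<delta>_le\<close> it gives a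
  Hoelder bound of exponent 1/2 that is valid down to time 0.\<close>

lemma nsq_le_sum: "nsq (s (i + l)) (s i) \<le> l * (\<Sum>j<i + l. \<delta> j)"
proof -
  have "nsq (s (i + l)) (s i) \<le> (\<Sum>j<l. 1 * sqrt (\<delta> (i + j)))\<^sup>2"
    using chain[of i l] nsq(1)[OF fin_s fin_s] by (simp add: real_sqrt_le_iff' sqrt_le_D)
  also have "\<dots> \<le> (\<Sum>j<l. 1\<^sup>2) * (\<Sum>j<l. (sqrt (\<delta> (i + j)))\<^sup>2)" by (rule Cauchy_Schwarz_ineq_sum)
  also have "\<dots> = l * (\<Sum>j\<in>(+) i ` {..<l}. \<delta> j)" using \<delta>_nonneg by (simp add: sum.reindex)
  also have "\<dots> \<le> l * (\<Sum>j<i + l. \<delta> j)" using \<delta>_nonneg by (intro mult_left_mono sum_mono2) auto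
  finally show ?thesis .
qed

text \<open>A Lipschitz bound by the speed at the starting time, from monotonicity of the
  increments.\<close>

lemma nsq_le_rate: "nsq (s (i + l)) (s i) \<le> l\<^sup>2 * \<delta> i"
proof -
  have "sqrt (nsq (s (i + l)) (s i)) \<le> l * sqrt (\<delta> i)"
    using order_trans[OF chain sum_bounded_above[of "{..<l}" "\<lambda>j. sqrt (\<delta> (i + j))" "sqrt (\<delta> i)"]] \<delta>_antimono by simp
  then have "(sqrt (nsq (s (i + l)) (s i)))\<^sup>2 \<le> (l * sqrt (\<delta> i))\<^sup>2" by (rule power_mono) (simp add: nsq(1)[OF fin_s fin_s])
  then show ?thesis by (simp add: power_mult_distrib nsq(1)[OF fin_s fin_s] \<delta>_nonneg)
qed

lemma flow_inequality:
  assumes y: "y \<in> S" and F: "\<And>j. i \<le> j \<Longrightarrow> j \<le> i + l \<Longrightarrow> V y * Hk (s j) y - (\<integral>x. V x * k x y \<partial>s j) \<le> C"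
  shows "0 \<le> Hk (s (i + l)) y - Hk (s i) y + l * \<gamma> * C"
  using F
proof (induction l)
  case (Suc l)
  let ?F = "V y * Hk (s (i + Suc l)) y - (\<integral>x. V x * k x y \<partial>s (i + Suc l))"
  have "0 \<le> resid V \<gamma> (s (i + l)) (s (i + Suc l)) y" using st[of "i + l"] y by (simp add: step_def)
  moreover have "\<gamma> * ?F \<le> \<gamma> * C" using \<gamma> Suc.prems[of "i + Suc l"] by (intro mult_left_mono) auto
  ultimately have "0 \<le> Hk (s (i + Suc l)) y - Hk (s (i + l)) y + \<gamma> * C" by (simp add: resid_def)
  moreover have "0 \<le> Hk (s (i + l)) y - Hk (s i) y + l * \<gamma> * C" by (rule Suc.IH) (use Suc.prems in auto)
  ultimately show ?case by (simp add: algebra_simps)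
qed simp

end

text \<open>Tychonoff for a product of compact intervals; countability of the index type makes
  compactness sequential.\<close>

lemma bounded_sequences_subsequence:
  fixes f :: "nat \<Rightarrow> 'i::countable \<Rightarrow> real"
  assumes f: "\<And>n i. \<bar>f n i\<bar> \<le> C i"
  obtains r :: "nat \<Rightarrow> nat" where "strict_mono r" "\<And>i. convergent (\<lambda>n. f (r n) i)"
proof -
  define K where "K = (\<Pi>\<^sub>E i\<in>UNIV. {- C i..C i})"
  have "compactin (product_topology (\<lambda>_::'i. euclideanreal) UNIV) K"
    unfolding K_def compactin_PiE by simp
  then have "seq_compact K" by (simp add: euclidean_product_topology compact_imp_seq_compact)
  moreover have "\<forall>n. f n \<in> K" using f by (auto simp: K_def abs_le_iff minus_le_iff)
  ultimately obtain l r where r: "strict_mono r" "(f \<circ> r) \<longlonglongrightarrow> l" by (rule seq_compactE)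
  have "(\<lambda>n. f (r n) i) \<longlonglongrightarrow> l i" for i
  proof -
    have "isCont (\<lambda>g::'i \<Rightarrow> real. g i) l"
      by (rule continuous_on_interior[of UNIV]) (auto intro: continuous_on_product_coordinates)
    from isCont_tendsto_compose[OF this r(2)] show ?thesis by simp
  qed
  then show ?thesis using r(1) that convergentI by metis
qed

context sinkhorn
begin

text \<open>The kernel is at least \<kappa>, so a bound on the RKHS norm bounds the mass; this gives
  the uniform mass bound for the schemes.\<close>

lemma mass_le_ip:
  assumes s: "fin_borel \<sigma>"
  shows "\<kappa> * (measure \<sigma> UNIV)\<^sup>2 \<le> ip \<sigma> \<sigma>"
proof -
  have le: "\<kappa> * measure \<sigma> UNIV \<le> Hk \<sigma> y" for y
  proof -
    have "(\<integral>x. \<kappa> \<partial>\<sigma>) \<le> (\<integral>x. k x y \<partial>\<sigma>)"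
      by (rule integral_mono) (auto intro!: integrable_continuous[OF s] k_cont1 continuous_intros simp: \<kappa>_le)
    then show ?thesis using s by (simp add: Hk_def fin_borel_def sets_eq_imp_space_eq[of \<sigma> borel] mult.commute)
  qed
  have "(\<integral>y. \<kappa> * measure \<sigma> UNIV \<partial>\<sigma>) \<le> (\<integral>y. Hk \<sigma> y \<partial>\<sigma>)"
    by (rule integral_mono) (auto intro!: integrable_continuous[OF s] Hk_cont[OF s] continuous_intros simp: le)
  then show ?thesis using s by (simp add: ip_def fin_borel_def sets_eq_imp_space_eq[of \<sigma> borel] power2_eq_square mult_ac)
qed

end

section \<open>Piecewise constant interpolation and compactness\<close>

locale scheme = sinkhorn \<epsilon> c for \<epsilon> and c :: "'a::metric_space \<Rightarrow> 'a \<Rightarrow> real" +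
  fixes V :: "'a \<Rightarrow> real" and \<tau> :: "nat \<Rightarrow> real" and S :: "nat \<Rightarrow> 'a set" and s :: "nat \<Rightarrow> nat \<Rightarrow> 'a measure"
    and M N :: real and \<mu>0 :: "'a measure" and xs :: "nat \<Rightarrow> 'a"
  assumes V: "cts V" and \<tau>: "\<tau> n > 0" "\<tau> n \<le> 1" "\<tau> \<longlonglongrightarrow> 0"
    and es: "euler_scheme (kc \<epsilon> c) V (2 / \<epsilon> * \<tau> n) (S n) (s n) M N"
    and \<mu>0: "\<mu>0 \<in> Probs"
    and init: "cts (\<phi> :: 'a \<Rightarrow> real) \<Longrightarrow> (\<lambda>n. \<integral>x. \<phi> x \<partial>s n 0) \<longlonglongrightarrow> (\<integral>x. \<phi> x \<partial>Sg \<mu>0)"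
    and xs: "\<forall>\<^sub>F n in sequentially. xs j \<in> S n" "e > 0 \<Longrightarrow> \<exists>j. dist x (xs j) < e"
begin

lemmas s_fin = euler_scheme.fin_s[OF es]

lemma M_nonneg: "0 \<le> M" and N_nonneg: "0 \<le> N"
  using euler_scheme.M_nonneg[OF es] euler_scheme.N_nonneg[OF es] by blast+

text \<open>Piecewise constant in time. \<open>nat\<close> sends negative integers to 0, so negative
  times give the initial measure.\<close>

definition Z :: "nat \<Rightarrow> real \<Rightarrow> 'a measure" where
  "Z n t = s n (nat \<lfloor>t / \<tau> n\<rfloor>)"

lemma Z_fin: "fin_borel (Z n t)" and Z_ip: "ip (Z n t) (Z n t) \<le> N"
  unfolding Z_def by (rule s_fin, rule euler_scheme.ip_le[OF es])

text \<open>The bound of \<open>sum_\<delta>_le\<close> for \<gamma> = 2 \<tau> / \<epsilon>,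
  divided by \<tau>, with u in place of the elapsed time J \<tau>.\<close>

definition A :: "real \<Rightarrow> real" where
  "A u = 2 / \<epsilon> * (2 * M * N + 8 / \<epsilon> * u * M\<^sup>2 * N)"

lemma A_mono: "u \<le> v \<Longrightarrow> A u \<le> A v"
  unfolding A_def using eps_pos N_nonneg by (intro mult_left_mono add_left_mono mult_right_mono) auto

lemma A_nonneg: "0 \<le> u \<Longrightarrow> 0 \<le> A u"
  unfolding A_def using eps_pos N_nonneg M_nonneg by (intro mult_nonneg_nonneg add_nonneg_nonneg) auto

lemma Z_mass: "measure (Z n t) UNIV \<le> sqrt (N / \<kappa>)"
proof -
  have "\<kappa> * (measure (Z n t) UNIV)\<^sup>2 \<le> N" using mass_le_ip[OF Z_fin] Z_ip by (rule order_trans)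
  then show ?thesis using \<kappa>_pos by (intro real_le_rsqrt) (simp add: field_simps)
qed

lemma Z_rkhs: "rkhs_le k (Hk (Z n t)) (sqrt N)"
  by (rule rkhs_le_mono[OF Hk_norm(2)[OF Z_fin] real_sqrt_le_mono[OF Z_ip[unfolded ip_def]]])

lemma Z_indices:
  assumes t: "0 \<le> t" "t \<le> u"
  obtains i l where "Z n t = s n i" "Z n u = s n (i + l)" "i = nat \<lfloor>t / \<tau> n\<rfloor>"
    "real l * \<tau> n \<le> u - t + \<tau> n" "u - t - \<tau> n \<le> real l * \<tau> n" "real (i + l) * \<tau> n \<le> u"
proof -
  define i where "i = nat \<lfloor>t / \<tau> n\<rfloor>"
  define j where "j = nat \<lfloor>u / \<tau> n\<rfloor>"
  have le: "t / \<tau> n \<le> u / \<tau> n" "0 \<le> t / \<tau> n" using t \<tau>(1)[of n] by (simp_all add: divide_right_mono)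
  have ij: "i \<le> j" unfolding i_def j_def using le by (intro nat_mono floor_mono)
  have "i \<le> t / \<tau> n" "t / \<tau> n < i + 1" "j \<le> u / \<tau> n" "u / \<tau> n < j + 1"
    using le unfolding i_def j_def by (linarith | simp)+
  then have "i * \<tau> n \<le> t" "t < i * \<tau> n + \<tau> n" "j * \<tau> n \<le> u" "u < j * \<tau> n + \<tau> n"
    using \<tau>(1)[of n] by (simp_all add: field_simps)
  then show ?thesis using ij
    by (intro that[of i "j - i"]) (auto simp: Z_def i_def[symmetric] j_def[symmetric] of_nat_diff left_diff_distrib)
qed

lemma sum_increments:
  assumes J: "real J * \<tau> n \<le> u"
  shows "(\<Sum>j<J. nsq (s n (Suc j)) (s n j)) \<le> \<tau> n * A u"
proof -
  have "(\<Sum>j<J. nsq (s n (Suc j)) (s n j)) \<le> \<tau> n * (2 / \<epsilon> * (2 * M * N + 8 / \<epsilon> * (J * \<tau> n) * M\<^sup>2 * N))"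
    using euler_scheme.sum_\<delta>_le[OF es, of n J] by (simp add: euler_scheme.\<delta>_def[OF es] algebra_simps)
  also have "\<dots> \<le> \<tau> n * A u" unfolding A_def[symmetric] by (rule mult_left_mono[OF A_mono[OF J]]) (simp add: \<tau> less_imp_le)
  finally show ?thesis .
qed

lemma Z_hoelder:
  assumes t: "0 \<le> t" "t \<le> u"
  shows "nsq (Z n u) (Z n t) \<le> (u - t + \<tau> n) * A u"
proof -
  obtain i l where il: "Z n t = s n i" "Z n u = s n (i + l)" "real l * \<tau> n \<le> u - t + \<tau> n" "real (i + l) * \<tau> n \<le> u"
    using Z_indices[OF t] by metis
  have "nsq (Z n u) (Z n t) \<le> l * (\<Sum>j<i + l. nsq (s n (Suc j)) (s n j))"
    using euler_scheme.nsq_le_sum[OF es, of n i l] by (simp add: euler_scheme.\<delta>_def[OF es] il)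
  also have "\<dots> \<le> l * (\<tau> n * A u)" by (intro mult_left_mono sum_increments il) auto
  also have "\<dots> \<le> (u - t + \<tau> n) * A u" using il(3) A_nonneg[of u] t by (simp add: mult_right_mono flip: mult.assoc)
  finally show ?thesis .
qed

text \<open>The squared speed of the discrete step that starts in the cell of t.\<close>

definition rate :: "nat \<Rightarrow> real \<Rightarrow> real" where
  "rate n t = nsq (s n (Suc (nat \<lfloor>t / \<tau> n\<rfloor>))) (s n (nat \<lfloor>t / \<tau> n\<rfloor>)) / (\<tau> n)\<^sup>2"

lemma rate_nonneg: "0 \<le> rate n t"
  unfolding rate_def by (intro divide_nonneg_nonneg nsq(1) s_fin) auto

lemma rate_antimono: "t \<le> u \<Longrightarrow> rate n u \<le> rate n t"
  unfolding rate_def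
  by (intro divide_right_mono euler_scheme.\<delta>_antimono[OF es, unfolded euler_scheme.\<delta>_def[OF es]] nat_mono floor_mono)
     (simp_all add: \<tau> less_imp_le)

lemma Z_rate:
  assumes t: "0 \<le> t" "t \<le> u"
  shows "nsq (Z n u) (Z n t) \<le> (u - t + \<tau> n)\<^sup>2 * rate n t"
proof -
  obtain i l where il: "Z n t = s n i" "Z n u = s n (i + l)" "i = nat \<lfloor>t / \<tau> n\<rfloor>" "real l * \<tau> n \<le> u - t + \<tau> n"
    using Z_indices[OF t] by metis
  have "nsq (Z n u) (Z n t) \<le> l\<^sup>2 * nsq (s n (Suc i)) (s n i)"
    using euler_scheme.nsq_le_rate[OF es, of n i l] by (simp add: euler_scheme.\<delta>_def[OF es] il(1,2))
  also have "\<dots> = (l * \<tau> n)\<^sup>2 * rate n t" using \<tau>(1)[of n] by (simp add: rate_def il(3) power_mult_distrib)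
  also have "\<dots> \<le> (u - t + \<tau> n)\<^sup>2 * rate n t" using il(4) \<tau>(1)[of n] by (intro mult_right_mono power_mono rate_nonneg) auto
  finally show ?thesis .
qed

lemma rate_measurable [measurable]: "rate n \<in> borel_measurable borel"
proof -
  have "(\<lambda>t. (\<lambda>i. nsq (s n (Suc i)) (s n i) / (\<tau> n)\<^sup>2) (nat \<lfloor>t / \<tau> n\<rfloor>)) \<in> borel_measurable borel"
    by (rule measurable_compose[where N="count_space UNIV"]) measurable
  then show ?thesis by (simp add: rate_def[abs_def])
qed

text \<open>Each step contributes its squared increment divided by \<tau>. The cell containing T may
  overshoot by \<tau> \<le> 1, hence T + 1.\<close>

lemma rate_integral:
  assumes T: "0 \<le> T"
  shows "(\<integral>\<^sup>+t. ennreal (rate n t) * indicator {0..T} t \<partial>lborel) \<le> ennreal (A (T + 1))"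
proof -
  define d where "d j = nsq (s n (Suc j)) (s n j)" for j
  have d: "0 \<le> d j" for j unfolding d_def by (intro nsq(1) s_fin)
  define J where "J = Suc (nat \<lfloor>T / \<tau> n\<rfloor>)"
  define I where "I j = {j * \<tau> n..<Suc j * \<tau> n}" for j
  note \<tau>n = \<tau>(1)[of n]
  have "real J \<le> T / \<tau> n + 1" using T \<tau>n unfolding J_def by (simp add: of_nat_nat)
  then have J: "J * \<tau> n \<le> T + 1" using \<tau>n \<tau>(2)[of n] by (simp add: field_simps)
  have "ennreal (rate n t) * indicator {0..T} t \<le> (\<Sum>j<J. ennreal (d j / (\<tau> n)\<^sup>2) * indicator (I j) t)" for t
  proof (cases "t \<in> {0..T}")
    case True
    define i where "i = nat \<lfloor>t / \<tau> n\<rfloor>"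
    have le: "0 \<le> t / \<tau> n" "t / \<tau> n \<le> T / \<tau> n" using True \<tau>n by (simp_all add: divide_right_mono)
    have iJ: "i \<in> {..<J}" unfolding J_def i_def using le by (auto simp: less_Suc_eq_le intro!: nat_mono floor_mono)
    have "i \<le> t / \<tau> n" "t / \<tau> n < i + 1" using le unfolding i_def by (linarith | simp)+
    then have "t \<in> I i" using \<tau>n by (simp add: I_def field_simps)
    then have "ennreal (rate n t) * indicator {0..T} t = ennreal (d i / (\<tau> n)\<^sup>2) * indicator (I i) t"
      using True by (simp add: rate_def d_def i_def)
    also have "\<dots> \<le> (\<Sum>j<J. ennreal (d j / (\<tau> n)\<^sup>2) * indicator (I j) t)" by (rule member_le_sum[OF iJ]) auto
    finally show ?thesis .
  qed simp
  then have "(\<integral>\<^sup>+t. ennreal (rate n t) * indicator {0..T} t \<partial>lborel) \<le> (\<integral>\<^sup>+t. (\<Sum>j<J. ennreal (d j / (\<tau> n)\<^sup>2) * indicator (I j) t) \<partial>lborel)"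
    by (intro nn_integral_mono)
  also have "\<dots> = (\<Sum>j<J. ennreal (d j / (\<tau> n)\<^sup>2) * emeasure lborel (I j))"
    by (subst nn_integral_sum) (auto simp: I_def nn_integral_cmult_indicator intro!: borel_measurable_times_ennreal simp del: nn_integral_indicator)
  also have "\<dots> = (\<Sum>j<J. ennreal (d j / (\<tau> n)\<^sup>2 * \<tau> n))"
  proof (intro sum.cong refl)
    fix j
    have "emeasure lborel (I j) = ennreal (\<tau> n)" using \<tau>n by (simp add: I_def algebra_simps)
    then show "ennreal (d j / (\<tau> n)\<^sup>2) * emeasure lborel (I j) = ennreal (d j / (\<tau> n)\<^sup>2 * \<tau> n)"
      using \<tau>n d[of j] by (subst ennreal_mult) auto
  qed
  also have "\<dots> = ennreal (\<Sum>j<J. d j / (\<tau> n)\<^sup>2 * \<tau> n)" using \<tau>n d by (intro sum_ennreal) auto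
  also have "(\<Sum>j<J. d j / (\<tau> n)\<^sup>2 * \<tau> n) = (\<Sum>j<J. d j) / \<tau> n"
    using \<tau>n by (simp add: sum_divide_distrib power2_eq_square)
  also have "ennreal \<dots> \<le> ennreal (A (T + 1))"
    using sum_increments[OF J] \<tau>n by (intro ennreal_leI) (simp add: d_def divide_le_eq mult.commute)
  finally show ?thesis .
qed

lemma Z_max: "Z n t = Z n (max 0 t)"
  using \<tau>(1)[of n] by (auto simp: Z_def max_def divide_nonpos_pos)

text \<open>A subsequence converges at rational times and at the points xs j. The Hoelder bound
  extends this to all nonnegative times and equicontinuity to all points; negative times reduce to
  0.\<close>

lemma convergent_subsequence:
  obtains r :: "nat \<Rightarrow> nat" where "strict_mono r" "\<And>t y. convergent (\<lambda>n. Hk (Z (r n) t) y)"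
proof -
  define f where "f n p = Hk (Z n (of_rat (fst p))) (xs (snd p))" for n and p :: "rat \<times> nat"
  have "\<bar>f n p\<bar> \<le> sqrt N" for n p unfolding f_def by (rule rkhs_le_bound[OF Z_rkhs])
  then obtain r where r: "strict_mono r" "\<And>p. convergent (\<lambda>n. f (r n) p)" using bounded_sequences_subsequence[of f "\<lambda>_. sqrt N"] by blast
  have \<tau>r: "(\<lambda>n. \<tau> (r n)) \<longlonglongrightarrow> 0" using LIMSEQ_subseq_LIMSEQ[OF \<tau>(3) r(1)] by (simp add: o_def)
  have conv: "convergent (\<lambda>n. Hk (Z (r n) t) y)" if t: "0 \<le> t" for t y
  proof -
    obtain L where "(\<lambda>n. Hk (Z (r n) t) y) \<longlonglongrightarrow> L"
    proof (rule tendsto_approx[of sequentially "\<lambda>n. Hk (Z (r n) t) y"])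
      fix e :: real assume e: "e > 0"
      obtain \<eta> where \<eta>: "\<eta> > 0" "\<And>f x y. rkhs_le k f (sqrt N) \<Longrightarrow> dist x y < \<eta> \<Longrightarrow> \<bar>f x - f y\<bar> \<le> e / 4"
        by (rule rkhs_equicontinuous[of "sqrt N" "e / 4"]) (use e N_nonneg in auto)
      obtain j where j: "dist y (xs j) < \<eta>" using xs(2)[OF \<eta>(1)] by blast
      \<comment> \<open>Both q - t and the time step will be below h, so the Hoelder bound stays
        below (e / 4)^2.\<close>
      define h where "h = min 1 ((e / 4)\<^sup>2 / (2 * (A (t + 1) + 1)))"
      have A1: "A (t + 1) + 1 > 0" using A_nonneg[of "t + 1"] t by simp
      have h: "0 < h" "h \<le> 1" "2 * h * (A (t + 1) + 1) \<le> (e / 4)\<^sup>2"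
      proof -
        show "0 < h" "h \<le> 1" using e A1 by (auto simp: h_def)
        have "2 * (A (t + 1) + 1) * h \<le> 2 * (A (t + 1) + 1) * ((e / 4)\<^sup>2 / (2 * (A (t + 1) + 1)))"
          using A1 by (intro mult_left_mono) (auto simp: h_def)
        then show "2 * h * (A (t + 1) + 1) \<le> (e / 4)\<^sup>2" using A1 by (simp add: mult_ac)
      qed
      obtain q where q: "t < of_rat q" "of_rat q < t + h" using of_rat_dense[of t "t + h"] h by auto
      have q0: "0 \<le> (of_rat q :: real)" using q t by linarith
      obtain c where c: "(\<lambda>n. f (r n) (q, j)) \<longlonglongrightarrow> c" using r(2) unfolding convergent_def by blast
      have "\<forall>\<^sub>F n in sequentially. \<bar>f (r n) (q, j) - c\<bar> < e / 4" using tendstoD[OF c, of "e / 4"] e by (simp add: dist_real_def)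
      moreover have "\<forall>\<^sub>F n in sequentially. \<tau> (r n) < h" using order_tendstoD(2)[OF \<tau>r h(1)] .
      ultimately have "\<forall>\<^sub>F n in sequentially. \<bar>Hk (Z (r n) t) y - c\<bar> \<le> e"
      proof eventually_elim
        case (elim n)
        have "nsq (Z (r n) (of_rat q)) (Z (r n) t) \<le> (of_rat q - t + \<tau> (r n)) * A (of_rat q)" by (rule Z_hoelder) (use q t in auto)
        also have "\<dots> \<le> (2 * h) * (A (t + 1) + 1)"
          by (intro mult_mono) (use q t h elim A_mono[of "of_rat q" "t + 1"] A_nonneg[OF q0] in linarith)+
        finally have "sqrt (nsq (Z (r n) (of_rat q)) (Z (r n) t)) \<le> sqrt ((e / 4)\<^sup>2)" using h(3) by (intro real_sqrt_le_mono) linarith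
        then have "\<bar>Hk (Z (r n) (of_rat q)) y - Hk (Z (r n) t) y\<bar> \<le> e / 4"
          using rkhs_le_bound[OF nsq(2)[OF Z_fin[of "r n" "of_rat q"] Z_fin[of "r n" t]], of y] e by simp
        moreover have "\<bar>Hk (Z (r n) (of_rat q)) y - f (r n) (q, j)\<bar> \<le> e / 4" unfolding f_def using \<eta>(2)[OF Z_rkhs j] by simp
        ultimately show ?case using elim(1) by linarith
      qed
      then show "\<exists>c. \<forall>\<^sub>F n in sequentially. \<bar>Hk (Z (r n) t) y - c\<bar> \<le> e" by blast
    qed simp_all
    then show ?thesis by (rule convergentI)
  qed
  have "convergent (\<lambda>n. Hk (Z (r n) t) y)" for t y using conv[of "max 0 t"] by (simp flip: Z_max)
  then show ?thesis using that r(1) by blast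
qed

text \<open>Lets the limit be studied under the assumption that the whole sequence
  converges.\<close>

lemma subscheme:
  assumes r: "strict_mono r"
  shows "scheme \<epsilon> c V (\<lambda>n. \<tau> (r n)) (\<lambda>n. S (r n)) (\<lambda>n. s (r n)) M N \<mu>0 xs"
proof (rule scheme.intro[OF sinkhorn_axioms], rule scheme_axioms.intro)
  show "(\<lambda>n. \<tau> (r n)) \<longlonglongrightarrow> 0" using LIMSEQ_subseq_LIMSEQ[OF \<tau>(3) r] by (simp add: o_def)
  show "(\<lambda>n. \<integral>x. \<phi> x \<partial>s (r n) 0) \<longlonglongrightarrow> (\<integral>x. \<phi> x \<partial>Sg \<mu>0)" if "cts \<phi>" for \<phi> :: "'a \<Rightarrow> real"
    using LIMSEQ_subseq_LIMSEQ[OF init[OF that] r] by (simp add: o_def)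
  show "\<forall>\<^sub>F n in sequentially. xs j \<in> S (r n)" for j
    using eventually_subseq[OF r xs(1)] .
qed (fact V \<tau> es \<mu>0 | rule xs(2), assumption)+

end

text \<open>Uniformity over measures of bounded mass comes from approximating \<phi> once by kernel
  sections, on which the distance of potentials controls the difference.\<close>

lemma (in kernel_space) integral_nsq_continuous:
  fixes \<phi> :: "'a \<Rightarrow> real"
  assumes c: "cts \<phi>" and e: "e > 0" and C: "C \<ge> 0"
  obtains \<eta> where "\<eta> > 0" "\<And>\<sigma> \<rho>. fin_borel \<sigma> \<Longrightarrow> fin_borel \<rho> \<Longrightarrow> measure \<sigma> UNIV \<le> C \<Longrightarrow> measure \<rho> UNIV \<le> C \<Longrightarrow>
    nsq \<sigma> \<rho> \<le> \<eta> \<Longrightarrow> \<bar>(\<integral>x. \<phi> x \<partial>\<sigma>) - (\<integral>x. \<phi> x \<partial>\<rho>)\<bar> \<le> e"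
proof -
  define e' where "e' = e / (4 * (C + 1))"
  have e': "e' > 0" "e' * C \<le> e / 4" using e C by (auto simp: e'_def field_simps)
  obtain S a where Sa: "finite S" "\<And>\<sigma>. fin_borel \<sigma> \<Longrightarrow> \<bar>(\<integral>x. \<phi> x \<partial>\<sigma>) - (\<Sum>z\<in>S. a z * Hk \<sigma> z)\<bar> \<le> e' * measure \<sigma> UNIV"
    by (rule integral_approx_span[OF c e'(1)]) (rule that)
  define a1 where "a1 = (\<Sum>z\<in>S. \<bar>a z\<bar>) + 1"
  have a1: "a1 > 0" by (simp add: a1_def sum_nonneg add_nonneg_pos)
  show ?thesis
  proof (rule that[of "(e / (2 * a1))\<^sup>2"])
    fix \<sigma> \<rho> assume f: "fin_borel \<sigma>" "fin_borel \<rho>" and m: "measure \<sigma> UNIV \<le> C" "measure \<rho> UNIV \<le> C"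
      and n: "nsq \<sigma> \<rho> \<le> (e / (2 * a1))\<^sup>2"
    have s: "sqrt (nsq \<sigma> \<rho>) \<le> e / (2 * a1)" using real_sqrt_le_mono[OF n] e a1 by simp
    have "\<bar>(\<Sum>z\<in>S. a z * Hk \<sigma> z) - (\<Sum>z\<in>S. a z * Hk \<rho> z)\<bar> = \<bar>\<Sum>z\<in>S. a z * (Hk \<sigma> z - Hk \<rho> z)\<bar>"
      by (simp add: sum_subtractf right_diff_distrib)
    also have "\<dots> \<le> (\<Sum>z\<in>S. \<bar>a z\<bar> * (e / (2 * a1)))"
      unfolding abs_mult[symmetric]
      by (rule order_trans[OF sum_abs], rule sum_mono, unfold abs_mult, rule mult_left_mono[OF order_trans[OF rkhs_le_bound[OF nsq(2)[OF f]] s]]) simp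
    also have "\<dots> = (a1 - 1) * (e / (2 * a1))" unfolding a1_def sum_distrib_right[symmetric] by simp
    also have "\<dots> \<le> e / 2" using e a1 by (simp add: field_simps)
    finally have "\<bar>(\<Sum>z\<in>S. a z * Hk \<sigma> z) - (\<Sum>z\<in>S. a z * Hk \<rho> z)\<bar> \<le> e / 2" .
    moreover have "e' * measure \<sigma> UNIV \<le> e' * C" "e' * measure \<rho> UNIV \<le> e' * C" using m e' by simp_all
    ultimately show "\<bar>(\<integral>x. \<phi> x \<partial>\<sigma>) - (\<integral>x. \<phi> x \<partial>\<rho>)\<bar> \<le> e"
      using Sa(2)[OF f(1)] Sa(2)[OF f(2)] e'(2) by linarith
  qed (use e a1 in simp)
qed

section \<open>The limit curve\<close>

locale scheme_limit = scheme \<epsilon> c V \<tau> S s M N \<mu>0 xs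
  for \<epsilon> and c :: "'a::metric_space \<Rightarrow> 'a \<Rightarrow> real" and V \<tau> S s M N \<mu>0 xs +
  assumes conv: "\<And>t y. convergent (\<lambda>n. Hk (Z n t) y)"
begin

definition \<sigma> :: "real \<Rightarrow> 'a measure" where
  "\<sigma> t = (SOME \<rho>. fin_borel \<rho> \<and> measure \<rho> UNIV \<le> sqrt (N / \<kappa>) \<and> (\<forall>\<phi> :: 'a \<Rightarrow> real. cts \<phi> \<longrightarrow> (\<lambda>n. \<integral>x. \<phi> x \<partial>Z n t) \<longlonglongrightarrow> (\<integral>x. \<phi> x \<partial>\<rho>)))"

lemma \<sigma>_fin: "fin_borel (\<sigma> t)" and \<sigma>_mass: "measure (\<sigma> t) UNIV \<le> sqrt (N / \<kappa>)"
  and \<sigma>_weak: "cts \<phi> \<Longrightarrow> (\<lambda>n. \<integral>x. \<phi> x \<partial>Z n t) \<longlonglongrightarrow> (\<integral>x. \<phi> x \<partial>\<sigma> t)" for \<phi> :: "'a \<Rightarrow> real"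
proof -
  from conv obtain b where b: "\<And>y. (\<lambda>n. Hk (Z n t) y) \<longlonglongrightarrow> b y" unfolding convergent_def by metis
  have "\<exists>\<rho>. fin_borel \<rho> \<and> measure \<rho> UNIV \<le> sqrt (N / \<kappa>) \<and> (\<forall>\<phi> :: 'a \<Rightarrow> real. cts \<phi> \<longrightarrow> (\<lambda>n. \<integral>x. \<phi> x \<partial>Z n t) \<longlonglongrightarrow> (\<integral>x. \<phi> x \<partial>\<rho>))"
    by (rule weak_limit_exists[of "\<lambda>n. Z n t", OF Z_fin Z_mass b]) blast
  from someI_ex[OF this, folded \<sigma>_def] show "fin_borel (\<sigma> t)" "measure (\<sigma> t) UNIV \<le> sqrt (N / \<kappa>)"
    "cts \<phi> \<Longrightarrow> (\<lambda>n. \<integral>x. \<phi> x \<partial>Z n t) \<longlonglongrightarrow> (\<integral>x. \<phi> x \<partial>\<sigma> t)" for \<phi> :: "'a \<Rightarrow> real" by blast+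
qed

lemma \<sigma>_lim: "(\<lambda>n. Hk (Z n t) y) \<longlonglongrightarrow> Hk (\<sigma> t) y"
  unfolding Hk_def by (rule \<sigma>_weak[OF k_cont1])

text \<open>In the pairing one measure enters through its potential, which converges uniformly, and
  the other converges weakly.\<close>

lemma ip_lim: "(\<lambda>n. ip (Z n t) (Z n u)) \<longlonglongrightarrow> ip (\<sigma> t) (\<sigma> u)"
  unfolding ip_def
proof (rule weak_strong[where C="sqrt (N / \<kappa>)" and g="Hk (\<sigma> t)"])
  show "uniform_limit UNIV (\<lambda>n. Hk (Z n t)) (Hk (\<sigma> t)) sequentially"
    by (rule rkhs_uniform_limit[where M="sqrt N"]) (simp_all add: Z_rkhs \<sigma>_lim)
qed (use N_nonneg \<kappa>_pos in \<open>auto intro!: always_eventually \<sigma>_weak Hk_cont Z_fin Z_mass \<sigma>_fin divide_nonneg_nonneg\<close>)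

lemma nsq_lim: "(\<lambda>n. nsq (Z n t) (Z n u)) \<longlonglongrightarrow> nsq (\<sigma> t) (\<sigma> u)"
  unfolding nsq_def by (intro tendsto_intros ip_lim)

lemma \<sigma>_0: "Hk (\<sigma> 0) = B \<mu>0" "ip (\<sigma> 0) (\<sigma> 0) = 1"
proof -
  have Z0: "Z n 0 = s n 0" for n by (simp add: Z_def)
  have eq: "(\<integral>x. \<phi> x \<partial>\<sigma> 0) = (\<integral>x. \<phi> x \<partial>Sg \<mu>0)" if "cts \<phi>" for \<phi> :: "'a \<Rightarrow> real"
    using LIMSEQ_unique[OF \<sigma>_weak[OF that, of 0]] init[OF that] by (simp add: Z0)
  show H: "Hk (\<sigma> 0) = B \<mu>0" using eq[OF k_cont1] Hk_Sg[OF \<mu>0] unfolding Hk_def[abs_def] by simp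
  show "ip (\<sigma> 0) (\<sigma> 0) = 1" unfolding ip_def H
    using eq[OF Hk_cont[OF Sg_fin_borel[OF \<mu>0]]] B_norm[OF \<mu>0] Hk_Sg[OF \<mu>0] by simp
qed

text \<open>Up to time t the squared norm loses the sum of the squared increments, which is at most
  \<open>\<tau> n * A t\<close> and vanishes in the limit.\<close>

lemma \<sigma>_norm:
  assumes t: "0 \<le> t"
  shows "ip (\<sigma> t) (\<sigma> t) = 1"
proof -
  have "(\<lambda>n. ip (Z n 0) (Z n 0) - ip (Z n t) (Z n t)) \<longlonglongrightarrow> 0"
  proof (rule tendsto_sandwich[OF always_eventually always_eventually])
    show "\<forall>n. 0 \<le> ip (Z n 0) (Z n 0) - ip (Z n t) (Z n t)" "\<forall>n. ip (Z n 0) (Z n 0) - ip (Z n t) (Z n t) \<le> \<tau> n * A t"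
    proof (rule_tac [!] allI)
      fix n
      obtain i l where il: "Z n t = s n (i + l)" "real (i + l) * \<tau> n \<le> t" using Z_indices[of t t n] t by (metis order_refl)
      have "ip (Z n 0) (Z n 0) - ip (Z n t) (Z n t) = (\<Sum>j<i + l. nsq (s n (Suc j)) (s n j))"
        using euler_scheme.norm_telescope[OF es, of n "i + l"] unfolding il(1) by (simp add: Z_def euler_scheme.\<delta>_def[OF es])
      then show "0 \<le> ip (Z n 0) (Z n 0) - ip (Z n t) (Z n t)" "ip (Z n 0) (Z n 0) - ip (Z n t) (Z n t) \<le> \<tau> n * A t"
        using sum_increments[OF il(2)] by (simp_all add: sum_nonneg nsq(1) s_fin)
    qed
    show "(\<lambda>n. \<tau> n * A t) \<longlonglongrightarrow> 0" using tendsto_mult_right[OF \<tau>(3), of "A t"] by simp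
  qed simp
  from LIMSEQ_unique[OF this tendsto_diff[OF ip_lim ip_lim]] show ?thesis using \<sigma>_0(2) by simp
qed

lemma \<sigma>_hoelder:
  assumes t: "0 \<le> t" "t \<le> u"
  shows "nsq (\<sigma> u) (\<sigma> t) \<le> (u - t) * A u"
proof (rule LIMSEQ_le[OF nsq_lim])
  show "(\<lambda>n. (u - t + \<tau> n) * A u) \<longlonglongrightarrow> (u - t) * A u"
    using tendsto_mult_right[OF tendsto_add[OF tendsto_const \<tau>(3)], of "u - t" "A u"] by simp
qed (use Z_hoelder[OF t] in blast)

text \<open>The squared speed of the limit. Values are extended because the lower limit may be
  infinite at t = 0; Fatou's lemma keeps the integral bound.\<close>

definition Q :: "real \<Rightarrow> ennreal" where
  "Q t = liminf (\<lambda>n. ennreal (rate n t))"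

lemma Q_measurable [measurable]: "Q \<in> borel_measurable borel"
  unfolding Q_def[abs_def] by measurable

lemma Q_antimono: "t \<le> u \<Longrightarrow> Q u \<le> Q t"
  unfolding Q_def by (intro Liminf_mono always_eventually allI ennreal_leI rate_antimono)

lemma Q_integral:
  assumes T: "0 \<le> T"
  shows "(\<integral>\<^sup>+t. Q t * indicator {0..T} t \<partial>lborel) \<le> ennreal (A (T + 1))"
proof -
  have "(\<integral>\<^sup>+t. Q t * indicator {0..T} t \<partial>lborel) = (\<integral>\<^sup>+t. liminf (\<lambda>n. ennreal (rate n t) * indicator {0..T} t) \<partial>lborel)"
    by (intro nn_integral_cong) (auto simp: Q_def indicator_def Liminf_const)
  also have "\<dots> \<le> liminf (\<lambda>n. \<integral>\<^sup>+t. ennreal (rate n t) * indicator {0..T} t \<partial>lborel)" by (rule nn_integral_liminf) measurable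
  also have "\<dots> \<le> liminf (\<lambda>n. ennreal (A (T + 1)))" by (intro Liminf_mono always_eventually allI rate_integral T)
  also have "\<dots> = ennreal (A (T + 1))" by (simp add: Liminf_const)
  finally show ?thesis .
qed

text \<open>Q is nonincreasing with finite integral, so it cannot be infinite at a positive
  time.\<close>

lemma Q_finite:
  assumes t: "0 < t"
  shows "Q t < \<infinity>"
proof -
  have "Q t * ennreal t = (\<integral>\<^sup>+u. Q t * indicator {0..t} u \<partial>lborel)" using t by (simp add: nn_integral_cmult_indicator)
  also have "\<dots> \<le> (\<integral>\<^sup>+u. Q u * indicator {0..t} u \<partial>lborel)" by (intro nn_integral_mono) (auto simp: indicator_def Q_antimono)
  also have "\<dots> \<le> ennreal (A (t + 1))" by (rule Q_integral) (use t in simp)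
  finally have "Q t * ennreal t < \<infinity>" using le_less_trans by fastforce
  then show ?thesis using t by (auto simp: ennreal_mult_less_top)
qed

definition m :: "real \<Rightarrow> real" where
  "m t = sqrt (enn2real (Q t))"

lemma m_nonneg: "0 \<le> m t" and m_square: "(m t)\<^sup>2 = enn2real (Q t)"
  by (simp_all add: m_def)

lemma m_antimono: "0 < t \<Longrightarrow> t \<le> u \<Longrightarrow> m u \<le> m t"
  unfolding m_def using Q_antimono Q_finite by (intro real_sqrt_le_mono enn2real_mono) (auto simp: top.not_eq_extremum)

lemma m_square_integrable: "(\<lambda>t. (m t)\<^sup>2) integrable_on {0..T}"
proof (cases "0 \<le> T")
  case True
  have "set_integrable lborel {0..T} (\<lambda>t. (m t)\<^sup>2)"
    unfolding set_integrable_def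
  proof (rule integrableI_bounded)
    have "(\<integral>\<^sup>+t. ennreal (norm (indicat_real {0..T} t *\<^sub>R (m t)\<^sup>2)) \<partial>lborel) \<le> (\<integral>\<^sup>+t. Q t * indicator {0..T} t \<partial>lborel)"
      by (intro nn_integral_mono) (auto simp: m_square indicator_def ennreal_enn2real_if)
    also have "\<dots> \<le> ennreal (A (T + 1))" by (rule Q_integral[OF True])
    also have "\<dots> < \<infinity>" by simp
    finally show "(\<integral>\<^sup>+t. ennreal (norm (indicat_real {0..T} t *\<^sub>R (m t)\<^sup>2)) \<partial>lborel) < \<infinity>" .
  qed (simp add: m_def)
  then show ?thesis by (rule set_borel_integral_eq_integral(1))
qed (simp add: integrable_on_empty)

lemma m_integrable: "m absolutely_integrable_on {0..T}"
proof (rule measurable_bounded_by_integrable_imp_absolutely_integrable)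
  have "m \<in> borel_measurable borel" unfolding m_def[abs_def] by measurable
  then show "m \<in> borel_measurable (lebesgue_on {0..T})" by (simp add: measurable_completion measurable_restrict_space1)
  show "(\<lambda>t. 1 + (m t)\<^sup>2) integrable_on {0..T}" by (intro integrable_add integrable_const_ivl m_square_integrable)
  show "norm (m t) \<le> 1 + (m t)\<^sup>2" for t
  proof -
    have "0 \<le> (m t - 1)\<^sup>2" by simp
    then show ?thesis using m_nonneg[of t] by (simp add: power2_diff)
  qed
qed simp

text \<open>Otherwise \<open>Z_rate\<close> would keep \<open>rate n t\<close> above the square of
  \<open>m t\<close> by a fixed amount for all large n, against its definition by a lower
  limit.\<close>

lemma \<sigma>_rate:
  assumes t: "0 < t" "t \<le> u"
  shows "sqrt (nsq (\<sigma> u) (\<sigma> t)) \<le> m t * (u - t)"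
proof -
  have "nsq (\<sigma> u) (\<sigma> t) \<le> (u - t)\<^sup>2 * (m t)\<^sup>2 + e" if e: "e > 0" for e
  proof (rule ccontr)
    assume n: "\<not> ?thesis"
    define e' where "e' = e / ((u - t)\<^sup>2 + 1)"
    have X: "(u - t)\<^sup>2 + 1 > 0" by (simp add: add_nonneg_pos)
    then have e': "e' > 0" "((u - t)\<^sup>2 + 1) * e' = e" using e by (simp_all add: e'_def)
    have "(\<lambda>n. (u - t + \<tau> n)\<^sup>2 * ((m t)\<^sup>2 + e')) \<longlonglongrightarrow> (u - t + 0)\<^sup>2 * ((m t)\<^sup>2 + e')" by (intro tendsto_intros \<tau>(3))
    moreover have "(u - t + 0)\<^sup>2 * ((m t)\<^sup>2 + e') \<le> (u - t)\<^sup>2 * (m t)\<^sup>2 + e" using e' by (simp add: distrib_left distrib_right)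
    ultimately have "\<forall>\<^sub>F n in sequentially. 0 < nsq (Z n u) (Z n t) - (u - t + \<tau> n)\<^sup>2 * ((m t)\<^sup>2 + e')"
      by (intro order_tendstoD(1)[OF tendsto_diff[OF nsq_lim]]) (use n in auto)
    then have "\<forall>\<^sub>F n in sequentially. ennreal ((m t)\<^sup>2 + e') \<le> ennreal (rate n t)"
    proof eventually_elim
      case (elim n)
      have "(u - t + \<tau> n)\<^sup>2 * ((m t)\<^sup>2 + e') < (u - t + \<tau> n)\<^sup>2 * rate n t" using elim Z_rate[of t u n] t by linarith
      then show ?case by (intro ennreal_leI) (simp add: mult_less_cancel_left)
    qed
    then have "ennreal ((m t)\<^sup>2 + e') \<le> Q t" unfolding Q_def by (rule Liminf_bounded)
    also have "Q t = ennreal ((m t)\<^sup>2)" unfolding m_square using Q_finite[OF t(1)] by simp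
    finally show False using e' by (simp add: ennreal_le_iff)
  qed
  then have "nsq (\<sigma> u) (\<sigma> t) \<le> (u - t)\<^sup>2 * (m t)\<^sup>2" by (rule field_le_epsilon)
  then have "sqrt (nsq (\<sigma> u) (\<sigma> t)) \<le> sqrt (((u - t) * m t)\<^sup>2)" by (intro real_sqrt_le_mono) (simp add: power_mult_distrib)
  then show ?thesis using t m_nonneg[of t] by (simp add: mult.commute)
qed

text \<open>On a short time interval the drift V b - H[V \<sigma>] changes by at most e, uniformly
  in n, by the Hoelder bound. The discrete inequalities at the point xs j, which lies on all later
  grids, can then be summed and passed to the limit.\<close>

lemma \<sigma>_flow:
  assumes t: "0 \<le> t" and e: "e > 0"
  obtains h where "h > 0" "\<And>u. t \<le> u \<Longrightarrow> u \<le> t + h \<Longrightarrow>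
    0 \<le> Hk (\<sigma> u) (xs j) - Hk (\<sigma> t) (xs j) + 2 / \<epsilon> * (u - t) * (V (xs j) * Hk (\<sigma> t) (xs j) - (\<integral>x. V x * k x (xs j) \<partial>\<sigma> t) + e)"
proof -
  define y where "y = xs j"
  define w where "w x = V y * k x y - V x * k x y" for x
  have wc: "cts w" unfolding w_def by (intro continuous_intros k_cont1 V)
  have wF: "(\<integral>x. w x \<partial>\<rho>) = V y * Hk \<rho> y - (\<integral>x. V x * k x y \<partial>\<rho>)" if "fin_borel \<rho>" for \<rho>
    unfolding w_def Hk_def by (subst Bochner_Integration.integral_diff) (auto intro!: integrable_continuous that continuous_intros k_cont1 V)
  define C where "C = sqrt (N / \<kappa>)"
  have C: "C \<ge> 0" using N_nonneg \<kappa>_pos by (simp add: C_def)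
  obtain \<eta> where \<eta>: "\<eta> > 0" "\<And>\<sigma> \<rho>. fin_borel \<sigma> \<Longrightarrow> fin_borel \<rho> \<Longrightarrow> measure \<sigma> UNIV \<le> C \<Longrightarrow> measure \<rho> UNIV \<le> C \<Longrightarrow>
    nsq \<sigma> \<rho> \<le> \<eta> \<Longrightarrow> \<bar>(\<integral>x. w x \<partial>\<sigma>) - (\<integral>x. w x \<partial>\<rho>)\<bar> \<le> e"
    by (rule integral_nsq_continuous[OF wc e C]) (rule that)
  define h where "h = min 1 (\<eta> / (2 * (A (t + 1) + 1)))"
  have A1: "A (t + 1) + 1 > 0" using A_nonneg[of "t + 1"] t by simp
  have h: "0 < h" "h \<le> 1" using \<eta>(1) A1 by (auto simp: h_def)
  have h2: "2 * h * (A (t + 1) + 1) \<le> \<eta>"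
  proof -
    have "2 * (A (t + 1) + 1) * h \<le> 2 * (A (t + 1) + 1) * (\<eta> / (2 * (A (t + 1) + 1)))"
      using A1 by (intro mult_left_mono) (auto simp: h_def)
    then show ?thesis using A1 by (simp add: mult_ac)
  qed
  show ?thesis
  proof (rule that[of h])
    fix u assume u: "t \<le> u" "u \<le> t + h"
    have near: "\<bar>(\<integral>x. w x \<partial>Z n v) - (\<integral>x. w x \<partial>Z n t)\<bar> \<le> e" if v: "t \<le> v" "v \<le> u" and n: "\<tau> n < h" for n v
    proof (rule \<eta>(2)[OF Z_fin Z_fin])
      have "nsq (Z n v) (Z n t) \<le> (v - t + \<tau> n) * A v" by (rule Z_hoelder) (use t v in auto)
      also have "\<dots> \<le> 2 * h * (A (t + 1) + 1)"
        by (intro mult_mono) (use u v n h t A_mono[of v "t + 1"] A_nonneg[of v] in linarith)+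
      finally show "nsq (Z n v) (Z n t) \<le> \<eta>" using h2 by linarith
    qed (simp_all add: C_def Z_mass)
    have ev: "\<forall>\<^sub>F n in sequentially. \<exists>l. u - t - \<tau> n \<le> l \<and> l \<le> u - t + \<tau> n \<and> 0 \<le> Hk (Z n u) y - Hk (Z n t) y + l * (2 / \<epsilon>) * ((\<integral>x. w x \<partial>Z n t) + e)"
      using xs(1)[of j] order_tendstoD(2)[OF \<tau>(3) h(1)]
    proof eventually_elim
      case (elim n)
      obtain i l where il: "Z n t = s n i" "Z n u = s n (i + l)" "real l * \<tau> n \<le> u - t + \<tau> n" "u - t - \<tau> n \<le> real l * \<tau> n" "real (i + l) * \<tau> n \<le> u" "i = nat \<lfloor>t / \<tau> n\<rfloor>"
        using Z_indices[OF t u(1)] by metis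
      have F: "V y * Hk (s n j') y - (\<integral>x. V x * k x y \<partial>s n j') \<le> (\<integral>x. w x \<partial>Z n t) + e" if j: "i \<le> j'" "j' \<le> i + l" for j'
      proof -
        \<comment> \<open>A time between t and u whose cell index is j'. For j' = i the grid time
          may precede t, hence the maximum.\<close>
        define v where "v = max t (j' * \<tau> n)"
        have "real j' * \<tau> n \<le> real (i + l) * \<tau> n" using j(2) \<tau>(1)[of n] by (intro mult_right_mono) auto
        then have v: "t \<le> v" "v \<le> u" using il(5) u by (auto simp: v_def)
        have "nat \<lfloor>v / \<tau> n\<rfloor> = j'"
        proof (cases "t \<le> j' * \<tau> n")
          case True then show ?thesis using \<tau>(1)[of n] by (simp add: v_def max_def)
        next
          case False
          then have "j' \<le> t / \<tau> n" using \<tau>(1)[of n] by (simp add: field_simps)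
          then have "j' \<le> i" unfolding il(6) by (simp add: le_nat_floor)
          then show ?thesis using False j il(6) by (simp add: v_def)
        qed
        then have "Z n v = s n j'" by (simp add: Z_def)
        then show ?thesis using near[OF v elim(2)] unfolding wF[OF s_fin, symmetric] by simp
      qed
      have "0 \<le> Hk (s n (i + l)) y - Hk (s n i) y + l * (2 / \<epsilon> * \<tau> n) * ((\<integral>x. w x \<partial>Z n t) + e)"
        by (rule euler_scheme.flow_inequality[OF es _ F]) (use elim(1) in \<open>auto simp: y_def\<close>)
      then show ?case using il by (intro exI[of _ "l * \<tau> n"]) (simp add: mult_ac)
    qed
    then obtain l where l: "\<forall>\<^sub>F n in sequentially. u - t - \<tau> n \<le> l n \<and> l n \<le> u - t + \<tau> n \<and> 0 \<le> Hk (Z n u) y - Hk (Z n t) y + l n * (2 / \<epsilon>) * ((\<integral>x. w x \<partial>Z n t) + e)"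
      by (auto simp: eventually_ex)
    have lim: "l \<longlonglongrightarrow> u - t"
    proof (rule tendsto_sandwich)
      show "(\<lambda>n. u - t - \<tau> n) \<longlonglongrightarrow> u - t" "(\<lambda>n. u - t + \<tau> n) \<longlonglongrightarrow> u - t"
        using tendsto_diff[OF tendsto_const \<tau>(3), of "u - t"] tendsto_add[OF tendsto_const \<tau>(3), of "u - t"] by simp_all
    qed (use l in \<open>auto elim: eventually_mono\<close>)
    have "(\<lambda>n. Hk (Z n u) y - Hk (Z n t) y + l n * (2 / \<epsilon>) * ((\<integral>x. w x \<partial>Z n t) + e))
        \<longlonglongrightarrow> Hk (\<sigma> u) y - Hk (\<sigma> t) y + (u - t) * (2 / \<epsilon>) * ((\<integral>x. w x \<partial>\<sigma> t) + e)"
      by (intro tendsto_add tendsto_diff tendsto_mult tendsto_const \<sigma>_lim \<sigma>_weak wc lim)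
    then have "0 \<le> Hk (\<sigma> u) y - Hk (\<sigma> t) y + (u - t) * (2 / \<epsilon>) * ((\<integral>x. w x \<partial>\<sigma> t) + e)"
      by (rule tendsto_lowerbound) (use l in \<open>auto elim: eventually_mono\<close>)
    then show "0 \<le> Hk (\<sigma> u) (xs j) - Hk (\<sigma> t) (xs j) + 2 / \<epsilon> * (u - t) * (V (xs j) * Hk (\<sigma> t) (xs j) - (\<integral>x. V x * k x (xs j) \<partial>\<sigma> t) + e)"
      unfolding wF[OF \<sigma>_fin] y_def by (simp add: mult_ac)
  qed (rule h)
qed

definition \<mu> :: "real \<Rightarrow> 'a measure" where
  "\<mu> t = density (\<sigma> t) (\<lambda>x. ennreal (Hk (\<sigma> t) x))"

lemma \<mu>: assumes "0 \<le> t" shows "\<mu> t \<in> Probs" "B (\<mu> t) = Hk (\<sigma> t)" "Sg (\<mu> t) = \<sigma> t"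
  using measure_of_potential[OF \<sigma>_fin \<sigma>_norm[OF assms, unfolded ip_def]] unfolding \<mu>_def by blast+

lemma \<mu>_0: "\<mu> 0 = \<mu>0"
  by (rule B_inj[OF \<mu>(1) \<mu>0]) (simp_all add: \<mu> \<sigma>_0)

lemma dist_nsq: "0 \<le> t \<Longrightarrow> 0 \<le> u \<Longrightarrow> dist_B (\<mu> u) (\<mu> t) = sqrt (nsq (\<sigma> u) (\<sigma> t))"
  unfolding dist_B_def by (simp add: \<mu>(2) nsq(3) \<sigma>_fin)

text \<open>Rates at positive times integrate to a bound on distances; at time 0 the Hoelder
  estimate supplies the continuity.\<close>

lemma dist_integral:
  assumes ab: "0 \<le> a" "a \<le> b"
  shows "dist_B (\<mu> b) (\<mu> a) \<le> integral {a..b} m"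
proof -
  have mi: "m integrable_on {0..T}" for T by (rule set_lebesgue_integral_eq_integral(1)[OF m_integrable])
  show ?thesis
  proof (rule nonincreasing_rate_bound[where D="\<lambda>a b. dist_B (\<mu> b) (\<mu> a)", OF _ _ _ _ m_antimono mi ab])
    show "dist_B (\<mu> c) (\<mu> a) \<le> dist_B (\<mu> b) (\<mu> a) + dist_B (\<mu> c) (\<mu> b)" if "0 \<le> a" "a \<le> b" "b \<le> c" for a b c
      using dist_B_triangle[OF \<mu>(1) \<mu>(1) \<mu>(1), of c b a] that by simp
    show "dist_B (\<mu> a) (\<mu> a) \<le> 0" if "0 \<le> a" for a using that by (simp add: dist_nsq nsq_def)
    show "dist_B (\<mu> t) (\<mu> s) \<le> m s * (t - s)" if "0 < s" "s < t" for s t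
      using that \<sigma>_rate[of s t] dist_nsq[of s t] by simp
    show "((\<lambda>s. dist_B (\<mu> s) (\<mu> 0)) \<longlongrightarrow> 0) (at_right 0)"
    proof (rule Lim_null_comparison)
      show "\<forall>\<^sub>F s in at_right 0. norm (dist_B (\<mu> s) (\<mu> 0)) \<le> sqrt (s * A 1)"
      proof (rule eventually_mono[OF eventually_at_right_real[of 0 1]])
        fix s :: real assume s: "s \<in> {0<..<1}"
        have "nsq (\<sigma> s) (\<sigma> 0) \<le> s * A s" using \<sigma>_hoelder[of 0 s] s by simp
        also have "\<dots> \<le> s * A 1" using s by (intro mult_left_mono A_mono) auto
        finally show "norm (dist_B (\<mu> s) (\<mu> 0)) \<le> sqrt (s * A 1)" using s by (simp add: dist_nsq nsq(1) \<sigma>_fin)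
      qed simp
      have "((\<lambda>s. sqrt (s * A 1)) \<longlongrightarrow> sqrt (0 * A 1)) (at_right 0)" by (intro tendsto_intros)
      then show "((\<lambda>s. sqrt (s * A 1)) \<longlongrightarrow> 0) (at_right 0)" by simp
    qed
  qed
qed

sublocale limit: adm_curve \<epsilon> c \<mu> m
  by unfold_locales (simp_all add: \<mu> m_integrable m_square_integrable dist_integral)

text \<open>At the points xs j the right difference quotient inherits the inequality of
  \<open>\<sigma>_flow\<close>; density and continuity of the multiplier give all points.\<close>

lemma multiplier_nonneg:
  assumes t: "0 < t" and d: "wder \<mu> t d C"
  shows "0 \<le> multiplier V (\<mu> t) d x"
proof -
  have mc: "cts (multiplier V (\<mu> t) d)"
    using d t by (intro multiplier_cont V \<mu>) (auto simp: wder_def dest: rkhs_le_cont)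
  have dense: "0 \<le> multiplier V (\<mu> t) d (xs j)" for j
  proof (rule field_le_epsilon)
    fix e :: real assume e: "e > 0"
    define y where "y = xs j"
    define F where "F = V y * Hk (\<sigma> t) y - (\<integral>x. V x * k x y \<partial>\<sigma> t) + e"
    obtain h where h: "h > 0" "\<And>u. t \<le> u \<Longrightarrow> u \<le> t + h \<Longrightarrow> 0 \<le> Hk (\<sigma> u) y - Hk (\<sigma> t) y + 2 / \<epsilon> * (u - t) * F"
      unfolding F_def y_def by (rule \<sigma>_flow[of t e j]) (use t e in auto)
    have "((\<lambda>u. (B (\<mu> u) y - B (\<mu> t) y) / (u - t)) \<longlongrightarrow> d y) (at_right t)"
      using wder_pointwise[OF d, of y] unfolding has_field_derivative_iff by (rule filterlim_mono) (auto simp: at_le)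
    moreover have "\<forall>\<^sub>F u in at_right t. - (2 / \<epsilon> * F) \<le> (B (\<mu> u) y - B (\<mu> t) y) / (u - t)"
    proof (rule eventually_mono[OF eventually_at_right_real[of t "t + h"]])
      show "- (2 / \<epsilon> * F) \<le> (B (\<mu> u) y - B (\<mu> t) y) / (u - t)" if u: "u \<in> {t<..<t + h}" for u
        using h(2)[of u] u t by (simp add: \<mu>(2) pos_le_divide_eq mult_ac)
    qed (use h(1) in simp)
    ultimately have "- (2 / \<epsilon> * F) \<le> d y" by (rule tendsto_lowerbound) simp
    then have "\<epsilon> / 2 * - (2 / \<epsilon> * F) \<le> \<epsilon> / 2 * d y" using eps_pos by (intro mult_left_mono) auto
    then have "0 \<le> \<epsilon> / 2 * d y + F" using eps_pos by (simp del: mult_minus_right)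
    then show "0 \<le> multiplier V (\<mu> t) d (xs j) + e"
      using t by (simp add: multiplier_def F_def \<mu> flip: y_def)
  qed
  show ?thesis
  proof (rule ccontr)
    assume "\<not> ?thesis"
    then have "\<forall>\<^sub>F y in nhds x. multiplier V (\<mu> t) d y < 0"
      using mc by (intro order_tendstoD(2)) (auto simp: continuous_on_eq_continuous_at isCont_def tendsto_at_iff_tendsto_nhds)
    then obtain e where "e > 0" "\<And>y. dist y x < e \<Longrightarrow> multiplier V (\<mu> t) d y < 0" by (auto simp: eventually_nhds_metric)
    then show False using xs(2)[of e x] dense by (metis dist_commute not_le)
  qed
qed

lemma limit_flow: "energy_curve \<epsilon> c \<mu> m V"
proof unfold_locales
  show "AE t in lborel. t > 0 \<longrightarrow> (\<exists>d. flow_at V \<mu> t d (m t))"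
    using limit.AE_wder by (rule AE_mp) (auto intro!: AE_I2 simp: flow_at_def intro: multiplier_nonneg)
qed (simp_all add: V m_nonneg m_antimono)

end

section \<open>Construction of the flow\<close>

context sinkhorn
begin

lemma flow_exists:
  assumes V: "cts V" and \<mu>0: "\<mu>0 \<in> Probs"
  obtains \<mu> m where "energy_curve \<epsilon> c \<mu> m V" "\<mu> 0 = \<mu>0"
proof -
  obtain M where M: "M > 0" "\<And>x. \<bar>V x\<bar> \<le> M" by (rule continuous_bounded[OF V]) (rule that)
  obtain xs :: "nat \<Rightarrow> 'a" and J :: "nat \<Rightarrow> nat" and \<pi> where \<pi>: "\<And>n. n \<le> J n" "\<And>n x. \<pi> n x \<in> xs ` {..J n}"
    "\<And>n z. \<pi> n -` {z} \<in> sets borel" "\<And>n x. dist x (\<pi> n x) < 1 / real (Suc n)" and dense: "\<And>x e. e > 0 \<Longrightarrow> \<exists>j. dist x (xs j) < e"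
    by (rule discretisation) (rule that)
  define S where "S n = xs ` {..J n}" for n
  have Sfin: "finite (S n)" for n by (simp add: S_def)
  define \<rho> where "\<rho> = Sg \<mu>0"
  have \<rho>: "fin_borel \<rho>" unfolding \<rho>_def by (rule Sg_fin_borel[OF \<mu>0])
  \<comment> \<open>The cap \<epsilon> / (2 M) ensures \<gamma> |V| \<le> 1 for \<gamma> = 2 \<tau>
    / \<epsilon>, as \<open>euler_step\<close> requires.\<close>
  define h where "h = min 1 (\<epsilon> / (2 * M))"
  have h: "0 < h" "h \<le> 1" "h \<le> \<epsilon> / (2 * M)" using M(1) eps_pos by (simp_all add: h_def)
  define \<tau> where "\<tau> n = h / real (Suc n)" for n
  have \<tau>_le: "0 < \<tau> n" "\<tau> n \<le> h" for n
    using divide_left_mono[of 1 "real (Suc n)" h] h(1) by (simp_all add: \<tau>_def)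
  have \<tau>: "0 < \<tau> n" "\<tau> n \<le> 1" "\<tau> n \<le> \<epsilon> / (2 * M)" for n using \<tau>_le[of n] h by linarith+
  have \<tau>_lim: "\<tau> \<longlonglongrightarrow> 0" unfolding \<tau>_def[abs_def] by (rule LIMSEQ_Suc[OF lim_const_over_n])
  \<comment> \<open>\<open>Sg \<mu>0\<close> is pushed to the grid by \<open>\<pi> n\<close>. Its
    mass is preserved, and since k \<le> 1 the squared mass bounds the squared norm for every
    n.\<close>
  define s0 where "s0 n = disc (S n) (\<lambda>z. measure \<rho> (\<pi> n -` {z}))" for n
  define s where "s n = rec_nat (s0 n) (\<lambda>_ \<sigma>'. SOME \<sigma>. step V (2 / \<epsilon> * \<tau> n) (S n) \<sigma>' \<sigma>)" for n
  have s0_int: "(\<integral>x. \<phi> x \<partial>s0 n) = (\<integral>x. \<phi> (\<pi> n x) \<partial>\<rho>)" if "cts \<phi>" for \<phi> :: "'a \<Rightarrow> real" and n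
    unfolding s0_def disc(2)[OF Sfin measure_nonneg borel_measurable_continuous_onI[OF that]]
    by (rule integral_finite_range(1)[OF \<rho> Sfin, symmetric]) (use \<pi> in \<open>auto simp: S_def\<close>)
  have s0_fin: "fin_borel (s0 n)" for n unfolding s0_def by (rule disc(1)[OF Sfin]) simp
  have s0_ip: "ip (s0 n) (s0 n) \<le> (measure \<rho> UNIV)\<^sup>2" for n
  proof -
    have m: "measure (s0 n) UNIV = measure \<rho> UNIV"
      using s0_int[OF continuous_on_const[of UNIV 1], of n] s0_fin[of n] \<rho>
      by (simp add: fin_borel_def sets_eq_imp_space_eq[of _ borel])
    have "\<bar>Hk (s0 n) x\<bar> \<le> measure \<rho> UNIV" for x
      using integral_abs_bound[OF s0_fin, of "\<lambda>z. k z x" 1 n] k_le_1 k_pos m by (simp add: Hk_def abs_of_pos)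
    then have "\<bar>ip (s0 n) (s0 n)\<bar> \<le> measure \<rho> UNIV * measure (s0 n) UNIV"
      unfolding ip_def by (rule integral_abs_bound[OF s0_fin])
    then show ?thesis using m by (simp add: power2_eq_square)
  qed
  have es: "euler_scheme k V (2 / \<epsilon> * \<tau> n) (S n) (s n) M ((measure \<rho> UNIV)\<^sup>2)" for n
  proof -
    interpret e: euler_step k V "2 / \<epsilon> * \<tau> n" "S n"
    proof unfold_locales
      show "2 / \<epsilon> * \<tau> n * \<bar>V x\<bar> \<le> 1" for x
      proof -
        have "2 / \<epsilon> * \<tau> n * \<bar>V x\<bar> \<le> 2 / \<epsilon> * (\<epsilon> / (2 * M)) * M"
          using \<tau>[of n] M eps_pos by (intro mult_mono) auto
        then show ?thesis using M(1) eps_pos by simp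
      qed
    qed (use V Sfin \<tau> eps_pos in auto)
    have Suc: "s n (Suc j) = (SOME \<sigma>. step V (2 / \<epsilon> * \<tau> n) (S n) (s n j) \<sigma>)" for j by (simp add: s_def)
    \<comment> \<open>The choice of the next measure is meaningful only once the current one is
      supported on the grid, so both facts are carried along the induction.\<close>
    have step_Suc: "step V (2 / \<epsilon> * \<tau> n) (S n) (s n j) (s n (Suc j))" if sj: "e.supp (s n j)" for j
    proof -
      obtain \<sigma> where "step V (2 / \<epsilon> * \<tau> n) (S n) (s n j) \<sigma>"
        using step_exists[OF V Sfin e.supp_fin_borel[OF sj]] by blast
      then show ?thesis unfolding Suc by (rule someI)
    qed
    have supp: "e.supp (s n j)" for j
    proof (induction j)
      case 0
      show ?case by (auto simp: e.supp_def s_def s0_def intro!: exI[of _ "\<lambda>z. measure \<rho> (\<pi> n -` {z})"])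
    qed (rule e.step_supp[OF step_Suc])
    show ?thesis
    proof unfold_locales
      show "e.supp (s n 0)" "\<And>j. step V (2 / \<epsilon> * \<tau> n) (S n) (s n j) (s n (Suc j))" by (intro supp step_Suc)+
      show "ip (s n 0) (s n 0) \<le> (measure \<rho> UNIV)\<^sup>2" using s0_ip[of n] by (simp add: s_def)
    qed (rule M)
  qed
  interpret scheme \<epsilon> c V \<tau> S s M "(measure \<rho> UNIV)\<^sup>2" \<mu>0 xs
  proof (rule scheme.intro[OF sinkhorn_axioms], rule scheme_axioms.intro)
    show "(\<lambda>n. \<integral>x. \<phi> x \<partial>s n 0) \<longlonglongrightarrow> (\<integral>x. \<phi> x \<partial>Sg \<mu>0)" if c: "cts \<phi>" for \<phi> :: "'a \<Rightarrow> real"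
      using tendsto_integral_discretisation[OF \<rho> c Sfin, of \<pi> id] \<pi> s0_int[OF c] by (simp add: s_def S_def \<rho>_def)
    show "\<forall>\<^sub>F n in sequentially. xs j \<in> S n" for j
    proof (rule eventually_mono[OF eventually_ge_at_top[of j]])
      show "xs j \<in> S n" if "j \<le> n" for n using order_trans[OF that \<pi>(1)] by (simp add: S_def)
    qed
  qed (fact V \<tau> \<tau>_lim es \<mu>0 | rule dense, assumption)+
  obtain r :: "nat \<Rightarrow> nat" where r: "strict_mono r" "\<And>t y. convergent (\<lambda>n. Hk (Z (r n) t) y)"
    by (rule convergent_subsequence) (rule that)
  interpret sub: scheme \<epsilon> c V "\<lambda>n. \<tau> (r n)" "\<lambda>n. S (r n)" "\<lambda>n. s (r n)" M "(measure \<rho> UNIV)\<^sup>2" \<mu>0 xs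
    by (rule subscheme[OF r(1)])
  interpret lim: scheme_limit \<epsilon> c V "\<lambda>n. \<tau> (r n)" "\<lambda>n. S (r n)" "\<lambda>n. s (r n)" M "(measure \<rho> UNIV)\<^sup>2" \<mu>0 xs
    by unfold_locales (use r(2) in \<open>simp add: Z_def sub.Z_def\<close>)
  show ?thesis by (rule that[OF lim.limit_flow lim.\<mu>_0])
qed

end

theorem mainTheorem1:
  fixes \<epsilon> :: real and c :: "'a::metric_space \<Rightarrow> 'a \<Rightarrow> real"
    and V :: "'a \<Rightarrow> real" and \<mu>0 :: "'a measure"
  assumes X_compact: "compact (UNIV :: 'a set)"
    and eps_pos: "\<epsilon> > 0"
    and c_cont: "continuous_on UNIV (\<lambda>(x, y). c x y)"
    and c_sym: "\<forall>x y. c x y = c y x"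
    and c_nonneg: "\<forall>x y. c x y \<ge> 0"
    and kc_pd: "pos_def_kernel (kc \<epsilon> c)"
    and kc_univ: "universal_kernel (kc \<epsilon> c)"
    and V_cont: "continuous_on UNIV V"
    and mu0: "\<mu>0 \<in> Probs"
  shows
    "\<exists>\<mu>. sinkhorn_flow \<epsilon> c V \<mu>0 \<mu>
       \<and> (\<forall>\<nu>. sinkhorn_flow \<epsilon> c V \<mu>0 \<nu> \<longrightarrow> (\<forall>t\<ge>0. \<nu> t = \<mu> t))
       \<comment> \<open>(i) energy dissipation\<close>
       \<and> loc_abs_cont (\<lambda>t. Energy V (\<mu> t))
       \<and> antimono_on {0..} (\<lambda>t. Energy V (\<mu> t))
       \<and> (AE t in lborel. t \<ge> 0 \<longrightarrow>
            (\<forall>D. tangent \<epsilon> c \<mu> t D \<longrightarrow>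
               ((\<lambda>s. Energy V (\<mu> s)) has_real_derivative - gmet \<epsilon> c (\<mu> t) D D) (at t)))
       \<comment> \<open>(ii) long-term behaviour\<close>
       \<and> (\<exists>L. ((\<lambda>t. Energy V (\<mu> t)) \<longlongrightarrow> L) at_top
             \<and> (\<exists>\<nu>\<in>Probs. Energy V \<nu> = L) \<and> (\<forall>\<nu>\<in>Probs. L \<le> Energy V \<nu>)
             \<and> (\<exists>x. V x = L) \<and> (\<forall>x. L \<le> V x))
       \<and> (\<forall>xs. (\<forall>x. x \<noteq> xs \<longrightarrow> V xs < V x) \<longrightarrow>
            (\<forall>\<phi>::'a \<Rightarrow> real. continuous_on UNIV \<phi> \<longrightarrow>
               ((\<lambda>t. \<integral>x. \<phi> x \<partial>(\<mu> t)) \<longlongrightarrow> \<phi> xs) at_top))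
       \<comment> \<open>(iii) non-expansiveness (any two flows of V, arbitrary starting points)\<close>
       \<and> (\<forall>\<mu>1 \<mu>2 \<nu>1 \<nu>2. sinkhorn_flow \<epsilon> c V \<nu>1 \<mu>1 \<longrightarrow> sinkhorn_flow \<epsilon> c V \<nu>2 \<mu>2 \<longrightarrow>
            antimono_on {0..} (\<lambda>t. rkhs_norm (kc \<epsilon> c)
                                    (\<lambda>x. Bemb \<epsilon> c (\<mu>1 t) x - Bemb \<epsilon> c (\<mu>2 t) x)))"
proof -
  interpret sinkhorn \<epsilon> c
    by unfold_locales (fact X_compact eps_pos c_cont c_nonneg kc_pd kc_univ)+
  \<comment> \<open>Besides existence, this curve comes with the monotone speed bound on which the
    energy results rest.\<close>
  obtain \<mu> m where "energy_curve \<epsilon> c \<mu> m V" and \<mu>_0: "\<mu> 0 = \<mu>0" by (rule flow_exists[OF V_cont mu0]) (rule that)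
  then interpret energy_curve \<epsilon> c \<mu> m V by simp
  have flow: "sinkhorn_flow \<epsilon> c V \<mu>0 \<mu>"
    using sinkhorn_flow_iff[OF adm_curve_axioms V_cont] \<mu>_0 flow by blast
  obtain x0 where x0: "\<And>x. V x0 \<le> V x"
    using continuous_attains_inf[OF X_compact _ V_cont] by auto
  \<comment> \<open>The Dirac measure at a minimiser of V attains the minimum of the energy over all
    probability measures.\<close>
  have dirac: "return borel x0 \<in> Probs" "Energy V (return borel x0) = V x0"
    using V_cont by (auto simp: Probs_def Energy_def prob_space_return integral_return borel_measurable_continuous_onI)
  have min: "V x0 \<le> Energy V \<nu>" if \<nu>: "\<nu> \<in> Probs" for \<nu>
  proof -
    interpret prob_space \<nu> using \<nu> by (simp add: Probs_def)
    have "(\<integral>x. V x0 \<partial>\<nu>) \<le> (\<integral>x. V x \<partial>\<nu>)"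
      by (rule integral_mono) (auto intro!: integrable_continuous Probs_fin_borel \<nu> V_cont x0 continuous_on_const)
    then show ?thesis by (simp add: Energy_def prob_space)
  qed
  show ?thesis
  proof (intro exI[of _ \<mu>] conjI)
    show "\<forall>\<nu>. sinkhorn_flow \<epsilon> c V \<mu>0 \<nu> \<longrightarrow> (\<forall>t\<ge>0. \<nu> t = \<mu> t)"
      using flow_unique[OF V_cont _ flow] by blast
    show "\<exists>L. ((\<lambda>t. Energy V (\<mu> t)) \<longlongrightarrow> L) at_top
             \<and> (\<exists>\<nu>\<in>Probs. Energy V \<nu> = L) \<and> (\<forall>\<nu>\<in>Probs. L \<le> Energy V \<nu>) \<and> (\<exists>x. V x = L) \<and> (\<forall>x. L \<le> V x)"
      using energy_limit[OF x0] dirac min x0 by (intro exI[of _ "V x0"]) blast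
    show "\<forall>xs. (\<forall>x. x \<noteq> xs \<longrightarrow> V xs < V x) \<longrightarrow> (\<forall>\<phi>::'a \<Rightarrow> real. cts \<phi> \<longrightarrow>
               ((\<lambda>t. \<integral>x. \<phi> x \<partial>(\<mu> t)) \<longlongrightarrow> \<phi> xs) at_top)"
      using converges_to_minimizer by blast
    show "\<forall>\<mu>1 \<mu>2 \<nu>1 \<nu>2. sinkhorn_flow \<epsilon> c V \<nu>1 \<mu>1 \<longrightarrow> sinkhorn_flow \<epsilon> c V \<nu>2 \<mu>2 \<longrightarrow>
            antimono_on {0..} (\<lambda>t. rkhs_norm k (\<lambda>x. B (\<mu>1 t) x - B (\<mu>2 t) x))"
      using flow_dist_nonincreasing[OF V_cont] unfolding dist_B_def monotone_on_def by auto
  qed (fact flow energy_loc_abs_cont energy_antimono energy_dissipation)+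
qed

end
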